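(* Let $(\mathcal X,d,\mu)$ be a non-homogeneous metric measure space (upper doubling and geometrically doubling) with dominating function $\lambda$. Let $K$ be a locally integrable function on $(\mathcal X\times\mathcal X)\setminus\{(x,x):x\in\mathcal X\}$ for which there exists a positive constant $C$ such that, for all $x,y\in\mathcal X$ with $x\neq y$, $$|K(x,y)|\le C\,\frac{d(x,y)}{\lambda(x,d(x,y))}$$ and, for all $y,y'\in\mathcal X$, $$\int_{d(x,y)\ge 2d(y,y')}\big[|K(x,y)-K(x,y')|+|K(y,x)-K(y',x)|\big]\frac{1}{d(x,y)}\,d\mu(x)\le C.$$ Let $\mathcal M$ be the Marcinkiewicz integral associated with $K$, that is, for $x\in\mathcal X$, $$\mathcal M(f)(x):=\left[\int_0^\infty\left|\int_{d(x,y)<t}K(x,y)f(y)\,d\mu(y)\right|^2\frac{dt}{t^3}\right]^{1/2}.$$ Then the following four statements are equivalent: (i) $\mathcal M$ is bounded on $L^{p_0}(\mu)$ for some $p_0\in(1,\infty)$; (ii) $\mathcal M$ is bounded from $L^1(\mu)$ into $L^{1,\infty}(\mu)$; (iii) $\mathcal M$ is bounded on $L^p(\mu)$ for all $p\in(1,\infty)$; (iv) $\mathcal M$ is bounded from the atomic Hardy space $H^1(\mu)$ into $L^1(\mu)$.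
   Context: Balls: $B(x,r):=\{y\in\mathcal X: d(x,y)<r\}$ with $x\in\mathcal X$, $r\in(0,\infty)$. A ball $B$ comes with its center $c_B$ and radius $r_B$; for $\rho\in(0,\infty)$, $\rho B:=B(c_B,\rho r_B)$. Non-homogeneous metric measure space: a metric space $(\mathcal X,d)$ with a Borel measure $\mu$ such that: (a) Upper doubling: there exist a dominating function $\lambda:\mathcal X\times(0,\infty)\to(0,\infty)$ and a positive constant $C_\lambda$ such that, for each $x\in\mathcal X$, $r\mapsto\lambda(x,r)$ is non-decreasing and, for all $x\in\mathcal X$ and $r\in(0,\infty)$, $\mu(B(x,r))\le\lambda(x,r)\le C_\lambda\lambda(x,r/2)$. It is always assumed in addition that, for all $x,y\in\mathcal X$ with $d(x,y)\le r$, $\lambda(x,r)\le C_\lambda\lambda(y,r)$. (b) Geometrically doubling: there exists $N_0\in\mathbb N=\{1,2,\dots\}$ such that every ball $B(x,r)\subset\mathcal X$ can be covered by at most $N_0$ balls $B(x_i,r/2)$. Coefficient $\delta$: for balls $B\subset S$, $\delta(B,S):=\int_{(2S)\setminus B}\frac{d\mu(x)}{\lambda(c_B,d(x,c_B))}$. Atomic blocks: let $\rho\in(1,\infty)$ and $p\in(1,\infty]$. A function $b\in L^1_{\rm loc}(\mu)$ (locally $\mu$-integrable) is a $(p,1)_\lambda$-atomic block if (1) there is a ball $B$ with $\operatorname{supp}(b)\subset B$; (2) $\int_{\mathcal X}b\,d\mu=0$; (3) for $j\in\{1,2\}$ there exist a function $a_j$ supported on a ball $B_j\subset B$ and $\kappa_j\in\mathbb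 C$ such that $b=\kappa_1a_1+\kappa_2a_2$ and $\|a_j\|_{L^p(\mu)}\le[\mu(\rho B_j)]^{1/p-1}[1+\delta(B_j,B)]^{-1}$. Set $|b|_{H^{1,p}_{\rm atb}(\mu)}:=|\kappa_1|+|\kappa_2|$. When $\mu(\mathcal X)<\infty$, the constant function $[\mu(\mathcal X)]^{-1}$ is also regarded as a $(p,1)_\lambda$-atomic block (of size $1$, so that $\|[\mu(\mathcal X)]^{-1}\|_{H^1(\mu)}\le1$). Atomic Hardy space: $f\in L^1(\mu)$ belongs to $H^{1,p}_{\rm atb}(\mu)$ if there exist $(p,1)_\lambda$-atomic blocks $\{b_j\}_{j\in\mathbb N}$ with $f=\sum_{j=1}^\infty b_j$ and $\sum_{j}|b_j|_{H^{1,p}_{\rm atb}(\mu)}<\infty$; the norm is the infimum of $\sum_j|b_j|_{H^{1,p}_{\rm atb}(\mu)}$ over all such decompositions. It is known that this space does not depend on $\rho\in(1,\infty)$ nor on $p\in(1,\infty]$ (with equivalent norms); it is denoted by $H^1(\mu)$. *)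

theory Defs
  imports "HOL-Analysis.Analysis" "HOL-Probability.Essential_Supremum"
begin

text \<open>Real powers on \<^typ>\<open>ennreal\<close>, intended for exponents \<open>s > 0\<close> only
  (so that \<open>0\<close> is sent to \<open>0\<close> and \<open>\<infinity>\<close> to \<open>\<infinity>\<close>).\<close>

definition ennpowr :: "ennreal \<Rightarrow> real \<Rightarrow> ennreal" where
  "ennpowr a s = (if a = \<infinity> then \<infinity> else ennreal (enn2real a powr s))"

definition eLp_norm :: "'a measure \<Rightarrow> ennreal \<Rightarrow> ('a \<Rightarrow> ennreal) \<Rightarrow> ennreal" where
  "eLp_norm M p g =
     (if p = \<infinity> then esssup M g
      else ennpowr (\<integral>\<^sup>+x. ennpowr (g x) (enn2real p) \<partial>M) (1 / enn2real p))"

abbreviation Lp_norm :: "'a measure \<Rightarrow> ennreal \<Rightarrow> ('a \<Rightarrow> complex) \<Rightarrow> ennreal" where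
  "Lp_norm M p f \<equiv> eLp_norm M p (\<lambda>x. ennreal (cmod (f x)))"

definition Lp_space :: "'a measure \<Rightarrow> ennreal \<Rightarrow> ('a \<Rightarrow> complex) set" where
  "Lp_space M p = {f \<in> borel_measurable M. Lp_norm M p f < \<infinity>}"

definition weak_L1_norm :: "'a measure \<Rightarrow> ('a \<Rightarrow> ennreal) \<Rightarrow> ennreal" where
  "weak_L1_norm M g = (SUP t\<in>{0<..}. ennreal t * emeasure M {x \<in> space M. ennreal t < g x})"

definition locally_integrable_on ::
    "'a::topological_space measure \<Rightarrow> 'a set \<Rightarrow> ('a \<Rightarrow> complex) \<Rightarrow> bool" where
  "locally_integrable_on M S f \<longleftrightarrow>
     (\<forall>z\<in>S. \<exists>U. open U \<and> z \<in> U \<and> set_integrable M (U \<inter> S) f)"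

text \<open>Boundedness of an operator \<open>T\<close> with values in the non-negative functions, from a space
  \<open>X\<close> with norm \<open>N\<close> to the space of all measurable \<open>g\<close> whose (quasi-)norm \<open>N' g\<close> is finite.\<close>

definition bounded_operator ::
    "'a measure \<Rightarrow> ('a \<Rightarrow> complex) set \<Rightarrow> (('a \<Rightarrow> complex) \<Rightarrow> ennreal) \<Rightarrow> (('a \<Rightarrow> ennreal) \<Rightarrow> ennreal)
     \<Rightarrow> (('a \<Rightarrow> complex) \<Rightarrow> 'a \<Rightarrow> ennreal) \<Rightarrow> bool" where
  "bounded_operator M X N N' T \<longleftrightarrow>
     (\<exists>C>0. \<forall>f\<in>X. T f \<in> borel_measurable M \<and> N' (T f) \<le> ennreal C * N f)"

definition bounded_on_Lp ::
    "'a measure \<Rightarrow> ennreal \<Rightarrow> (('a \<Rightarrow> complex) \<Rightarrow> 'a \<Rightarrow> ennreal) \<Rightarrow> bool" where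
  "bounded_on_Lp M p T \<longleftrightarrow> bounded_operator M (Lp_space M p) (Lp_norm M p) (eLp_norm M p) T"

definition bounded_L1_weak_L1 ::
    "'a measure \<Rightarrow> (('a \<Rightarrow> complex) \<Rightarrow> 'a \<Rightarrow> ennreal) \<Rightarrow> bool" where
  "bounded_L1_weak_L1 M T \<longleftrightarrow> bounded_operator M (Lp_space M 1) (Lp_norm M 1) (weak_L1_norm M) T"

definition upper_doubling ::
    "'a::metric_space measure \<Rightarrow> ('a \<Rightarrow> real \<Rightarrow> real) \<Rightarrow> real \<Rightarrow> bool" where
  "upper_doubling M lam C \<longleftrightarrow>
     C > 0 \<and>
     (\<forall>x. \<forall>r>0. lam x r > 0) \<and>
     (\<forall>x. mono_on {0<..} (lam x)) \<and>
     (\<forall>x. \<forall>r>0. emeasure M (ball x r) \<le> ennreal (lam x r) \<and> lam x r \<le> C * lam x (r / 2)) \<and>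
     (\<forall>x y. \<forall>r>0. dist x y \<le> r \<longrightarrow> lam x r \<le> C * lam y r)"

definition geometrically_doubling :: "'a::metric_space itself \<Rightarrow> bool" where
  "geometrically_doubling _ \<longleftrightarrow>
     (\<exists>N::nat. N \<ge> 1 \<and>
        (\<forall>(x::'a). \<forall>r>0. \<exists>F. finite F \<and> card F \<le> N \<and> ball x r \<subseteq> (\<Union>z\<in>F. ball z (r / 2))))"

definition nonhomogeneous_space ::
    "'a::metric_space measure \<Rightarrow> ('a \<Rightarrow> real \<Rightarrow> real) \<Rightarrow> bool" where
  "nonhomogeneous_space M lam \<longleftrightarrow>
     sets M = sets borel \<and> (\<exists>C. upper_doubling M lam C) \<and> geometrically_doubling TYPE('a)"

text \<open>The coefficient \<open>\<delta>(B, S)\<close> for \<open>B = ball c r\<close> and \<open>S = ball c' r'\<close>. Balls are given by centre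
  and radius throughout, since a ball as a set need not determine them.\<close>

definition delta_coeff ::
    "'a::metric_space measure \<Rightarrow> ('a \<Rightarrow> real \<Rightarrow> real) \<Rightarrow> 'a \<Rightarrow> real \<Rightarrow> 'a \<Rightarrow> real \<Rightarrow> real" where
  "delta_coeff M lam c r c' r' =
     (LINT x:(ball c' (2 * r') - ball c r)|M. 1 / lam c (dist x c))"

definition supported_in :: "'a measure \<Rightarrow> 'a set \<Rightarrow> ('a \<Rightarrow> complex) \<Rightarrow> bool" where
  "supported_in M B f \<longleftrightarrow> (AE x in M. x \<notin> B \<longrightarrow> f x = 0)"

text \<open>\<open>proper_atomic_block M lam \<rho> p b s\<close>: \<open>b\<close> is a \<open>(p,1)\<close>-atomic block admitting a representation
  \<open>b = \<kappa> 1 * a 1 + \<kappa> 2 * a 2\<close> with \<open>s = \<bar>\<kappa> 1\<bar> + \<bar>\<kappa> 2\<bar>\<close>. The size depends on the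
  representation, hence a relation. For \<open>p = \<infinity>\<close> the exponent \<open>1/p - 1\<close> is \<open>-1\<close>. If
  \<open>\<mu> (\<rho> B\<^sub>j) = 0\<close>, the power is \<open>0\<close> rather than \<open>\<infinity>\<close>, but then \<open>a j = 0\<close> almost everywhere.\<close>

definition proper_atomic_block ::
    "'a::metric_space measure \<Rightarrow> ('a \<Rightarrow> real \<Rightarrow> real) \<Rightarrow> real \<Rightarrow> ennreal \<Rightarrow> ('a \<Rightarrow> complex) \<Rightarrow> real \<Rightarrow> bool"
  where
  "proper_atomic_block M lam \<rho> p b s \<longleftrightarrow>
     locally_integrable_on M UNIV b \<and>
     (LINT x|M. b x) = 0 \<and>
     (\<exists>c r. r > 0 \<and> supported_in M (ball c r) b \<and>
        (\<exists>(a :: nat \<Rightarrow> 'a \<Rightarrow> complex) (cc :: nat \<Rightarrow> 'a) (rr :: nat \<Rightarrow> real) (\<kappa> :: nat \<Rightarrow> complex).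
           (\<forall>j\<in>{1,2}.
              rr j > 0 \<and> ball (cc j) (rr j) \<subseteq> ball c r \<and>
              a j \<in> borel_measurable M \<and> supported_in M (ball (cc j) (rr j)) (a j) \<and>
              Lp_norm M p (a j) \<le>
                ennreal (measure M (ball (cc j) (\<rho> * rr j)) powr (enn2real (1 / p) - 1)
                         * inverse (1 + delta_coeff M lam (cc j) (rr j) c r))) \<and>
           (AE x in M. b x = \<kappa> 1 * a 1 x + \<kappa> 2 * a 2 x) \<and>
           s = cmod (\<kappa> 1) + cmod (\<kappa> 2)))"

text \<open>On a space of finite measure, the constant function \<open>1 / \<mu>(X)\<close> is a block of size \<open>1\<close>. So that
  the span of the blocks is a vector space, its multiples by \<open>\<kappa>\<close> are blocks of size \<open>\<bar>\<kappa>\<bar>\<close>, just as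
  for the proper blocks.\<close>

definition atomic_block ::
    "'a::metric_space measure \<Rightarrow> ('a \<Rightarrow> real \<Rightarrow> real) \<Rightarrow> real \<Rightarrow> ennreal \<Rightarrow> ('a \<Rightarrow> complex) \<Rightarrow> real \<Rightarrow> bool"
  where
  "atomic_block M lam \<rho> p b s \<longleftrightarrow>
     proper_atomic_block M lam \<rho> p b s \<or>
     (emeasure M (space M) < \<infinity> \<and>
      (\<exists>\<kappa>::complex. b = (\<lambda>x. \<kappa> * of_real (1 / measure M (space M))) \<and> s = cmod \<kappa>))"

text \<open>Every block of size \<open>s\<close> has \<open>L\<^sup>1\<close> norm at most \<open>s\<close>, so pointwise almost everywhere convergence
  of \<open>\<Sum>b\<^sub>j\<close> is here the same as convergence in \<open>L\<^sup>1\<close>.\<close>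

definition atomic_decomposition ::
    "'a::metric_space measure \<Rightarrow> ('a \<Rightarrow> real \<Rightarrow> real) \<Rightarrow> real \<Rightarrow> ennreal \<Rightarrow> ('a \<Rightarrow> complex)
     \<Rightarrow> (nat \<Rightarrow> 'a \<Rightarrow> complex) \<Rightarrow> (nat \<Rightarrow> real) \<Rightarrow> bool" where
  "atomic_decomposition M lam \<rho> p f b s \<longleftrightarrow>
     (\<forall>j. atomic_block M lam \<rho> p (b j) (s j)) \<and> summable s \<and>
     (AE x in M. (\<lambda>j. b j x) sums f x)"

definition Hardy_space ::
    "'a::metric_space measure \<Rightarrow> ('a \<Rightarrow> real \<Rightarrow> real) \<Rightarrow> real \<Rightarrow> ennreal \<Rightarrow> ('a \<Rightarrow> complex) set" where
  "Hardy_space M lam \<rho> p =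
     {f \<in> Lp_space M 1. \<exists>b s. atomic_decomposition M lam \<rho> p f b s}"

definition Hardy_norm ::
    "'a::metric_space measure \<Rightarrow> ('a \<Rightarrow> real \<Rightarrow> real) \<Rightarrow> real \<Rightarrow> ennreal \<Rightarrow> ('a \<Rightarrow> complex) \<Rightarrow> real" where
  "Hardy_norm M lam \<rho> p f = Inf {suminf s |b s. atomic_decomposition M lam \<rho> p f b s}"

definition bounded_Hardy_L1 ::
    "'a::metric_space measure \<Rightarrow> ('a \<Rightarrow> real \<Rightarrow> real) \<Rightarrow> real \<Rightarrow> ennreal
     \<Rightarrow> (('a \<Rightarrow> complex) \<Rightarrow> 'a \<Rightarrow> ennreal) \<Rightarrow> bool" where
  "bounded_Hardy_L1 M lam \<rho> p T \<longleftrightarrow>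
     bounded_operator M (Hardy_space M lam \<rho> p) (\<lambda>f. ennreal (Hardy_norm M lam \<rho> p f)) (eLp_norm M 1) T"

text \<open>Kernels live off the diagonal; the values \<open>K x x\<close> of the total function are irrelevant below.
  In the last condition the region of integration avoids the singularities \<open>x = y\<close>, \<open>x = y'\<close>
  unless \<open>y = y'\<close>, in which case the integrand vanishes.\<close>

definition marcinkiewicz_kernel ::
    "'a::metric_space measure \<Rightarrow> ('a \<Rightarrow> real \<Rightarrow> real) \<Rightarrow> ('a \<Rightarrow> 'a \<Rightarrow> complex) \<Rightarrow> bool" where
  "marcinkiewicz_kernel M lam K \<longleftrightarrow>
     locally_integrable_on (M \<Otimes>\<^sub>M M) {(x, y). x \<noteq> y} (\<lambda>(x, y). K x y) \<and>
     (\<exists>C>0.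
        (\<forall>x y. x \<noteq> y \<longrightarrow> cmod (K x y) \<le> C * (dist x y / lam x (dist x y))) \<and>
        (\<forall>y y'. (\<integral>\<^sup>+x\<in>{x. dist x y \<ge> 2 * dist y y'}.
                   ennreal ((cmod (K x y - K x y') + cmod (K y x - K y' x)) * (1 / dist x y)) \<partial>M)
                \<le> ennreal C))"

text \<open>Since \<open>K\<close> is undefined on the diagonal, the point \<open>x\<close> is left out of the ball (equivalently,
  \<open>K x x\<close> is read as \<open>0\<close>). This only matters if \<open>x\<close> is an atom of \<open>M\<close>. The value may be \<open>\<infinity>\<close>.\<close>

definition marcinkiewicz ::
    "'a::metric_space measure \<Rightarrow> ('a \<Rightarrow> 'a \<Rightarrow> complex) \<Rightarrow> ('a \<Rightarrow> complex) \<Rightarrow> 'a \<Rightarrow> ennreal" where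
  "marcinkiewicz M K f x =
     ennpowr (\<integral>\<^sup>+t\<in>{0<..}.
        ennreal ((cmod (LINT y:(ball x t - {x})|M. K x y * f y))\<^sup>2 * (1 / t ^ 3)) \<partial>lborel) (1 / 2)"

end

theory Submission imports Defs begin

text \<open>With \<open>t\<close> restricted to \<open>(1 / n, n)\<close>, the Marcinkiewicz integral is the norm of a singular
 integral with values in \<open>L\<^sup>2(dt / t\<^sup>3)\<close>, whose kernel satisfies a size condition, Hoermander's condition and,
 with a constant depending on \<open>n\<close>, Schur's condition. Its adjoint has a kernel of the same kind.
 A Calderon--Zygmund decomposition over the measure \<open>\<mu>\<close>, in which the averages of the bad part are moved to
 larger doubling balls, turns a bound on one \<open>L\<^sup>q\<close> into the weak type \<open>(1,1)\<close>; interpolation and duality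
 then reach all exponents. If only the weak type \<open>(1,1)\<close> or the bound on the Hardy space is known, the
 \<open>L\<^sup>2\<close> norms \<open>A\<close> of the truncated operators are still finite by Schur's test, they bound the \<open>L\<^sup>4\<close> norms
 linearly, and interpolating with the given estimate yields \<open>A \<le> C * A powr (1 - \<epsilon>)\<close> with \<open>C\<close> independent
 of \<open>n\<close>. The bad part of the decomposition consists of atomic blocks, which is how the Hardy space
 enters. Conversely, an \<open>L\<^sup>q\<close> bound gives a uniform \<open>L\<^sup>1\<close> estimate of atomic blocks.\<close>

section \<open>Powers and interpolation\<close>

text \<open>As \<mu> need not be doubling, the mass of a bad ball cannot be put back on a comparable
  ball. It goes to the first doubling dilate; the annuli in between cost only a bounded coefficient
  \<delta>, because at non-doubling scales the density of \<mu> relative to \<lambda> grows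
  geometrically. Kernels are operator-valued with both L^2 factors free, so that transposition stays
  in one class and reaches exponents above 2. For the Hardy space the obstacle is the size of a
  block: p = \<infinity> asks for sup bounds, so only functions with |f| <= 1 are decomposed with
  controlled size. Balancing \<open>A powr 4 * s powr - 4 * h powr 3\<close> (the good part, by the
  L^4 bound) with \<open>1 / (h * s)\<close> (the blocks) yields a restricted weak type with
  exponent 7/4; summing dyadic levels raises it to 15/8, still below 2, and interpolation with L^4
  leaves the power 3/4 of \<open>A\<close>. Any fixed power below 1 closes the bootstrap. If
  \<mu>(X) is finite, low heights admit no decomposition; there the constant block takes
  over.\<close>

abbreviation ind :: "'a set => 'a => 'b::zero_neq_one" where "ind \<equiv> indicator"

abbreviation ecmod :: "complex => ennreal" where "ecmod z \<equiv> ennreal (cmod z)"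

section \<open>Arithmetic of real powers of extended nonnegative numbers\<close>

lemma ennpowr_0 [simp]: "s > 0 ==> ennpowr 0 s = 0"
 by (simp add: ennpowr_def)

lemma ennpowr_top [simp]: "ennpowr \<infinity> s = \<infinity>" "ennpowr top s = top"
 by (simp_all add: ennpowr_def)

lemma ennpowr_ennreal: "x >= 0 ==> ennpowr (ennreal x) s = ennreal (x powr s)"
 by (simp add: ennpowr_def)

lemma ennpowr_mono: assumes "a <= b" "s > 0" shows "ennpowr a s <= ennpowr b s"
proof (cases b)
 case (real r)
 then obtain q where "a = ennreal q" "q >= 0" "q <= r"
  using assms by (metis ennreal_cases ennreal_le_iff ennreal_less_top leD top.not_eq_extremum)
 then show ?thesis using real assms by (simp add: ennpowr_ennreal powr_mono2)
qed (use assms in \<open>auto simp: ennpowr_def\<close>)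

lemma ennpowr_ennpowr: assumes "s > 0" "t > 0" shows "ennpowr (ennpowr a s) t = ennpowr a (s * t)"
 by (cases a) (auto simp: ennpowr_ennreal powr_powr)

lemma ennpowr_1 [simp]: "ennpowr a 1 = a"
 by (cases a) (auto simp: ennpowr_ennreal)

lemma ennpowr_inverse: assumes "s > 0"
 shows "ennpowr (ennpowr a s) (1 / s) = a" "ennpowr (ennpowr a (1 / s)) s = a"
 using assms by (simp_all add: ennpowr_ennpowr)

lemma ennpowr_le_iff: assumes "s > 0" shows "ennpowr a s <= ennpowr b s \<longleftrightarrow> a <= b"
proof
 assume "ennpowr a s <= ennpowr b s"
 then show "a <= b"
  using ennpowr_mono[of "ennpowr a s" "ennpowr b s" "1 / s"] assms by (simp add: ennpowr_inverse)
qed (use assms ennpowr_mono in blast)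

lemma ennpowr_less_iff: assumes "s > 0" shows "ennpowr a s < ennpowr b s \<longleftrightarrow> a < b"
 using ennpowr_le_iff[OF assms] by (meson linorder_not_le)

lemma ennpowr_eq_0_iff: assumes "s > 0" shows "ennpowr a s = 0 \<longleftrightarrow> a = 0"
 by (cases a) (auto simp: ennpowr_ennreal assms)

lemma ennpowr_eq_top_iff: "ennpowr a s = top \<longleftrightarrow> a = top"
 by (cases a) (auto simp: ennpowr_ennreal)

lemma ennpowr_mult: assumes "s > 0" shows "ennpowr (a * b) s = ennpowr a s * ennpowr b s"
proof (cases a)
 case a: (real x)
 show ?thesis
 proof (cases b)
  case b: (real y)
  then show ?thesis using a
   by (simp add: ennreal_mult[symmetric] ennpowr_ennreal powr_mult)
 next
  case top
  then show ?thesis using assms a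
   by (cases "x = 0") (auto simp: ennreal_mult_top ennpowr_ennreal)
 qed
next
 case top
 show ?thesis
 proof (cases b)
  case b: (real y)
  then show ?thesis using assms top
   by (cases "y = 0") (auto simp: ennreal_top_mult ennpowr_ennreal)
 qed (use top in \<open>auto\<close>)
qed

lemma ennpowr_2: "ennpowr a 2 = a\<^sup>2"
 by (cases a) (auto simp: ennpowr_ennreal ennreal_power power2_eq_square ennreal_mult_top ennreal_mult[symmetric] ennreal_top_mult)

lemma ennpowr_half_sq [simp]: "(ennpowr a (1 / 2))\<^sup>2 = a"
 using ennpowr_inverse(2)[of 2 a] by (simp add: ennpowr_2)

lemma ennpowr_sq_half [simp]: "ennpowr (a\<^sup>2) (1 / 2) = a"
 using ennpowr_inverse(1)[of 2 a] by (simp add: ennpowr_2)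

lemma ennpowr_add_exp: assumes "s > 0" "t > 0"
 shows "ennpowr a (s + t) = ennpowr a s * ennpowr a t"
 by (cases a) (use assms in \<open>auto simp: ennpowr_ennreal powr_add ennreal_mult\<close>)

lemma measurable_ennpowr [measurable]: "(\<lambda>a. ennpowr a s) \<in> borel_measurable borel"
 unfolding ennpowr_def by measurable

lemma measurable_ennpowr' [measurable (raw)]:
 "f \<in> borel_measurable M ==> (\<lambda>x. ennpowr (f x) s) \<in> borel_measurable M"
 using measurable_compose[OF _ measurable_ennpowr] by blast

lemma sq_le_sq_ennreal: "(a::ennreal)\<^sup>2 <= b\<^sup>2 \<longleftrightarrow> a <= b"
 using ennpowr_le_iff[of 2 a b] by (simp add: ennpowr_2)

text \<open>The inverse power \<open>1 / s\<close> carries strict lower bounds back and forth. This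
  moves powers through lower limits around the applications of Fatou's lemma.\<close>

lemma ennpowr_Liminf:
 assumes "s > 0" shows "ennpowr (liminf X) s <= liminf (\<lambda>n. ennpowr (X n) s)"
proof (rule le_Liminf_iff[THEN iffD2], intro allI impI)
 fix y assume "y < ennpowr (liminf X) s"
 then have "ennpowr y (1 / s) < liminf X"
  using ennpowr_less_iff[of "1 / s" y "ennpowr (liminf X) s"] assms by (simp add: ennpowr_inverse)
 then have "eventually (\<lambda>n. ennpowr y (1 / s) < X n) sequentially"
  using less_LiminfD by blast
 then show "eventually (\<lambda>n. y < ennpowr (X n) s) sequentially"
  by eventually_elim (metis assms ennpowr_inverse(2) ennpowr_less_iff)
qed

section \<open>Hoelder's inequality and L^2 norms\<close>

lemma Young_ennreal:
 fixes a b :: ennreal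
 assumes "p > 1" "q > 1" "1 / p + 1 / q = (1 :: real)"
 shows "a * b <= ennreal (1 / p) * ennpowr a p + ennreal (1 / q) * ennpowr b q"
proof (cases a)
 case a: (real x)
 show ?thesis
 proof (cases b)
  case b: (real y)
  then show ?thesis using a Youngs_inequality[OF assms, of x y] assms
   by (simp add: ennpowr_ennreal ennreal_mult[symmetric] ennreal_plus[symmetric] del: ennreal_plus)
 qed (use a assms in \<open>auto simp: ennreal_mult_top\<close>)
qed (use assms in \<open>auto simp: ennreal_mult_top\<close>)

text \<open>Both factors are normalised to norm 1 and Young's inequality is applied pointwise. The
  norms 0 and \<open>top\<close> are split off, since division by them does not normalise.\<close>

lemma Hoelder_ennreal:
 fixes f g :: "'a => ennreal"
 assumes [measurable]: "f \<in> borel_measurable M" "g \<in> borel_measurable M"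
  and pq: "p > 1" "q > 1" "1 / p + 1 / q = (1 :: real)"
 shows "(\<integral>\<^sup>+x. f x * g x \<partial>M) <= ennpowr (\<integral>\<^sup>+x. ennpowr (f x) p \<partial>M) (1 / p) * ennpowr (\<integral>\<^sup>+x. ennpowr (g x) q \<partial>M) (1 / q)" (is "?L <= ennpowr ?F _ * ennpowr ?G _")
proof -
 define A where "A = ennpowr ?F (1 / p)"
 define B where "B = ennpowr ?G (1 / q)"
 have Ap: "?F = ennpowr A p" and Bq: "?G = ennpowr B q"
  unfolding A_def B_def using pq by (simp_all add: ennpowr_inverse)
 consider "A = 0 \<or> B = 0" | "A \<noteq> 0" "B \<noteq> 0" "A = top \<or> B = top"
  | "A \<noteq> 0" "B \<noteq> 0" "A \<noteq> top" "B \<noteq> top" by blast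
 then show ?thesis unfolding A_def[symmetric] B_def[symmetric]
 proof cases
  case 1
  have "AE x in M. f x * g x = 0"
  proof (cases "A = 0")
   case True
   then have "?F = 0" using Ap pq by simp
   then have "AE x in M. ennpowr (f x) p = 0" by (simp add: nn_integral_0_iff_AE)
   then show ?thesis by eventually_elim (use pq in \<open>simp add: ennpowr_eq_0_iff\<close>)
  next
   case False
   then have "?G = 0" using 1 Bq pq by simp
   then have "AE x in M. ennpowr (g x) q = 0" by (simp add: nn_integral_0_iff_AE)
   then show ?thesis by eventually_elim (use pq in \<open>simp add: ennpowr_eq_0_iff\<close>)
  qed
  then show "?L <= A * B"
   by (subst nn_integral_cong_AE) auto
 next
  case 2
  then have "A * B = top" by (auto simp: ennreal_mult_top ennreal_top_mult ennreal_mult_eq_top_iff)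
  then show "?L <= A * B" by simp
 next
  case 3
  let ?Y = "\<lambda>x. A * B * (ennreal (1 / p) * (ennpowr (f x / A) p) + ennreal (1 / q) * ennpowr (g x / B) q)"
  have *: "f x * g x <= ?Y x" for x
  proof -
   have "f x * g x = A * B * ((f x / A) * (g x / B))"
   proof -
    have "A * (f x / A) = f x" "B * (g x / B) = g x"
     using 3 by (simp_all add: ennreal_times_divide mult_divide_eq_ennreal mult.commute[of A] mult.commute[of B])
    then show ?thesis by (metis (no_types, opaque_lifting) mult.assoc mult.left_commute)
   qed
   also have "... <= ?Y x"
    by (intro mult_left_mono Young_ennreal pq) auto
   finally show ?thesis .
  qed
  have one: "(\<integral>\<^sup>+x. ennpowr (f x / A) p \<partial>M) = 1" (is "?a = 1")
   "(\<integral>\<^sup>+x. ennpowr (g x / B) q \<partial>M) = 1" (is "?b = 1")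
  proof -
   have "?a = ?F * ennpowr (inverse A) p"
    using pq by (simp add: divide_ennreal_def ennpowr_mult nn_integral_multc)
   also have "... = ennpowr (A * inverse A) p" using pq Ap by (simp add: ennpowr_mult)
   also have "A * inverse A = 1" using 3 by (simp add: less_top ennreal_divide_self flip: divide_ennreal_def)
   finally show "?a = 1" using ennpowr_ennreal[of 1 p] by simp
   have "?b = ?G * ennpowr (inverse B) q"
    using pq by (simp add: divide_ennreal_def ennpowr_mult nn_integral_multc)
   also have "... = ennpowr (B * inverse B) q" using pq Bq by (simp add: ennpowr_mult)
   also have "B * inverse B = 1" using 3 by (simp add: less_top ennreal_divide_self flip: divide_ennreal_def)
   finally show "?b = 1" using ennpowr_ennreal[of 1 q] by simp
  qed
  have "?L <= (\<integral>\<^sup>+x. ?Y x \<partial>M)"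
   by (intro nn_integral_mono *)
  also have "... = A * B * (ennreal (1 / p) + ennreal (1 / q))"
   by (simp add: nn_integral_cmult nn_integral_add one)
  also have "ennreal (1 / p) + ennreal (1 / q) = 1"
   using pq by (simp flip: ennreal_plus)
  finally show "?L <= A * B" by simp
 qed
qed

lemma Cauchy_Schwarz_half:
 fixes f g :: "'a => ennreal"
 assumes [measurable]: "f \<in> borel_measurable M" "g \<in> borel_measurable M"
 shows "(\<integral>\<^sup>+x. f x * g x \<partial>M) <= ennpowr (\<integral>\<^sup>+x. (f x)\<^sup>2 \<partial>M) (1 / 2) * ennpowr (\<integral>\<^sup>+x. (g x)\<^sup>2 \<partial>M) (1 / 2)"
 using Hoelder_ennreal[of f M g 2 2] by (simp add: ennpowr_2)

text \<open>Defined on extended nonnegative functions, with infinity as a legal value, so that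
  Minkowski and Cauchy--Schwarz can be used before finiteness is known.\<close>

definition l2 :: "'b measure => ('b => ennreal) => ennreal" where
 "l2 N w = ennpowr (\<integral>\<^sup>+b. (w b)\<^sup>2 \<partial>N) (1 / 2)"

lemma l2_sq: "(l2 N w)\<^sup>2 = (\<integral>\<^sup>+b. (w b)\<^sup>2 \<partial>N)"
 by (simp add: l2_def)

lemma l2_mono_AE: "AE b in N. v b <= w b ==> l2 N v <= l2 N w"
 unfolding l2_def by (intro ennpowr_mono nn_integral_mono_AE) (auto elim!: eventually_mono intro: power_mono)

lemma l2_mono: "(\<And>b. b \<in> space N ==> v b <= w b) ==> l2 N v <= l2 N w"
 by (rule l2_mono_AE) auto

lemma l2_cmult: assumes [measurable]: "w \<in> borel_measurable N" shows "l2 N (\<lambda>b. c * w b) = c * l2 N w"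
 unfolding l2_def by (simp add: power_mult_distrib nn_integral_cmult ennpowr_mult)

lemma nn_integral_mult_le_l2:
 assumes [measurable]: "v \<in> borel_measurable N" "w \<in> borel_measurable N"
 shows "(\<integral>\<^sup>+b. v b * w b \<partial>N) <= l2 N v * l2 N w"
 unfolding l2_def by (rule Cauchy_Schwarz_half) auto

lemma measurable_l2 [measurable (raw)]:
 assumes "sigma_finite_measure N"
  and [measurable]: "(\<lambda>(x, b). w x b) \<in> borel_measurable (M \<Otimes>\<^sub>M N)"
 shows "(\<lambda>x. l2 N (w x)) \<in> borel_measurable M"
proof -
 interpret sigma_finite_measure N by fact
 show ?thesis unfolding l2_def by measurable
qed

text \<open>Minkowski's integral inequality; the square of the inner integral is a double integral, to
 which Cauchy--Schwarz applies pointwise.\<close>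

lemma l2_nn_integral:
 assumes "sigma_finite_measure M" "sigma_finite_measure N"
  and w [measurable]: "(\<lambda>(x, b). w x b) \<in> borel_measurable (M \<Otimes>\<^sub>M N)"
 shows "l2 N (\<lambda>b. \<integral>\<^sup>+x. w x b \<partial>M) <= (\<integral>\<^sup>+x. l2 N (w x) \<partial>M)"
proof -
 interpret M: sigma_finite_measure M by fact
 interpret N: sigma_finite_measure N by fact
 interpret MN: pair_sigma_finite M N ..
 note [measurable] = measurable_l2[OF assms(2)]
 have [measurable]: "(\<lambda>(b, x). w x b) \<in> borel_measurable (N \<Otimes>\<^sub>M M)"
  using w by (subst measurable_pair_swap_iff) simp
 have "(l2 N (\<lambda>b. \<integral>\<^sup>+x. w x b \<partial>M))\<^sup>2 = (\<integral>\<^sup>+b. (\<integral>\<^sup>+x. w x b \<partial>M)\<^sup>2 \<partial>N)" by (simp add: l2_sq)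
 also have "... = (\<integral>\<^sup>+b. (\<integral>\<^sup>+x. \<integral>\<^sup>+y. w x b * w y b \<partial>M \<partial>M) \<partial>N)"
  by (intro nn_integral_cong) (simp add: power2_eq_square nn_integral_cmult nn_integral_multc)
 also have "... = (\<integral>\<^sup>+x. (\<integral>\<^sup>+b. \<integral>\<^sup>+y. w x b * w y b \<partial>M \<partial>N) \<partial>M)"
  by (subst MN.Fubini') (auto simp: )
 also have "... = (\<integral>\<^sup>+x. (\<integral>\<^sup>+y. \<integral>\<^sup>+b. w x b * w y b \<partial>N \<partial>M) \<partial>M)"
  by (intro nn_integral_cong) (subst MN.Fubini', auto)
 also have "... <= (\<integral>\<^sup>+x. (\<integral>\<^sup>+y. l2 N (w x) * l2 N (w y) \<partial>M) \<partial>M)"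
  by (intro nn_integral_mono nn_integral_mult_le_l2) auto
 also have "... = (\<integral>\<^sup>+x. l2 N (w x) \<partial>M)\<^sup>2"
  by (simp add: power2_eq_square nn_integral_cmult nn_integral_multc)
 finally show ?thesis by (simp add: sq_le_sq_ennreal)
qed

lemma l2_add:
 assumes [measurable]: "v \<in> borel_measurable N" "w \<in> borel_measurable N"
 shows "l2 N (\<lambda>b. v b + w b) <= l2 N v + l2 N w"
proof -
 have "(l2 N (\<lambda>b. v b + w b))\<^sup>2 = (\<integral>\<^sup>+b. (v b)\<^sup>2 \<partial>N) + 2 * (\<integral>\<^sup>+b. v b * w b \<partial>N) + (\<integral>\<^sup>+b. (w b)\<^sup>2 \<partial>N)"
  by (simp add: l2_sq power2_sum nn_integral_add mult.assoc nn_integral_cmult)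
 also have "... <= (l2 N v)\<^sup>2 + 2 * (l2 N v * l2 N w) + (l2 N w)\<^sup>2"
  by (intro add_mono mult_left_mono nn_integral_mult_le_l2) (auto simp: l2_sq)
 also have "... = (l2 N v + l2 N w)\<^sup>2" by (simp add: power2_sum ac_simps)
 finally show ?thesis by (simp add: sq_le_sq_ennreal)
qed

section \<open>Layer cake formula and Marcinkiewicz interpolation\<close>

lemma nn_integral_powr_below:
 fixes e a :: real assumes "e > 0" "a >= 0"
 shows "(\<integral>\<^sup>+s. ennreal (s powr (e - 1)) * ind {0<..<a} s \<partial>lborel) = ennreal (a powr e / e)"
proof -
 have "(\<integral>\<^sup>+s. ennreal (s powr (e - 1)) * ind {0<..<a} s \<partial>lborel)
   = (\<integral>\<^sup>+s. ennreal (s powr (e - 1)) * ind {0..a} s \<partial>lborel)"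
 proof (rule nn_integral_cong_AE)
  have "AE s in lborel. s \<noteq> 0 \<and> s \<noteq> a" using AE_lborel_singleton[of 0] AE_lborel_singleton[of a] by eventually_elim auto
  then show "AE s in lborel. ennreal (s powr (e - 1)) * ind {0<..<a} s = ennreal (s powr (e - 1)) * ind {0..a} s"
   by eventually_elim (auto simp: indicator_def)
 qed
 also have "... = ennreal (a powr e / e)"
  using nn_integral_has_integral_lebesgue'[OF _ has_integral_powr_from_0[of "e - 1" a]] assms by simp
 finally show ?thesis .
qed

lemma nn_integral_powr_above:
 fixes e a :: real assumes "e > 0" "a > 0"
 shows "(\<integral>\<^sup>+s. ennreal (s powr (- e - 1)) * ind {a..} s \<partial>lborel) = ennreal (a powr (- e) / e)"
 using nn_integral_has_integral_lebesgue'[OF _ has_integral_powr_to_inf[of "- e - 1" a]] assms by simp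

lemma ennpowr_layer_cake:
 fixes g :: ennreal assumes "p > 0"
 shows "ennpowr g p = (\<integral>\<^sup>+s. ennreal (p * s powr (p - 1)) * ind {s. 0 < s \<and> ennreal s < g} s \<partial>lborel)"
proof -
 have fin: "(\<integral>\<^sup>+s. ennreal (p * s powr (p - 1)) * ind {0<..<a} s \<partial>lborel) = ennreal (a powr p)" if "a >= 0" for a
  using nn_integral_powr_below[OF assms that] assms
  by (simp add: ennreal_mult mult.assoc nn_integral_cmult) (simp flip: ennreal_mult)
 show ?thesis
 proof (cases g)
  case (real a)
  then have "{s. 0 < s \<and> ennreal s < g} = {0<..<a}" by (auto simp: ennreal_less_iff)
  then show ?thesis using fin[of a] real by (simp add: ennpowr_ennreal)
 next
  case top
  have "ennreal n <= (\<integral>\<^sup>+s. ennreal (p * s powr (p - 1)) * ind {s. 0 < s \<and> ennreal s < g} s \<partial>lborel)" for n :: nat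
  proof -
   \<comment> \<open>An infinite \<open>g\<close> lies above every height; stopping at height
     \<open>n powr (1 / p)\<close> makes the integral exactly \<open>n\<close>.\<close>
   have "ennreal n = (\<integral>\<^sup>+s. ennreal (p * s powr (p - 1)) * ind {0<..<real n powr (1 / p)} s \<partial>lborel)"
    using fin[of "real n powr (1 / p)"] assms by (simp add: powr_powr)
   also have "... <= (\<integral>\<^sup>+s. ennreal (p * s powr (p - 1)) * ind {s. 0 < s \<and> ennreal s < g} s \<partial>lborel)"
    using top by (intro nn_integral_mono mult_left_mono) (auto simp: indicator_def)
   finally show ?thesis .
  qed
  then have "(\<integral>\<^sup>+s. ennreal (p * s powr (p - 1)) * ind {s. 0 < s \<and> ennreal s < g} s \<partial>lborel) = top"
   by (metis ennreal_Ex_less_of_nat ennreal_of_nat_eq_real_of_nat leD top.not_eq_extremum)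
  then show ?thesis using top by simp
 qed
qed

lemma nn_integral_layer_cake:
 fixes G :: "'a => ennreal"
 assumes "sigma_finite_measure V" and [measurable]: "G \<in> borel_measurable V" and "p > 0"
 shows "(\<integral>\<^sup>+y. ennpowr (G y) p \<partial>V) =
  (\<integral>\<^sup>+s. ennreal (p * s powr (p - 1)) * emeasure V {y \<in> space V. ennreal s < G y} * ind {0<..} s \<partial>lborel)"
proof -
 interpret V: sigma_finite_measure V by fact
 interpret P: pair_sigma_finite lborel V ..
 have "(\<integral>\<^sup>+y. ennpowr (G y) p \<partial>V) = (\<integral>\<^sup>+y. \<integral>\<^sup>+s. ennreal (p * s powr (p - 1)) * ind {s. 0 < s \<and> ennreal s < G y} s \<partial>lborel \<partial>V)"
  by (simp add: ennpowr_layer_cake[OF assms(3)])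
 also have "... = (\<integral>\<^sup>+s. \<integral>\<^sup>+y. ennreal (p * s powr (p - 1)) * ind {s. 0 < s \<and> ennreal s < G y} s \<partial>V \<partial>lborel)"
  by (rule P.Fubini') (simp add: indicator_def of_bool_def cong: measurable_cong)
 also have "... = (\<integral>\<^sup>+s. ennreal (p * s powr (p - 1)) * emeasure V {y \<in> space V. ennreal s < G y} * ind {0<..} s \<partial>lborel)"
 proof (intro nn_integral_cong)
  fix s :: real
  have "(\<integral>\<^sup>+y. ennreal (p * s powr (p - 1)) * ind {s. 0 < s \<and> ennreal s < G y} s \<partial>V)
   = (\<integral>\<^sup>+y. ennreal (p * s powr (p - 1)) * ind {0<..} s * ind {y \<in> space V. ennreal s < G y} y \<partial>V)"
   by (intro nn_integral_cong) (auto simp: indicator_def)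
  also have "... = ennreal (p * s powr (p - 1)) * ind {0<..} s * emeasure V {y \<in> space V. ennreal s < G y}"
   by (simp add: nn_integral_cmult_indicator)
  finally show "(\<integral>\<^sup>+y. ennreal (p * s powr (p - 1)) * ind {s. 0 < s \<and> ennreal s < G y} s \<partial>V) =
    ennreal (p * s powr (p - 1)) * emeasure V {y \<in> space V. ennreal s < G y} * ind {0<..} s"
   by (simp add: mult_ac)
 qed
 finally show ?thesis .
qed

text \<open>The level sets are integrated against \<open>p * s powr (p - 1)\<close> and the order of
  integration is exchanged; \<open>r < p\<close> makes the inner integral converge at 0,
  \<open>p < q\<close> at infinity. The cutting parameter \<open>\<kappa>\<close> stays explicit in
  the constant, because the later bootstraps are won by choosing it as a power of the operator
  norm.\<close>

lemma Marcinkiewicz_interpolation: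
 fixes G :: "'a => ennreal" and F :: "'b => real"
 assumes "sigma_finite_measure V" "sigma_finite_measure M"
  and [measurable]: "G \<in> borel_measurable V" "F \<in> borel_measurable M"
  and F0: "\<And>x. F x >= 0" and par: "0 < r" "r < p" "p < q" "\<kappa> > 0" "D >= 0" "E >= 0"
  and weak: "\<And>s. s > 0 ==> emeasure V {y \<in> space V. ennreal s < G y} <=
    ennreal (D * s powr - r) * (\<integral>\<^sup>+x. ennreal (F x powr r) * ind {x. \<kappa> * s < F x} x \<partial>M) +
    ennreal (E * s powr - q) * (\<integral>\<^sup>+x. ennreal (F x powr q) * ind {x. F x <= \<kappa> * s} x \<partial>M)"
 shows "(\<integral>\<^sup>+y. ennpowr (G y) p \<partial>V) <=
   ennreal (p * D * \<kappa> powr (r - p) / (p - r) + p * E * \<kappa> powr (q - p) / (q - p)) * (\<integral>\<^sup>+x. ennreal (F x powr p) \<partial>M)" (is "?L <= ennreal (?D + ?E) * ?F")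
proof -
 interpret V: sigma_finite_measure V by fact
 interpret M: sigma_finite_measure M by fact
 interpret P: pair_sigma_finite lborel M ..
 let ?w = "\<lambda>s. ennreal (p * s powr (p - 1)) * ind {0<..} s"
 let ?a = "\<lambda>s x. ennreal (p * D * s powr (p - r - 1) * F x powr r) * ind {s. 0 < s \<and> \<kappa> * s < F x} s"
 let ?b = "\<lambda>s x. ennreal (p * E * s powr (p - q - 1) * F x powr q) * ind {s. 0 < s \<and> F x <= \<kappa> * s} s"
 let ?A = "\<lambda>s. \<integral>\<^sup>+x. ?a s x \<partial>M" and ?B = "\<lambda>s. \<integral>\<^sup>+x. ?b s x \<partial>M"
 let ?V = "\<lambda>s. emeasure V {y \<in> space V. ennreal s < G y}"
 have a: "(\<integral>\<^sup>+s. ?a s x \<partial>lborel) <= ennreal (?D * F x powr p)" for x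
 proof -
  have "{s. 0 < s \<and> \<kappa> * s < F x} = {0<..<F x / \<kappa>}" using par by (auto simp: field_simps)
  then have "(\<integral>\<^sup>+s. ?a s x \<partial>lborel) = ennreal (p * D * F x powr r) * (\<integral>\<^sup>+s. ennreal (s powr (p - r - 1)) * ind {0<..<F x / \<kappa>} s \<partial>lborel)"
   using par by (simp add: ennreal_mult[symmetric] flip: nn_integral_cmult mult.assoc)
    (simp add: ac_simps)
  also have "... = ennreal (p * D * F x powr r * ((F x / \<kappa>) powr (p - r) / (p - r)))"
   using par F0[of x] by (subst nn_integral_powr_below) (auto simp: ennreal_mult[symmetric])
  also have "p * D * F x powr r * ((F x / \<kappa>) powr (p - r) / (p - r)) = ?D * F x powr p"
   using par F0[of x] by (cases "F x = 0") (auto simp: powr_divide powr_diff field_simps)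
  finally show ?thesis by simp
 qed
 have b: "(\<integral>\<^sup>+s. ?b s x \<partial>lborel) <= ennreal (?E * F x powr p)" for x
 proof (cases "F x = 0")
  case False
  then have Fx: "F x > 0" using F0[of x] by simp
  then have "{s. 0 < s \<and> F x <= \<kappa> * s} = {F x / \<kappa>..}" using par
   by (auto simp: field_simps) (metis mult_pos_neg not_less order.strict_trans2 par(4) less_le_not_le linorder_not_less mult_nonneg_nonpos mult.commute)
  then have "(\<integral>\<^sup>+s. ?b s x \<partial>lborel) = ennreal (p * E * F x powr q) * (\<integral>\<^sup>+s. ennreal (s powr (p - q - 1)) * ind {F x / \<kappa>..} s \<partial>lborel)"
   using par by (simp add: ennreal_mult[symmetric] flip: nn_integral_cmult mult.assoc)
    (simp add: ac_simps)
  also have "... = ennreal (p * E * F x powr q * ((F x / \<kappa>) powr (- (q - p)) / (q - p)))"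
   using par Fx nn_integral_powr_above[of "q - p" "F x / \<kappa>"] by (simp add: ennreal_mult[symmetric])
  also have "p * E * F x powr q * ((F x / \<kappa>) powr (- (q - p)) / (q - p)) = ?E * F x powr p"
   using par Fx by (simp add: powr_divide powr_diff powr_add powr_minus field_simps)
  finally show ?thesis by simp
 qed simp
 have "?L = (\<integral>\<^sup>+s. ?w s * ?V s \<partial>lborel)"
  using nn_integral_layer_cake[OF assms(1,3), of p] par by (simp add: ac_simps)
 also have "... <= (\<integral>\<^sup>+s. ?A s + ?B s \<partial>lborel)"
 proof (intro nn_integral_mono)
  fix s :: real
  show "?w s * ?V s <= ?A s + ?B s"
  proof (cases "s > 0")
   case True
   let ?X = "\<integral>\<^sup>+x. ennreal (p * s powr (p - 1)) * ennreal (D * s powr - r) * (ennreal (F x powr r) * ind {x. \<kappa> * s < F x} x) \<partial>M"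
   let ?Y = "\<integral>\<^sup>+x. ennreal (p * s powr (p - 1)) * ennreal (E * s powr - q) * (ennreal (F x powr q) * ind {x. F x <= \<kappa> * s} x) \<partial>M"
   have "?w s * ?V s <= ennreal (p * s powr (p - 1)) * (
    ennreal (D * s powr - r) * (\<integral>\<^sup>+x. ennreal (F x powr r) * ind {x. \<kappa> * s < F x} x \<partial>M) +
    ennreal (E * s powr - q) * (\<integral>\<^sup>+x. ennreal (F x powr q) * ind {x. F x <= \<kappa> * s} x \<partial>M))"
    using True weak[OF True] by (auto intro: mult_left_mono)
   also have "... = ?X + ?Y"
    by (simp add: distrib_left nn_integral_cmult mult.assoc)
   also have "?X = ?A s"
    using par True by (intro nn_integral_cong) (auto simp: indicator_def ennreal_mult[symmetric] powr_diff powr_add powr_minus field_simps)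
   also have "?Y = ?B s"
    using par True by (intro nn_integral_cong) (auto simp: indicator_def ennreal_mult[symmetric] powr_diff powr_add powr_minus field_simps)
   finally show ?thesis .
  qed simp
 qed
 also have "... = (\<integral>\<^sup>+s. ?A s \<partial>lborel) + (\<integral>\<^sup>+s. ?B s \<partial>lborel)"
  by (intro nn_integral_add) (auto simp: indicator_def of_bool_def cong: measurable_cong)
 also have "(\<integral>\<^sup>+s. ?A s \<partial>lborel) = (\<integral>\<^sup>+x. (\<integral>\<^sup>+s. ?a s x \<partial>lborel) \<partial>M)"
  by (rule P.Fubini'[symmetric]) (simp add: indicator_def of_bool_def cong: measurable_cong)
 also have "(\<integral>\<^sup>+s. ?B s \<partial>lborel) = (\<integral>\<^sup>+x. (\<integral>\<^sup>+s. ?b s x \<partial>lborel) \<partial>M)"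
  by (rule P.Fubini'[symmetric]) (simp add: indicator_def of_bool_def cong: measurable_cong)
 also have "(\<integral>\<^sup>+x. (\<integral>\<^sup>+s. ?a s x \<partial>lborel) \<partial>M) + (\<integral>\<^sup>+x. (\<integral>\<^sup>+s. ?b s x \<partial>lborel) \<partial>M) <=
   (\<integral>\<^sup>+x. ennreal (?D * F x powr p) \<partial>M) + (\<integral>\<^sup>+x. ennreal (?E * F x powr p) \<partial>M)"
  by (intro add_mono nn_integral_mono a b)
 also have "... = (\<integral>\<^sup>+x. ennreal ((?D + ?E) * F x powr p) \<partial>M)"
  using par by (subst nn_integral_add[symmetric]) (auto simp: distrib_right simp flip: ennreal_plus)
 also have "... = ennreal (?D + ?E) * ?F"
  using par by (simp add: ennreal_mult nn_integral_cmult)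
 finally show ?thesis .
qed

text \<open>Greedy selection: keep a ball of largest radius, discard all that meet it, recurse on
  the rest. A discarded ball is no larger than the kept one it meets, hence lies in its threefold
  dilate.\<close>

lemma Vitali_finite:
 fixes x :: "'i => 'a::metric_space"
 assumes "finite I"
 shows "\<exists>J\<subseteq>I. disjoint_family_on (\<lambda>i. ball (x i) (r i)) J \<and>
   (\<Union>i\<in>I. ball (x i) (r i)) \<subseteq> (\<Union>j\<in>J. ball (x j) (3 * r j))"
 using assms
proof (induction I rule: finite_psubset_induct)
 case (psubset I)
 show ?case
 proof (cases "I = {}")
  case False
  then have "Max (r ` I) \<in> r ` I" using psubset.hyps by (intro Max_in) auto
  then obtain i where "i \<in> I" "r i = Max (r ` I)" by (metis imageE)
  then have i: "i \<in> I" "\<And>k. k \<in> I ==> r k <= r i" using psubset.hyps by auto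
  define I' where "I' = {k \<in> I - {i}. ball (x k) (r k) \<inter> ball (x i) (r i) = {}}"
  have "I' \<subset> I" using i unfolding I'_def by auto
  from psubset.IH[OF this] obtain J where J: "J \<subseteq> I'" "disjoint_family_on (\<lambda>i. ball (x i) (r i)) J"
   "(\<Union>i\<in>I'. ball (x i) (r i)) \<subseteq> (\<Union>j\<in>J. ball (x j) (3 * r j))" by blast
  have "(\<Union>k\<in>I. ball (x k) (r k)) \<subseteq> (\<Union>j\<in>insert i J. ball (x j) (3 * r j))"
  proof
   fix y assume "y \<in> (\<Union>k\<in>I. ball (x k) (r k))"
   then obtain k where k: "k \<in> I" "dist (x k) y < r k" by auto
   have rk: "0 < r k" using k(2) zero_le_dist[of "x k" y] by linarith
   consider "k = i" | "k \<noteq> i" "k \<in> I'" | "k \<noteq> i" "k \<notin> I'" by blast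
   then show "y \<in> (\<Union>j\<in>insert i J. ball (x j) (3 * r j))"
   proof cases
    case 1
    then show ?thesis using k rk by auto
   next
    case 2
    then have "y \<in> (\<Union>i\<in>I'. ball (x i) (r i))" using k by auto
    then have "y \<in> (\<Union>j\<in>J. ball (x j) (3 * r j))" using J(3) by (rule rev_subsetD)
    then show ?thesis by simp
   next
    case 3
    then obtain z where "dist (x k) z < r k" "dist (x i) z < r i" using k unfolding I'_def by auto
    then have "dist (x i) y < r i + r k + r k"
     using k dist_triangle[of "x i" y z] dist_triangle[of z y "x k"] by (simp add: dist_commute)
    then show ?thesis using i(2)[OF k(1)] by auto
   qed
  qed
  moreover have "ball (x k) (r k) \<inter> ball (x i) (r i) = {}" if "k \<in> J" for k
   using J(1) that unfolding I'_def by auto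
  then have "disjoint_family_on (\<lambda>i. ball (x i) (r i)) (insert i J)"
   using J(2) unfolding disjoint_family_on_def by (simp add: Int_commute)
  moreover have "insert i J \<subseteq> I" using J(1) i(1) unfolding I'_def by auto
  ultimately show ?thesis by (intro exI[of _ "insert i J"] conjI)
 qed (simp add: disjoint_family_on_def)
qed

section \<open>Upper doubling spaces\<close>

locale integral_notation = fixes M :: "'a measure"
begin

abbreviation mu_integral :: "('a => ennreal) => ennreal" (binder "\<integral>" 10) where "mu_integral f \<equiv> integral\<^sup>N M f"

end

text \<open>The existentially bound constants of \<open>nonhomogeneous_space\<close> are fixed as
  \<open>Cl\<close> and \<open>N\<close>, since every later constant is an explicit expression in
  them.\<close>

locale nonhomog = integral_notation M for M :: "'a::metric_space measure" +
 fixes lam :: "'a => real => real" and Cl :: real and N :: nat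
 assumes sets_M [measurable_cong]: "sets M = sets borel"
  and Cl_pos: "Cl > 0"
  and lam_pos: "\<And>x r. r > 0 ==> lam x r > 0"
  and lam_mono': "\<And>x. mono_on {0<..} (lam x)"
  and ball_le_lam: "\<And>x r. r > 0 ==> emeasure M (ball x r) <= ennreal (lam x r)"
  and lam_half: "\<And>x r. r > 0 ==> lam x r <= Cl * lam x (r / 2)"
  and lam_comp: "\<And>x y r. r > 0 ==> dist x y <= r ==> lam x r <= Cl * lam y r"
  and N1: "N >= 1"
  and half_cover: "\<And>x r. r > 0 ==> \<exists>F. finite F \<and> card F <= N \<and> ball x r \<subseteq> (\<Union>z\<in>F. ball (z::'a) (r / 2))"
begin

abbreviation L1 :: "('a => complex) => ennreal" where "L1 f \<equiv> \<integral>x. ecmod (f x)"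

abbreviation dl :: "'a => 'a => ennreal" where "dl c y \<equiv> ennreal (1 / lam c (dist c y))"

abbreviation lev :: "('a => ennreal) => real => 'a set" where "lev g s \<equiv> {x \<in> space M. ennreal s < g x}"

abbreviation mlev :: "('a => ennreal) => real => ennreal" where "mlev g s \<equiv> emeasure M (lev g s)"

lemma space_M [simp]: "space M = UNIV"
 using sets_eq_imp_space_eq[OF sets_M] by simp

lemma open_sets [intro, measurable]: "open A ==> A \<in> sets M"
 by (simp add: sets_M)

lemma ball_sets [measurable]: "ball x r \<in> sets M" by auto

lemma lam_mono: "0 < r ==> r <= s ==> lam x r <= lam x s"
 using lam_mono'[of x] by (auto simp: mono_on_def)

lemma Cl_ge_1: "Cl >= 1"
proof -
 have "lam undefined 1 * 1 <= Cl * lam undefined 1"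
  using lam_half[of 1 undefined] mult_left_mono[OF lam_mono[of "1/2" 1 undefined], of Cl] Cl_pos by linarith
 then show ?thesis using lam_pos[of 1 undefined] by simp
qed

lemma lam_pow: assumes "r > 0" shows "lam x (2 ^ k * r) <= Cl ^ k * lam x r"
proof (induction k)
 case (Suc k)
 have "lam x (2 ^ Suc k * r) <= Cl * lam x (2 ^ k * r)" using lam_half[of "2 ^ Suc k * r" x] assms by simp
 also have "... <= Cl * (Cl ^ k * lam x r)" using Suc Cl_pos by simp
 finally show ?case by simp
qed simp

lemma emeasure_ball_finite: "emeasure M (ball x r) < top"
proof (cases "r > 0")
 case True
 then show ?thesis using ball_le_lam[of r x] le_less_trans ennreal_less_top by blast
next
 case False
 then have "ball x r = {}" by (simp add: not_less)
 then show ?thesis by (metis emeasure_empty ennreal_zero_less_top)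
qed

lemma bounded_finite: "A \<subseteq> ball x r ==> emeasure M A < top"
 using emeasure_mono[of A "ball x r" M] emeasure_ball_finite[of x r] le_less_trans by auto

definition mb where "mb x r = measure M (ball x r)"

lemma emeasure_ball: "emeasure M (ball x r) = ennreal (mb x r)"
 unfolding mb_def using emeasure_ball_finite[of x r] by (intro emeasure_eq_ennreal_measure) auto

lemma mb_nonneg [simp]: "mb x r >= 0" by (simp add: mb_def)

lemma mb_le_lam: "r > 0 ==> mb x r <= lam x r"
 using ball_le_lam[of r x] lam_pos[of r x] by (simp add: emeasure_ball)

lemma mb_mono: "ball x r \<subseteq> ball y s ==> mb x r <= mb y s"
 unfolding mb_def using emeasure_ball_finite[of y s] by (intro measure_mono_fmeasurable) (auto simp: fmeasurable_def)

sublocale sigma_finite_measure M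
proof
 let ?A = "range (\<lambda>n::nat. ball (undefined::'a) (real n))"
 have "\<exists>n::nat. dist undefined x < real n" for x :: 'a by (rule reals_Archimedean2)
 then have "\<Union>?A = space M" by auto
 then show "\<exists>A. countable A \<and> A \<subseteq> sets M \<and> \<Union> A = space M \<and> (\<forall>a\<in>A. emeasure M a \<noteq> \<infinity>)"
  using emeasure_ball_finite by (intro exI[of _ ?A]) (auto simp: less_top)
qed

section \<open>Separability, measurability and regularity\<close>

lemma pow_cover:
 assumes "r > 0"
 shows "\<exists>F. finite F \<and> card F <= N ^ k \<and> ball (x::'a) r \<subseteq> (\<Union>z\<in>F. ball z (r / 2 ^ k))"
proof (induction k)
 case 0
 then show ?case by (intro exI[of _ "{x}"]) auto
next
 case (Suc k)
 then obtain F where F: "finite F" "card F <= N ^ k" "ball x r \<subseteq> (\<Union>z\<in>F. ball z (r / 2 ^ k))" by blast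
 have "\<forall>z. \<exists>G. finite G \<and> card G <= N \<and> ball z (r / 2 ^ k) \<subseteq> (\<Union>w\<in>G. ball (w::'a) (r / 2 ^ k / 2))"
  using half_cover[of "r / 2 ^ k"] assms by simp
 then obtain G where G: "\<And>z. finite (G z) \<and> card (G z) <= N \<and> ball z (r / 2 ^ k) \<subseteq> (\<Union>w\<in>G z. ball (w::'a) (r / 2 ^ k / 2))"
  by metis
 have "card (\<Union>z\<in>F. G z) <= (\<Sum>z\<in>F. card (G z))" using F(1) by (rule card_UN_le)
 also have "... <= card F * N" using sum_bounded_above[of F "\<lambda>z. card (G z)" N] G by simp
 also have "... <= N ^ Suc k" using F(2) by simp
 finally have "card (\<Union>z\<in>F. G z) <= N ^ Suc k" .
 moreover have "ball x r \<subseteq> (\<Union>w\<in>(\<Union>z\<in>F. G z). ball w (r / 2 ^ Suc k))"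
 proof
  fix y assume "y \<in> ball x r"
  then obtain z where z: "z \<in> F" "y \<in> ball z (r / 2 ^ k)" using F(3) by blast
  then obtain w where "w \<in> G z" "y \<in> ball w (r / 2 ^ k / 2)" using G[of z] by blast
  then show "y \<in> (\<Union>w\<in>(\<Union>z\<in>F. G z). ball w (r / 2 ^ Suc k))" using z by (auto simp: mult.commute)
 qed
 ultimately show ?case using F(1) G by (intro exI[of _ "\<Union>z\<in>F. G z"]) auto
qed

lemma totally_bounded_ball:
 assumes "R > 0" "e > 0"
 shows "\<exists>F. finite F \<and> ball (x::'a) R \<subseteq> (\<Union>z\<in>F. ball z e)"
proof -
 obtain k :: nat where "R / e < 2 ^ k" using real_arch_pow[of 2 "R / e"] by auto
 then have k: "R / 2 ^ k <= e" using assms by (simp add: field_simps)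
 obtain F where "finite F" "ball x R \<subseteq> (\<Union>z\<in>F. ball z (R / 2 ^ k))" using pow_cover[OF assms(1), where x = x and k = k] by blast
 moreover have "ball z (R / 2 ^ k) \<subseteq> ball z e" for z :: 'a using k by (rule subset_ball)
 ultimately show ?thesis by (intro exI[of _ F]) blast
qed

text \<open>Geometric doubling makes balls totally bounded, and countably many of them exhaust the
  space.\<close>

lemma countable_dense: "\<exists>D::'a set. countable D \<and> (\<forall>x. \<forall>e>0. \<exists>d\<in>D. dist x d < e)"
proof -
 have "\<forall>n k. \<exists>F. finite F \<and> ball (undefined::'a) (real (Suc n)) \<subseteq> (\<Union>z\<in>F. ball z (inverse (real (Suc k))))"
  using totally_bounded_ball by (metis inverse_positive_iff_positive of_nat_0_less_iff zero_less_Suc)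
 then obtain F where F: "\<And>n k. finite (F n k)" "\<And>n k. ball (undefined::'a) (real (Suc n)) \<subseteq> (\<Union>z\<in>F n k. ball z (inverse (real (Suc k))))"
  by metis
 show ?thesis
 proof (intro exI[of _ "\<Union>n k. F n k"] conjI allI impI)
  show "countable (\<Union>n k. F n k)" using F(1) by (intro countable_UN) (auto intro: countable_finite)
  fix x :: 'a and e :: real assume "e > 0"
  then obtain k where k: "inverse (real (Suc k)) < e" using reals_Archimedean by blast
  obtain n :: nat where "dist (undefined::'a) x < real n" using reals_Archimedean2 by blast
  then have "x \<in> ball (undefined::'a) (real (Suc n))" by simp
  then obtain z where "z \<in> F n k" "x \<in> ball z (inverse (real (Suc k)))" using F(2)[where n = n and k = k] by blast
  then show "\<exists>d\<in>\<Union>n k. F n k. dist x d < e" using k by (auto simp: dist_commute intro!: exI bexI[of _ z])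
 qed
qed

lemma countable_basis: "\<exists>B::'a set set. countable B \<and> topological_basis B"
proof -
 obtain D :: "'a set" where D: "countable D" "\<And>x e. e > 0 ==> \<exists>d\<in>D. dist x d < e" using countable_dense by blast
 let ?B = "(\<lambda>(d, n). ball d (inverse (real (Suc n)))) ` (D \<times> UNIV)"
 have "countable ?B" using D(1) by auto
 moreover have "topological_basis ?B"
 proof (rule topological_basisI)
  fix U and x :: 'a assume "open U" "x \<in> U"
  then obtain e where e: "e > 0" "ball x e \<subseteq> U" using open_contains_ball by blast
  then obtain n where n: "inverse (real (Suc n)) < e / 2" using reals_Archimedean[of "e/2"] by auto
  have "0 < inverse (real (Suc n))" by simp
  from D(2)[OF this, of x] obtain d where d: "d \<in> D" "dist x d < inverse (real (Suc n))" by blast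
  have "ball d (inverse (real (Suc n))) \<subseteq> ball x e"
  proof
   fix y assume "y \<in> ball d (inverse (real (Suc n)))"
   then show "y \<in> ball x e" using n d dist_triangle[of x y d] by simp
  qed
  then show "\<exists>B'\<in>?B. x \<in> B' \<and> B' \<subseteq> U"
   using d e by (intro bexI[of _ "ball d (inverse (real (Suc n)))"]) (auto simp: dist_commute)
 qed auto
 ultimately show ?thesis by blast
qed

text \<open>With a countable basis every open subset of the product is a countable union of
  rectangles. This is how geometric doubling makes \<open>dist\<close> and the kernel jointly
  measurable.\<close>

lemma open_in_product: assumes "open (U :: ('a \<times> 'a) set)" shows "U \<in> sets (M \<Otimes>\<^sub>M M)"
proof -
 obtain B :: "'a set set" where B: "countable B" "topological_basis B" using countable_basis by blast
 let ?P = "(\<lambda>(a, b). a \<times> b) ` (B \<times> B)"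
 have P: "topological_basis ?P" by (rule topological_basis_prod[OF B(2) B(2)])
 then obtain P' where "P' \<subseteq> ?P" "\<Union>P' = U" using assms unfolding topological_basis_def by blast
 moreover have "countable P'" using \<open>P' \<subseteq> ?P\<close> B(1) by (meson countable_SIGMA countable_image countable_subset)
 moreover have "\<And>p. p \<in> ?P ==> p \<in> sets (M \<Otimes>\<^sub>M M)"
  using B(2) by (auto intro!: pair_measureI open_sets topological_basis_open)
 ultimately have "\<Union>P' \<in> sets (M \<Otimes>\<^sub>M M)" by (intro sets.countable_Union) auto
 then show ?thesis using \<open>\<Union>P' = U\<close> by simp
qed

lemma measurable_dist' [measurable]: "(\<lambda>z. dist (fst z) (snd z)) \<in> borel_measurable (M \<Otimes>\<^sub>M M)"
 unfolding borel_measurable_iff_less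
proof
 fix c :: real
 have "open {z::'a\<times>'a. dist (fst z) (snd z) < c}" by (intro open_Collect_less continuous_intros)
 moreover have "{w \<in> space (M \<Otimes>\<^sub>M M). dist (fst w) (snd w) < c} = {z::'a\<times>'a. dist (fst z) (snd z) < c}"
  by (auto simp: space_pair_measure)
 ultimately show "{w \<in> space (M \<Otimes>\<^sub>M M). dist (fst w) (snd w) < c} \<in> sets (M \<Otimes>\<^sub>M M)" using open_in_product by simp
qed

lemma measurable_dist_fun [measurable (raw)]:
 assumes "f \<in> measurable L M" "g \<in> measurable L M"
 shows "(\<lambda>z. dist (f z) (g z)) \<in> borel_measurable L"
 using measurable_compose[OF measurable_Pair[OF assms] measurable_dist'] by simp

text \<open>The basis sets on which \<open>f\<close> is integrable cover \<open>S\<close>, and there are only countably many.\<close>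

lemma measurable_if_locally_integrable:
 fixes f :: "'c::topological_space => complex"
 assumes B: "countable B" "topological_basis (B :: 'c set set)" and opn: "\<And>U. open U ==> U \<in> sets L"
  and f: "locally_integrable_on L S f" and S: "S \<in> sets L"
 shows "(\<lambda>z. ind S z *\<^sub>R f z) \<in> borel_measurable L"
proof -
 define B' where "B' = {b \<in> B. set_integrable L (b \<inter> S) f}"
 have cov: "S \<subseteq> \<Union>B'"
 proof
  fix z assume z: "z \<in> S"
  then obtain U where U: "open U" "z \<in> U" "set_integrable L (U \<inter> S) f"
   using f unfolding locally_integrable_on_def by blast
  then obtain b where b: "b \<in> B" "z \<in> b" "b \<subseteq> U" using topological_basisE[OF B(2)] by metis
  have "set_integrable L (b \<inter> S) f"
   using b sets.Int[OF opn[OF topological_basis_open[OF B(2) b(1)]] S] by (intro set_integrable_subset[OF U(3)]) auto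
  then show "z \<in> \<Union>B'" using b unfolding B'_def by blast
 qed
 have cB: "countable B'" using B unfolding B'_def by (auto intro: countable_subset)
 have B's: "\<And>b. b \<in> B' ==> b \<in> sets L" unfolding B'_def using opn topological_basis_open[OF B(2)] by blast
 show ?thesis
 proof (cases "B' = {}")
  case True
  then have "S = {}" using cov by auto
  then show ?thesis by simp
 next
  case False
  define e where "e = from_nat_into B'"
  have e: "\<And>i. e i \<in> B'" "range e = B'" using False cB unfolding e_def by (auto simp: from_nat_into)
  let ?g = "\<lambda>z. ind S z *\<^sub>R f z"
  have "?g -` A \<inter> space L \<in> sets L" if A: "A \<in> sets borel" for A
  proof -
   have meas: "(\<lambda>z. ind (b \<inter> S) z *\<^sub>R f z) \<in> borel_measurable L" if "b \<in> B'" for b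
    using that unfolding B'_def set_integrable_def by auto
   have "?g -` A \<inter> space L = (\<Union>i. ((\<lambda>z. ind (e i \<inter> S) z *\<^sub>R f z) -` A \<inter> space L) \<inter> (e i \<inter> S)) \<union> (((\<lambda>z. 0::complex) -` A \<inter> space L) \<inter> (space L - S))"
   proof (rule set_eqI)
    fix z
    show "z \<in> ?g -` A \<inter> space L \<longleftrightarrow> z \<in> (\<Union>i. ((\<lambda>z. ind (e i \<inter> S) z *\<^sub>R f z) -` A \<inter> space L) \<inter> (e i \<inter> S)) \<union> (((\<lambda>z. 0::complex) -` A \<inter> space L) \<inter> (space L - S))"
    proof (cases "z \<in> S")
     case True
     then obtain i where "z \<in> e i" using cov e(2) by blast
     then show ?thesis using True by (auto simp: indicator_def)
    qed (auto simp: indicator_def)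
   qed
   also have "... \<in> sets L"
    using meas[OF e(1)] A B's[OF e(1)] S
    by (intro sets.Un sets.countable_UN sets.Int measurable_sets[OF _ A]) auto
   finally show ?thesis .
  qed
  then show ?thesis by (intro measurableI) auto
 qed
qed

text \<open>Induction over the Borel sets. Open sets are exhausted from inside by points at distance
  at least \<open>1 / (n + 1)\<close> from the complement, complementation swaps the roles of
  \<open>U\<close> and \<open>C\<close>, and in a countable union only finitely many of the closed
  sets are kept. The ball makes all measures finite, so that continuity from above applies.\<close>

lemma closed_open_approx:
 assumes "A \<in> sets M" "e > (0::real)"
 shows "\<exists>U C. open U \<and> closed C \<and> C \<subseteq> A \<and> A \<subseteq> U \<and> emeasure M ((U - C) \<inter> ball z R) < ennreal e"
proof -
 have *: "A \<in> sigma_sets UNIV {S::'a set. open S}" using assms by (simp add: sets_M sets_borel)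
 have fin: "emeasure M (D \<inter> ball z R) \<noteq> \<infinity>" for D
  using bounded_finite[of "D \<inter> ball z R" z R] by (auto simp: less_top)
 from * assms(2) show ?thesis
 proof (induction arbitrary: e rule: sigma_sets.induct)
  case (Basic A)
  then have oA: "open A" by simp
  show ?case
  \<comment> \<open>The distance to the empty set is 0 by convention, which would make all sets
    \<open>C n\<close> below empty.\<close>
  proof (cases "A = UNIV")
   case True
   then show ?thesis using Basic by (intro exI[of _ UNIV] conjI) auto
  next
   case False
   define C where "C n = {x. inverse (real (Suc n)) <= infdist x (- A)}" for n
   have cl: "closed (C n)" for n unfolding C_def by (intro closed_Collect_le continuous_intros)
   have sub: "C n \<subseteq> A" for n
   proof
    fix x assume x: "x \<in> C n"
    show "x \<in> A"
    proof (rule ccontr)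
     assume "x \<notin> A"
     then have "infdist x (-A) = 0" by simp
     moreover have "0 < inverse (real (Suc n))" by simp
     ultimately show False using x unfolding C_def by simp
    qed
   qed
   have un: "A \<subseteq> (\<Union>n. C n)"
   proof
    fix x assume x: "x \<in> A"
    have "infdist x (-A) \<noteq> 0" using x oA False in_closed_iff_infdist_zero[of "-A" x] by auto
    then have "infdist x (-A) > 0" using infdist_nonneg[of x "-A"] by linarith
    then obtain n where "inverse (real (Suc n)) < infdist x (-A)" using reals_Archimedean by blast
    then show "x \<in> (\<Union>n. C n)" unfolding C_def by (auto intro: less_imp_le)
   qed
   have "(\<lambda>n. emeasure M ((A - C n) \<inter> ball z R)) \<longlonglongrightarrow> emeasure M (\<Inter>n. (A - C n) \<inter> ball z R)"
   proof (rule Lim_emeasure_decseq)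
    show "range (\<lambda>n. (A - C n) \<inter> ball z R) \<subseteq> sets M"
     using oA cl by (auto intro!: sets.Int sets.Diff simp: sets_M)
    have "C n \<subseteq> C (Suc n)" for n
    proof -
     have "inverse (real (Suc (Suc n))) <= inverse (real (Suc n))" by (simp add: divide_simps)
     then show ?thesis unfolding C_def by (meson Collect_mono order_trans)
    qed
    then show "decseq (\<lambda>n. (A - C n) \<inter> ball z R)" by (intro decseq_SucI) blast
    show "\<And>n. emeasure M ((A - C n) \<inter> ball z R) \<noteq> \<infinity>" by (rule fin)
   qed
   moreover have "(\<Inter>n. (A - C n) \<inter> ball z R) = {}" using un by blast
   ultimately have "(\<lambda>n. emeasure M ((A - C n) \<inter> ball z R)) \<longlonglongrightarrow> 0" by simp
   then have "eventually (\<lambda>n. emeasure M ((A - C n) \<inter> ball z R) < ennreal e) sequentially"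
    using Basic by (intro order_tendstoD) auto
   then obtain n where "emeasure M ((A - C n) \<inter> ball z R) < ennreal e" by (auto simp: eventually_sequentially)
   then show ?thesis using oA cl sub by blast
  qed
 next
  case Empty
  then show ?case by (intro exI[of _ "{}"]) auto
 next
  case (Compl A)
  obtain U C where "open U" "closed C" "C \<subseteq> A" "A \<subseteq> U" "emeasure M ((U - C) \<inter> ball z R) < ennreal e"
   using Compl.IH[OF Compl.prems] by (elim exE conjE)
  moreover have "(- C) - (- U) = U - C" by blast
  ultimately have "open (-C) \<and> closed (-U) \<and> -U \<subseteq> UNIV - A \<and> UNIV - A \<subseteq> -C \<and> emeasure M ((-C - (-U)) \<inter> ball z R) < ennreal e"
   by (simp add: open_Compl closed_Compl Compl_eq_Diff_UNIV[symmetric])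
  then show ?case by (intro exI)
 next
  case (Union A)
  \<comment> \<open>These errors sum to \<open>e / 2\<close>; the other half is the slack for
    replacing the infinite union of closed sets by a finite one.\<close>
  define d where "d i = e / 2 ^ (i + 2)" for i :: nat
  have d: "d i > 0" for i using Union.prems unfolding d_def by simp
  have "\<forall>i. \<exists>U C. open U \<and> closed C \<and> C \<subseteq> A i \<and> A i \<subseteq> U \<and> emeasure M ((U - C) \<inter> ball z R) < ennreal (d i)"
   using Union.IH d by meson
  then obtain U C where UC: "\<And>i. open (U i) \<and> closed (C i) \<and> C i \<subseteq> A i \<and> A i \<subseteq> U i \<and> emeasure M ((U i - C i) \<inter> ball z R) < ennreal (d i)"
   by metis
  have [measurable]: "U i \<in> sets M" "C i \<in> sets M" for i using UC by (auto simp: sets_M)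
  have "emeasure M (((\<Union>i. U i) - (\<Union>i. C i)) \<inter> ball z R) <= emeasure M (\<Union>i. (U i - C i) \<inter> ball z R)"
   by (intro emeasure_mono) auto
  also have "... <= (\<Sum>i. emeasure M ((U i - C i) \<inter> ball z R))" by (intro emeasure_subadditive_countably) auto
  also have "... <= (\<Sum>i. ennreal (d i))" using UC by (intro suminf_le) (auto intro: less_imp_le)
  also have "... = ennreal (e / 2)"
  proof (rule suminf_ennreal_eq)
   show "d sums (e / 2)"
    using sums_mult[OF power_half_series, of "e/2"] unfolding d_def by (simp add: field_simps power_divide)
  qed (use d less_imp_le in blast)
  also have "... < ennreal e" using Union.prems by (simp add: ennreal_less_iff)
  finally have lt: "emeasure M (((\<Union>i. U i) - (\<Union>i. C i)) \<inter> ball z R) < ennreal e" .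
  have "(\<lambda>n. emeasure M (((\<Union>i. U i) - (\<Union>i<n. C i)) \<inter> ball z R)) \<longlonglongrightarrow> emeasure M (\<Inter>n. ((\<Union>i. U i) - (\<Union>i<n. C i)) \<inter> ball z R)"
  proof (rule Lim_emeasure_decseq)
   show "range (\<lambda>n. ((\<Union>i. U i) - (\<Union>i<n. C i)) \<inter> ball z R) \<subseteq> sets M" by auto
   show "decseq (\<lambda>n. ((\<Union>i. U i) - (\<Union>i<n. C i)) \<inter> ball z R)" by (intro decseq_SucI) (auto simp: lessThan_Suc)
   show "\<And>n. emeasure M (((\<Union>i. U i) - (\<Union>i<n. C i)) \<inter> ball z R) \<noteq> \<infinity>" by (rule fin)
  qed
  moreover have "(\<Inter>n. ((\<Union>i. U i) - (\<Union>i<n. C i)) \<inter> ball z R) = ((\<Union>i. U i) - (\<Union>i. C i)) \<inter> ball z R" by auto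
  ultimately have "eventually (\<lambda>n. emeasure M (((\<Union>i. U i) - (\<Union>i<n. C i)) \<inter> ball z R) < ennreal e) sequentially"
   using lt by (intro order_tendstoD) auto
  then obtain n where "emeasure M (((\<Union>i. U i) - (\<Union>i<n. C i)) \<inter> ball z R) < ennreal e" by (auto simp: eventually_sequentially)
  then show ?case using UC by (intro exI[of _ "\<Union>i. U i"] exI[of _ "\<Union>i<n. C i"] conjI) (auto intro!: closed_UN)
 qed
qed

lemma outer_regular_bounded:
 assumes "A \<in> sets M" "A \<subseteq> ball z R" "e > (0::real)"
 shows "\<exists>U. open U \<and> A \<subseteq> U \<and> U \<subseteq> ball z R \<and> emeasure M (U - A) < ennreal e"
proof -
 obtain U C where UC: "open U" "closed C" "C \<subseteq> A" "A \<subseteq> U" "emeasure M ((U - C) \<inter> ball z R) < ennreal e"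
  using closed_open_approx[OF assms(1,3), of z R] by (elim exE conjE)
 have "emeasure M (U \<inter> ball z R - A) <= emeasure M ((U - C) \<inter> ball z R)"
  using UC by (intro emeasure_mono) (auto simp: sets_M)
 then have "emeasure M (U \<inter> ball z R - A) < ennreal e" using UC(5) by (rule le_less_trans)
 then show ?thesis using UC assms(2) by (intro exI[of _ "U \<inter> ball z R"]) auto
qed

text \<open>If no small scale at \<open>x\<close> is doubling, the measure of balls drops by the
  factor \<open>\<beta>\<close> every three scales, while the number of balls of that size needed
  for a covering grows by \<open>N ^ (3 * a)\<close> only. Since \<open>\<beta>\<close> is at least
  twice that, the exceptional points have covers of measure \<open>O (2 ^ - i)\<close>.\<close>

lemma AE_small_doubling_balls:
 assumes "a >= 1" and \<beta>: "\<beta> >= 2 * real N ^ (3 * a)" and R1: "R1 > 0"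
 shows "AE x in M. \<forall>k0. \<exists>k\<ge>k0. 0 < mb x (R1 / (2 ^ a) ^ k) \<and>
   mb x ((2 ^ a) ^ 3 * (R1 / (2 ^ a) ^ k)) <= \<beta> * mb x (R1 / (2 ^ a) ^ k)"
proof -
 define r where "r k = R1 / (2 ^ a) ^ k" for k :: nat
 define P where "P x k \<longleftrightarrow> 0 < mb x (r k) \<and> mb x ((2 ^ a) ^ 3 * r k) <= \<beta> * mb x (r k)" for x k
 have r3: "(2 ^ a) ^ 3 * r (k + 3) = r k" for k
  unfolding r_def by (simp add: power_add field_simps)
 have N0: "real N >= 1" using N1 by simp
 have b0: "\<beta> > 0" using \<beta> N0 using one_le_power[OF N0, of "3 * a"] by linarith
 \<comment> \<open>The exceptional set itself is never shown to be measurable; it is enclosed in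
   open sets of small measure.\<close>
 define A where "A n k0 = {x \<in> ball undefined (real n). \<forall>k\<ge>k0. \<not> P x k}" for n k0 :: nat
 have "\<exists>Z. Z \<in> null_sets M \<and> A n k0 \<subseteq> Z" for n k0
 proof (cases "n = 0")
  case True
  then show ?thesis unfolding A_def by (intro exI[of _ "{}"]) auto
 next
  case False
  define W where "W = mb undefined (real n + R1)"
  have step: "\<beta> ^ i * mb x (r (k0 + 3 * i)) <= W" if x: "x \<in> A n k0" for x i
  proof (induction i)
   case 0
   have "r k0 <= R1" unfolding r_def using R1 by (simp add: field_simps)
   moreover have "dist undefined x < real n" using x unfolding A_def by simp
   ultimately have "ball x (r k0) \<subseteq> ball undefined (real n + R1)"
    using order_le_less_trans[OF dist_triangle[of undefined _ x]] by (force simp: subset_eq)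
   then show ?case unfolding W_def using mb_mono by simp
  next
   case (Suc i)
   have "\<not> P x (k0 + 3 * i + 3)" using x unfolding A_def by auto
   then have "\<beta> * mb x (r (k0 + 3 * i + 3)) <= mb x (r (k0 + 3 * i))"
    unfolding P_def r3 using mb_nonneg[of x "r (k0 + 3 * i)"] mb_nonneg[of x "r (k0 + 3 * i + 3)"]
    by (cases "mb x (r (k0 + 3 * i + 3)) = 0") auto
   then have "\<beta> ^ i * (\<beta> * mb x (r (k0 + 3 * i + 3))) <= \<beta> ^ i * mb x (r (k0 + 3 * i))"
    using b0 by (intro mult_left_mono) auto
   then show ?case using Suc by (simp add: algebra_simps)
  qed
  \<comment> \<open>\<open>c\<close> halvings bring the radius \<open>n\<close> below half of the
    starting scale; from there on, three scales cost \<open>3 * a\<close> halvings.\<close>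
  obtain c :: nat where "real n * 2 / r k0 < 2 ^ c" using real_arch_pow[of 2 "real n * 2 / r k0"] by auto
  moreover have rpos: "r k > 0" for k unfolding r_def using R1 by simp
  ultimately have c: "real n / 2 ^ c <= r k0 / 2" using rpos[of k0] by (simp add: field_simps)
  have "\<exists>O'. open O' \<and> A n k0 \<subseteq> O' \<and> emeasure M O' <= ennreal (real N ^ c * W / 2 ^ i)" for i
  proof -
   define rr where "rr = r (k0 + 3 * i)"
   have "real n / 2 ^ (c + 3 * a * i) = real n / 2 ^ c / 2 ^ (3 * a * i)" by (simp add: power_add)
   also have "... <= r k0 / 2 / 2 ^ (3 * a * i)" using c by (intro divide_right_mono) auto
   also have "... = rr / 2" unfolding rr_def r_def by (simp add: power_add power_mult field_simps)
   finally have rr: "real n / 2 ^ (c + 3 * a * i) <= rr / 2" .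
   obtain F where F: "finite F" "card F <= N ^ (c + 3 * a * i)" "ball (undefined::'a) (real n) \<subseteq> (\<Union>z\<in>F. ball z (real n / 2 ^ (c + 3 * a * i)))"
    using pow_cover[where r = "real n" and x = "undefined::'a" and k = "c + 3 * a * i"] False by (metis of_nat_0_less_iff not_gr_zero)
   \<comment> \<open>The decay of the measure is known only at points of \<open>A n k0\<close>, so
     the covering balls are recentred there at the price of doubling the radius.\<close>
   define F' where "F' = {z \<in> F. ball z (rr / 2) \<inter> A n k0 \<noteq> {}}"
   define s where "s z = (SOME x. x \<in> ball z (rr / 2) \<inter> A n k0)" for z
   have s: "s z \<in> ball z (rr / 2) \<inter> A n k0" if "z \<in> F'" for z
    unfolding s_def using that unfolding F'_def by (metis (mono_tags, lifting) ex_in_conv mem_Collect_eq someI_ex)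
   have fF': "finite F'" unfolding F'_def using F by simp
   have "A n k0 \<subseteq> (\<Union>z\<in>F'. ball (s z) rr)"
   proof
    fix x assume x: "x \<in> A n k0"
    then obtain z where z: "z \<in> F" "x \<in> ball z (real n / 2 ^ (c + 3 * a * i))" using F(3) unfolding A_def by blast
    then have xz: "dist z x < rr / 2" using order_less_le_trans[OF _ rr] by simp
    then have "x \<in> ball z (rr / 2) \<inter> A n k0" using x by simp
    then have "z \<in> F'" using z unfolding F'_def by blast
    then show "x \<in> (\<Union>z\<in>F'. ball (s z) rr)"
     using s[of z] xz dist_triangle[of "s z" x z] by (intro UN_I[of z]) (simp_all add: dist_commute)
   qed
   moreover have "emeasure M (\<Union>z\<in>F'. ball (s z) rr) <= ennreal (real N ^ c * W / 2 ^ i)"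
   proof -
    have "emeasure M (\<Union>z\<in>F'. ball (s z) rr) <= (\<Sum>z\<in>F'. emeasure M (ball (s z) rr))"
     using fF' by (intro emeasure_subadditive_finite) auto
    also have "... <= (\<Sum>z\<in>F'. ennreal (W / \<beta> ^ i))"
    proof (intro sum_mono)
     fix z assume "z \<in> F'"
     then have "\<beta> ^ i * mb (s z) rr <= W" using step[of "s z" i] s unfolding rr_def by blast
     then have "mb (s z) rr <= W / \<beta> ^ i" using b0 by (simp add: field_simps)
     then show "emeasure M (ball (s z) rr) <= ennreal (W / \<beta> ^ i)" by (simp add: emeasure_ball ennreal_leI)
    qed
    also have "... = ennreal (real (card F') * (W / \<beta> ^ i))"
     by (simp add: ennreal_mult'' ennreal_of_nat_eq_real_of_nat W_def b0 less_imp_le flip: ennreal_mult)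
    also have "... <= ennreal (real N ^ c * W / 2 ^ i)"
    proof (rule ennreal_leI)
     have "card F' <= N ^ (c + 3 * a * i)" using F card_mono[of F F'] unfolding F'_def by force
     then have "real (card F') <= real N ^ (c + 3 * a * i)" by (metis of_nat_le_iff of_nat_power)
     then have "real (card F') * (W / \<beta> ^ i) <= real N ^ (c + 3 * a * i) * (W / \<beta> ^ i)"
      using b0 by (intro mult_right_mono) (auto simp: W_def)
     also have "... = real N ^ c * W * ((real N ^ (3 * a)) ^ i / \<beta> ^ i)"
      by (simp add: power_add power_mult[symmetric])
     also have "... <= real N ^ c * W * (1 / 2 ^ i)"
     proof (intro mult_left_mono)
      have "(2 * real N ^ (3 * a)) ^ i <= \<beta> ^ i" using \<beta> by (intro power_mono) auto
      then show "(real N ^ (3 * a)) ^ i / \<beta> ^ i <= 1 / 2 ^ i" using b0 by (simp add: field_simps power_mult_distrib)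
     qed (auto simp: W_def)
     finally show "real (card F') * (W / \<beta> ^ i) <= real N ^ c * W / 2 ^ i" by simp
    qed
    finally show ?thesis .
   qed
   ultimately show ?thesis by (intro exI[of _ "\<Union>z\<in>F'. ball (s z) rr"]) auto
  qed
  then obtain O' where O': "\<And>i::nat. open (O' i)" "\<And>i. A n k0 \<subseteq> O' i" "\<And>i. emeasure M (O' i) <= ennreal (real N ^ c * W / 2 ^ i)"
   by metis
  have [measurable]: "O' i \<in> sets M" for i using O' by auto
  have "emeasure M (\<Inter>i. O' i) <= ennreal (real N ^ c * W / 2 ^ i)" for i
   using O'(3)[of i] emeasure_mono[of "\<Inter>i. O' i" "O' i" M] by (meson INF_lower UNIV_I \<open>O' i \<in> sets M\<close> order_trans)
  moreover have "(\<lambda>i. ennreal (real N ^ c * W / 2 ^ i)) \<longlonglongrightarrow> ennreal 0"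
  proof (intro tendsto_ennrealI)
   have "(\<lambda>i. (real N ^ c * W) * (1 / 2) ^ i) \<longlonglongrightarrow> (real N ^ c * W) * 0"
    by (intro tendsto_mult_left LIMSEQ_realpow_zero) auto
   then show "(\<lambda>i. real N ^ c * W / 2 ^ i) \<longlonglongrightarrow> 0" by (simp add: power_one_over)
  qed
  ultimately have "emeasure M (\<Inter>i. O' i) <= ennreal 0" by (meson LIMSEQ_le_const)
  then show ?thesis using O' by (intro exI[of _ "\<Inter>i. O' i"]) (auto simp: null_sets_def)
 qed
 then obtain Z where Z: "\<And>n k0. Z n k0 \<in> null_sets M" "\<And>n k0. A n k0 \<subseteq> Z n k0" by metis
 have "{x \<in> space M. \<not> (\<forall>k0. \<exists>k\<ge>k0. P x k)} \<subseteq> (\<Union>n k0. Z n k0)"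
 proof
  fix x assume "x \<in> {x \<in> space M. \<not> (\<forall>k0. \<exists>k\<ge>k0. P x k)}"
  then obtain k0 where k0: "\<forall>k\<ge>k0. \<not> P x k" by blast
  obtain n :: nat where "dist undefined x < real n" using reals_Archimedean2 by blast
  then have "x \<in> A n k0" using k0 unfolding A_def by auto
  then show "x \<in> (\<Union>n k0. Z n k0)" using Z(2)[of n k0] by (intro UN_I[of n] UN_I[of k0]) auto
 qed
 moreover have "(\<Union>n k0. Z n k0) \<in> null_sets M" using Z by auto
 ultimately have "AE x in M. \<forall>k0. \<exists>k\<ge>k0. P x k" by (rule AE_I'[rotated])
 then show ?thesis unfolding P_def r_def by simp
qed

end

section \<open>The Calderon--Zygmund decomposition\<close>

text \<open>All dilations are by powers of \<open>2 ^ a\<close>. The exponent stays a parameter so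
  that the ratio can later dominate the given \<rho>; \<open>a >= 3\<close> gives ratio at least 8,
  enough for the factors 2 and 3 that arise from covering and from overlapping balls.\<close>

locale cz_space = nonhomog +
 fixes a :: nat
 assumes a3: "a >= 3"
begin

definition \<alpha> :: real where "\<alpha> = 2 ^ a"
text \<open>The first summand is what small doubling balls require
  (\<open>AE_small_doubling_balls\<close>), the second what large doubling balls require
  (\<open>doubling_dilate\<close>).\<close>

definition \<beta> :: real where "\<beta> = 2 * real N ^ (3 * a) + 8 * Cl ^ (3 * a)"

lemma alpha_ge_8: "\<alpha> >= 8"
proof -
 have "(2::real) ^ 3 <= 2 ^ a" using a3 by (rule power_increasing) simp
 then show ?thesis by (simp add: \<alpha>_def)
qed

lemma alpha_pos [simp]: "\<alpha> > 0" "\<alpha> >= 0" "\<alpha> >= 1"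
 using alpha_ge_8 by auto

lemma beta_ge: "\<beta> >= 8 * Cl ^ (3 * a)" "\<beta> >= 2 * real N ^ (3 * a)" "\<beta> >= 8" "\<beta> > 0"
proof -
 have "Cl ^ (3 * a) >= 1" using Cl_ge_1 by simp
 then show "\<beta> >= 8 * Cl ^ (3 * a)" "\<beta> >= 2 * real N ^ (3 * a)" "\<beta> >= 8" "\<beta> > 0"
  unfolding \<beta>_def using zero_le_power[of "real N" "3 * a"] by linarith+
qed

lemma lam_alpha: "r > 0 ==> lam x (\<alpha> ^ k * r) <= Cl ^ (a * k) * lam x r"
 using lam_pow[of r x "a * k"] by (simp add: \<alpha>_def power_mult)

lemma mb_le: "r <= s ==> mb x r <= mb x s"
 by (intro mb_mono subset_ball)

lemma nn_integral_annuli: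
 fixes f :: "'a => ennreal" and \<rho> :: "nat => real"
 assumes "\<And>n y. n < K ==> \<rho> n <= dist x y ==> dist x y < \<rho> (Suc n) ==> f y <= c n"
 shows "(\<integral>y. f y * ind (ball x (\<rho> K) - ball x (\<rho> 0)) y) <= (\<Sum>n<K. c n * emeasure M (ball x (\<rho> (Suc n))))"
proof -
 have pt: "f y * ind (ball x (\<rho> K) - ball x (\<rho> 0)) y <= (\<Sum>n<K. c n * ind (ball x (\<rho> (Suc n))) y)" for y
  using assms
 proof (induction K)
  case (Suc K)
  show ?case
  proof (cases "dist x y < \<rho> K")
   case True
   then have "f y * ind (ball x (\<rho> (Suc K)) - ball x (\<rho> 0)) y <= f y * ind (ball x (\<rho> K) - ball x (\<rho> 0)) y"
    by (intro mult_left_mono) (auto simp: indicator_def)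
   also have "... <= (\<Sum>n<K. c n * ind (ball x (\<rho> (Suc n))) y)" using Suc by simp
   also have "... <= (\<Sum>n<Suc K. c n * ind (ball x (\<rho> (Suc n))) y)" by simp
   finally show ?thesis .
  next
   case False
   then show ?thesis using Suc.prems[of K y] by (auto simp: indicator_def intro: add_increasing)
  qed
 qed simp
 have "(\<integral>y. f y * ind (ball x (\<rho> K) - ball x (\<rho> 0)) y) <= (\<integral>y. (\<Sum>n<K. c n * ind (ball x (\<rho> (Suc n))) y))"
  by (intro nn_integral_mono pt)
 also have "... = (\<Sum>n<K. c n * emeasure M (ball x (\<rho> (Suc n))))"
  by (subst nn_integral_sum) (auto simp: nn_integral_cmult_indicator)
 finally show ?thesis .
qed

text \<open>The density \<open>m n / l n\<close> never exceeds 1, but a non-doubling scale forces it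
  to grow by 8 over three steps, since \<beta> exceeds \<open>8 * Cl ^ (3 * a)\<close>. So a first
  doubling scale \<open>n >= 1\<close> exists, and before it the density is a geometric progression,
  whose sum bounds the integral over the annuli.\<close>

lemma doubling_dilate:
 assumes r: "r > 0" and pos: "mb x r > 0"
 shows "\<exists>n\<ge>1. mb x (\<alpha> ^ (n + 3) * r) <= \<beta> * mb x (\<alpha> ^ n * r) \<and>
  (\<integral>y. dl x y * ind (ball x (\<alpha> * (\<alpha> ^ n * r)) - ball x (\<alpha> * r)) y) <= ennreal (4 * Cl ^ a)"
proof -
 define m where "m n = mb x (\<alpha> ^ n * r)" for n
 define l where "l n = lam x (\<alpha> ^ n * r)" for n
 have lpos: "l n > 0" for n unfolding l_def using r by (intro lam_pos) simp
 have ml: "m n <= l n" for n unfolding l_def m_def using r by (intro mb_le_lam) simp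
 have m0: "m n >= 0" for n unfolding m_def by simp
 have l3: "l (n + 3) <= Cl ^ (3 * a) * l n" for n
  using lam_alpha[of "\<alpha> ^ n * r" x 3] r unfolding l_def by (simp add: power_add mult_ac)
 have l1: "l (Suc n) <= Cl ^ a * l n" for n
  using lam_alpha[of "\<alpha> ^ n * r" x 1] r unfolding l_def by (simp add: mult_ac)
 define b where "b n = m n / l n" for n
 have b1: "b n <= 1" for n unfolding b_def using ml lpos by (simp add: field_simps)
 have b3: "b n <= b (n + 3) / 8" if "\<beta> * m n <= m (n + 3)" for n
 proof -
  have "8 * m n * l (n + 3) <= 8 * m n * (Cl ^ (3 * a) * l n)" using l3 m0 by (intro mult_left_mono) auto
  also have "... = (8 * Cl ^ (3 * a)) * m n * l n" by simp
  also have "... <= \<beta> * m n * l n" using beta_ge m0 lpos[of n] by (intro mult_right_mono) auto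
  also have "... <= m (n + 3) * l n" using that lpos[of n] by (intro mult_right_mono) auto
  finally show ?thesis unfolding b_def using lpos[of n] lpos[of "n+3"] by (simp add: field_simps)
 qed
 have ex: "\<exists>n\<ge>1. m (n + 3) <= \<beta> * m n"
 proof (rule ccontr)
  assume "\<not> ?thesis"
  then have *: "\<beta> * m n <= m (n + 3)" if "n >= 1" for n using that by (meson less_imp_le not_le)
  have "b 1 <= (1 / 8) ^ i" for i
  proof -
   have "b 1 <= b (1 + 3 * i) * (1 / 8) ^ i"
   proof (induction i)
    case (Suc i)
    have "b (1 + 3 * i) <= b (1 + 3 * Suc i) / 8" using b3[OF *, of "1 + 3 * i"] by (simp add: add.commute)
    then have "b (1 + 3 * i) * (1 / 8) ^ i <= b (1 + 3 * Suc i) / 8 * (1 / 8) ^ i" by (intro mult_right_mono) auto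
    with Suc have "b 1 <= b (1 + 3 * Suc i) / 8 * (1 / 8) ^ i" by (rule order_trans)
    then show ?case by simp
   qed simp
   also have "... <= 1 * (1 / 8) ^ i" using b1 by (intro mult_right_mono) auto
   finally show ?thesis by simp
  qed
  moreover have "(\<lambda>i. (1 / 8 :: real) ^ i) \<longlonglongrightarrow> 0" by (rule LIMSEQ_realpow_zero) auto
  ultimately have "b 1 <= 0" by (meson LIMSEQ_le_const)
  moreover have "m 1 > 0" using pos mb_le[of r "\<alpha> ^ 1 * r" x] r alpha_pos(3) unfolding m_def by (simp add: mult_le_cancel_right1)
  ultimately show False unfolding b_def using lpos[of 1] by (simp add: field_simps)
 qed
 define n where "n = (LEAST n. n >= 1 \<and> m (n + 3) <= \<beta> * m n)"
 have n: "n >= 1 \<and> m (n + 3) <= \<beta> * m n" unfolding n_def by (rule LeastI_ex[OF ex])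
 have before: "\<beta> * m i <= m (i + 3)" if "1 <= i" "i < n" for i
  using not_less_Least[of i "\<lambda>n. n >= 1 \<and> m (n + 3) <= \<beta> * m n"] that unfolding n_def by auto
 \<comment> \<open>Descending induction in steps of three: a factor 8 per three scales is 2 per
   scale. From \<open>n\<close> on the claim follows from \<open>b1\<close>.\<close>
 have bb: "b i <= 2 ^ i / 2 ^ n" if "1 <= i" "i <= n + 2" for i
  using that
 proof (induction "n + 2 - i" arbitrary: i rule: less_induct)
  case less
  show ?case
  proof (cases "i < n")
   case True
   have "b (i + 3) <= 2 ^ (i + 3) / 2 ^ n" using True by (intro less) auto
   moreover have "b i <= b (i + 3) / 8" using b3 before True less by simp
   ultimately have "b i <= 2 ^ (i + 3) / 2 ^ n / 8" by (meson divide_right_mono order_trans zero_le_numeral)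
   then show ?thesis by (simp add: power_add)
  next
   case False
   then have "(1::real) <= 2 ^ i / 2 ^ n" by (simp add: power_increasing)
   then show ?thesis using b1[of i] by linarith
  qed
 qed
 have "(\<integral>y. dl x y * ind (ball x (\<alpha> ^ (n + 1) * r) - ball x (\<alpha> ^ (0 + 1) * r)) y)
   <= (\<Sum>i<n. ennreal (1 / l (i + 1)) * emeasure M (ball x (\<alpha> ^ (Suc i + 1) * r)))"
 proof (rule nn_integral_annuli)
  fix i y assume "\<alpha> ^ (i + 1) * r <= dist x y"
  moreover have "0 < \<alpha> ^ (i + 1) * r" using r by simp
  ultimately have "l (i + 1) <= lam x (dist x y)" unfolding l_def by (intro lam_mono)
  then show "dl x y <= ennreal (1 / l (i + 1))"
   using lpos[of "i + 1"] by (intro ennreal_leI divide_left_mono) auto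
 qed
 also have "... = ennreal (\<Sum>i<n. m (i + 2) / l (i + 1))"
  using lpos m0 unfolding emeasure_ball m_def by (subst sum_ennreal[symmetric]) (auto simp: less_imp_le intro!: sum.cong simp flip: ennreal_mult)
 also have "... <= ennreal (4 * Cl ^ a)"
 proof (rule ennreal_leI)
  have "(\<Sum>i<n. m (i + 2) / l (i + 1)) <= (\<Sum>i<n. Cl ^ a * (2 ^ (i + 2) / 2 ^ n))"
  proof (rule sum_mono)
   fix i assume i: "i \<in> {..<n}"
   have "m (i + 2) / l (i + 1) <= Cl ^ a * b (i + 2)"
   proof -
    have "m (i + 2) * l (i + 2) <= m (i + 2) * (Cl ^ a * l (i + 1))"
     using l1[of "i + 1"] m0 by (intro mult_left_mono) auto
    then show ?thesis unfolding b_def using lpos[of "i+1"] lpos[of "i+2"] by (simp add: field_simps)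
   qed
   also have "... <= Cl ^ a * (2 ^ (i + 2) / 2 ^ n)" using bb[of "i + 2"] i Cl_pos by (intro mult_left_mono) auto
   finally show "m (i + 2) / l (i + 1) <= Cl ^ a * (2 ^ (i + 2) / 2 ^ n)" .
  qed
  also have "... = Cl ^ a * 4 / 2 ^ n * (\<Sum>i<n. 2 ^ i)" by (simp add: sum_distrib_left sum_divide_distrib mult_ac)
  also have "(\<Sum>i<n. 2 ^ i) = (2::real) ^ n - 1" using geometric_sum[of "2::real" n] by simp
  also have "Cl ^ a * 4 / 2 ^ n * (2 ^ n - 1) <= Cl ^ a * 4 / 2 ^ n * 2 ^ n" using Cl_pos by (intro mult_left_mono) auto
  finally show "(\<Sum>i<n. m (i + 2) / l (i + 1)) <= 4 * Cl ^ a" by simp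
 qed
 finally show ?thesis using n unfolding m_def by (intro exI[of _ n]) (auto simp: mult_ac)
qed

text \<open>The sets are chosen in the order of increasing radii: the functions chosen before have total
 mass at most \<open>h\<close> times the measure of the next ball, so at least half of it is still available.\<close>

lemma spread_masses:
 fixes R q :: "'a => real"
 assumes "finite J" "h > 0" "\<And>i. i \<in> J ==> q i >= 0" "\<And>i. i \<in> J ==> mb i (R i) > 0"
  and "\<And>i. i \<in> J ==> (\<Sum>j | j \<in> J \<and> R j <= R i \<and> ball j (R j) \<inter> ball i (R i) \<noteq> {}. q j) <= h * mb i (R i)"
 shows "\<exists>A. (\<forall>i\<in>J. A i \<in> sets M \<and> A i \<subseteq> ball i (R i) \<and> mb i (R i) <= 2 * measure M (A i)) \<and>
   (\<forall>y. (\<Sum>j\<in>J. q j / measure M (A j) * ind (A j) y) <= 4 * h)"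
 using assms(1,3-)
proof (induction J rule: finite_ranking_induct[where f = R])
 case empty
 then show ?case using assms(2) by simp
next
 case (insert i J)
 show ?case
 proof (cases "i \<in> J")
  case True
  then show ?thesis using insert by (simp add: insert_absorb)
 next
  case False
  have "(\<Sum>j | j \<in> J \<and> R j <= R k \<and> ball j (R j) \<inter> ball k (R k) \<noteq> {}. q j) <= h * mb k (R k)" if "k \<in> J" for k
  proof -
   have "(\<Sum>j | j \<in> J \<and> R j <= R k \<and> ball j (R j) \<inter> ball k (R k) \<noteq> {}. q j) <=
    (\<Sum>j | j \<in> insert i J \<and> R j <= R k \<and> ball j (R j) \<inter> ball k (R k) \<noteq> {}. q j)"
    using insert.hyps(1) insert.prems(1) by (intro sum_mono2) auto
   also have "... <= h * mb k (R k)" using insert.prems(3) that by blast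
   finally show ?thesis .
  qed
  then have "\<exists>A. (\<forall>i\<in>J. A i \<in> sets M \<and> A i \<subseteq> ball i (R i) \<and> mb i (R i) <= 2 * measure M (A i)) \<and>
   (\<forall>y. (\<Sum>j\<in>J. q j / measure M (A j) * ind (A j) y) <= 4 * h)"
   by (intro insert.IH insert.prems(1,2)) auto
  then obtain A where A0: "(\<forall>i\<in>J. A i \<in> sets M \<and> A i \<subseteq> ball i (R i) \<and> mb i (R i) <= 2 * measure M (A i)) \<and>
   (\<forall>y. (\<Sum>j\<in>J. q j / measure M (A j) * ind (A j) y) <= 4 * h)" by (rule exE)
  note A = conjunct1[OF A0, rule_format] conjunct2[OF A0, rule_format]
  define g where "g y = (\<Sum>j\<in>J. q j / measure M (A j) * ind (A j) y)" for y
  have [measurable]: "g \<in> borel_measurable M" unfolding g_def using A(1)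
   by (intro borel_measurable_sum borel_measurable_times borel_measurable_const borel_measurable_indicator) auto
  \<comment> \<open>The functions chosen before put at most mass \<open>h * mb i (R i)\<close> on
    this ball, so by Chebyshev they exceed \<open>2 * h\<close> on at most half of it. The new
    summand is also at most \<open>2 * h\<close>, which makes \<open>4 * h\<close> the
    invariant.\<close>
  define Ai where "Ai = {y \<in> ball i (R i). g y <= 2 * h}"
  have Ais [measurable]: "Ai \<in> sets M"
  proof -
   have "Ai = ball i (R i) \<inter> {y \<in> space M. g y <= 2 * h}" unfolding Ai_def by auto
   then show ?thesis by simp
  qed
  have fA: "emeasure M (A j) = ennreal (measure M (A j))" if "j \<in> J" for j
   using A(1)[OF that] bounded_finite[of "A j" j "R j"] by (intro emeasure_eq_ennreal_measure) auto
  have fm: "D \<in> fmeasurable M" if "D \<in> sets M" "D \<subseteq> ball k (R k)" for D k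
   using bounded_finite[OF that(2)] that by (auto simp: fmeasurable_def)
  have qi: "q i <= h * mb i (R i)"
  proof -
   have "ball i (R i) \<noteq> {}" using insert.prems(2)[of i] unfolding mb_def by force
   then have "i \<in> {j. j \<in> insert i J \<and> R j <= R i \<and> ball j (R j) \<inter> ball i (R i) \<noteq> {}}" by simp
   then have "q i <= (\<Sum>j | j \<in> insert i J \<and> R j <= R i \<and> ball j (R j) \<inter> ball i (R i) \<noteq> {}. q j)"
    using insert.hyps(1) insert.prems(1) by (intro member_le_sum) auto
   also have "... <= h * mb i (R i)" using insert.prems(3) by blast
   finally show ?thesis .
  qed
  have "ennreal (2 * h * measure M (ball i (R i) - Ai)) <= ennreal (h * mb i (R i))"
  proof -
   have "ennreal (2 * h * measure M (ball i (R i) - Ai)) = ennreal (2 * h) * emeasure M (ball i (R i) - Ai)"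
    using assms(2) fm[of "ball i (R i) - Ai" i] by (simp add: ennreal_mult emeasure_eq_measure2)
   also have "... = (\<integral>y. ennreal (2 * h) * ind (ball i (R i) - Ai) y)"
    by (simp add: nn_integral_cmult_indicator)
   also have "... <= (\<integral>y. (\<Sum>j\<in>J. ennreal (q j / measure M (A j)) * ind (A j \<inter> ball i (R i)) y))"
   proof (intro nn_integral_mono)
    fix y
    show "ennreal (2 * h) * ind (ball i (R i) - Ai) y <= (\<Sum>j\<in>J. ennreal (q j / measure M (A j)) * ind (A j \<inter> ball i (R i)) y)"
    proof (cases "y \<in> ball i (R i) - Ai")
     case True
     then have "ennreal (2 * h) <= ennreal (g y)" unfolding Ai_def by (intro ennreal_leI) auto
     also have "ennreal (g y) = (\<Sum>j\<in>J. ennreal (q j / measure M (A j) * ind (A j) y))"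
      unfolding g_def using insert.prems(1) by (intro sum_ennreal[symmetric]) auto
     also have "... = (\<Sum>j\<in>J. ennreal (q j / measure M (A j)) * ind (A j \<inter> ball i (R i)) y)"
      using True by (intro sum.cong) (auto simp: indicator_def)
     finally show ?thesis using True by simp
    qed simp
   qed
   also have "... = (\<Sum>j\<in>J. ennreal (q j / measure M (A j)) * emeasure M (A j \<inter> ball i (R i)))"
   proof -
    have [measurable]: "A j \<inter> ball i (R i) \<in> sets M" if "j \<in> J" for j using A(1)[OF that] by blast
    show ?thesis
     by (subst nn_integral_sum) (auto intro!: sum.cong nn_integral_cmult_indicator borel_measurable_times borel_measurable_indicator \<open>\<And>j. j \<in> J ==> A j \<inter> ball i (R i) \<in> sets M\<close>)
   qed
   also have "... <= (\<Sum>j\<in>J. if ball j (R j) \<inter> ball i (R i) \<noteq> {} then ennreal (q j) else 0)"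
   proof (rule sum_mono)
    fix j assume j: "j \<in> J"
    have m: "measure M (A j) > 0" using A(1)[OF j] insert.prems(2)[of j] j by simp
    show "ennreal (q j / measure M (A j)) * emeasure M (A j \<inter> ball i (R i)) <= (if ball j (R j) \<inter> ball i (R i) \<noteq> {} then ennreal (q j) else 0)"
    proof (cases "ball j (R j) \<inter> ball i (R i) = {}")
     case True
     then have "A j \<inter> ball i (R i) = {}" using A(1)[OF j] by blast
     then show ?thesis by simp
    next
     case False
     have "ennreal (q j / measure M (A j)) * emeasure M (A j \<inter> ball i (R i)) <= ennreal (q j / measure M (A j)) * emeasure M (A j)"
      using A(1)[OF j] by (intro mult_left_mono emeasure_mono) auto
     also have "... = ennreal (q j)" using fA[OF j] m insert.prems(1)[of j] j by (simp flip: ennreal_mult)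
     finally show ?thesis using False by simp
    qed
   qed
   also have "... = (\<Sum>j | j \<in> J \<and> ball j (R j) \<inter> ball i (R i) \<noteq> {}. ennreal (q j))"
    using insert.hyps(1) by (simp add: sum.inter_filter)
   also have "... = ennreal (\<Sum>j | j \<in> J \<and> ball j (R j) \<inter> ball i (R i) \<noteq> {}. q j)"
    using insert.prems(1) by (intro sum_ennreal) auto
   also have "... <= ennreal (\<Sum>j | j \<in> insert i J \<and> R j <= R i \<and> ball j (R j) \<inter> ball i (R i) \<noteq> {}. q j)"
    using insert.hyps insert.prems(1) by (intro ennreal_leI sum_mono2) auto
   also have "... <= ennreal (h * mb i (R i))" using insert.prems(3) by (intro ennreal_leI) blast
   finally show ?thesis .
  qed
  then have "2 * h * measure M (ball i (R i) - Ai) <= h * mb i (R i)" using assms(2) by (simp add: ennreal_le_iff)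
  moreover have "measure M (ball i (R i) - Ai) = mb i (R i) - measure M Ai"
   unfolding mb_def using emeasure_ball_finite[of i "R i"] Ais
   by (intro measure_Diff) (auto simp: Ai_def)
  ultimately have half: "mb i (R i) <= 2 * measure M Ai" using assms(2) by (simp add: algebra_simps)
  define A' where "A' = A(i := Ai)"
  have "(\<Sum>j\<in>insert i J. q j / measure M (A' j) * ind (A' j) y) <= 4 * h" for y
  proof -
   have eq: "(\<Sum>j\<in>insert i J. q j / measure M (A' j) * ind (A' j) y) = q i / measure M Ai * ind Ai y + g y"
    using insert.hyps(1) False unfolding A'_def g_def by (auto intro!: sum.cong)
   show ?thesis
   proof (cases "y \<in> Ai")
    case True
    have mA: "measure M Ai > 0" using half insert.prems(2)[of i] by simp
    have "q i <= 2 * h * measure M Ai" using order_trans[OF qi mult_left_mono[OF half, of h]] assms(2) by (simp add: mult_ac)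
    then have "q i / measure M Ai <= 2 * h" using mA by (simp add: field_simps)
    then show ?thesis unfolding eq using True unfolding Ai_def by (simp add: indicator_def)
   next
    case False
    then show ?thesis unfolding eq using A(2)[of y] by (simp add: g_def)
   qed
  qed
  moreover have "\<forall>k\<in>insert i J. A' k \<in> sets M \<and> A' k \<subseteq> ball k (R k) \<and> mb k (R k) <= 2 * measure M (A' k)"
   using A(1) Ais half unfolding A'_def by (auto simp: Ai_def)
  ultimately show ?thesis by (intro exI[of _ A'] conjI allI)
 qed
qed

section \<open>Selection of balls by a stopping rule\<close>

lemma measurable_mb [measurable]: "(\<lambda>x. mb x r) \<in> borel_measurable M"
proof -
 have "(\<lambda>x. emeasure M (Pair x -` {z. dist (fst z) (snd z) < r})) \<in> borel_measurable M"
 proof (rule measurable_emeasure_Pair)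
  show "{z. dist (fst z) (snd z) < r} \<in> sets (M \<Otimes>\<^sub>M M)"
   by (intro open_in_product open_Collect_less continuous_intros)
 qed
 then have "(\<lambda>x. enn2real (emeasure M (ball x r))) \<in> borel_measurable M"
  by (simp add: ball_def vimage_def)
 then show ?thesis by (simp add: mb_def measure_def)
qed

lemma measurable_ball_integral [measurable]:
 fixes F :: "'a => real"
 assumes [measurable]: "F \<in> borel_measurable M"
 shows "(\<lambda>x. LINT y|M. ind (ball x r) y * F y) \<in> borel_measurable M"
proof -
 have "(\<lambda>x. LINT y|M. of_bool (dist x y < r) * F y) \<in> borel_measurable M" by measurable
 then show ?thesis by (simp add: indicator_def of_bool_def)
qed

lemma sum_indicator_disjoint:
 assumes "finite J" "disjoint_family_on Q J" "(\<Union>j\<in>J. Q j) \<subseteq> B"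
 shows "(\<Sum>j\<in>J. ind (Q j) x) <= (ind B x :: real)"
proof -
 have "(\<Sum>j\<in>J. ind (Q j) x) = (ind (\<Union>j\<in>J. Q j) x :: real)"
  using assms(1,2) by (rule indicator_UN_disjoint[symmetric])
 then show ?thesis using assms(3) by (auto simp: indicator_def)
qed

lemma sum_integrals_disjoint:
 fixes F :: "'a => real"
 assumes "integrable M F" "\<And>x. F x >= 0" "finite J" "disjoint_family_on Q J" "\<And>j. j \<in> J ==> Q j \<in> sets M"
  "(\<Union>j\<in>J. Q j) \<subseteq> B" "B \<in> sets M"
 shows "(\<Sum>j\<in>J. LINT y|M. ind (Q j) y * F y) <= (LINT y|M. ind B y * F y)"
proof -
 have int: "integrable M (\<lambda>y. ind D y * F y)" if "D \<in> sets M" for D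
  using integrable_mult_indicator[OF that assms(1)] by simp
 have "(\<Sum>j\<in>J. LINT y|M. ind (Q j) y * F y) = (LINT y|M. (\<Sum>j\<in>J. ind (Q j) y * F y))"
  using int assms(5) by (intro Bochner_Integration.integral_sum[symmetric]) auto
 also have "... = (LINT y|M. (\<Sum>j\<in>J. ind (Q j) y) * F y)" by (simp add: sum_distrib_right)
 also have "... <= (LINT y|M. ind B y * F y)"
 proof (rule integral_mono)
  show "integrable M (\<lambda>y. (\<Sum>j\<in>J. ind (Q j) y) * F y)"
   using int assms(5) by (simp add: sum_distrib_right)
  show "integrable M (\<lambda>y. ind B y * F y)" using int assms(7) .
  fix y show "(\<Sum>j\<in>J. ind (Q j) y) * F y <= ind B y * F y"
   using sum_indicator_disjoint[OF assms(3,4,6), of y] assms(2)[of y] by (intro mult_right_mono)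
 qed
 finally show ?thesis .
qed

text \<open>The stopping radius at \<open>x\<close> is the largest in a geometric scale whose ball
  has much mass of \<open>F\<close> compared with its dilate. \<open>F\<close> is \<open>F0\<close>
  raised on an open neighbourhood of the level set, so that small balls around every point of it
  have mean above \<open>h\<close>; together with \<open>AE_small_doubling_balls\<close> this takes
  the place of Lebesgue differentiation. The hypothesis \<open>large\<close> stops the search at
  large radii. A set of measure below \<open>\<epsilon>\<close> is given up to keep the family
  finite, as the covering and the spreading of masses both demand.\<close>

lemma CZ_decomposition:
 fixes F0 :: "'a => real"
 assumes F0 [measurable]: "F0 \<in> borel_measurable M" and nn: "\<And>x. F0 x >= 0"
  and bd: "\<And>x. F0 x <= m" and supp: "\<And>x. x \<notin> ball z0 R0 ==> F0 x = 0"
  and h: "h > 0" and eps: "\<epsilon> > 0" and large: "\<beta> * (LINT x|M. F0 x) < h * mb z0 r0"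
 shows "\<exists>F J r R Q A. F \<in> borel_measurable M \<and> (\<forall>x. F0 x <= F x) \<and> integrable M F \<and>
   (LINT x|M. F x) <= (LINT x|M. F0 x) + \<epsilon> \<and> finite J \<and>
   (\<forall>j\<in>J. 0 < r j \<and> \<alpha> * r j <= R j \<and> Q j \<in> sets M \<and> Q j \<subseteq> ball j (\<alpha> * r j) \<and>
    A j \<in> sets M \<and> A j \<subseteq> ball j (R j) \<and> 0 < mb j (R j) \<and> mb j (\<alpha> ^ 3 * R j) <= \<beta> * mb j (R j) \<and>
    mb j (R j) <= 2 * measure M (A j) \<and>
    (\<integral>y. dl j y * ind (ball j (\<alpha> * R j) - ball j (\<alpha> * r j)) y) <= ennreal (4 * Cl ^ a)) \<and>
   disjoint_family_on Q J \<and> (\<Sum>j\<in>J. mb j (\<alpha>\<^sup>2 * r j)) <= \<beta> / h * (LINT x|M. F x) \<and>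
   (\<forall>y. (\<Sum>j\<in>J. (LINT x|M. ind (Q j) x * F x) / measure M (A j) * ind (A j) y) <= 4 * h) \<and>
   emeasure M {x \<in> space M. h < F0 x \<and> x \<notin> (\<Union>j\<in>J. Q j)} < ennreal \<epsilon>"
proof -
 define I0 where "I0 = (LINT x|M. F0 x)"
 have int_ball: "integrable M (ind B :: 'a => real)" if "B \<subseteq> ball z r" "B \<in> sets M" for B z r
  using bounded_finite[OF that(1)] that by (intro integrable_real_indicator) auto
 have I0_nn: "I0 >= 0" unfolding I0_def using nn by simp
 have F0_int: "integrable M F0"
 proof (rule Bochner_Integration.integrable_bound)
  show "integrable M (\<lambda>x. m * ind (ball z0 R0) x)" by (intro integrable_mult_right int_ball[of _ z0 R0]) auto
  show "AE x in M. norm (F0 x) <= norm (m * ind (ball z0 R0) x)"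
   using bd nn supp by (intro AE_I2) (auto simp: indicator_def intro: order_trans[OF bd abs_ge_self])
 qed simp
 define G0 where "G0 = {x \<in> space M. h < F0 x}"
 have G0s [measurable]: "G0 \<in> sets M" unfolding G0_def by measurable
 have G0b: "G0 \<subseteq> ball z0 R0"
 proof
  fix x assume "x \<in> G0"
  then have "F0 x \<noteq> 0" using h unfolding G0_def by auto
  then show "x \<in> ball z0 R0" using supp by blast
 qed
 define e where "e = min (\<epsilon> / (2 * h)) ((h * mb z0 r0 - \<beta> * I0) / (4 * h * \<beta>))"
 have e: "e > 0" "2 * h * e <= \<epsilon>" "\<beta> * (I0 + 2 * h * e) < h * mb z0 r0"
 proof -
  have gap: "h * mb z0 r0 - \<beta> * I0 > 0" using large unfolding I0_def by simp
  then show "e > 0" unfolding e_def using h eps beta_ge by simp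
  have "e <= \<epsilon> / (2 * h)" unfolding e_def by simp
  then show "2 * h * e <= \<epsilon>" using h by (simp add: field_simps)
  have "e <= (h * mb z0 r0 - \<beta> * I0) / (4 * h * \<beta>)" unfolding e_def by simp
  then have "4 * h * \<beta> * e <= h * mb z0 r0 - \<beta> * I0" using h beta_ge by (simp add: field_simps)
  then have "2 * h * \<beta> * e < h * mb z0 r0 - \<beta> * I0" using gap by linarith
  then show "\<beta> * (I0 + 2 * h * e) < h * mb z0 r0" by (simp add: algebra_simps)
 qed
 obtain G where G: "open G" "G0 \<subseteq> G" "G \<subseteq> ball z0 R0" "emeasure M (G - G0) < ennreal e"
  using outer_regular_bounded[OF G0s G0b e(1)] by (elim exE conjE)
 have Gs [measurable]: "G \<in> sets M" using G(1) by auto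
 \<comment> \<open>The height \<open>2 * h\<close> on the added set makes \<open>F > h\<close> on
   all of the open set \<open>G\<close>.\<close>
 define F where "F x = F0 x + 2 * h * ind (G - G0) x" for x
 have Fm [measurable]: "F \<in> borel_measurable M" unfolding F_def by measurable
 have F0F: "F0 x <= F x" for x unfolding F_def using h by simp
 have Fnn: "F x >= 0" for x using nn[of x] F0F[of x] by linarith
 have intGG: "integrable M (\<lambda>x. 2 * h * ind (G - G0) x)"
  using G(3) by (intro integrable_mult_right int_ball[of _ z0 R0]) auto
 have F_int: "integrable M F" unfolding F_def using F0_int intGG by (rule Bochner_Integration.integrable_add)
 have mGG: "measure M (G - G0) <= e"
  using G(4) e(1) by (metis emeasure_eq_ennreal_measure ennreal_le_iff less_imp_le less_le_trans not_less_iff_gr_or_eq top.not_eq_extremum top_greatest)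
 have LF: "(LINT x|M. F x) = I0 + 2 * h * measure M (G - G0)"
  unfolding F_def I0_def using F0_int intGG by simp
 have LF_le: "(LINT x|M. F x) <= I0 + 2 * h * e" unfolding LF using mGG h by simp
 have FG: "F x > h" if "x \<in> G" for x
  using that h nn[of x] unfolding F_def G0_def by (cases "h < F0 x") (auto simp: indicator_def)
 define fb where "fb x r = (LINT y|M. ind (ball x r) y * F y)" for x r
 have int: "integrable M (\<lambda>y. ind D y * F y)" if "D \<in> sets M" for D
  using integrable_mult_indicator[OF that F_int] by simp
 have fb_le: "fb x r <= (LINT x|M. F x)" for x r
  unfolding fb_def using int[of "ball x r"] F_int Fnn by (intro integral_mono) (auto split: split_indicator)
 \<comment> \<open>The mass on the ball is compared with the measure of its
   \<open>\<alpha>\<^sup>2\<close> dilate, because it is the dilates whose total measure has to be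
   controlled by the mass on disjoint balls.\<close>
 define P where "P x r \<longleftrightarrow> 0 < mb x r \<and> h * mb x (\<alpha>\<^sup>2 * r) <= \<beta> * fb x r" for x r
 define R1 where "R1 = \<bar>r0\<bar> + \<bar>R0\<bar> + 1"
 have R1: "R1 > 0" unfolding R1_def by simp
 have notP: "\<not> P x r" if "x \<in> G" "r >= R1" for x r
 proof -
  have "ball z0 r0 \<subseteq> ball x (\<alpha>\<^sup>2 * r)"
  proof
   fix y assume y: "y \<in> ball z0 r0"
   have "dist x y <= dist x z0 + dist z0 y" by (rule dist_triangle)
   moreover have "dist z0 x < R0" using that(1) G(3) by auto
   ultimately have "dist x y < R1" using y unfolding R1_def by (simp add: dist_commute)
   moreover have "1 * R1 <= \<alpha>\<^sup>2 * r" using that(2) R1 alpha_pos(3) by (intro mult_mono one_le_power) auto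
   ultimately show "y \<in> ball x (\<alpha>\<^sup>2 * r)" by simp
  qed
  then have "mb z0 r0 <= mb x (\<alpha>\<^sup>2 * r)" by (rule mb_mono)
  then have "h * mb z0 r0 <= h * mb x (\<alpha>\<^sup>2 * r)" using h by simp
  moreover have "\<beta> * fb x r <= \<beta> * (I0 + 2 * h * e)"
   using fb_le[of x r] LF_le beta_ge by (intro mult_left_mono) auto
  ultimately show ?thesis using e(3) unfolding P_def by linarith
 qed
 define rk where "rk k = R1 / \<alpha> ^ k" for k
 have rk: "rk k > 0" for k unfolding rk_def using R1 by simp
 define Gn where "Gn n = {x \<in> G. \<exists>k\<le>n. P x (rk k)}" for n
 have Gns [measurable]: "Gn n \<in> sets M" for n
 proof -
  have "{x \<in> space M. \<exists>k\<in>{..n}. P x (rk k)} \<in> sets M" unfolding P_def fb_def by measurable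
  moreover have "Gn n = G \<inter> {x \<in> space M. \<exists>k\<in>{..n}. P x (rk k)}" unfolding Gn_def by auto
  ultimately show ?thesis by simp
 qed
 \<comment> \<open>A ball inside \<open>G\<close> has mean above \<open>h\<close>; if it is also
   doubling, its \<open>\<alpha>\<^sup>2\<close> dilate is larger by at most the factor
   \<open>\<beta>\<close>, so \<open>P\<close> holds at that scale.\<close>
 have "AE x in M. x \<in> G \<longrightarrow> x \<in> (\<Union>n. Gn n)"
  using AE_small_doubling_balls[of a \<beta> R1] a3 beta_ge(2) R1
 proof (simp, elim eventually_mono, intro impI)
  fix x assume x: "\<forall>k0. \<exists>k\<ge>k0. 0 < mb x (R1 / (2 ^ a) ^ k) \<and> mb x ((2 ^ a) ^ 3 * R1 / (2 ^ a) ^ k) <= \<beta> * mb x (R1 / (2 ^ a) ^ k)" and xG: "x \<in> G"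
  obtain d where d: "d > 0" "ball x d \<subseteq> G" using G(1) xG open_contains_ball by blast
  obtain k0 where "R1 / d < \<alpha> ^ k0" using real_arch_pow[of \<alpha> "R1 / d"] alpha_ge_8 by auto
  then have k0: "rk k0 < d" unfolding rk_def using d by (simp add: field_simps)
  obtain k where k: "k >= k0" "0 < mb x (rk k)" "mb x (\<alpha> ^ 3 * rk k) <= \<beta> * mb x (rk k)"
   using x unfolding rk_def \<alpha>_def by auto
  have "rk k <= rk k0" unfolding rk_def using k(1) R1 alpha_pos(3) by (intro divide_left_mono power_increasing) auto
  then have sub: "ball x (rk k) \<subseteq> G" using d(2) k0 by (auto simp: subset_eq)
  have "h * mb x (rk k) = (LINT y|M. ind (ball x (rk k)) y * h)"
   by (simp add: mb_def)
  also have "... <= fb x (rk k)" unfolding fb_def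
  proof (rule integral_mono)
   show "integrable M (\<lambda>y. ind (ball x (rk k)) y * h)"
    by (intro integrable_mult_left int_ball[of _ x "rk k"]) auto
   show "integrable M (\<lambda>y. ind (ball x (rk k)) y * F y)" using int by simp
   fix y show "ind (ball x (rk k)) y * h <= ind (ball x (rk k)) y * F y"
    using FG[of y] sub by (auto simp: indicator_def intro: less_imp_le)
  qed
  finally have 1: "h * mb x (rk k) <= fb x (rk k)" .
  have "\<alpha>\<^sup>2 * rk k <= \<alpha> ^ 3 * rk k" using rk[of k] alpha_pos(3) by (intro mult_right_mono power_increasing) auto
  then have "mb x (\<alpha>\<^sup>2 * rk k) <= \<beta> * mb x (rk k)" using k(3) mb_le order_trans by blast
  then have "h * mb x (\<alpha>\<^sup>2 * rk k) <= \<beta> * (h * mb x (rk k))" using h by (simp add: mult.left_commute)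
  also have "... <= \<beta> * fb x (rk k)" using 1 beta_ge by (intro mult_left_mono) auto
  finally have "P x (rk k)" unfolding P_def using k by simp
  then show "\<exists>n. x \<in> Gn n" unfolding Gn_def using xG by auto
 qed
 then have "AE x in M. x \<notin> G - (\<Union>n. Gn n)" by eventually_elim blast
 then have "G - (\<Union>n. Gn n) \<in> null_sets M" by (subst AE_iff_null_sets) auto
 moreover have "(\<Inter>n. G - Gn n) = G - (\<Union>n. Gn n)" by blast
 ultimately have z: "emeasure M (\<Inter>n. G - Gn n) = 0" by (simp add: null_sets_def)
 have "(\<lambda>n. emeasure M (G - Gn n)) \<longlonglongrightarrow> emeasure M (\<Inter>n. G - Gn n)"
 proof (rule Lim_emeasure_decseq)
  show "decseq (\<lambda>n. G - Gn n)" unfolding Gn_def decseq_def by (auto intro: order_trans)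
  show "emeasure M (G - Gn n) \<noteq> \<infinity>" for n
   using bounded_finite[OF order_trans[OF Diff_subset G(3)], of "Gn n"] by simp
 qed auto
 then have "eventually (\<lambda>n. emeasure M (G - Gn n) < ennreal \<epsilon>) sequentially"
  unfolding z using eps by (intro order_tendstoD) auto
 then obtain n where n: "emeasure M (G - Gn n) < ennreal \<epsilon>" by (auto simp: eventually_sequentially)
 have R0': "0 < \<bar>R0\<bar> + 1" by linarith
 \<comment> \<open>On \<open>Gn n\<close> the stopping radii are at least \<open>rk n\<close>, so a
   finite net of this mesh, moved into \<open>Gn n\<close>, provides finitely many stopping balls
   that cover it.\<close>
 obtain Z where Z: "finite Z" "ball z0 (\<bar>R0\<bar> + 1) \<subseteq> (\<Union>z\<in>Z. ball z (rk n / 2))"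
  using totally_bounded_ball[OF R0' half_gt_zero[OF rk[of n]], of z0] by (elim exE conjE)
 define Z' where "Z' = {z \<in> Z. ball z (rk n / 2) \<inter> Gn n \<noteq> {}}"
 define s where "s z = (SOME x. x \<in> ball z (rk n / 2) \<inter> Gn n)" for z
 have s: "s z \<in> ball z (rk n / 2) \<inter> Gn n" if "z \<in> Z'" for z
  unfolding s_def using that unfolding Z'_def by (metis (mono_tags, lifting) ex_in_conv mem_Collect_eq someI_ex)
 define I where "I = s ` Z'"
 have I: "finite I" "I \<subseteq> Gn n" unfolding I_def using Z(1) s unfolding Z'_def by auto
 \<comment> \<open>The least index belongs to the largest radius.\<close>
 define kk where "kk i = (LEAST k. P i (rk k))" for i
 define r where "r i = rk (kk i)" for i
 have kk: "P i (r i)" "kk i <= n" if i: "i \<in> Gn n" for i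
 proof -
  obtain k where k: "k <= n" "P i (rk k)" using i unfolding Gn_def by auto
  show "P i (r i)" unfolding r_def kk_def using k(2) by (rule LeastI)
  have "kk i <= k" unfolding kk_def using k(2) by (rule Least_le)
  then show "kk i <= n" using k(1) by simp
 qed
 have rpos: "r i > 0" for i unfolding r_def by (rule rk)
 have "rk n <= r i" if "i \<in> Gn n" for i
  unfolding r_def rk_def using kk(2)[OF that] R1 alpha_pos(3) by (intro divide_left_mono power_increasing) auto
 then have Gcov: "Gn n \<subseteq> (\<Union>i\<in>I. ball i (r i))"
 proof (intro subsetI)
  fix x assume le: "\<And>i. i \<in> Gn n ==> rk n <= r i" and x: "x \<in> Gn n"
  then have "dist z0 x < R0" using G(3) unfolding Gn_def by auto
  then have "x \<in> ball z0 (\<bar>R0\<bar> + 1)" by simp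
  then obtain z where z: "z \<in> Z" "x \<in> ball z (rk n / 2)" using Z(2) by blast
  then have zZ: "z \<in> Z'" unfolding Z'_def using x by blast
  have "dist (s z) x < rk n" using s[OF zZ] z(2) dist_triangle[of "s z" x z] by (simp add: dist_commute)
  then have "x \<in> ball (s z) (r (s z))" using le[of "s z"] s[OF zZ] by simp
  then show "x \<in> (\<Union>i\<in>I. ball i (r i))" unfolding I_def using zZ by blast
 qed
 obtain J where J: "J \<subseteq> I" "disjoint_family_on (\<lambda>i. ball i (r i)) J"
  "(\<Union>i\<in>I. ball i (r i)) \<subseteq> (\<Union>j\<in>J. ball j (3 * r j))"
  using Vitali_finite[OF I(1), of "\<lambda>i. i" r] by (elim exE conjE)
 have fJ: "finite J" using J(1) I(1) finite_subset by blast
 have JG: "j \<in> Gn n" "j \<in> G" if "j \<in> J" for j using that J(1) I(2) unfolding Gn_def by auto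
 \<comment> \<open>Maximality: the dilate by \<open>\<alpha> ^ m\<close> is again a radius of the
   scale, at index \<open>kk i - m\<close>, or else exceeds \<open>R1\<close>, where
   \<open>notP\<close> applies.\<close>
 have notP': "\<beta> * fb i (\<alpha> ^ m * r i) <= h * mb i (\<alpha> ^ (m + 2) * r i)" if "i \<in> J" "m >= 1" for i m
 proof -
  have "\<not> P i (\<alpha> ^ m * r i)"
  proof (cases "m <= kk i")
   case True
   then have "\<alpha> ^ kk i = \<alpha> ^ m * \<alpha> ^ (kk i - m)" by (simp flip: power_add)
   then have "\<alpha> ^ m * r i = rk (kk i - m)" unfolding r_def rk_def using alpha_pos(1) by (simp del: alpha_pos)
   then show ?thesis using not_less_Least[of "kk i - m" "\<lambda>k. P i (rk k)"] True that(2) unfolding kk_def by auto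
  next
   case False
   then have "\<alpha> ^ kk i <= \<alpha> ^ m" using alpha_pos(3) by (intro power_increasing) auto
   then have "R1 * \<alpha> ^ kk i <= R1 * \<alpha> ^ m" using R1 by simp
   then have "\<alpha> ^ m * r i >= R1" unfolding r_def rk_def by (simp add: field_simps)
   then show ?thesis using notP JG that(1) by blast
  qed
  moreover have "0 < mb i (\<alpha> ^ m * r i)"
  proof -
   have "1 * r i <= \<alpha> ^ m * r i" using rpos[of i] alpha_pos(3) by (intro mult_right_mono one_le_power) auto
   then have "mb i (r i) <= mb i (\<alpha> ^ m * r i)" by (intro mb_le) simp
   then show ?thesis using kk(1)[OF JG(1)[OF that(1)]] unfolding P_def by linarith
  qed
  ultimately show ?thesis unfolding P_def by (simp add: power_add mult_ac power2_eq_square)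
 qed
 have "\<forall>i\<in>J. \<exists>k\<ge>1. mb i (\<alpha> ^ (k + 3) * r i) <= \<beta> * mb i (\<alpha> ^ k * r i) \<and>
  (\<integral>y. dl i y * ind (ball i (\<alpha> * (\<alpha> ^ k * r i)) - ball i (\<alpha> * r i)) y) <= ennreal (4 * Cl ^ a)" (is "\<forall>i\<in>J. ?K i")
 proof
  fix i assume "i \<in> J"
  then have "mb i (r i) > 0" using kk(1)[OF JG(1)] unfolding P_def by blast
  then show "?K i" by (rule doubling_dilate[OF rpos])
 qed
 from bchoice[OF this] obtain kS where kS: "\<And>i. i \<in> J ==> kS i >= 1"
  "\<And>i. i \<in> J ==> mb i (\<alpha> ^ (kS i + 3) * r i) <= \<beta> * mb i (\<alpha> ^ kS i * r i)"
  "\<And>i. i \<in> J ==> (\<integral>y. dl i y * ind (ball i (\<alpha> * (\<alpha> ^ kS i * r i)) - ball i (\<alpha> * r i)) y) <= ennreal (4 * Cl ^ a)"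
  by auto
 define R where "R i = \<alpha> ^ kS i * r i" for i
 have Rr: "\<alpha> * r i <= R i" if "i \<in> J" for i
  unfolding R_def using kS(1)[OF that] rpos[of i] alpha_pos(3) power_increasing[of 1 "kS i" \<alpha>] by simp
 have Rpos: "R i > 0" for i unfolding R_def using rpos by simp
 have mbR: "0 < mb i (R i)" if "i \<in> J" for i
 proof -
  have "1 * r i <= R i" unfolding R_def using rpos[of i] alpha_pos(3) by (intro mult_right_mono one_le_power) auto
  then have "mb i (r i) <= mb i (R i)" by (intro mb_le) simp
  then show ?thesis using kk(1)[OF JG(1)[OF that]] unfolding P_def by linarith
 qed
 have dblR: "mb i (\<alpha> ^ 3 * R i) <= \<beta> * mb i (R i)" if "i \<in> J" for i
  using kS(2)[OF that] unfolding R_def by (simp add: power_add mult_ac)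
 obtain f :: "'a => nat" where f: "inj_on f J" using finite_imp_inj_to_nat_seg[OF fJ] by blast
 \<comment> \<open>The dilated balls overlap; numbering them by \<open>f\<close> and removing the
   earlier ones makes them disjoint without changing their union.\<close>
 define Q where "Q j = ball j (\<alpha> * r j) - (\<Union>i\<in>{i \<in> J. f i < f j}. ball i (\<alpha> * r i))" for j
 have Qs: "Q j \<in> sets M" for j unfolding Q_def using fJ by (intro sets.Diff sets.finite_UN) auto
 have Qdisj: "disjoint_family_on Q J"
  unfolding disjoint_family_on_def
 proof (intro ballI impI)
  fix i j assume ij: "i \<in> J" "j \<in> J" "i \<noteq> j"
  then have "f i \<noteq> f j" using f by (auto simp: inj_on_def)
  then consider "f i < f j" | "f j < f i" by linarith
  then show "Q i \<inter> Q j = {}" using ij unfolding Q_def by cases auto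
 qed
 have Qun: "(\<Union>j\<in>J. ball j (\<alpha> * r j)) \<subseteq> (\<Union>j\<in>J. Q j)"
 proof
  fix y assume "y \<in> (\<Union>j\<in>J. ball j (\<alpha> * r j))"
  then have ex: "\<exists>j. j \<in> J \<and> y \<in> ball j (\<alpha> * r j)" by blast
  define j where "j = arg_min f (\<lambda>j. j \<in> J \<and> y \<in> ball j (\<alpha> * r j))"
  have j: "j \<in> J \<and> y \<in> ball j (\<alpha> * r j)" unfolding j_def by (rule arg_min_natI) (use ex in \<open>rule someI_ex\<close>)
  have "f j <= f i" if "i \<in> J" "y \<in> ball i (\<alpha> * r i)" for i
   unfolding j_def using arg_min_nat_le[of "\<lambda>j. j \<in> J \<and> y \<in> ball j (\<alpha> * r j)" i f] that by blast
  then have "y \<in> Q j" unfolding Q_def using j by (auto simp: not_less[symmetric])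
  then show "y \<in> (\<Union>j\<in>J. Q j)" using j by blast
 qed
 define q where "q j = (LINT x|M. ind (Q j) x * F x)" for j
 have q: "q j >= 0" for j unfolding q_def using Fnn by (intro integral_nonneg_AE) auto
 \<comment> \<open>Smaller balls meeting \<open>ball i (R i)\<close> lie in its threefold dilate,
   hence in \<open>ball i (\<alpha> * R i)\<close>. Maximality bounds the mass there by
   \<open>h / \<beta>\<close> times the measure of the \<open>\<alpha> ^ 3\<close> dilate, and the
   doubling of \<open>R i\<close> removes \<open>\<beta>\<close>.\<close>
 have over: "(\<Sum>j | j \<in> J \<and> R j <= R i \<and> ball j (R j) \<inter> ball i (R i) \<noteq> {}. q j) <= h * mb i (R i)" if i: "i \<in> J" for i
 proof -
  let ?J = "{j. j \<in> J \<and> R j <= R i \<and> ball j (R j) \<inter> ball i (R i) \<noteq> {}}"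
  have "(\<Sum>j\<in>?J. q j) <= fb i (\<alpha> * R i)" unfolding q_def fb_def
  proof (rule sum_integrals_disjoint[OF F_int Fnn])
   show "disjoint_family_on Q ?J" using Qdisj by (rule disjoint_family_on_mono[rotated]) auto
   show "(\<Union>j\<in>?J. Q j) \<subseteq> ball i (\<alpha> * R i)"
   proof
    fix y assume "y \<in> (\<Union>j\<in>?J. Q j)"
    then obtain j w where j: "j \<in> J" "R j <= R i" "dist j w < R j" "dist i w < R i" "y \<in> Q j" by auto
    then have "dist j y < R j" using Rr[OF j(1)] unfolding Q_def by auto
    then have "dist i y < R i + R j + R j"
     using j dist_triangle[of i y w] dist_triangle[of w y j] by (simp add: dist_commute)
    also have "... <= 3 * R i" using j by simp
    also have "... <= \<alpha> * R i" using alpha_ge_8 Rpos[of i] by (intro mult_right_mono) auto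
    finally show "y \<in> ball i (\<alpha> * R i)" by simp
   qed
  qed (use fJ Qs in auto)
  moreover have "\<beta> * fb i (\<alpha> * R i) <= h * mb i (\<alpha> ^ 3 * R i)"
   using notP'[OF i, of "kS i + 1"] unfolding R_def by (simp add: power_add mult_ac eval_nat_numeral)
  moreover have "h * mb i (\<alpha> ^ 3 * R i) <= \<beta> * (h * mb i (R i))" using dblR[OF i] h by (simp add: mult.left_commute)
  ultimately have "(\<Sum>j\<in>?J. q j) <= fb i (\<alpha> * R i)" "\<beta> * fb i (\<alpha> * R i) <= \<beta> * (h * mb i (R i))" by linarith+
  moreover from this(2) have "fb i (\<alpha> * R i) <= h * mb i (R i)" by (simp only: mult_le_cancel_left_pos[OF beta_ge(4)])
  ultimately show ?thesis by linarith
 qed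
 obtain A where A0: "(\<forall>i\<in>J. A i \<in> sets M \<and> A i \<subseteq> ball i (R i) \<and> mb i (R i) <= 2 * measure M (A i)) \<and>
   (\<forall>y. (\<Sum>j\<in>J. q j / measure M (A j) * ind (A j) y) <= 4 * h)"
  by (rule exE[OF spread_masses[OF fJ h q mbR over]])
 note A = conjunct1[OF A0, rule_format] conjunct2[OF A0, rule_format]
 have sumB: "(\<Sum>j\<in>J. mb j (\<alpha>\<^sup>2 * r j)) <= \<beta> / h * (LINT x|M. F x)"
 proof -
  have "(\<Sum>j\<in>J. mb j (\<alpha>\<^sup>2 * r j)) <= (\<Sum>j\<in>J. \<beta> / h * fb j (r j))"
   using kk(1)[OF JG(1)] h unfolding P_def by (intro sum_mono) (simp add: field_simps)
  also have "... = \<beta> / h * (\<Sum>j\<in>J. fb j (r j))" by (simp add: sum_distrib_left)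
  also have "... <= \<beta> / h * (LINT x|M. ind UNIV x * F x)"
   unfolding fb_def by (intro mult_left_mono sum_integrals_disjoint[OF F_int Fnn fJ J(2)]) (use h beta_ge(4) in auto)
  finally show ?thesis by simp
 qed
 have rest: "emeasure M {x \<in> space M. h < F0 x \<and> x \<notin> (\<Union>j\<in>J. Q j)} < ennreal \<epsilon>"
 proof -
  have "Gn n \<subseteq> (\<Union>j\<in>J. Q j)"
  proof -
   have "ball j (3 * r j) \<subseteq> ball j (\<alpha> * r j)" for j
    using alpha_ge_8 rpos[of j] by (intro subset_ball mult_right_mono) auto
   then have "(\<Union>j\<in>J. ball j (3 * r j)) \<subseteq> (\<Union>j\<in>J. ball j (\<alpha> * r j))" by (rule UN_mono[OF order_refl])
   then show ?thesis using Gcov J(3) Qun by (meson order_trans)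
  qed
  then have "{x \<in> space M. h < F0 x \<and> x \<notin> (\<Union>j\<in>J. Q j)} \<subseteq> G - Gn n"
   using subsetD[OF G(2)] unfolding G0_def by auto
  then have "emeasure M {x \<in> space M. h < F0 x \<and> x \<notin> (\<Union>j\<in>J. Q j)} <= emeasure M (G - Gn n)"
   by (rule emeasure_mono) auto
  then show ?thesis using n by (rule le_less_trans)
 qed
 have all: "\<forall>j\<in>J. 0 < r j \<and> \<alpha> * r j <= R j \<and> Q j \<in> sets M \<and> Q j \<subseteq> ball j (\<alpha> * r j) \<and>
    A j \<in> sets M \<and> A j \<subseteq> ball j (R j) \<and> 0 < mb j (R j) \<and> mb j (\<alpha> ^ 3 * R j) <= \<beta> * mb j (R j) \<and>
    mb j (R j) <= 2 * measure M (A j) \<and>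
    (\<integral>y. dl j y * ind (ball j (\<alpha> * R j) - ball j (\<alpha> * r j)) y) <= ennreal (4 * Cl ^ a)" (is "\<forall>j\<in>J. ?P j")
 proof
  fix j assume j: "j \<in> J"
  have "Q j \<subseteq> ball j (\<alpha> * r j)" unfolding Q_def by blast
  then show "?P j"
   using rpos Rr[OF j] Qs A(1)[OF j] mbR[OF j] dblR[OF j] kS(3)[OF j] unfolding R_def by simp
 qed
 have "(LINT x|M. F x) <= (LINT x|M. F0 x) + \<epsilon>" using LF_le e(2) unfolding I0_def by linarith
 moreover note A(2) sumB rest
 ultimately show ?thesis
  using Fm F0F F_int fJ all Qdisj unfolding q_def
  by (intro exI[of _ F] exI[of _ J] exI[of _ r] exI[of _ R] exI[of _ Q] exI[of _ A] conjI) blast+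
qed

end

section \<open>Vector-valued kernels\<close>

text \<open>A function on the product is read as a function of \<open>x\<close> with values in L^2
  of the second factor; this is its pointwise norm.\<close>

definition nrm :: "'b measure => ('a \<times> 'b => complex) => 'a => ennreal" where
 "nrm L u x = l2 L (\<lambda>b. ecmod (u (x, b)))"

text \<open>The Hilbert--Schmidt norm of the operator from L^2(N1) to L^2(N2) that the kernel
  assigns to the pair \<open>(x, y)\<close>. It is easy to compute, dominates the operator norm and
  is invariant under transposition.\<close>

definition hs :: "'b measure => 'c measure => ('a \<times> 'c => 'a \<times> 'b => complex) => 'a => 'a => ennreal" where
 "hs N1 N2 k x y = l2 N2 (\<lambda>c. l2 N1 (\<lambda>b. ecmod (k (x, c) (y, b))))"

definition int_op :: "'w measure => ('z => 'w => complex) => ('w => complex) => 'z => complex" where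
 "int_op W k u z = (LINT w|W. k z w * u w)"

text \<open>Both fibre measures are free, so the transposed kernel is an instance with
  \<open>N1\<close> and \<open>N2\<close> exchanged. The Marcinkiewicz integral has a point as first
  fibre and the half line as second one.\<close>

locale hs_kernel = integral_notation M + M: sigma_finite_measure M + N1: sigma_finite_measure N1 + N2: sigma_finite_measure N2
 for M :: "'a measure" and N1 :: "'b measure" and N2 :: "'c measure" +
 fixes k :: "'a \<times> 'c => 'a \<times> 'b => complex"
 assumes k_meas: "(\<lambda>(z, w). k z w) \<in> borel_measurable ((M \<Otimes>\<^sub>M N2) \<Otimes>\<^sub>M (M \<Otimes>\<^sub>M N1))"
begin

abbreviation W1 where "W1 \<equiv> M \<Otimes>\<^sub>M N1"
abbreviation W2 where "W2 \<equiv> M \<Otimes>\<^sub>M N2"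
abbreviation I1 where "I1 u \<equiv> \<integral>y. nrm N1 u y"

sublocale P1: pair_sigma_finite M N1 ..
sublocale P2: pair_sigma_finite M N2 ..

lemma sigma_finite_W: "sigma_finite_measure W1"
 by (intro sigma_finite_pair_measure M.sigma_finite_measure_axioms N1.sigma_finite_measure_axioms)

lemma sigma_finite_Z: "sigma_finite_measure W2"
 by (intro sigma_finite_pair_measure M.sigma_finite_measure_axioms N2.sigma_finite_measure_axioms)

lemma pair_ZW: "pair_sigma_finite W2 W1"
 unfolding pair_sigma_finite_def using sigma_finite_W sigma_finite_Z by blast

lemma measurable_l2_N1 [measurable (raw)]:
 "(\<lambda>(x, b). w x b) \<in> borel_measurable (L \<Otimes>\<^sub>M N1) ==> (\<lambda>x. l2 N1 (w x)) \<in> borel_measurable L"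
 by (rule measurable_l2[OF N1.sigma_finite_measure_axioms])

lemma measurable_l2_N2 [measurable (raw)]:
 "(\<lambda>(x, b). w x b) \<in> borel_measurable (L \<Otimes>\<^sub>M N2) ==> (\<lambda>x. l2 N2 (w x)) \<in> borel_measurable L"
 by (rule measurable_l2[OF N2.sigma_finite_measure_axioms])

lemma measurable_k [measurable (raw)]:
 assumes "f \<in> measurable L W2" "g \<in> measurable L W1"
 shows "(\<lambda>l. k (f l) (g l)) \<in> borel_measurable L"
 using measurable_compose[OF measurable_Pair[OF assms] k_meas] by simp

abbreviation T where "T \<equiv> int_op W1 k"
abbreviation S where "S u \<equiv> nrm N2 (int_op W1 k u)"
abbreviation hk where "hk \<equiv> hs N1 N2 k"

lemma measurable_nrm1 [measurable (raw)]:
 assumes [measurable]: "u \<in> borel_measurable W1" "f \<in> measurable L M"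
 shows "(\<lambda>x. nrm N1 u (f x)) \<in> borel_measurable L"
 unfolding nrm_def by measurable

lemma measurable_nrm2 [measurable (raw)]:
 assumes [measurable]: "u \<in> borel_measurable W2" "f \<in> measurable L M"
 shows "(\<lambda>x. nrm N2 u (f x)) \<in> borel_measurable L"
 unfolding nrm_def by measurable

lemma measurable_hk [measurable (raw)]:
 assumes [measurable]: "f \<in> measurable L M" "g \<in> measurable L M"
 shows "(\<lambda>x. hk (f x) (g x)) \<in> borel_measurable L"
 unfolding hs_def by measurable

lemma measurable_T [measurable]:
 assumes [measurable]: "u \<in> borel_measurable W1"
 shows "T u \<in> borel_measurable W2"
 unfolding int_op_def by measurable

text \<open>The operator with absolute values everywhere: a majorant of \<open>T\<close> whose
  finiteness certifies absolute convergence.\<close>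

definition Tn where "Tn u z = (\<integral>\<^sup>+w. ecmod (k z w) * ecmod (u w) \<partial>W1)"

lemma l2_Tn_le:
 assumes [measurable]: "u \<in> borel_measurable W1" and x: "x \<in> space M"
 shows "l2 N2 (\<lambda>c. Tn u (x, c)) <= (\<integral>y. hk x y * nrm N1 u y)"
proof -
 have [measurable]: "(\<lambda>_. x) \<in> measurable L M" for L :: "'l measure" using x by simp
 let ?\<kappa> = "\<lambda>c y. l2 N1 (\<lambda>b. ecmod (k (x, c) (y, b)))"
 have "l2 N2 (\<lambda>c. Tn u (x, c)) <= l2 N2 (\<lambda>c. \<integral>y. ?\<kappa> c y * nrm N1 u y)"
 proof (rule l2_mono)
  fix c assume c: "c \<in> space N2"
  then have [measurable]: "(\<lambda>_. c) \<in> measurable L N2" for L :: "'l measure" by simp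
  have "Tn u (x, c) = (\<integral>y. \<integral>\<^sup>+b. ecmod (k (x, c) (y, b)) * ecmod (u (y, b)) \<partial>N1)"
   unfolding Tn_def by (rule N1.nn_integral_fst[symmetric]) measurable
  also have "... <= (\<integral>y. ?\<kappa> c y * nrm N1 u y)"
  proof (intro nn_integral_mono)
   fix y assume y: "y \<in> space M"
   then have [measurable]: "(\<lambda>_. y) \<in> measurable L M" for L :: "'l measure" by simp
   show "(\<integral>\<^sup>+b. ecmod (k (x, c) (y, b)) * ecmod (u (y, b)) \<partial>N1) <= ?\<kappa> c y * nrm N1 u y"
    unfolding nrm_def by (rule nn_integral_mult_le_l2) measurable
  qed
  finally show "Tn u (x, c) <= (\<integral>y. ?\<kappa> c y * nrm N1 u y)" .
 qed
 also have "... <= (\<integral>y. l2 N2 (\<lambda>c. ?\<kappa> c y * nrm N1 u y))"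
  by (rule l2_nn_integral[OF M.sigma_finite_measure_axioms N2.sigma_finite_measure_axioms]) measurable
 also have "... = (\<integral>y. hk x y * nrm N1 u y)"
 proof (intro nn_integral_cong)
  fix y assume y: "y \<in> space M"
  then have [measurable]: "(\<lambda>_. y) \<in> measurable L M" for L :: "'l measure" by simp
  have "l2 N2 (\<lambda>c. nrm N1 u y * ?\<kappa> c y) = nrm N1 u y * l2 N2 (\<lambda>c. ?\<kappa> c y)"
   by (rule l2_cmult) measurable
  then show "l2 N2 (\<lambda>c. ?\<kappa> c y * nrm N1 u y) = hk x y * nrm N1 u y" by (simp add: mult.commute hs_def)
 qed
 finally show ?thesis .
qed

lemma norm_T_le: "ecmod (T u z) <= Tn u z"
proof -
 have "ecmod (T u z) <= (\<integral>\<^sup>+w. ecmod (k z w * u w) \<partial>W1)"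
 proof (cases "integrable W1 (\<lambda>w. k z w * u w)")
  case True
  then show ?thesis unfolding int_op_def by (rule integral_norm_bound_ennreal)
 qed (simp add: int_op_def not_integrable_integral_eq)
 then show ?thesis by (simp add: Tn_def norm_mult ennreal_mult)
qed

lemma S_le:
 assumes "u \<in> borel_measurable W1" "x \<in> space M"
 shows "S u x <= (\<integral>y. hk x y * nrm N1 u y)"
proof -
 have "S u x <= l2 N2 (\<lambda>c. Tn u (x, c))" unfolding nrm_def by (intro l2_mono norm_T_le)
 then show ?thesis using l2_Tn_le[OF assms] by (rule order_trans)
qed

text \<open>Bochner integrals are 0 by default when they diverge, so \<open>T\<close> is additive
  only where the integrals converge. This pointwise condition guarantees it for almost every fibre
  variable; by Schur's condition it holds at almost every \<open>x\<close> when the norm of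
  \<open>u\<close> is integrable.\<close>

definition fin_at where "fin_at u x \<longleftrightarrow> (\<integral>y. hk x y * nrm N1 u y) < \<infinity>"

lemma AE_integrable:
 assumes u [measurable]: "u \<in> borel_measurable W1" and x: "x \<in> space M" and fin: "fin_at u x"
 shows "AE c in N2. integrable W1 (\<lambda>w. k (x, c) w * u w)"
proof -
 have [measurable]: "(\<lambda>_. x) \<in> measurable L M" for L :: "'l measure" using x by simp
 have "l2 N2 (\<lambda>c. Tn u (x, c)) < \<infinity>" using l2_Tn_le[OF u x] fin unfolding fin_at_def by (rule le_less_trans)
 then have "(\<integral>\<^sup>+c. (Tn u (x, c))\<^sup>2 \<partial>N2) \<noteq> \<infinity>"
  unfolding l2_def by (metis ennpowr_top(1) less_irrefl)
 moreover have "(\<lambda>c. (Tn u (x, c))\<^sup>2) \<in> borel_measurable N2" unfolding Tn_def by measurable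
 ultimately have "AE c in N2. (Tn u (x, c))\<^sup>2 \<noteq> \<infinity>" by (rule nn_integral_PInf_AE[rotated])
 then show ?thesis
 proof (rule AE_mp, intro AE_I2 impI)
  fix c assume c: "c \<in> space N2" and f: "(Tn u (x, c))\<^sup>2 \<noteq> \<infinity>"
  then have [measurable]: "(\<lambda>_. c) \<in> measurable L N2" for L :: "'l measure" by simp
  have "Tn u (x, c) < \<infinity>" using f by (cases "Tn u (x, c) = \<infinity>") (auto simp: less_top)
  then show "integrable W1 (\<lambda>w. k (x, c) w * u w)"
   unfolding Tn_def by (intro integrableI_bounded) (simp_all add: norm_mult ennreal_mult)
 qed
qed

lemma l2_triangle_AE:
 assumes [measurable]: "f \<in> borel_measurable L" "g \<in> borel_measurable L"
  and "AE c in L. cmod (h c) <= cmod (f c) + cmod (g c)"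
 shows "l2 L (\<lambda>c. ecmod (h c)) <= l2 L (\<lambda>c. ecmod (f c)) + l2 L (\<lambda>c. ecmod (g c))"
proof -
 have "l2 L (\<lambda>c. ecmod (h c)) <= l2 L (\<lambda>c. ecmod (f c) + ecmod (g c))"
  using assms(3) by (intro l2_mono_AE) (auto elim!: eventually_mono simp flip: ennreal_plus intro: ennreal_leI)
 also have "... <= l2 L (\<lambda>c. ecmod (f c)) + l2 L (\<lambda>c. ecmod (g c))"
  by (rule l2_add) measurable
 finally show ?thesis .
qed

lemma S_add:
 assumes u [measurable]: "u \<in> borel_measurable W1" "v \<in> borel_measurable W1"
  and x: "x \<in> space M" and fin: "fin_at u x" "fin_at v x"
 shows "S (\<lambda>w. u w + v w) x <= S u x + S v x"
proof -
 have [measurable]: "(\<lambda>_. x) \<in> measurable L M" for L :: "'l measure" using x by simp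
 have "AE c in N2. cmod (T (\<lambda>w. u w + v w) (x, c)) <= cmod (T u (x, c)) + cmod (T v (x, c))"
  using AE_integrable[OF u(1) x fin(1)] AE_integrable[OF u(2) x fin(2)]
  by eventually_elim (simp add: int_op_def distrib_left norm_triangle_ineq)
 then show ?thesis unfolding nrm_def by (intro l2_triangle_AE) measurable
qed

lemma nrm_add:
 assumes [measurable]: "u \<in> borel_measurable W1" "v \<in> borel_measurable W1" and x: "x \<in> space M"
 shows "nrm N1 (\<lambda>w. u w + v w) x <= nrm N1 u x + nrm N1 v x"
proof -
 have [measurable]: "(\<lambda>_. x) \<in> measurable L M" for L :: "'l measure" using x by simp
 show ?thesis unfolding nrm_def by (intro l2_triangle_AE AE_I2 norm_triangle_ineq) measurable
qed

lemma fin_at_add: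
 assumes [measurable]: "u \<in> borel_measurable W1" "v \<in> borel_measurable W1"
  and x: "x \<in> space M" and "fin_at u x" "fin_at v x"
 shows "fin_at (\<lambda>w. u w + v w) x"
proof -
 have [measurable]: "(\<lambda>_. x) \<in> measurable L M" for L :: "'l measure" using x by simp
 have "(\<integral>y. hk x y * nrm N1 (\<lambda>w. u w + v w) y) <= (\<integral>y. hk x y * nrm N1 u y + hk x y * nrm N1 v y)"
  by (intro nn_integral_mono) (auto simp: distrib_left[symmetric] intro!: mult_left_mono nrm_add)
 also have "... = (\<integral>y. hk x y * nrm N1 u y) + (\<integral>y. hk x y * nrm N1 v y)"
  by (rule nn_integral_add) measurable
 also have "... < \<infinity>" using assms unfolding fin_at_def by simp
 finally show ?thesis unfolding fin_at_def .
qed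

lemma nrm_0 [simp]: "nrm L (\<lambda>_. 0) x = 0"
 by (simp add: nrm_def l2_def)

lemma S_sum:
 assumes "finite I" and x: "x \<in> space M"
  and "\<And>i. i \<in> I ==> u i \<in> borel_measurable W1" "\<And>i. i \<in> I ==> fin_at (u i) x"
 shows "S (\<lambda>w. \<Sum>i\<in>I. u i w) x <= (\<Sum>i\<in>I. S (u i) x) \<and> fin_at (\<lambda>w. \<Sum>i\<in>I. u i w) x"
 using assms(1,3,4)
proof (induction I)
 case empty
 then show ?case by (simp add: int_op_def fin_at_def)
next
 case (insert i I)
 have [measurable]: "(\<lambda>w. \<Sum>i\<in>I. u i w) \<in> borel_measurable W1"
  using insert.prems by (intro borel_measurable_sum) auto
 have IH: "S (\<lambda>w. \<Sum>i\<in>I. u i w) x <= (\<Sum>i\<in>I. S (u i) x)" "fin_at (\<lambda>w. \<Sum>i\<in>I. u i w) x"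
  using insert by auto
 have ui: "u i \<in> borel_measurable W1" "fin_at (u i) x" using insert.prems by auto
 have "S (\<lambda>w. u i w + (\<Sum>i\<in>I. u i w)) x <= S (u i) x + S (\<lambda>w. \<Sum>i\<in>I. u i w) x"
  using ui IH x by (intro S_add) auto
 also have "... <= S (u i) x + (\<Sum>i\<in>I. S (u i) x)" using IH(1) by (rule add_left_mono)
 finally show ?case using insert.hyps fin_at_add[OF ui(1) _ x ui(2) IH(2)] by simp
qed

section \<open>Schur's test, cancellation and transposition\<close>

lemma nn_integral_Schur1:
 assumes L: "\<And>y. y \<in> space M ==> (\<integral>x. hk x y) <= L"
  and f [measurable]: "f \<in> borel_measurable M"
 shows "(\<integral>x. \<integral>y. hk x y * f y) <= L * (\<integral>y. f y)"
proof -
 interpret MM: pair_sigma_finite M M ..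
 have "(\<integral>x. \<integral>y. hk x y * f y) = (\<integral>y. \<integral>x. hk x y * f y)"
  by (rule MM.Fubini') measurable
 also have "... = (\<integral>y. (\<integral>x. hk x y) * f y)"
 proof (intro nn_integral_cong nn_integral_multc)
  fix y assume "y \<in> space M"
  then have [measurable]: "(\<lambda>_. y) \<in> measurable L M" for L :: "'l measure" by simp
  show "(\<lambda>x. hk x y) \<in> borel_measurable M" by measurable
 qed
 also have "... <= (\<integral>y. L * f y)" using L by (intro nn_integral_mono mult_right_mono) auto
 also have "... = L * (\<integral>y. f y)" by (rule nn_integral_cmult) measurable
 finally show ?thesis .
qed

lemma AE_fin_at:
 assumes L: "\<And>y. y \<in> space M ==> (\<integral>x. hk x y) <= L" "L < \<infinity>"
  and [measurable]: "u \<in> borel_measurable W1" and fin: "I1 u < \<infinity>"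
 shows "AE x in M. fin_at u x"
proof -
 have "(\<integral>x. \<integral>y. hk x y * nrm N1 u y) <= L * I1 u"
  by (rule nn_integral_Schur1[OF L(1)]) measurable
 also have "... < \<infinity>" using L(2) fin by (simp add: ennreal_mult_less_top)
 finally have "AE x in M. (\<integral>y. hk x y * nrm N1 u y) \<noteq> \<infinity>"
  by (intro nn_integral_PInf_AE) auto
 then show ?thesis unfolding fin_at_def by (simp add: less_top)
qed

lemma Schur_L1:
 assumes L: "\<And>y. y \<in> space M ==> (\<integral>x. hk x y) <= L"
  and [measurable]: "u \<in> borel_measurable W1"
 shows "(\<integral>x. S u x) <= L * I1 u"
proof -
 have "(\<integral>x. S u x) <= (\<integral>x. \<integral>y. hk x y * nrm N1 u y)"
  by (intro nn_integral_mono S_le) auto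
 also have "... <= L * I1 u" by (rule nn_integral_Schur1[OF L]) measurable
 finally show ?thesis .
qed

lemma Schur_L2:
 assumes L: "\<And>y. y \<in> space M ==> (\<integral>x. hk x y) <= L" "\<And>x. x \<in> space M ==> (\<integral>y. hk x y) <= L"
  and [measurable]: "u \<in> borel_measurable W1"
 shows "(\<integral>x. (S u x)\<^sup>2) <= L\<^sup>2 * (\<integral>y. (nrm N1 u y)\<^sup>2)"
proof -
 have "(\<integral>x. (S u x)\<^sup>2) <= (\<integral>x. L * (\<integral>y. hk x y * (nrm N1 u y)\<^sup>2))"
 proof (intro nn_integral_mono)
  fix x assume x: "x \<in> space M"
  then have [measurable]: "(\<lambda>_. x) \<in> measurable L M" for L :: "'l measure" by simp
  have "(S u x)\<^sup>2 <= (\<integral>y. hk x y * nrm N1 u y)\<^sup>2"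
   using S_le[OF assms(3) x] by (rule power_mono) simp
  also have "... = (\<integral>y. ennpowr (hk x y) (1 / 2) * (ennpowr (hk x y) (1 / 2) * nrm N1 u y))\<^sup>2"
   by (simp add: mult.assoc[symmetric] power2_eq_square[symmetric])
  also have "... <= (\<integral>y. (ennpowr (hk x y) (1 / 2))\<^sup>2) * (\<integral>y. (ennpowr (hk x y) (1 / 2) * nrm N1 u y)\<^sup>2)"
   by (rule Cauchy_Schwarz_nn_integral) measurable
  also have "... <= L * (\<integral>y. hk x y * (nrm N1 u y)\<^sup>2)"
   using L(2)[OF x] by (simp add: power_mult_distrib mult_right_mono)
  finally show "(S u x)\<^sup>2 <= L * (\<integral>y. hk x y * (nrm N1 u y)\<^sup>2)" .
 qed
 also have "... = L * (\<integral>x. \<integral>y. hk x y * (nrm N1 u y)\<^sup>2)"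
  by (rule nn_integral_cmult) measurable
 also have "... <= L * (L * (\<integral>y. (nrm N1 u y)\<^sup>2))"
  by (intro mult_left_mono nn_integral_Schur1[OF L(1)]) auto
 finally show ?thesis by (simp add: power2_eq_square mult.assoc)
qed

lemma S_cancel:
 assumes u [measurable]: "u \<in> borel_measurable W1" and x: "x \<in> space M" and y0: "y0 \<in> space M"
  and fin: "fin_at u x" "hk x y0 < \<infinity>" "I1 u < \<infinity>"
  and canc: "AE b in N1. (LINT y|M. u (y, b)) = 0"
 shows "S u x <= (\<integral>y. hs N1 N2 (\<lambda>z w. k z w - k z (y0, snd w)) x y * nrm N1 u y)"
proof -
 have [measurable]: "(\<lambda>_. x) \<in> measurable L M" "(\<lambda>_. y0) \<in> measurable L M" for L :: "'l measure" using x y0 by auto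
 let ?k0 = "\<lambda>z w. k z (y0, snd w)" and ?kd = "\<lambda>z w. k z w - k z (y0, snd w)"
 interpret K0: hs_kernel M N1 N2 ?k0 by unfold_locales measurable
 interpret Kd: hs_kernel M N1 N2 ?kd by unfold_locales measurable
 have fin0: "K0.fin_at u x"
 proof -
  have "hs N1 N2 ?k0 x y = hk x y0" for y unfolding hs_def by simp
  then have "(\<integral>y. hs N1 N2 ?k0 x y * nrm N1 u y) = hk x y0 * I1 u"
   by (simp add: nn_integral_cmult)
  then show ?thesis unfolding K0.fin_at_def using fin by (simp add: ennreal_mult_less_top)
 qed
 have "AE c in N2. T u (x, c) = int_op W1 ?kd u (x, c)"
  using AE_integrable[OF u x fin(1)] K0.AE_integrable[OF u x fin0]
 proof (rule eventually_elim2)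
  fix c assume i: "integrable W1 (\<lambda>w. k (x, c) w * u w)"
   and i0: "integrable W1 (\<lambda>w. k (x, c) (y0, snd w) * u w)"
  have "(LINT w|W1. k (x, c) (y0, snd w) * u w) = (LINT b|N1. LINT y|M. k (x, c) (y0, b) * u (y, b))"
   using P1.integral_snd[of "\<lambda>y b. k (x, c) (y0, b) * u (y, b)"] i0 by (simp add: case_prod_unfold)
  also have "... = (LINT b|N1. k (x, c) (y0, b) * (LINT y|M. u (y, b)))" by simp
  also have "... = 0"
   using canc by (intro integral_eq_zero_AE) (auto elim!: eventually_mono)
  finally have "(LINT w|W1. k (x, c) (y0, snd w) * u w) = 0" .
  then show "T u (x, c) = int_op W1 ?kd u (x, c)"
   using i i0 by (simp add: int_op_def left_diff_distrib)
 qed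
 then have "S u x <= nrm N2 (int_op W1 ?kd u) x"
  unfolding nrm_def by (intro l2_mono_AE) (auto elim!: eventually_mono)
 also have "... <= (\<integral>y. hs N1 N2 ?kd x y * nrm N1 u y)" by (rule Kd.S_le[OF u x])
 finally show ?thesis .
qed

lemma adjoint_kernel: "hs_kernel M N2 N1 (\<lambda>w z. k z w)"
 by unfold_locales measurable

lemma hs_adjoint:
 assumes "x \<in> space M" "y \<in> space M"
 shows "hs N2 N1 (\<lambda>w z. k z w) y x = hk x y"
proof -
 interpret NN: pair_sigma_finite N2 N1 ..
 have [measurable]: "(\<lambda>_. x) \<in> measurable L M" "(\<lambda>_. y) \<in> measurable L M" for L :: "'l measure" using assms by auto
 have "(\<integral>\<^sup>+b. \<integral>\<^sup>+c. (ecmod (k (x, c) (y, b)))\<^sup>2 \<partial>N2 \<partial>N1) = (\<integral>\<^sup>+c. \<integral>\<^sup>+b. (ecmod (k (x, c) (y, b)))\<^sup>2 \<partial>N1 \<partial>N2)"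
  by (rule NN.Fubini') measurable
 then show ?thesis unfolding hs_def by (simp add: l2_def)
qed

text \<open>Fubini, with \<open>fin\<close> as the absolute convergence. The pairing is bilinear,
  without conjugation, so the adjoint is simply the transposed kernel.\<close>

lemma duality:
 assumes u [measurable]: "u \<in> borel_measurable W1" and g [measurable]: "g \<in> borel_measurable W2"
  and fin: "(\<integral>x. nrm N2 g x * (\<integral>y. hk x y * nrm N1 u y)) < \<infinity>"
 shows "ecmod (LINT w|W1. int_op W2 (\<lambda>w z. k z w) g w * u w) <= (\<integral>x. nrm N2 g x * S u x)"
proof -
 have int: "integrable (W2 \<Otimes>\<^sub>M W1) (\<lambda>(z, w). g z * (k z w * u w))"
 proof (rule integrableI_bounded)
  have "(\<integral>\<^sup>+p. ennreal (norm (case p of (z, w) => g z * (k z w * u w))) \<partial>(W2 \<Otimes>\<^sub>M W1))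
   = (\<integral>\<^sup>+z. \<integral>\<^sup>+w. ecmod (g z) * (ecmod (k z w) * ecmod (u w)) \<partial>W1 \<partial>W2)"
   by (subst sigma_finite_measure.nn_integral_fst[OF sigma_finite_W, symmetric]) (auto simp: norm_mult ennreal_mult)
  also have "... = (\<integral>\<^sup>+z. ecmod (g z) * Tn u z \<partial>W2)"
   unfolding Tn_def by (intro nn_integral_cong nn_integral_cmult) measurable
  also have "... = (\<integral>x. \<integral>\<^sup>+c. ecmod (g (x, c)) * Tn u (x, c) \<partial>N2)"
   unfolding Tn_def by (rule N2.nn_integral_fst[symmetric]) measurable
  also have "... <= (\<integral>x. nrm N2 g x * (\<integral>y. hk x y * nrm N1 u y))"
  proof (intro nn_integral_mono)
   fix x assume x: "x \<in> space M"
   then have [measurable]: "(\<lambda>_. x) \<in> measurable L M" for L :: "'l measure" by simp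
   have "(\<integral>\<^sup>+c. ecmod (g (x, c)) * Tn u (x, c) \<partial>N2) <= nrm N2 g x * l2 N2 (\<lambda>c. Tn u (x, c))"
    unfolding nrm_def Tn_def by (rule nn_integral_mult_le_l2) measurable
   also have "... <= nrm N2 g x * (\<integral>y. hk x y * nrm N1 u y)"
    using l2_Tn_le[OF u x] by (rule mult_left_mono) simp
   finally show "(\<integral>\<^sup>+c. ecmod (g (x, c)) * Tn u (x, c) \<partial>N2) <= nrm N2 g x * (\<integral>y. hk x y * nrm N1 u y)" .
  qed
  also have "... < \<infinity>" by (rule fin)
  finally show "(\<integral>\<^sup>+p. ennreal (norm (case p of (z, w) => g z * (k z w * u w))) \<partial>(W2 \<Otimes>\<^sub>M W1)) < \<infinity>" .
 qed measurable
 have "(LINT w|W1. int_op W2 (\<lambda>w z. k z w) g w * u w) = (LINT w|W1. LINT z|W2. g z * (k z w * u w))"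
 proof (intro Bochner_Integration.integral_cong refl)
  fix w
  have "(\<lambda>z. g z * (k z w * u w)) = (\<lambda>z. (k z w * g z) * u w)" by (simp add: mult_ac)
  then show "int_op W2 (\<lambda>w z. k z w) g w * u w = (LINT z|W2. g z * (k z w * u w))"
   by (simp add: int_op_def)
 qed
 also have "... = (LINT z|W2. LINT w|W1. g z * (k z w * u w))"
  by (rule pair_sigma_finite.Fubini_integral[OF pair_ZW int])
 also have "... = (LINT z|W2. g z * T u z)" by (simp add: int_op_def)
 finally have "ecmod (LINT w|W1. int_op W2 (\<lambda>w z. k z w) g w * u w) = ecmod (LINT z|W2. g z * T u z)" by simp
 also have "... <= (\<integral>\<^sup>+z. ecmod (g z * T u z) \<partial>W2)"
 proof (cases "integrable W2 (\<lambda>z. g z * T u z)")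
  case True
  then show ?thesis by (rule integral_norm_bound_ennreal)
 qed (simp add: not_integrable_integral_eq)
 also have "... = (\<integral>x. \<integral>\<^sup>+c. ecmod (g (x, c)) * ecmod (T u (x, c)) \<partial>N2)"
  by (subst N2.nn_integral_fst[symmetric]) (auto simp: norm_mult ennreal_mult)
 also have "... <= (\<integral>x. nrm N2 g x * S u x)"
 proof (intro nn_integral_mono)
  fix x assume x: "x \<in> space M"
  then have [measurable]: "(\<lambda>_. x) \<in> measurable L M" for L :: "'l measure" by simp
  show "(\<integral>\<^sup>+c. ecmod (g (x, c)) * ecmod (T u (x, c)) \<partial>N2) <= nrm N2 g x * S u x"
   unfolding nrm_def by (rule nn_integral_mult_le_l2) measurable
 qed
 finally show ?thesis .
qed

end

text \<open>The test class: for it all L^q norms are finite and, under Schur's condition, all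
  operators converge absolutely almost everywhere.\<close>

definition nice :: "'a::metric_space measure => 'b measure => ('a \<times> 'b => complex) => bool" where
 "nice M L u \<longleftrightarrow> u \<in> borel_measurable (M \<Otimes>\<^sub>M L) \<and> (\<exists>m. \<forall>x. nrm L u x <= ennreal m) \<and> bounded {x. nrm L u x \<noteq> 0}"

text \<open>L^q boundedness in its a priori form, tested on \<open>nice\<close> functions only. The
  q-th powers are compared, and the bound \<open>A\<close> is a parameter because its size is what
  the bootstraps track.\<close>

definition bounded_nice ::
  "'a::metric_space measure => 'b measure => 'c measure => ('a \<times> 'c => 'a \<times> 'b => complex) => real => real => bool" where
 "bounded_nice M N1 N2 k q A \<longleftrightarrow>
  (\<forall>u. nice M N1 u \<longrightarrow> (\<integral>\<^sup>+x. ennpowr (nrm N2 (int_op (M \<Otimes>\<^sub>M N1) k u) x) q \<partial>M)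
    <= ennreal (A powr q) * (\<integral>\<^sup>+x. ennpowr (nrm N1 u x) q \<partial>M))"

lemma (in hs_kernel) measurable_hs_diff:
 assumes y0: "y0 \<in> space M"
 shows "(\<lambda>p. hs N1 N2 (\<lambda>z w. k z w - k z (y0, snd w)) (fst p) (snd p)) \<in> borel_measurable (M \<Otimes>\<^sub>M M)"
proof -
 have [measurable]: "(\<lambda>_. y0) \<in> measurable L M" for L :: "'l measure" using y0 by simp
 interpret Kd: hs_kernel M N1 N2 "\<lambda>z w. k z w - k z (y0, snd w)" by unfold_locales measurable
 show ?thesis by measurable
qed

text \<open>The constants play different roles: \<open>Ck\<close> is uniform over the truncations,
  whereas \<open>L\<close> may depend on them. \<open>L\<close> serves only absolute convergence and
  the initial finite L^2 bound, so it must not survive in any final constant.\<close>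

locale cz_kernel = cz_space M lam Cl N a + hs_kernel M N1 N2 k
 for M :: "'a::metric_space measure" and lam :: "'a => real => real" and Cl :: real and N :: nat and a :: nat
  and N1 :: "'b measure" and N2 :: "'c measure" and k +
 fixes Ck L :: real
 assumes Ck: "Ck >= 0" and L: "L >= 0"
  and size: "\<And>x y. x \<noteq> y ==> hs N1 N2 k x y <= ennreal (Ck / lam x (dist x y))"
  and diag: "\<And>x. hs N1 N2 k x x = 0"
  and Hoermander: "\<And>y y0. (\<integral>x. hs N1 N2 (\<lambda>z w. k z w - k z (y0, snd w)) x y * ind {x. 2 * dist y y0 <= dist x y0} x) <= ennreal Ck"
  and Schur: "\<And>y. (\<integral>x. hs N1 N2 k x y) <= ennreal L" "\<And>x. (\<integral>y. hs N1 N2 k x y) <= ennreal L"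
begin

abbreviation bdd where "bdd \<equiv> bounded_nice M N1 N2 k"

text \<open>Cancellation replaces the kernel by its difference with the kernel frozen at the centre.
  Outside the double ball every \<open>y\<close> in the support satisfies
  \<open>2 * dist y c <= dist x c\<close>, which is the region of Hoermander's condition.\<close>

lemma S_far:
 assumes v [measurable]: "v \<in> borel_measurable W1" and fin: "I1 v < \<infinity>"
  and canc: "AE b in N1. (LINT y|M. v (y, b)) = 0"
  and supp: "AE y in M. y \<notin> ball c r \<longrightarrow> nrm N1 v y = 0" and r: "r > 0"
 shows "(\<integral>x. S v x * ind (- ball c (2 * r)) x) <= ennreal Ck * I1 v"
proof -
 interpret MM: pair_sigma_finite M M ..
 let ?h = "hs N1 N2 (\<lambda>z w. k z w - k z (c, snd w))"
 have hm [measurable]: "(\<lambda>x. ?h (f x) (g x)) \<in> borel_measurable L"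
  if "f \<in> measurable L M" "g \<in> measurable L M" for f g and L :: "'l measure"
  using measurable_compose[OF measurable_Pair[OF that] measurable_hs_diff[of c]] by simp
 have [measurable]: "- ball c (2 * r) \<in> sets M" by (simp add: sets_M)
 have "AE x in M. fin_at v x" by (rule AE_fin_at[OF Schur(1) _ v fin]) simp
 then have "(\<integral>x. S v x * ind (- ball c (2 * r)) x)
   <= (\<integral>x. \<integral>y. ind (- ball c (2 * r)) x * ?h x y * nrm N1 v y)"
 proof (intro nn_integral_mono_AE, elim eventually_mono)
  fix x assume f: "fin_at v x"
  show "S v x * ind (- ball c (2 * r)) x <= (\<integral>y. ind (- ball c (2 * r)) x * ?h x y * nrm N1 v y)"
  proof (cases "x \<in> ball c (2 * r)")
   case False
   then have "x \<noteq> c" using r by auto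
   then have "hk x c < \<infinity>" using size[of x c] by (simp add: order_le_less_trans)
   then have "S v x <= (\<integral>y. ?h x y * nrm N1 v y)" by (intro S_cancel[OF v _ _ f _ fin canc]) auto
   then show ?thesis using False by simp
  qed simp
 qed
 also have "... = (\<integral>y. \<integral>x. ind (- ball c (2 * r)) x * ?h x y * nrm N1 v y)"
  by (rule MM.Fubini') measurable
 also have "... <= (\<integral>y. ennreal Ck * nrm N1 v y)"
  using supp
 proof (intro nn_integral_mono_AE, elim eventually_mono)
  fix y assume sy: "y \<notin> ball c r \<longrightarrow> nrm N1 v y = 0"
  have "(\<integral>x. ind (- ball c (2 * r)) x * ?h x y * nrm N1 v y) = (\<integral>x. ind (- ball c (2 * r)) x * ?h x y) * nrm N1 v y"
   by (rule nn_integral_multc) measurable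
  also have "... <= ennreal Ck * nrm N1 v y"
  proof (cases "y \<in> ball c r")
   case True
   have "(\<integral>x. ind (- ball c (2 * r)) x * ?h x y) <= (\<integral>x. ?h x y * ind {x. 2 * dist y c <= dist x c} x)"
    using True by (intro nn_integral_mono) (auto simp: indicator_def dist_commute)
   also have "... <= ennreal Ck" by (rule Hoermander)
   finally show ?thesis by (rule mult_right_mono) simp
  qed (use sy in simp)
  finally show "(\<integral>x. ind (- ball c (2 * r)) x * ?h x y * nrm N1 v y) <= ennreal Ck * nrm N1 v y" .
 qed
 also have "... = ennreal Ck * I1 v" by (rule nn_integral_cmult) measurable
 finally show ?thesis .
qed

text \<open>Only the size of the kernel is used. For \<open>y\<close> in the ball,
  \<open>dist c x <= 2 ^ n * dist x y\<close>: one factor \<open>Cl\<close> changes the centre from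
  \<open>c\<close> to \<open>x\<close>, and \<open>n\<close> more change the radius.\<close>

lemma S_near:
 assumes v [measurable]: "v \<in> borel_measurable W1"
  and supp: "AE y in M. y \<notin> ball c r \<longrightarrow> nrm N1 v y = 0" and r: "r > 0"
  and \<theta>: "\<theta> > 1" "2 ^ n * (\<theta> - 1) >= \<theta>" and x: "\<theta> * r <= dist c x"
 shows "S v x <= ennreal (Ck * Cl ^ (n + 1) / lam c (dist c x)) * I1 v"
proof -
 have "S v x <= (\<integral>y. hk x y * nrm N1 v y)" by (rule S_le[OF v]) simp
 also have "... <= (\<integral>y. ennreal (Ck * Cl ^ (n + 1) / lam c (dist c x)) * nrm N1 v y)"
  using supp
 proof (intro nn_integral_mono_AE, elim eventually_mono)
  fix y assume sy: "y \<notin> ball c r \<longrightarrow> nrm N1 v y = 0"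
  show "hk x y * nrm N1 v y <= ennreal (Ck * Cl ^ (n + 1) / lam c (dist c x)) * nrm N1 v y"
  proof (cases "y \<in> ball c r")
   case True
   let ?d = "dist c x"
   have d: "?d > 0" using r \<theta>(1) x by (metis less_le_trans less_trans mult_pos_pos zero_less_one)
   have "?d <= dist x y + dist c y" using dist_triangle[of c x y] by (simp add: dist_commute)
   moreover have "\<theta> * dist c y <= ?d" using True \<theta>(1) order_trans[OF mult_left_mono[of "dist c y" r \<theta>] x] by simp
   ultimately have "\<theta> * ?d <= \<theta> * dist x y + ?d"
    using \<theta>(1) mult_left_mono[of ?d "dist x y + dist c y" \<theta>] by (simp add: distrib_left)
   then have "(\<theta> - 1) * ?d <= \<theta> * dist x y" by (simp add: algebra_simps)
   have "\<theta> * ?d <= 2 ^ n * (\<theta> - 1) * ?d" using \<theta>(2) d by (intro mult_right_mono) auto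
   also have "... = 2 ^ n * ((\<theta> - 1) * ?d)" by simp
   also have "... <= 2 ^ n * (\<theta> * dist x y)" using \<open>(\<theta> - 1) * ?d <= \<theta> * dist x y\<close> by (rule mult_left_mono) simp
   finally have "\<theta> * ?d <= \<theta> * (2 ^ n * dist x y)" by (simp only: mult.left_commute)
   then have dd: "?d <= 2 ^ n * dist x y" using \<theta>(1) by simp
   then have xy: "dist x y > 0" using d by (cases "x = y") auto
   have "lam c ?d <= Cl * lam x ?d" using d by (intro lam_comp) auto
   also have "... <= Cl * lam x (2 ^ n * dist x y)" using d dd Cl_pos by (intro mult_left_mono lam_mono) auto
   also have "... <= Cl * (Cl ^ n * lam x (dist x y))" using xy Cl_pos by (intro mult_left_mono lam_pow) auto
   finally have l: "lam c ?d <= Cl ^ (n + 1) * lam x (dist x y)" by simp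
   have "Ck / lam x (dist x y) <= Ck * Cl ^ (n + 1) / lam c ?d"
    using l lam_pos[OF d, of c] lam_pos[OF xy, of x] Ck mult_left_mono[OF l Ck] by (simp add: field_simps)
   then have "hk x y <= ennreal (Ck * Cl ^ (n + 1) / lam c ?d)"
    using order_trans[OF size[of x y] ennreal_leI] xy by auto
   then show ?thesis by (rule mult_right_mono) simp
  qed (use sy in simp)
 qed
 also have "... = ennreal (Ck * Cl ^ (n + 1) / lam c (dist c x)) * I1 v"
  by (rule nn_integral_cmult) measurable
 finally show ?thesis .
qed

section \<open>Bounded functions with bounded support as test functions\<close>

lemma nice_integrable:
 assumes "nice M N1 u" "q > 0"
 shows "(\<integral>y. ennpowr (nrm N1 u y) q) < \<infinity>"
proof -
 obtain m where m: "\<And>x. nrm N1 u x <= ennreal m" using assms unfolding nice_def by blast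
 obtain z R where B: "{x. nrm N1 u x \<noteq> 0} \<subseteq> ball z R"
  using assms unfolding nice_def by (metis bounded_subset_ballD)
 have "(\<integral>y. ennpowr (nrm N1 u y) q) <= (\<integral>y. ennpowr (ennreal m) q * ind (ball z R) y)"
 proof (intro nn_integral_mono)
  fix y show "ennpowr (nrm N1 u y) q <= ennpowr (ennreal m) q * ind (ball z R) y"
   using B assms(2) ennpowr_mono[OF m[of y] assms(2)] by (cases "nrm N1 u y = 0") (auto simp: subset_eq)
 qed
 also have "... = ennpowr (ennreal m) q * emeasure M (ball z R)" by (rule nn_integral_cmult_indicator) measurable
 also have "... < \<infinity>"
  using emeasure_ball_finite[of z R] ennpowr_eq_top_iff[of "ennreal m" q] by (auto simp: ennreal_mult_less_top less_top)
 finally show ?thesis .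
qed

lemma nice_integrable1: "nice M N1 u ==> (I1 u) < \<infinity>"
 using nice_integrable[of u 1] by simp

lemma nice_indicator:
 assumes "nice M N1 u" "D \<in> sets M"
 shows "nice M N1 (\<lambda>w. ind D (fst w) * u w)" "nrm N1 (\<lambda>w. ind D (fst w) * u w) x = ind D x * nrm N1 u x"
proof -
 show eq: "nrm N1 (\<lambda>w. ind D (fst w) * u w) x = ind D x * nrm N1 u x" for x
  by (cases "x \<in> D") (simp_all add: nrm_def l2_def)
 have [measurable]: "u \<in> borel_measurable W1" "D \<in> sets M" using assms unfolding nice_def by auto
 obtain m where m: "\<And>x. nrm N1 u x <= ennreal m" using assms unfolding nice_def by blast
 have "nrm N1 (\<lambda>w. ind D (fst w) * u w) x <= ennreal m" for x
  using m[of x] unfolding eq by (cases "x \<in> D") auto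
 moreover have "bounded {x. nrm N1 (\<lambda>w. ind D (fst w) * u w) x \<noteq> 0}"
  using assms(1) unfolding nice_def eq by (elim conjE bounded_subset) auto
 moreover have "(\<lambda>w. ind D (fst w) * u w) \<in> borel_measurable W1" by measurable
 ultimately show "nice M N1 (\<lambda>w. ind D (fst w) * u w)" unfolding nice_def by blast
qed

lemma nice_add:
 assumes "nice M N1 u" "nice M N1 v"
 shows "nice M N1 (\<lambda>w. u w + v w)"
proof -
 have [measurable]: "u \<in> borel_measurable W1" "v \<in> borel_measurable W1" using assms unfolding nice_def by auto
 obtain m m' where m: "\<And>x. nrm N1 u x <= ennreal m" "\<And>x. nrm N1 v x <= ennreal m'" using assms unfolding nice_def by blast
 have tri: "nrm N1 (\<lambda>w. u w + v w) x <= nrm N1 u x + nrm N1 v x" for x by (rule nrm_add) auto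
 have "nrm N1 (\<lambda>w. u w + v w) x <= ennreal (\<bar>m\<bar> + \<bar>m'\<bar>)" for x
 proof -
  have "nrm N1 (\<lambda>w. u w + v w) x <= ennreal m + ennreal m'" using tri[of x] m[of x] by (meson add_mono order_trans)
  also have "... <= ennreal \<bar>m\<bar> + ennreal \<bar>m'\<bar>" by (intro add_mono ennreal_leI) auto
  finally show ?thesis by simp
 qed
 moreover have "bounded {x. nrm N1 (\<lambda>w. u w + v w) x \<noteq> 0}"
 proof (rule bounded_subset)
  show "bounded ({x. nrm N1 u x \<noteq> 0} \<union> {x. nrm N1 v x \<noteq> 0})" using assms unfolding nice_def by simp
  show "{x. nrm N1 (\<lambda>w. u w + v w) x \<noteq> 0} \<subseteq> {x. nrm N1 u x \<noteq> 0} \<union> {x. nrm N1 v x \<noteq> 0}"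
  proof (intro subsetI CollectI)
   fix x assume "x \<in> {x. nrm N1 (\<lambda>w. u w + v w) x \<noteq> 0}"
   then show "x \<in> {x. nrm N1 u x \<noteq> 0} \<union> {x. nrm N1 v x \<noteq> 0}" using tri[of x] by auto
  qed
 qed
 moreover have "(\<lambda>w. u w + v w) \<in> borel_measurable W1" by measurable
 ultimately show ?thesis unfolding nice_def by blast
qed

lemma nice_zero: "nice M N1 (\<lambda>_. 0)"
 unfolding nice_def by (auto intro: exI[of _ 0])

lemma nice_sum: "finite I ==> (\<And>i. i \<in> I ==> nice M N1 (u i)) ==> nice M N1 (\<lambda>w. \<Sum>i\<in>I. u i w)"
 by (induction I rule: finite_induct) (auto intro: nice_zero nice_add)

lemma nice_tensor:
 assumes [measurable]: "w \<in> borel_measurable N1" "A \<in> sets M" and "bounded A" and fin: "l2 N1 (\<lambda>b. ecmod (w b)) <= ennreal m"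
 shows "nice M N1 (\<lambda>p. of_real (t * ind A (fst p)) * w (snd p))"
  "nrm N1 (\<lambda>p. of_real (t * ind A (fst p)) * w (snd p)) x = ennreal \<bar>t\<bar> * ind A x * l2 N1 (\<lambda>b. ecmod (w b))"
proof -
 show eq: "nrm N1 (\<lambda>p. of_real (t * ind A (fst p)) * w (snd p)) x = ennreal \<bar>t\<bar> * ind A x * l2 N1 (\<lambda>b. ecmod (w b))" for x
 proof -
  have "nrm N1 (\<lambda>p. of_real (t * ind A (fst p)) * w (snd p)) x = l2 N1 (\<lambda>b. (ennreal \<bar>t\<bar> * ind A x) * ecmod (w b))"
   unfolding nrm_def by (intro arg_cong[where f = "l2 N1"] ext) (auto simp: indicator_def norm_mult ennreal_mult)
  then show ?thesis by (simp add: l2_cmult)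
 qed
 have "nrm N1 (\<lambda>p. of_real (t * ind A (fst p)) * w (snd p)) x <= ennreal (\<bar>t\<bar> * \<bar>m\<bar>)" for x
 proof -
  have "nrm N1 (\<lambda>p. of_real (t * ind A (fst p)) * w (snd p)) x <= ennreal \<bar>t\<bar> * 1 * ennreal m"
   unfolding eq using fin by (intro mult_mono) (auto simp: indicator_def)
  also have "... <= ennreal \<bar>t\<bar> * 1 * ennreal \<bar>m\<bar>" by (intro mult_left_mono ennreal_leI) auto
  finally show ?thesis by (simp add: ennreal_mult)
 qed
 moreover have "bounded {x. nrm N1 (\<lambda>p. of_real (t * ind A (fst p)) * w (snd p)) x \<noteq> 0}"
  using assms(3) unfolding eq by (elim bounded_subset) (auto simp: indicator_def)
 moreover have "(\<lambda>p. of_real (t * ind A (fst p)) * w (snd p)) \<in> borel_measurable W1" by measurable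
 ultimately show "nice M N1 (\<lambda>p. of_real (t * ind A (fst p)) * w (snd p))" unfolding nice_def by blast
qed

lemma nice_AE_fin: "nice M N1 u ==> AE x in M. fin_at u x"
 by (rule AE_fin_at[OF Schur(1) _ _ nice_integrable1]) (auto simp: nice_def)

lemma measurable_S [measurable]:
 "u \<in> borel_measurable W1 ==> (\<lambda>x. S u x) \<in> borel_measurable M"
 by (rule measurable_nrm2[OF measurable_T measurable_ident_sets[OF refl]])

lemma local_bound:
 assumes bnd: "bdd q A" and q: "q > 1" and A: "A >= 0" and v: "nice M N1 v"
  and B [measurable]: "B \<in> sets M"
 shows "(\<integral>x. S v x * ind B x) <= ennreal A * ennpowr (\<integral>x. ennpowr (nrm N1 v x) q) (1 / q) * ennpowr (emeasure M B) (1 - 1 / q)"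
proof -
 define p where "p = q / (q - 1)"
 have pq: "p > 1" "1 / q + 1 / p = 1" "1 / p = 1 - 1 / q" using q unfolding p_def by (auto simp: field_simps)
 have [measurable]: "v \<in> borel_measurable W1" using v unfolding nice_def by auto
 have "(\<integral>x. S v x * ind B x) <= ennpowr (\<integral>x. ennpowr (S v x) q) (1 / q) * ennpowr (\<integral>x. ennpowr (ind B x) p) (1 / p)"
  using q pq by (intro Hoelder_ennreal) auto
 also have "(\<integral>x. ennpowr (ind B x) p) = (\<integral>x. ind B x)"
  using pq ennpowr_ennreal[of 1 p] by (intro nn_integral_cong) (auto simp: indicator_def)
 also have "... = emeasure M B" by simp
 also have "ennpowr (\<integral>x. ennpowr (S v x) q) (1 / q) <= ennpowr (ennreal (A powr q) * (\<integral>x. ennpowr (nrm N1 v x) q)) (1 / q)"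
  using bnd v q unfolding bounded_nice_def by (intro ennpowr_mono) auto
 also have "... = ennreal A * ennpowr (\<integral>x. ennpowr (nrm N1 v x) q) (1 / q)"
  using q A by (simp add: ennpowr_mult ennpowr_ennreal powr_powr)
 finally show ?thesis by (simp add: pq mult_right_mono)
qed

lemma Markov_q:
 assumes [measurable]: "f \<in> borel_measurable M" and s: "s > 0" and q: "q > 0"
 shows "mlev f s <= ennreal (s powr - q) * (\<integral>x. ennpowr (f x) q)"
proof -
 have "mlev f s = (\<integral>x. ind (lev f s) x)"
  by (rule nn_integral_indicator[symmetric]) measurable
 also have "... <= (\<integral>x. ennreal (s powr - q) * ennpowr (f x) q)"
 proof (intro nn_integral_mono)
  fix x
  show "ind (lev f s) x <= ennreal (s powr - q) * ennpowr (f x) q"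
  proof (cases "ennreal s < f x")
   case True
   have "1 = ennreal (s powr - q) * ennpowr (ennreal s) q"
    using s by (simp add: ennpowr_ennreal powr_minus flip: ennreal_mult)
   also have "... <= ennreal (s powr - q) * ennpowr (f x) q" using True q by (intro mult_left_mono ennpowr_mono) auto
   finally show ?thesis using True by simp
  qed simp
 qed
 also have "... = ennreal (s powr - q) * (\<integral>x. ennpowr (f x) q)" by (rule nn_integral_cmult) measurable
 finally show ?thesis .
qed

lemma nrm_sum:
 assumes "finite I" "\<And>i. i \<in> I ==> u i \<in> borel_measurable W1"
 shows "nrm N1 (\<lambda>w. \<Sum>i\<in>I. u i w) x <= (\<Sum>i\<in>I. nrm N1 (u i) x)"
 using assms
proof (induction I rule: finite_induct)
 case (insert i I)
 have "nrm N1 (\<lambda>w. u i w + (\<Sum>i\<in>I. u i w)) x <= nrm N1 (u i) x + nrm N1 (\<lambda>w. \<Sum>i\<in>I. u i w) x"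
  using insert.prems by (intro nrm_add borel_measurable_sum) auto
 also have "... <= nrm N1 (u i) x + (\<Sum>i\<in>I. nrm N1 (u i) x)" using insert by (intro add_left_mono) auto
 finally show ?case using insert.hyps by simp
qed simp

lemma l2_integral_le:
 assumes "nice M N1 u"
 shows "l2 N1 (\<lambda>b. ecmod (LINT y|M. u (y, b))) <= I1 u"
  "AE b in N1. integrable M (\<lambda>y. u (y, b))"
  "(\<lambda>b. LINT y|M. u (y, b)) \<in> borel_measurable N1"
proof -
 have [measurable]: "u \<in> borel_measurable W1" using assms unfolding nice_def by auto
 show "(\<lambda>b. LINT y|M. u (y, b)) \<in> borel_measurable N1" by measurable
 have le: "l2 N1 (\<lambda>b. \<integral>y. ecmod (u (y, b))) <= I1 u"
  unfolding nrm_def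
  by (rule l2_nn_integral[OF sigma_finite_measure_axioms N1.sigma_finite_measure_axioms]) measurable
 have pt: "ecmod (LINT y|M. u (y, b)) <= (\<integral>y. ecmod (u (y, b)))" for b
 proof (cases "integrable M (\<lambda>y. u (y, b))")
  case True
  then show ?thesis by (rule integral_norm_bound_ennreal)
 qed (simp add: not_integrable_integral_eq)
 show "l2 N1 (\<lambda>b. ecmod (LINT y|M. u (y, b))) <= I1 u"
  by (rule order_trans[OF l2_mono[OF pt] le])
 have "l2 N1 (\<lambda>b. \<integral>y. ecmod (u (y, b))) \<noteq> \<infinity>"
  using le nice_integrable1[OF assms] by (auto simp: less_top)
 then have "(\<integral>\<^sup>+b. (\<integral>y. ecmod (u (y, b)))\<^sup>2 \<partial>N1) \<noteq> \<infinity>" unfolding l2_def by (auto simp: ennpowr_eq_top_iff)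
 then have "AE b in N1. (\<integral>y. ecmod (u (y, b)))\<^sup>2 \<noteq> \<infinity>"
  by (intro nn_integral_PInf_AE) auto
 then show "AE b in N1. integrable M (\<lambda>y. u (y, b))"
 proof (rule AE_mp, intro AE_I2 impI)
  fix b assume b: "b \<in> space N1" and f: "(\<integral>y. ecmod (u (y, b)))\<^sup>2 \<noteq> \<infinity>"
  have [measurable]: "(\<lambda>_. b) \<in> measurable L N1" for L :: "'l measure" using b by simp
  have "(\<integral>y. ecmod (u (y, b))) < \<infinity>"
   using f by (cases "(\<integral>y. ecmod (u (y, b))) = \<infinity>") (auto simp: less_top)
  then show "integrable M (\<lambda>y. u (y, b))" by (intro integrableI_bounded) auto
 qed
qed

text \<open>All that later estimates use about one bad piece \<open>\<psi>\<close> and its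
  compensation \<open>\<phi>\<close>. The package is independent of how the pieces are estimated,
  since they are fed to an L^q bound in one place and to the Hardy space in another.
  \<open>q\<close> majorises the mass, and the integral of \<open>dl\<close> controls the
  coefficient \<delta> between the two radii.\<close>

definition CZ_block where
 "CZ_block u j r R Q A q \<psi> \<phi> \<longleftrightarrow> 0 < r \<and> \<alpha> * r <= R \<and> Q \<subseteq> ball j (\<alpha> * r) \<and>
   A \<in> sets M \<and> A \<subseteq> ball j R \<and> 0 < measure M A \<and>
   mb j (\<alpha> ^ 3 * R) <= \<beta> * mb j R \<and> mb j R <= 2 * measure M A \<and>
   (\<integral>y. dl j y * ind (ball j (\<alpha> * R) - ball j (\<alpha> * r)) y) <= ennreal (4 * Cl ^ a) \<and>
   0 <= q \<and> nice M N1 \<psi> \<and> nice M N1 \<phi> \<and> (\<forall>x. nrm N1 \<psi> x <= ind Q x * nrm N1 u x) \<and>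
   (I1 \<psi>) <= ennreal q \<and> (\<forall>x. nrm N1 \<phi> x <= ennreal (q / measure M A) * ind A x) \<and>
   (AE b in N1. (LINT y|M. \<psi> (y, b) + \<phi> (y, b)) = 0)"

lemma CZ_blockD:
 assumes "CZ_block u j r R Q A q \<psi> \<phi>"
 shows "0 < r" "\<alpha> * r <= R" "Q \<subseteq> ball j (\<alpha> * r)" "A \<in> sets M" "A \<subseteq> ball j R" "0 < measure M A"
  "mb j (\<alpha> ^ 3 * R) <= \<beta> * mb j R" "mb j R <= 2 * measure M A"
  "(\<integral>y. dl j y * ind (ball j (\<alpha> * R) - ball j (\<alpha> * r)) y) <= ennreal (4 * Cl ^ a)"
  "0 <= q" "nice M N1 \<psi>" "nice M N1 \<phi>" "\<forall>x. nrm N1 \<psi> x <= ind Q x * nrm N1 u x" "I1 \<psi> <= ennreal q"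
  "\<forall>x. nrm N1 \<phi> x <= ennreal (q / measure M A) * ind A x" "AE b in N1. (LINT y|M. \<psi> (y, b) + \<phi> (y, b)) = 0"
 using assms by (simp_all only: CZ_block_def simp_thms)

text \<open>The average \<open>w j\<close> of the bad part over \<open>Q j\<close> is put on \<open>A j\<close>, which makes \<open>\<psi> j + \<phi> j\<close>
 a function with vanishing integral.\<close>

lemma CZ_nice:
 assumes u: "nice M N1 u" and h: "h > 0" and eps: "\<epsilon> > 0"
  and large: "ennreal (\<beta> / h) * I1 u < emeasure M (space M)"
 obtains J :: "'a set" and r R Q A q \<psi> \<phi> g e
 where "finite J" and "\<And>j. j \<in> J ==> CZ_block u j (r j) (R j) (Q j) (A j) (q j) (\<psi> j) (\<phi> j)"
  and "(\<Sum>j\<in>J. mb j (\<alpha>\<^sup>2 * r j)) <= \<beta> / h * (enn2real (I1 u) + \<epsilon>)"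
  and "(\<Sum>j\<in>J. q j) <= enn2real (I1 u) + \<epsilon>"
  and "\<And>p. u p = g p + e p + (\<Sum>j\<in>J. \<psi> j p + \<phi> j p)" and "nice M N1 g" and "nice M N1 e"
  and "\<And>x. nrm N1 g x <= ennreal (5 * h)" and "I1 g <= ennreal (2 * (enn2real (I1 u) + \<epsilon>))"
  and "\<exists>E. E \<in> sets M \<and> emeasure M E < ennreal \<epsilon> \<and> (\<forall>x. nrm N1 e x = ind E x * nrm N1 u x)"
proof -
 have [measurable]: "u \<in> borel_measurable W1" using u unfolding nice_def by auto
 obtain m where m: "\<And>x. nrm N1 u x <= ennreal m" using u unfolding nice_def by blast
 obtain z0 R0 where B: "{x. nrm N1 u x \<noteq> 0} \<subseteq> ball z0 R0"
  using u unfolding nice_def by (metis bounded_subset_ballD)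
 define F0 where "F0 x = enn2real (nrm N1 u x)" for x
 have F0: "nrm N1 u x = ennreal (F0 x)" for x
  unfolding F0_def using m[of x] by (intro ennreal_enn2real[symmetric]) (auto simp: less_top[symmetric] top_unique)
 have F0m [measurable]: "F0 \<in> borel_measurable M" unfolding F0_def by measurable
 define I where "I = enn2real (I1 u)"
 have fin: "I1 u = ennreal I" unfolding I_def using nice_integrable1[OF u] by simp
 have I0: "I >= 0" unfolding I_def by simp
 have LI: "(LINT x|M. F0 x) = I" unfolding I_def F0
  by (subst integral_eq_nn_integral) (auto simp: F0_def)
 have "\<exists>r. \<beta> * I < h * mb z0 r"
 proof (rule ccontr)
  assume "\<not> ?thesis"
  then have n: "\<And>r. h * mb z0 r <= \<beta> * I" by (simp add: not_less)
  have "emeasure M (ball z0 (real n)) <= ennreal (\<beta> / h * I)" for n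
   unfolding emeasure_ball using n[of "real n"] h by (intro ennreal_leI) (simp add: field_simps)
  moreover have "(SUP n. emeasure M (ball z0 (real n))) = emeasure M (\<Union>n. ball z0 (real n))"
   by (intro SUP_emeasure_incseq) (auto simp: incseq_def)
  moreover have "(\<Union>n. ball z0 (real n)) = space M" using reals_Archimedean2 by auto
  ultimately have "emeasure M (space M) <= ennreal (\<beta> / h * I)" by (metis SUP_least)
  then show False using large I0 h beta_ge unfolding fin by (simp add: ennreal_mult[symmetric])
 qed
 then obtain r0 where r0: "\<beta> * (LINT x|M. F0 x) < h * mb z0 r0" unfolding LI by blast
 have bd0: "F0 x <= \<bar>m\<bar>" for x unfolding F0_def using m[of x]
  by (intro enn2real_leI) (auto intro: order_trans[OF _ ennreal_leI])
 have sp0: "F0 x = 0" if "x \<notin> ball z0 R0" for x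
 proof -
  have "nrm N1 u x = 0" using B that by blast
  then show ?thesis unfolding F0_def by simp
 qed
 have nn0: "F0 x >= 0" for x unfolding F0_def by simp
 obtain F J r R Q A where CZ: "F \<in> borel_measurable M \<and> (\<forall>x. F0 x <= F x) \<and> integrable M F \<and>
   (LINT x|M. F x) <= (LINT x|M. F0 x) + \<epsilon> \<and> finite J \<and>
   (\<forall>j\<in>J. 0 < r j \<and> \<alpha> * r j <= R j \<and> Q j \<in> sets M \<and> Q j \<subseteq> ball j (\<alpha> * r j) \<and>
    A j \<in> sets M \<and> A j \<subseteq> ball j (R j) \<and> 0 < mb j (R j) \<and> mb j (\<alpha> ^ 3 * R j) <= \<beta> * mb j (R j) \<and>
    mb j (R j) <= 2 * measure M (A j) \<and>
    (\<integral>y. dl j y * ind (ball j (\<alpha> * R j) - ball j (\<alpha> * r j)) y) <= ennreal (4 * Cl ^ a)) \<and>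
   disjoint_family_on Q J \<and> (\<Sum>j\<in>J. mb j (\<alpha>\<^sup>2 * r j)) <= \<beta> / h * (LINT x|M. F x) \<and>
   (\<forall>y. (\<Sum>j\<in>J. (LINT x|M. ind (Q j) x * F x) / measure M (A j) * ind (A j) y) <= 4 * h) \<and>
   emeasure M {x \<in> space M. h < F0 x \<and> x \<notin> (\<Union>j\<in>J. Q j)} < ennreal \<epsilon>"
  by (atomize_elim, rule CZ_decomposition[OF F0m nn0 bd0 _ h eps r0]) (rule sp0)
 note c1 = CZ[THEN conjunct1] and d1 = CZ[THEN conjunct2]
 note c2 = d1[THEN conjunct1] and d2 = d1[THEN conjunct2]
 note c3 = d2[THEN conjunct1] and d3 = d2[THEN conjunct2]
 note c4 = d3[THEN conjunct1] and d4 = d3[THEN conjunct2]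
 note c5 = d4[THEN conjunct1] and d5 = d4[THEN conjunct2]
 note c6 = d5[THEN conjunct1] and d6 = d5[THEN conjunct2]
 note c7 = d6[THEN conjunct1] and d7 = d6[THEN conjunct2]
 note c8 = d7[THEN conjunct1] and d8 = d7[THEN conjunct2]
 note c9 = d8[THEN conjunct1] and d9 = d8[THEN conjunct2]
 note F = c1 c2[rule_format] c3 c4[unfolded LI] and fJ = c5 and J = c6[rule_format] and disj = c7
  and sumB = c8 and over = c9[rule_format] and E = d9
 have Fnn: "F x >= 0" for x using F(2)[of x] unfolding F0_def by (meson enn2real_nonneg order_trans)
 have [measurable]: "Q j \<in> sets M" "A j \<in> sets M" if "j \<in> J" for j using J[OF that] by auto
 have mA: "measure M (A j) > 0" if "j \<in> J" for j using J[OF that] by linarith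
 \<comment> \<open>The mass is that of \<open>F\<close>, not of \<open>u\<close>: the overlap
   estimate of the decomposition is stated for \<open>F\<close>, which dominates the norm of
   \<open>u\<close>.\<close>
 define q where "q j = (LINT x|M. ind (Q j) x * F x)" for j
 have q0: "q j >= 0" for j unfolding q_def using Fnn by (intro integral_nonneg_AE) auto
 have sumq: "(\<Sum>j\<in>J. q j) <= I + \<epsilon>"
 proof -
  have "(\<Sum>j\<in>J. q j) <= (LINT x|M. ind UNIV x * F x)"
   unfolding q_def by (rule sum_integrals_disjoint[OF F(3) Fnn fJ disj]) (use J in auto)
  then show ?thesis using F(4) by simp
 qed
 define \<psi> where "\<psi> j p = ind (Q j) (fst p) * u p" for j and p :: "'a \<times> 'b"
 have \<psi>: "nice M N1 (\<psi> j)" "\<And>x. nrm N1 (\<psi> j) x = ind (Q j) x * nrm N1 u x" if "j \<in> J" for j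
  unfolding \<psi>_def using nice_indicator[OF u, of "Q j"] J[OF that] by auto
 have \<psi>int: "I1 (\<psi> j) <= ennreal (q j)" if j: "j \<in> J" for j
 proof -
  have i: "integrable M (\<lambda>x. ind (Q j) x * F x)"
   using integrable_mult_indicator[OF _ F(3), of "Q j"] J[OF j] by simp
  have "I1 (\<psi> j) <= (\<integral>y. ennreal (ind (Q j) y * F y))"
   using F(2) by (intro nn_integral_mono) (auto simp: \<psi>(2)[OF j] F0 indicator_def intro: ennreal_leI)
  also have "... = ennreal (q j)" unfolding q_def by (rule nn_integral_eq_integral[OF i]) (simp add: Fnn)
  finally show ?thesis .
 qed
 define w where "w j b = (LINT y|M. \<psi> j (y, b))" for j b
 have w: "w j \<in> borel_measurable N1" "l2 N1 (\<lambda>b. ecmod (w j b)) <= ennreal (q j)" if j: "j \<in> J" for j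
  using l2_integral_le(1,3)[OF \<psi>(1)[OF j]] \<psi>int[OF j] unfolding w_def by (auto intro: order_trans)
 have bA: "bounded (A j)" if "j \<in> J" for j using J[OF that] bounded_ball bounded_subset by blast
 have As: "A j \<in> sets M" if "j \<in> J" for j using J[OF that] by blast
 \<comment> \<open>With sign \<open>- 1\<close> this makes the block integrate to zero; with sign
   \<open>1\<close> the same function goes into the good part, so the two cancel in the sum.\<close>
 define \<theta> where "\<theta> t j p = of_real (t / measure M (A j) * ind (A j) (fst p)) * w j (snd p)" for t j and p :: "'a \<times> 'b"
 have \<theta>n: "nice M N1 (\<theta> t j)" if "j \<in> J" for t j
  unfolding \<theta>_def by (rule nice_tensor(1)[OF w(1)[OF that] As[OF that] bA[OF that] w(2)[OF that]])
 have \<theta>le: "nrm N1 (\<theta> t j) x <= ennreal (q j / measure M (A j)) * ind (A j) x" if j: "j \<in> J" and t: "\<bar>t\<bar> = 1" for t j x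
 proof -
  have "nrm N1 (\<theta> t j) x = ennreal \<bar>t / measure M (A j)\<bar> * ind (A j) x * l2 N1 (\<lambda>b. ecmod (w j b))"
   unfolding \<theta>_def by (rule nice_tensor(2)[OF w(1)[OF j] As[OF j] bA[OF j] w(2)[OF j]])
  also have "... <= ennreal (1 / measure M (A j)) * ind (A j) x * ennreal (q j)"
   using t w(2)[OF j] by (intro mult_mono) (auto simp: abs_divide)
  also have "... = ennreal (q j / measure M (A j)) * ind (A j) x"
   using q0 mA[OF j] by (auto simp: indicator_def simp flip: ennreal_mult)
  finally show ?thesis .
 qed
 \<comment> \<open>Off the sets \<open>Q j\<close> the function is either below \<open>h\<close>, on
   \<open>D\<close>, or on the remainder \<open>E'\<close> of measure below
   \<open>\<epsilon>\<close>.\<close>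
 define D where "D = {x \<in> space M. F0 x <= h} - (\<Union>j\<in>J. Q j)"
 define E' where "E' = {x \<in> space M. h < F0 x \<and> x \<notin> (\<Union>j\<in>J. Q j)}"
 have UQ: "(\<Union>j\<in>J. Q j) \<in> sets M" using fJ J by (intro sets.finite_UN) auto
 have Ds [measurable]: "D \<in> sets M" 
 proof -
  have "{x \<in> space M. F0 x <= h} \<in> sets M" by measurable
  then show ?thesis unfolding D_def by (rule sets.Diff[OF _ UQ])
 qed
 have Es [measurable]: "E' \<in> sets M"
 proof -
  have "E' = {x \<in> space M. h < F0 x} - (\<Union>j\<in>J. Q j)" unfolding E'_def by auto
  moreover have "{x \<in> space M. h < F0 x} \<in> sets M" by measurable
  ultimately show ?thesis using sets.Diff[OF _ UQ] by (simp only:)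
 qed
 define g where "g p = ind D (fst p) * u p + (\<Sum>j\<in>J. \<theta> 1 j p)" for p
 define e where "e p = ind E' (fst p) * u p" for p
 have gD: "nice M N1 (\<lambda>p. ind D (fst p) * u p)" by (rule nice_indicator(1)[OF u Ds])
 have gS: "nice M N1 (\<lambda>p. \<Sum>j\<in>J. \<theta> 1 j p)" using \<theta>n by (intro nice_sum fJ) auto
 have g: "nice M N1 g" unfolding g_def using gD gS by (rule nice_add)
 have gle: "nrm N1 g x <= ind D x * nrm N1 u x + (\<Sum>j\<in>J. ennreal (q j / measure M (A j)) * ind (A j) x)" for x
 proof -
  have "nrm N1 g x <= nrm N1 (\<lambda>p. ind D (fst p) * u p) x + nrm N1 (\<lambda>p. \<Sum>j\<in>J. \<theta> 1 j p) x"
   unfolding g_def using gD gS by (intro nrm_add) (auto simp: nice_def)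
  also have "... <= ind D x * nrm N1 u x + (\<Sum>j\<in>J. nrm N1 (\<theta> 1 j) x)"
   using \<theta>n nice_indicator(2)[OF u Ds] by (intro add_mono nrm_sum fJ) (auto simp: nice_def)
  also have "... <= ind D x * nrm N1 u x + (\<Sum>j\<in>J. ennreal (q j / measure M (A j)) * ind (A j) x)"
   by (intro add_left_mono sum_mono \<theta>le) auto
  finally show ?thesis .
 qed
 show thesis
 proof (rule that[of J r R Q A q \<psi> "\<theta> (-1)" g e])
  show "finite J" by (rule fJ)
  fix j assume j: "j \<in> J"
  have "AE b in N1. (LINT y|M. \<psi> j (y, b) + \<theta> (-1) j (y, b)) = 0"
   using l2_integral_le(2)[OF \<psi>(1)[OF j]]
  proof eventually_elim
   fix b assume i: "integrable M (\<lambda>y. \<psi> j (y, b))"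
   have fA: "emeasure M (A j) < \<infinity>" using bounded_finite[of "A j" j "R j"] J[OF j] by simp
   have ind: "integrable M (\<lambda>y. complex_of_real (ind (A j) y))"
    using fA j by (intro integrable_of_real integrable_real_indicator) auto
   have eq: "(\<lambda>y. \<theta> (-1) j (y, b)) = (\<lambda>y. complex_of_real (ind (A j) y) * (of_real (- 1 / measure M (A j)) * w j b))"
    unfolding \<theta>_def by (auto simp: fun_eq_iff)
   have i2: "integrable M (\<lambda>y. \<theta> (-1) j (y, b))" unfolding eq by (rule integrable_mult_left) (use ind in simp)
   have "(LINT y|M. \<psi> j (y, b) + \<theta> (-1) j (y, b)) = w j b + (LINT y|M. \<theta> (-1) j (y, b))"
    unfolding w_def using i i2 by (rule Bochner_Integration.integral_add)
   also have "(LINT y|M. \<theta> (-1) j (y, b)) = complex_of_real (measure M (A j)) * (of_real (- 1 / measure M (A j)) * w j b)"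
    unfolding eq using As[OF j] by simp
   also have "... = - w j b" using mA[OF j] by simp
   finally show "(LINT y|M. \<psi> j (y, b) + \<theta> (-1) j (y, b)) = 0" by simp
  qed
  then show "CZ_block u j (r j) (R j) (Q j) (A j) (q j) (\<psi> j) (\<theta> (-1) j)"
   unfolding CZ_block_def using J[OF j] mA[OF j]
   by (intro conjI allI q0 \<psi>(1)[OF j] eq_refl[OF \<psi>(2)[OF j]] \<psi>int[OF j] \<theta>n[OF j] \<theta>le[OF j]) (elim conjE; simp)+
 next
  have "\<beta> / h * (LINT x|M. F x) <= \<beta> / h * (I + \<epsilon>)" using F(4) h beta_ge by (intro mult_left_mono) auto
  then show "(\<Sum>j\<in>J. mb j (\<alpha>\<^sup>2 * r j)) <= \<beta> / h * (enn2real (I1 u) + \<epsilon>)" using sumB unfolding I_def by linarith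
  show "(\<Sum>j\<in>J. q j) <= enn2real (I1 u) + \<epsilon>" using sumq unfolding I_def .
  show "nice M N1 g" by (rule g)
  show "nice M N1 e" unfolding e_def by (rule nice_indicator(1)[OF u Es])
  show "\<exists>E. E \<in> sets M \<and> emeasure M E < ennreal \<epsilon> \<and> (\<forall>x. nrm N1 e x = ind E x * nrm N1 u x)"
   unfolding e_def using nice_indicator(2)[OF u Es] E[folded E'_def] Es by (intro exI[of _ E'] conjI allI)
  show "nrm N1 g x <= ennreal (5 * h)" for x
  proof -
   have "(\<Sum>j\<in>J. ennreal (q j / measure M (A j)) * ind (A j) x) = ennreal (\<Sum>j\<in>J. q j / measure M (A j) * ind (A j) x)"
   proof -
    have "(\<Sum>j\<in>J. ennreal (q j / measure M (A j)) * ind (A j) x) = (\<Sum>j\<in>J. ennreal (q j / measure M (A j) * ind (A j) x))"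
     by (intro sum.cong refl) (simp add: indicator_def)
    also have "... = ennreal (\<Sum>j\<in>J. q j / measure M (A j) * ind (A j) x)"
     using q0 by (intro sum_ennreal) simp
    finally show ?thesis .
   qed
   also have "... <= ennreal (4 * h)" using over[of x] unfolding q_def by (rule ennreal_leI)
   finally have 2: "(\<Sum>j\<in>J. ennreal (q j / measure M (A j)) * ind (A j) x) <= ennreal (4 * h)" .
   have 1: "ind D x * nrm N1 u x <= ennreal h"
    unfolding F0 by (cases "x \<in> D") (simp_all add: D_def ennreal_leI)
   have "nrm N1 g x <= ennreal h + ennreal (4 * h)" by (rule order_trans[OF gle add_mono[OF 1 2]])
   then show ?thesis using h by (simp flip: ennreal_plus)
  qed
  have "I1 g <= (\<integral>x. ind D x * nrm N1 u x + (\<Sum>j\<in>J. ennreal (q j / measure M (A j)) * ind (A j) x))"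
   by (intro nn_integral_mono gle)
  also have "... = (\<integral>x. ind D x * nrm N1 u x) + (\<integral>x. (\<Sum>j\<in>J. ennreal (q j / measure M (A j)) * ind (A j) x))"
   by (rule nn_integral_add) measurable
  also have "(\<integral>x. (\<Sum>j\<in>J. ennreal (q j / measure M (A j)) * ind (A j) x)) = (\<Sum>j\<in>J. \<integral>x. ennreal (q j / measure M (A j)) * ind (A j) x)"
   by (rule nn_integral_sum) measurable
  also have "... = (\<Sum>j\<in>J. ennreal (q j))"
  proof (rule sum.cong[OF refl])
   fix j assume j: "j \<in> J"
   have fA: "emeasure M (A j) = ennreal (measure M (A j))"
    using bounded_finite[of "A j" j "R j"] J[OF j] by (intro emeasure_eq_ennreal_measure) auto
   have "(\<integral>x. ennreal (q j / measure M (A j)) * ind (A j) x) = ennreal (q j / measure M (A j)) * emeasure M (A j)"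
    using J[OF j] by (intro nn_integral_cmult_indicator) auto
   also have "... = ennreal (q j)" unfolding fA using q0[of j] mA[OF j] by (simp flip: ennreal_mult)
   finally show "(\<integral>x. ennreal (q j / measure M (A j)) * ind (A j) x) = ennreal (q j)" .
  qed
  also have "... = ennreal (\<Sum>j\<in>J. q j)" using q0 by (intro sum_ennreal) auto
  also have "(\<integral>x. ind D x * nrm N1 u x) <= I1 u"
   by (intro nn_integral_mono) (auto simp: indicator_def)
  also have "I1 u + ennreal (\<Sum>j\<in>J. q j) <= ennreal (I + \<epsilon>) + ennreal (I + \<epsilon>)"
   unfolding fin using sumq eps by (intro add_mono ennreal_leI) auto
  finally show "I1 g <= ennreal (2 * (enn2real (I1 u) + \<epsilon>))"
   using I0 eps unfolding I_def[symmetric] by (simp add: add_right_mono flip: ennreal_plus)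
  fix p :: "'a \<times> 'b"
  have "(\<Sum>j\<in>J. \<theta> 1 j p + \<theta> (-1) j p) = 0" unfolding \<theta>_def by (intro sum.neutral) simp
  then have 1: "(\<Sum>j\<in>J. \<theta> 1 j p) + (\<Sum>j\<in>J. \<theta> (-1) j p) = 0" by (simp add: sum.distrib)
  have "ind D (fst p) + ind E' (fst p) + (\<Sum>j\<in>J. ind (Q j) (fst p)) = (1 :: complex)"
  proof -
   have "(\<Sum>j\<in>J. ind (Q j) (fst p)) = (ind (\<Union>j\<in>J. Q j) (fst p) :: complex)"
    using fJ disj by (rule indicator_UN_disjoint[symmetric])
   then show ?thesis unfolding D_def E'_def by (auto simp: indicator_def)
  qed
  then have "u p = (ind D (fst p) + ind E' (fst p) + (\<Sum>j\<in>J. ind (Q j) (fst p))) * u p" by simp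
  also have "... = ind D (fst p) * u p + e p + (\<Sum>j\<in>J. \<psi> j p)"
   unfolding \<psi>_def e_def by (simp add: distrib_right sum_distrib_right)
  also have "... = g p + e p + ((\<Sum>j\<in>J. \<psi> j p) + (\<Sum>j\<in>J. \<theta> (-1) j p))"
   unfolding g_def using 1 by (simp add: algebra_simps add_eq_0_iff)
  also have "... = g p + e p + (\<Sum>j\<in>J. \<psi> j p + \<theta> (-1) j p)" by (simp add: sum.distrib)
  finally show "u p = g p + e p + (\<Sum>j\<in>J. \<psi> j p + \<theta> (-1) j p)" .
 qed
qed

end

section \<open>Weak type estimates and duality\<close>

text \<open>\<open>lam c\<close> is monotone on positive radii only; taking the maximum with
  \<open>\<rho>\<close> gives a globally monotone, hence Borel, function that agrees with it on the
  annulus.\<close>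

lemma (in cz_space) measurable_lam_annulus [measurable]:
 assumes "\<rho> > 0"
 shows "(\<lambda>y. dl c y * ind (ball c \<rho>' - ball c \<rho>) y) \<in> borel_measurable M"
proof -
 have "mono (\<lambda>t. lam c (max t \<rho>))" using assms by (intro monoI lam_mono) auto
 then have [measurable]: "(\<lambda>t. lam c (max t \<rho>)) \<in> borel_measurable borel" by (rule borel_measurable_mono)
 have "(\<lambda>y. ennreal (1 / lam c (max (dist c y) \<rho>)) * ind (ball c \<rho>' - ball c \<rho>) y) \<in> borel_measurable M"
  by measurable
 also have "(\<lambda>y. ennreal (1 / lam c (max (dist c y) \<rho>)) * ind (ball c \<rho>' - ball c \<rho>) y) =
   (\<lambda>y. dl c y * ind (ball c \<rho>' - ball c \<rho>) y)"
  by (auto simp: fun_eq_iff indicator_def max_def)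
 finally show ?thesis .
qed

context cz_kernel begin

text \<open>Beyond \<open>2 * R\<close> the cancellation of the block is used, with L^1 norm at most
  \<open>2 * t\<close>. Closer in, \<open>\<psi>\<close> is estimated by the size of the kernel,
  whose integral over the annuli is the bounded \<delta>. There \<open>\<phi>\<close> is estimated
  by the L^q bound and Hoelder, which is efficient because the doubling of \<open>R\<close> makes
  the measure of \<open>ball j (\<alpha> * R)\<close> comparable to that of
  \<open>B\<close>.\<close>

lemma S_block:
 assumes bnd: "bdd q A" and q: "q > 1" and A: "A >= 0"
  and blk: "CZ_block u j r R Q B t \<psi> \<phi>"
 shows "(\<integral>x. S (\<lambda>p. \<psi> p + \<phi> p) x * ind (- ball j (\<alpha>\<^sup>2 * r)) x) <=
   ennreal ((2 * Ck + 4 * Ck * Cl ^ (a + 2) + 2 * \<beta> * A) * t)"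
proof -
 let ?N = "\<integral>x. ennpowr (nrm N1 \<phi> x) q"
 let ?B = "measure M B" and ?ann' = "ball j (\<alpha> * R) - ball j (\<alpha> * r)"
 note D = CZ_blockD[OF blk]
 note r = D(1,2) and Q = D(3) and B = D(4-6) and dbl = D(7,8) and delta = D(9) and t = D(10) and \<phi> = D(12) D(15)[rule_format] and canc = D(16)
 have "nrm N1 \<psi> x = 0" if "x \<notin> Q" for x using spec[OF D(13), of x] that by simp
 note \<psi> = D(11) this D(14)
 have \<psi>m [measurable]: "\<psi> \<in> borel_measurable W1" and \<phi>m [measurable]: "\<phi> \<in> borel_measurable W1"
  using \<psi> \<phi> unfolding nice_def by auto
 note [measurable] = B(1)
 have R: "R > 0" using r alpha_pos(1) by (meson less_le_trans mult_pos_pos)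
 have fB: "emeasure M B = ennreal ?B"
  using bounded_finite[OF B(2)] by (intro emeasure_eq_ennreal_measure) auto
 have \<phi>int: "I1 \<phi> <= ennreal t"
 proof -
  have "I1 \<phi> <= (\<integral>y. ennreal (t / ?B) * ind B y)"
   by (intro nn_integral_mono \<phi>(2))
  also have "... = ennreal (t / ?B) * ennreal ?B"
   unfolding fB[symmetric] by (rule nn_integral_cmult_indicator) measurable
  also have "... = ennreal t" using B t by (simp flip: ennreal_mult)
  finally show ?thesis .
 qed
 let ?b = "\<lambda>p. \<psi> p + \<phi> p"
 let ?f = "\<lambda>x. S ?b x * ind (- ball j (2 * R)) x" and ?l = "\<lambda>x. S \<phi> x * ind (ball j (\<alpha> * R)) x"
 have bn: "nice M N1 ?b" using \<psi>(1) \<phi>(1) by (rule nice_add)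
 have bint: "(I1 ?b) <= ennreal (2 * t)"
 proof -
  have "(I1 ?b) <= (\<integral>y. nrm N1 \<psi> y + nrm N1 \<phi> y)"
   by (intro nn_integral_mono nrm_add) auto
  also have "... = I1 \<psi> + I1 \<phi>" by (rule nn_integral_add) measurable
  also have "... <= ennreal t + ennreal t" using \<psi>(3) \<phi>int by (rule add_mono)
  finally show ?thesis using t by (simp flip: ennreal_plus)
 qed
 have "nrm N1 ?b y = 0" if "y \<notin> ball j R" for y
 proof -
  have "y \<notin> Q" "y \<notin> B" using that Q B(2) r(2) subset_ball[of "\<alpha> * r" R j] by auto
  then have "nrm N1 \<psi> y = 0" "nrm N1 \<phi> y = 0" using \<psi>(2) \<phi>(2)[of y] by auto
  then show ?thesis using nrm_add[OF \<psi>m \<phi>m, of y] by simp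
 qed
 then have "(\<integral>x. ?f x) <= ennreal Ck * (I1 ?b)"
  using nice_integrable1[OF bn] canc by (intro S_far R) auto
 also have "... <= ennreal Ck * ennreal (2 * t)" using bint by (rule mult_left_mono) simp
 finally have far: "(\<integral>x. ?f x) <= ennreal (2 * Ck * t)"
  using Ck t by (simp add: mult_ac flip: ennreal_mult)
 let ?ann = "ball j (\<alpha> * R) - ball j (\<alpha> * (\<alpha> * r))"
 have near: "(\<integral>x. S \<psi> x * ind ?ann x) <= ennreal (4 * Ck * Cl ^ (a + 2) * t)"
 proof -
  have ar: "\<alpha> * r > 0" using r by simp
  have "(\<integral>x. S \<psi> x * ind ?ann x) <=
   (\<integral>x. ennreal (Ck * Cl\<^sup>2 * t) * (dl j x * ind ?ann' x))"
  proof (intro nn_integral_mono)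
   fix x
   show "S \<psi> x * ind ?ann x <= ennreal (Ck * Cl\<^sup>2 * t) * (dl j x * ind ?ann' x)"
   proof (cases "x \<in> ?ann")
    case True
    then have d: "\<alpha> * (\<alpha> * r) <= dist j x" by auto
    have "1 * (\<alpha> * r) <= \<alpha> * (\<alpha> * r)" using ar alpha_pos(3) by (intro mult_right_mono) auto
    then have d': "\<alpha> * r <= dist j x" using d by linarith
    then have x: "x \<in> ?ann'" using True by simp
    have dpos: "dist j x > 0" using d' ar by linarith
    have "S \<psi> x <= ennreal (Ck * Cl ^ (1 + 1) / lam j (dist j x)) * I1 \<psi>"
    proof (rule S_near[OF \<psi>m _ ar _ _ d])
     show "AE y in M. y \<notin> ball j (\<alpha> * r) \<longrightarrow> nrm N1 \<psi> y = 0" using \<psi>(2) Q by (intro AE_I2) blast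
     show "1 < \<alpha>" "\<alpha> <= 2 ^ 1 * (\<alpha> - 1)" using alpha_ge_8 by auto
    qed
    also have "... <= ennreal (Ck * Cl ^ (1 + 1) / lam j (dist j x)) * ennreal t" using \<psi>(3) by (rule mult_left_mono) simp
    also have "... = ennreal (Ck * Cl\<^sup>2 * t) * dl j x"
     using Ck t lam_pos[OF dpos, of j] Cl_pos by (simp add: power2_eq_square flip: ennreal_mult)
    finally show ?thesis using x True by simp
   qed simp
  qed
  also have "... = ennreal (Ck * Cl\<^sup>2 * t) * (\<integral>x. dl j x * ind ?ann' x)"
   using ar by (intro nn_integral_cmult measurable_lam_annulus)
  also have "... <= ennreal (Ck * Cl\<^sup>2 * t) * ennreal (4 * Cl ^ a)" using delta by (rule mult_left_mono) simp
  also have "... = ennreal (4 * Ck * Cl ^ (a + 2) * t)"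
   using Ck t Cl_pos by (simp add: power_add power2_eq_square mult_ac flip: ennreal_mult)
  finally show ?thesis .
 qed
 have loc: "(\<integral>x. ?l x) <= ennreal (2 * \<beta> * A * t)"
 proof -
  have "?N <= (\<integral>x. ennpowr (ennreal (t / ?B)) q * ind B x)"
  proof (intro nn_integral_mono)
   fix x
   have "ennpowr (nrm N1 \<phi> x) q <= ennpowr (ennreal (t / ?B) * ind B x) q"
    using \<phi>(2)[of x] q by (intro ennpowr_mono) auto
   also have "... = ennpowr (ennreal (t / ?B)) q * ind B x"
    using q by (cases "x \<in> B") auto
   finally show "ennpowr (nrm N1 \<phi> x) q <= ennpowr (ennreal (t / ?B)) q * ind B x" .
  qed
  also have "... = ennpowr (ennreal (t / ?B)) q * ennreal ?B"
   unfolding fB[symmetric] by (rule nn_integral_cmult_indicator) measurable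
  finally have "ennpowr ?N (1 / q) <= ennpowr (ennpowr (ennreal (t / ?B)) q * ennreal ?B) (1 / q)"
   using q by (intro ennpowr_mono) auto
  also have "... = ennreal (t / ?B * ?B powr (1 / q))"
   using q t by (simp add: ennpowr_mult ennpowr_inverse) (simp add: ennpowr_ennreal flip: ennreal_mult)
  finally have 1: "ennpowr ?N (1 / q) <= ennreal (t / ?B * ?B powr (1 / q))" .
  have "\<alpha> * R <= \<alpha> ^ 3 * R" using R alpha_pos(3) power_increasing[of 1 3 \<alpha>] by (intro mult_right_mono) auto
  then have "mb j (\<alpha> * R) <= mb j (\<alpha> ^ 3 * R)" by (rule mb_le)
  also have "... <= \<beta> * (2 * ?B)" using dbl beta_ge(4) mult_left_mono[OF dbl(2), of \<beta>] by linarith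
  finally have mbR: "mb j (\<alpha> * R) <= 2 * \<beta> * ?B" by simp
  have 2: "ennpowr (emeasure M (ball j (\<alpha> * R))) (1 - 1 / q) <= ennreal ((2 * \<beta> * ?B) powr (1 - 1 / q))"
   unfolding emeasure_ball using mbR q by (subst ennpowr_ennreal) (auto intro!: ennreal_leI powr_mono2)
  have "(\<integral>x. ?l x) <=
    ennreal A * ennpowr ?N (1 / q) * ennpowr (emeasure M (ball j (\<alpha> * R))) (1 - 1 / q)"
   by (rule local_bound[OF bnd q A \<phi>(1)]) measurable
  also have "... <= ennreal A * ennreal (t / ?B * ?B powr (1 / q)) * ennreal ((2 * \<beta> * ?B) powr (1 - 1 / q))"
   using 1 2 by (intro mult_mono) auto
  also have "... = ennreal (A * t * (2 * \<beta>) powr (1 - 1 / q))"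
  proof -
   have "A * (t / ?B * ?B powr (1 / q)) * (2 * \<beta> * ?B) powr (1 - 1 / q) =
    A * t * (2 * \<beta>) powr (1 - 1 / q) * (?B powr (1 / q) * ?B powr (1 - 1 / q) / ?B)"
    using beta_ge B(3) by (simp add: powr_mult)
   also have "?B powr (1 / q) * ?B powr (1 - 1 / q) = ?B"
    using B(3) by (simp flip: powr_add)
   finally show ?thesis using B(3) A t by (simp flip: ennreal_mult)
  qed
  also have "... <= ennreal (2 * \<beta> * A * t)"
  proof (rule ennreal_leI)
   have "(2 * \<beta>) powr (1 - 1 / q) <= (2 * \<beta>) powr 1" using beta_ge q by (intro powr_mono) auto
   then have "A * t * (2 * \<beta>) powr (1 - 1 / q) <= A * t * (2 * \<beta>)" using beta_ge A t by (intro mult_left_mono) auto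
   then show "A * t * (2 * \<beta>) powr (1 - 1 / q) <= 2 * \<beta> * A * t" by (simp add: mult_ac)
  qed
  finally show ?thesis .
 qed
 have "AE x in M. S ?b x * ind (- ball j (\<alpha>\<^sup>2 * r)) x <=
  ?f x + (S \<psi> x * ind ?ann x + ?l x)"
  using nice_AE_fin[OF \<psi>(1)] nice_AE_fin[OF \<phi>(1)]
 proof eventually_elim
  fix x assume f: "fin_at \<psi> x" "fin_at \<phi> x"
  show "S ?b x * ind (- ball j (\<alpha>\<^sup>2 * r)) x <=
   ?f x + (S \<psi> x * ind ?ann x + ?l x)"
  proof (cases "x \<in> ball j (\<alpha> * R) \<and> x \<notin> ball j (\<alpha>\<^sup>2 * r)")
   case True
   then have "S ?b x <= S \<psi> x + S \<phi> x" using f by (intro S_add) auto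
   then show ?thesis using True by (auto simp: power2_eq_square mult.assoc add_increasing)
  next
   case False
   have "2 * R <= \<alpha> * R" using alpha_ge_8 R by (intro mult_right_mono) auto
   then have "ball j (2 * R) \<subseteq> ball j (\<alpha> * R)" by (rule subset_ball)
   then show ?thesis using False by (auto simp: indicator_def)
  qed
 qed
 then have "(\<integral>x. S ?b x * ind (- ball j (\<alpha>\<^sup>2 * r)) x) <=
  (\<integral>x. ?f x + (S \<psi> x * ind ?ann x + ?l x))"
  by (rule nn_integral_mono_AE)
 also have "... = (\<integral>x. ?f x) +
   ((\<integral>x. S \<psi> x * ind ?ann x) + (\<integral>x. ?l x))"
 proof -
  have [measurable]: "- ball j (2 * R) \<in> sets M" by (simp add: sets_M)
  have [measurable]: "(\<lambda>x. S ?b x) \<in> borel_measurable M" "(\<lambda>x. S \<psi> x) \<in> borel_measurable M" "(\<lambda>x. S \<phi> x) \<in> borel_measurable M"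
   by (intro measurable_S borel_measurable_add \<psi>m \<phi>m)+
  show ?thesis by (subst nn_integral_add, measurable)+
 qed
 also have "... <= ennreal (2 * Ck * t) + (ennreal (4 * Ck * Cl ^ (a + 2) * t) + ennreal (2 * \<beta> * A * t))"
  by (intro add_mono far near loc)
 also have "... = ennreal ((2 * Ck + 4 * Ck * Cl ^ (a + 2) + 2 * \<beta> * A) * t)"
  using Ck t A Cl_pos beta_ge by (simp add: distrib_right flip: ennreal_plus)
 finally show ?thesis .
qed

text \<open>The summands belong to the good part (Chebyshev in L^q, with sup norm at most
  \<open>5 * h\<close> and L^1 norm about twice that of \<open>u\<close>), to the union of the
  dilated balls, and to the blocks outside those balls. The height \<open>h\<close> is independent
  of the level \<open>s\<close> so that the three can be balanced.\<close>

definition weak_bound :: "real => real => real => real => real" where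
 "weak_bound q A s h = 2 * 5 powr (q - 1) * A powr q * s powr - q * h powr (q - 1) + \<beta> / h +
   (2 * Ck + 4 * Ck * Cl ^ (a + 2) + 2 * \<beta> * A) / s"

text \<open>Good part and remainder are handled once and for all; the estimate of the bad part is
  the hypothesis \<open>bad\<close>, because the L^q bounds and the Hardy space supply it in
  different ways. The decomposition is available for every \<open>\<epsilon>\<close>, which tends to
  0 at the end.\<close>

lemma CZ_weak:
 assumes bnd: "bdd q A" and q: "q > 1" and A: "A >= 0" and u: "nice M N1 u"
  and s: "s > 0" and h: "h > 0" and c: "c >= 0"
  and large: "ennreal (\<beta> / h) * I1 u < emeasure M (space M)"
  and bad: "\<And>\<epsilon> J r R Q B t \<psi> \<phi>. \<epsilon> > 0 ==> finite J ==> (\<And>j. j \<in> J ==> CZ_block u j (r j) (R j) (Q j) (B j) (t j) (\<psi> j) (\<phi> j)) ==>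
   (\<Sum>j\<in>J. mb j (\<alpha>\<^sup>2 * r j)) <= \<beta> / h * (enn2real (I1 u) + \<epsilon>) ==>
   (\<Sum>j\<in>J. t j) <= enn2real (I1 u) + \<epsilon> ==>
   mlev (S (\<lambda>p. \<Sum>j\<in>J. \<psi> j p + \<phi> j p)) s <= ennreal (c * (enn2real (I1 u) + \<epsilon>))"
 shows "mlev (S u) (3 * s) <=
  ennreal (2 * 5 powr (q - 1) * A powr q * s powr - q * h powr (q - 1) + c) * I1 u"
proof -
 define I where "I = enn2real (I1 u)"
 have fin: "I1 u = ennreal I" unfolding I_def using nice_integrable1[OF u] by simp
 have I0: "I >= 0" unfolding I_def by simp
 obtain m where m: "\<And>x. nrm N1 u x <= ennreal m" using u unfolding nice_def by blast
 define W where "W = 2 * 5 powr (q - 1) * A powr q * s powr - q * h powr (q - 1)"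
 \<comment> \<open>The coefficient of \<open>\<epsilon>\<close> for the remainder, which is bounded
   by \<open>m\<close> and lives on a set of measure below \<open>\<epsilon>\<close>.\<close>
 define d where "d = s powr - q * A powr q * \<bar>m\<bar> powr q"
 have c0: "W >= 0" "d >= 0" unfolding W_def d_def by auto
 have main: "mlev (S u) (3 * s) <= ennreal ((W + c) * (I + \<epsilon>) + d * \<epsilon>)" if eps: "\<epsilon> > 0" for \<epsilon>
 proof -
  obtain J :: "'a set" and r R Q B t \<psi> \<phi> g e where fJ: "finite J" and blk: "\<And>j. j \<in> J ==> CZ_block u j (r j) (R j) (Q j) (B j) (t j) (\<psi> j) (\<phi> j)"
   and sumB: "(\<Sum>j\<in>J. mb j (\<alpha>\<^sup>2 * r j)) <= \<beta> / h * (enn2real (I1 u) + \<epsilon>)"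
   and sumt: "(\<Sum>j\<in>J. t j) <= enn2real (I1 u) + \<epsilon>"
   and dec: "\<And>p. u p = g p + e p + (\<Sum>j\<in>J. \<psi> j p + \<phi> j p)" and n: "nice M N1 g" "nice M N1 e"
   and g: "\<And>x. nrm N1 g x <= ennreal (5 * h)" "I1 g <= ennreal (2 * (enn2real (I1 u) + \<epsilon>))"
   and e: "\<exists>E. E \<in> sets M \<and> emeasure M E < ennreal \<epsilon> \<and> (\<forall>x. nrm N1 e x = ind E x * nrm N1 u x)"
   by (rule CZ_nice[OF u h eps large]) (rule that)
  define b where "b p = (\<Sum>j\<in>J. \<psi> j p + \<phi> j p)" for p
  have nb: "nice M N1 b" unfolding b_def using CZ_blockD(11,12)[OF blk] by (intro nice_sum nice_add fJ)
  have m4: "mlev (S b) s <= ennreal (c * (I + \<epsilon>))"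
   unfolding b_def I_def using bad[OF eps fJ blk sumB sumt] .
  note g = g(1) g(2)[folded I_def]
  have nm: "v \<in> borel_measurable W1" if "nice M N1 v" for v using that unfolding nice_def by blast
  have [measurable]: "lev (S v) s \<in> sets M" if "nice M N1 v" for v
   using measurable_S[OF nm[OF that]] by measurable
  note E = this[OF n(1)] this[OF n(2)] this[OF nb]
  note [measurable] = nm[OF n(1)] nm[OF n(2)]
  have u_eq: "u = (\<lambda>p. (g p + e p) + b p)" using dec unfolding b_def by (auto simp: fun_eq_iff)
  have sub: "AE x in M. x \<in> lev (S u) (3 * s) \<longrightarrow>
   x \<in> lev (S g) s \<union> lev (S e) s \<union> lev (S b) s"
   using nice_AE_fin[OF n(1)] nice_AE_fin[OF n(2)] nice_AE_fin[OF nb]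
  proof (eventually_elim, intro impI)
   fix x assume fin: "fin_at g x" "fin_at e x" "fin_at b x" and x: "x \<in> lev (S u) (3 * s)"
   note a = S_add[OF nm[OF n(1)] nm[OF n(2)] _ fin(1,2)] fin_at_add[OF nm[OF n(1)] nm[OF n(2)] _ fin(1,2)]
   show "x \<in> lev (S g) s \<union> lev (S e) s \<union> lev (S b) s"
   proof (rule ccontr)
    assume nx: "\<not> ?thesis"
   have "S u x <= S (\<lambda>p. g p + e p) x + S b x"
    unfolding u_eq by (rule S_add[OF nm[OF nice_add[OF n]] nm[OF nb] _ a(2) fin(3)]) simp_all
   also have "... <= (S g x + S e x) + S b x" using a(1) by (intro add_right_mono) simp
   also have "... <= (ennreal s + ennreal s) + ennreal s" using x nx by (intro add_mono) (auto simp: not_less)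
   also have "... = ennreal (3 * s)" using s by (simp flip: ennreal_plus)
   finally show False using x by simp
   qed
  qed
  have m1: "mlev (S g) s <= ennreal (W * (I + \<epsilon>))"
  proof -
   have "mlev (S g) s <= ennreal (s powr - q) * (\<integral>x. ennpowr (S g x) q)"
    using s q by (intro Markov_q measurable_S nm n) auto
   also have "... <= ennreal (s powr - q) * (ennreal (A powr q) * (\<integral>x. ennpowr (nrm N1 g x) q))"
    using bnd n(1) unfolding bounded_nice_def by (intro mult_left_mono) auto
   also have "(\<integral>x. ennpowr (nrm N1 g x) q) <= (\<integral>x. ennreal ((5 * h) powr (q - 1)) * nrm N1 g x)"
   proof (intro nn_integral_mono)
    fix x
    have "ennpowr (nrm N1 g x) q = ennpowr (nrm N1 g x) (q - 1) * nrm N1 g x"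
     using ennpowr_add_exp[of "q - 1" 1 "nrm N1 g x"] q by simp
    also have "... <= ennpowr (ennreal (5 * h)) (q - 1) * nrm N1 g x"
     using g(1)[of x] q by (intro mult_right_mono ennpowr_mono) auto
    finally show "ennpowr (nrm N1 g x) q <= ennreal ((5 * h) powr (q - 1)) * nrm N1 g x"
     using h by (simp add: ennpowr_ennreal)
   qed
   also have "... = ennreal ((5 * h) powr (q - 1)) * I1 g"
    by (rule nn_integral_cmult) measurable
   also have "... <= ennreal ((5 * h) powr (q - 1)) * ennreal (2 * (I + \<epsilon>))" using g(2) by (rule mult_left_mono) simp
   finally have "mlev (S g) s <= ennreal (s powr - q) * (ennreal (A powr q) * (ennreal ((5 * h) powr (q - 1)) * ennreal (2 * (I + \<epsilon>))))"
    by (simp add: mult_left_mono)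
   also have "... = ennreal (W * (I + \<epsilon>))"
   proof -
    have "ennreal (s powr - q) * (ennreal (A powr q) * (ennreal ((5 * h) powr (q - 1)) * ennreal (2 * Y)))
     = ennreal (W * Y)" if "Y >= 0" for Y
     unfolding W_def using h that by (simp add: powr_mult mult_ac flip: ennreal_mult)
    from this[of "I + \<epsilon>"] show ?thesis using I0 eps by simp
   qed
   finally show ?thesis .
  qed
  have m2: "mlev (S e) s <= ennreal (d * \<epsilon>)"
  proof -
   obtain E where E: "E \<in> sets M" "emeasure M E < ennreal \<epsilon>" "\<And>x. nrm N1 e x = ind E x * nrm N1 u x" using e by blast
   have "mlev (S e) s <= ennreal (s powr - q) * (\<integral>x. ennpowr (S e x) q)"
    using s q by (intro Markov_q measurable_S nm n) auto
   also have "... <= ennreal (s powr - q) * (ennreal (A powr q) * (\<integral>x. ennpowr (nrm N1 e x) q))"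
    using bnd n(2) unfolding bounded_nice_def by (intro mult_left_mono) auto
   also have "(\<integral>x. ennpowr (nrm N1 e x) q) <= (\<integral>x. ennreal (\<bar>m\<bar> powr q) * ind E x)"
   proof (intro nn_integral_mono)
    fix x
    have "ennpowr (nrm N1 u x) q <= ennpowr (ennreal \<bar>m\<bar>) q"
     using m[of x] q by (intro ennpowr_mono) (auto intro: order_trans[OF _ ennreal_leI])
    then show "ennpowr (nrm N1 e x) q <= ennreal (\<bar>m\<bar> powr q) * ind E x"
     unfolding E(3) using q by (cases "x \<in> E") (auto simp: ennpowr_ennreal)
   qed
   also have "... = ennreal (\<bar>m\<bar> powr q) * emeasure M E" using E(1) by (rule nn_integral_cmult_indicator)
   also have "... <= ennreal (\<bar>m\<bar> powr q) * ennreal \<epsilon>" using E(2) by (intro mult_left_mono) auto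
   finally have "mlev (S e) s <= ennreal (s powr - q) * (ennreal (A powr q) * (ennreal (\<bar>m\<bar> powr q) * ennreal \<epsilon>))"
    by (simp add: mult_left_mono)
   also have "... = ennreal (d * \<epsilon>)" unfolding d_def using eps by (simp add: mult_ac flip: ennreal_mult)
   finally show ?thesis .
  qed
  have "mlev (S u) (3 * s) <=
   emeasure M (lev (S g) s \<union> lev (S e) s \<union> lev (S b) s)"
   using sub by (rule emeasure_mono_AE) (intro sets.Un E)
  also have "... <= mlev (S g) s + mlev (S e) s + mlev (S b) s"
   by (intro order_trans[OF emeasure_subadditive] add_mono order_refl sets.Un E)
  also have "... <= ennreal (W * (I + \<epsilon>)) + ennreal (d * \<epsilon>) + ennreal (c * (I + \<epsilon>))" by (intro add_mono m1 m2 m4)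
  also have "... = ennreal ((W + c) * (I + \<epsilon>) + d * \<epsilon>)"
   using c0 c I0 eps by (simp add: distrib_right flip: ennreal_plus)
  finally show ?thesis .
 qed
 have "mlev (S u) (3 * s) <= ennreal ((W + c) * I)"
 proof (rule ennreal_le_epsilon)
  fix d' :: real assume d': "d' > 0"
  define \<epsilon> where "\<epsilon> = d' / (W + c + d + 1)"
  have eps: "\<epsilon> > 0" unfolding \<epsilon>_def using d' c0 c by simp
  have "(W + c + d + 1) * \<epsilon> = d'" unfolding \<epsilon>_def using c0 c by simp
  then have "(W + c) * (I + \<epsilon>) + d * \<epsilon> <= (W + c) * I + d'" using eps by (simp add: algebra_simps)
  then show "mlev (S u) (3 * s) <= ennreal ((W + c) * I) + ennreal d'"
   using main[OF eps] c0 c I0 d' by (auto simp flip: ennreal_plus intro: order_trans ennreal_leI)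
 qed
 then show ?thesis unfolding fin W_def[symmetric] using c0 c I0 by (simp add: ennreal_mult)
qed

lemma weak_type:
 assumes bnd: "bdd q A" and q: "q > 1" and A: "A >= 0" and u: "nice M N1 u"
  and s: "s > 0" and h: "h > 0"
 shows "mlev (S u) (3 * s) <= ennreal (weak_bound q A s h) * I1 u"
proof (cases "ennreal (\<beta> / h) * I1 u < emeasure M (space M)")
 case False
 have "mlev (S u) (3 * s) <= emeasure M (space M)" by (rule emeasure_space)
 also have "... <= ennreal (\<beta> / h) * I1 u" using False by simp
 also have "... <= ennreal (weak_bound q A s h) * I1 u"
  unfolding weak_bound_def using Ck Cl_pos beta_ge A s h by (intro mult_right_mono ennreal_leI) auto
 finally show ?thesis .
next
 case large: True
 define Cb where "Cb = 2 * Ck + 4 * Ck * Cl ^ (a + 2) + 2 * \<beta> * A"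
 have Cb0: "Cb >= 0" unfolding Cb_def using Ck Cl_pos beta_ge A by simp
 have c: "\<beta> / h + Cb / s >= 0" using Cb0 beta_ge s h by simp
 have "mlev (S u) (3 * s) <=
  ennreal (2 * 5 powr (q - 1) * A powr q * s powr - q * h powr (q - 1) + (\<beta> / h + Cb / s)) * I1 u"
 proof (rule CZ_weak[OF bnd q A u s h c large])
  fix \<epsilon> :: real and J :: "'a set" and r R Q B t \<psi> \<phi>
  assume eps: "\<epsilon> > 0" and fJ: "finite J" and blk: "\<And>j. j \<in> J ==> CZ_block u j (r j) (R j) (Q j) (B j) (t j) (\<psi> j) (\<phi> j)"
   and sumB: "(\<Sum>j\<in>J. mb j (\<alpha>\<^sup>2 * r j)) <= \<beta> / h * (enn2real (I1 u) + \<epsilon>)"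
   and sumt: "(\<Sum>j\<in>J. t j) <= enn2real (I1 u) + \<epsilon>"
  define I where "I = enn2real (I1 u) + \<epsilon>"
  have I0: "I >= 0" unfolding I_def using eps by simp
  note t = CZ_blockD(10)[OF blk]
  let ?b = "\<lambda>j p. \<psi> j p + \<phi> j p"
  have bn: "nice M N1 (?b j)" if "j \<in> J" for j using CZ_blockD(11,12)[OF blk[OF that]] by (rule nice_add)
  have bm: "\<And>j. j \<in> J ==> ?b j \<in> borel_measurable W1" using bn unfolding nice_def by blast
  define E3 where "E3 = (\<Union>j\<in>J. ball j (\<alpha>\<^sup>2 * r j))"
  define H where "H x = (\<Sum>j\<in>J. S (?b j) x * ind (- ball j (\<alpha>\<^sup>2 * r j)) x)" for x
  have [measurable]: "- ball j (\<alpha>\<^sup>2 * r j) \<in> sets M" for j by (simp add: sets_M)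
  have Hs: "(\<lambda>x. S (?b j) x * ind (- ball j (\<alpha>\<^sup>2 * r j)) x) \<in> borel_measurable M" if "j \<in> J" for j
   using measurable_S[OF bm[OF that]] by (intro borel_measurable_times_ennreal borel_measurable_indicator) auto
  have Hm [measurable]: "H \<in> borel_measurable M" unfolding H_def using Hs by (intro borel_measurable_sum) auto
  define E4 where "E4 = lev H s"
  have E4s [measurable]: "E4 \<in> sets M" unfolding E4_def by measurable
  have E3s [measurable]: "E3 \<in> sets M" unfolding E3_def using fJ by (intro sets.finite_UN) auto
  have AEb: "AE x in M. \<forall>j\<in>J. fin_at (?b j) x" using nice_AE_fin[OF bn] fJ by (intro AE_finite_allI) auto
  have sub: "AE x in M. x \<in> lev (S (\<lambda>p. \<Sum>j\<in>J. ?b j p)) s \<longrightarrow> x \<in> E3 \<union> E4"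
   using AEb
  proof (eventually_elim, intro impI)
   fix x assume fb: "\<forall>j\<in>J. fin_at (?b j) x" and x: "x \<in> lev (S (\<lambda>p. \<Sum>j\<in>J. ?b j p)) s"
   show "x \<in> E3 \<union> E4"
   proof (rule ccontr)
    assume nx: "x \<notin> E3 \<union> E4"
   have "S (\<lambda>p. \<Sum>j\<in>J. ?b j p) x <= (\<Sum>j\<in>J. S (?b j) x)" using S_sum[OF fJ, of x ?b] bm fb by auto
   also have "... = H x" unfolding H_def using nx unfolding E3_def by (intro sum.cong) (auto simp: indicator_def)
   also have "... <= ennreal s" using nx unfolding E4_def by (auto simp: not_less)
   finally show False using x by simp
   qed
  qed
  have m3: "emeasure M E3 <= ennreal (\<beta> / h * I)"
  proof -
   have "emeasure M E3 <= (\<Sum>j\<in>J. emeasure M (ball j (\<alpha>\<^sup>2 * r j)))"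
    unfolding E3_def using fJ by (intro emeasure_subadditive_finite) auto
   also have "... = ennreal (\<Sum>j\<in>J. mb j (\<alpha>\<^sup>2 * r j))" unfolding emeasure_ball by (intro sum_ennreal) auto
   also have "... <= ennreal (\<beta> / h * I)" using sumB unfolding I_def by (rule ennreal_leI)
   finally show ?thesis .
  qed
  have m4: "emeasure M E4 <= ennreal (Cb / s * I)"
  proof -
   have "emeasure M E4 <= ennreal (s powr - 1) * (\<integral>x. ennpowr (H x) 1)"
    unfolding E4_def using s by (intro Markov_q Hm) auto
   also have "(\<integral>x. ennpowr (H x) 1) = (\<Sum>j\<in>J. \<integral>x. S (?b j) x * ind (- ball j (\<alpha>\<^sup>2 * r j)) x)"
    unfolding H_def ennpowr_1 using Hs by (rule nn_integral_sum)
   also have "... <= (\<Sum>j\<in>J. ennreal (Cb * t j))"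
   proof (rule sum_mono)
    fix j assume j: "j \<in> J"
    show "(\<integral>x. S (?b j) x * ind (- ball j (\<alpha>\<^sup>2 * r j)) x) <= ennreal (Cb * t j)"
     unfolding Cb_def by (rule S_block[OF bnd q A blk[OF j]])
   qed
   also have "... = ennreal (Cb * (\<Sum>j\<in>J. t j))"
    using t Cb0 by (subst sum_ennreal) (auto simp: sum_distrib_left)
   also have "... <= ennreal (Cb * I)" using sumt Cb0 unfolding I_def by (intro ennreal_leI mult_left_mono) auto
   finally have "emeasure M E4 <= ennreal (s powr - 1) * ennreal (Cb * I)" by (simp add: mult_left_mono)
   also have "... = ennreal (Cb / s * I)"
   proof -
    have "ennreal (s powr - 1) * ennreal (Cb * Y) = ennreal (Cb / s * Y)" if "Y >= 0" for Y
     using s Cb0 that by (simp add: powr_minus field_simps flip: ennreal_mult)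
    from this[OF I0] show ?thesis .
   qed
   finally show ?thesis .
  qed
  have "mlev (S (\<lambda>p. \<Sum>j\<in>J. ?b j p)) s <= emeasure M (E3 \<union> E4)"
   using sub by (rule emeasure_mono_AE) measurable
  also have "... <= emeasure M E3 + emeasure M E4" by (rule emeasure_subadditive) auto
  also have "... <= ennreal (\<beta> / h * I) + ennreal (Cb / s * I)" by (intro add_mono m3 m4)
  also have "... = ennreal ((\<beta> / h + Cb / s) * I)" using Cb0 I0 s h beta_ge by (simp add: distrib_right flip: ennreal_plus)
  finally show "mlev (S (\<lambda>p. \<Sum>j\<in>J. ?b j p)) s <= ennreal ((\<beta> / h + Cb / s) * (enn2real (I1 u) + \<epsilon>))"
   unfolding I_def .
 qed
 then show ?thesis unfolding weak_bound_def Cb_def[symmetric] by (simp only: add.assoc)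
qed

text \<open>Only the part of \<open>u\<close> above the height \<open>\<kappa> * s\<close> is subject to the weak type inequality.\<close>

lemma interpolate:
 assumes weak: "\<And>u s. nice M N1 u ==> s > 0 ==> (\<And>x. nrm N1 u x = 0 \<or> ennreal (2 * \<kappa> * s) < nrm N1 u x) ==>
   mlev (S u) s <= ennreal (D * s powr - r) * (\<integral>x. ennpowr (nrm N1 u x) r)"
  and bnd: "bdd q A"
  and par: "0 < r" "r < p" "p < q" "\<kappa> > 0" "D >= 0" "A >= 0"
 shows "bdd p ((p * (2 powr r * D) * \<kappa> powr (r - p) / (p - r) + p * (2 * A) powr q * \<kappa> powr (q - p) / (q - p)) powr (1 / p))"
 unfolding bounded_nice_def
proof (intro allI impI)
 fix u assume u: "nice M N1 u"
 have [measurable]: "u \<in> borel_measurable W1" using u unfolding nice_def by auto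
 obtain m where m: "\<And>x. nrm N1 u x <= ennreal m" using u unfolding nice_def by blast
 define F where "F x = enn2real (nrm N1 u x)" for x
 have F: "nrm N1 u x = ennreal (F x)" for x
  unfolding F_def using m[of x] by (intro ennreal_enn2real[symmetric]) (auto simp: less_top[symmetric] top_unique)
 have F0: "F x >= 0" for x unfolding F_def by simp
 have Fm [measurable]: "F \<in> borel_measurable M" unfolding F_def by measurable
 have Su [measurable]: "S u \<in> borel_measurable M" using measurable_S[of u] by simp
 let ?C = "p * (2 powr r * D) * \<kappa> powr (r - p) / (p - r) + p * (2 * A) powr q * \<kappa> powr (q - p) / (q - p)"
 have "mlev (S u) s <=
    ennreal ((2 powr r * D) * s powr - r) * (\<integral>x. ennreal (F x powr r) * ind {x. \<kappa> * s < F x} x) +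
    ennreal ((2 * A) powr q * s powr - q) * (\<integral>x. ennreal (F x powr q) * ind {x. F x <= \<kappa> * s} x)" if s: "s > 0" for s
 proof -
  define B where "B = {x \<in> space M. \<kappa> * s < F x}"
  have Bs [measurable]: "B \<in> sets M" unfolding B_def by measurable
  have Bs' [measurable]: "- B \<in> sets M" using sets.compl_sets[OF Bs] by (simp add: Compl_eq_Diff_UNIV)
  let ?u1 = "\<lambda>p. ind B (fst p) * u p" and ?u2 = "\<lambda>p. ind (- B) (fst p) * u p"
  have n: "nice M N1 ?u1" "nice M N1 ?u2" by (auto intro!: nice_indicator(1) u)
  have nr: "nrm N1 ?u1 x = ind B x * nrm N1 u x" "nrm N1 ?u2 x = ind (- B) x * nrm N1 u x" for x
   by (auto intro!: nice_indicator(2) u)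
  have [measurable]: "?u1 \<in> borel_measurable W1" "?u2 \<in> borel_measurable W1"
   using n unfolding nice_def by auto
  have [measurable]: "S ?u1 \<in> borel_measurable M" "S ?u2 \<in> borel_measurable M"
   using measurable_S[of ?u1] measurable_S[of ?u2] by simp_all
  have ueq: "u = (\<lambda>p. ?u1 p + ?u2 p)" by (auto simp: fun_eq_iff indicator_def)
  have "AE x in M. x \<in> lev (S u) s \<longrightarrow>
   x \<in> lev (S ?u1) (s / 2) \<union> lev (S ?u2) (s / 2)"
   using nice_AE_fin[OF n(1)] nice_AE_fin[OF n(2)]
  proof eventually_elim
   fix x assume f: "fin_at ?u1 x" "fin_at ?u2 x"
   have "S u x <= S ?u1 x + S ?u2 x" by (subst ueq, rule S_add) (use f in auto)
   moreover have "S ?u1 x + S ?u2 x <= ennreal s" if "S ?u1 x <= ennreal (s / 2)" "S ?u2 x <= ennreal (s / 2)"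
    using add_mono[OF that] s by (simp flip: ennreal_plus)
   ultimately show "x \<in> lev (S u) s \<longrightarrow>
    x \<in> lev (S ?u1) (s / 2) \<union> lev (S ?u2) (s / 2)"
    by (auto simp: not_less) (meson leD not_le order_trans)
  qed
  then have "mlev (S u) s <=
   emeasure M (lev (S ?u1) (s / 2) \<union> lev (S ?u2) (s / 2))"
   by (rule emeasure_mono_AE) measurable
  also have "... <= mlev (S ?u1) (s / 2) + mlev (S ?u2) (s / 2)"
   by (rule emeasure_subadditive) measurable
  also have "... <= ennreal (D * (s / 2) powr - r) * (\<integral>x. ennpowr (nrm N1 ?u1 x) r) +
    ennreal ((s / 2) powr - q) * (ennreal (A powr q) * (\<integral>x. ennpowr (nrm N1 ?u2 x) q))"
  proof (rule add_mono)
   \<comment> \<open>The weak estimate is used at level \<open>s / 2\<close>; this is why its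
     hypothesis has the threshold \<open>2 * \<kappa> * s\<close>, which becomes the cutting height
     \<open>\<kappa> * s\<close>. The same halving produces the factors \<open>2 powr r\<close> and
     \<open>2 powr q\<close>.\<close>
   show "mlev (S ?u1) (s / 2) <= ennreal (D * (s / 2) powr - r) * (\<integral>x. ennpowr (nrm N1 ?u1 x) r)"
   proof (rule weak[OF n(1)])
    show "s / 2 > 0" using s by simp
    show "nrm N1 ?u1 x = 0 \<or> ennreal (2 * \<kappa> * (s / 2)) < nrm N1 ?u1 x" for x
     unfolding nr(1) F using s par by (cases "x \<in> B") (auto simp: B_def ennreal_less_iff)
   qed
   have "mlev (S ?u2) (s / 2) <= ennreal ((s / 2) powr - q) * (\<integral>x. ennpowr (S ?u2 x) q)"
    using s par by (intro Markov_q) auto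
   also have "... <= ennreal ((s / 2) powr - q) * (ennreal (A powr q) * (\<integral>x. ennpowr (nrm N1 ?u2 x) q))"
    using bnd n(2) unfolding bounded_nice_def by (intro mult_left_mono) auto
   finally show "mlev (S ?u2) (s / 2) <= ennreal ((s / 2) powr - q) * (ennreal (A powr q) * (\<integral>x. ennpowr (nrm N1 ?u2 x) q))" .
  qed
  also have "(\<integral>x. ennpowr (nrm N1 ?u1 x) r) = (\<integral>x. ennreal (F x powr r) * ind {x. \<kappa> * s < F x} x)"
   unfolding nr F using par by (intro nn_integral_cong) (auto simp: B_def ennpowr_ennreal F0 split: split_indicator)
  also have "(\<integral>x. ennpowr (nrm N1 ?u2 x) q) = (\<integral>x. ennreal (F x powr q) * ind {x. F x <= \<kappa> * s} x)"
   unfolding nr F using par by (intro nn_integral_cong) (auto simp: B_def ennpowr_ennreal F0 split: split_indicator)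
  also have "ennreal (D * (s / 2) powr - r) = ennreal ((2 powr r * D) * s powr - r)"
   using s by (simp add: powr_divide powr_minus field_simps)
  also have "ennreal ((s / 2) powr - q) * (ennreal (A powr q) * X) = ennreal ((2 * A) powr q * s powr - q) * X" for X
  proof -
   have "(s / 2) powr - q * A powr q = (2 * A) powr q * s powr - q"
    using s par by (simp add: powr_divide powr_minus powr_mult field_simps)
   then show ?thesis by (simp add: mult.assoc[symmetric] flip: ennreal_mult)
  qed
  finally show ?thesis .
 qed
 then have "(\<integral>y. ennpowr (S u y) p) <= ennreal ?C * (\<integral>x. ennreal (F x powr p))"
  using par by (intro Marcinkiewicz_interpolation[OF sigma_finite_measure_axioms sigma_finite_measure_axioms Su Fm F0]) auto
 also have "(\<integral>x. ennreal (F x powr p)) = (\<integral>x. ennpowr (nrm N1 u x) p)"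
  by (simp add: F ennpowr_ennreal F0)
 also have "ennreal ?C = ennreal ((?C powr (1 / p)) powr p)"
  using par by (simp add: powr_powr)
 finally show "(\<integral>y. ennpowr (S u y) p) <= ennreal ((?C powr (1 / p)) powr p) * (\<integral>x. ennpowr (nrm N1 u x) p)" .
qed

section \<open>Duality\<close>

lemma bounded_nice_mono:
 assumes "bdd q A" "0 <= A" "A <= B" "q > 0"
 shows "bdd q B"
 using assms unfolding bounded_nice_def
 by (meson ennreal_leI less_imp_le mult_right_mono order_trans powr_mono2 zero_le)

text \<open>The image of \<open>g\<close> under the adjoint is paired with its own extremal
  function, cut to sets \<open>Y m\<close> on which its norm is bounded so that the extremal
  function is \<open>nice\<close>. This gives \<open>I <= X * I powr (1 / p)\<close> for the
  truncated integral \<open>I\<close>; since \<open>I\<close> is finite, one divides and lets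
  \<open>m\<close> grow.\<close>

lemma dual_bound:
 assumes bnd: "bdd p A" and pq: "p > 1" "q > 1" "1 / p + 1 / q = 1" and A: "A >= 0"
 shows "bounded_nice M N2 N1 (\<lambda>w z. k z w) q A"
 unfolding bounded_nice_def
proof (intro allI impI)
 fix g assume g: "nice M N2 g"
 interpret Ad: hs_kernel M N2 N1 "\<lambda>w z. k z w" by (rule adjoint_kernel)
 have hs': "hs N2 N1 (\<lambda>w z. k z w) y x = hk x y" for x y by (rule hs_adjoint) auto
 have [measurable]: "g \<in> borel_measurable W2" using g unfolding nice_def by auto
 obtain mg where mg: "\<And>x. nrm N2 g x <= ennreal mg" using g unfolding nice_def by blast
 obtain z R where Bg: "{x. nrm N2 g x \<noteq> 0} \<subseteq> ball z R" using g unfolding nice_def by (metis bounded_subset_ballD)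
 define w where "w = int_op W2 (\<lambda>w z. k z w) g"
 have wm [measurable]: "w \<in> borel_measurable W1" unfolding w_def by (rule Ad.measurable_T) measurable
 define G where "G = nrm N1 w"
 have Gm [measurable]: "G \<in> borel_measurable M" unfolding G_def by measurable
 define Ig where "Ig = (\<integral>x. ennpowr (nrm N2 g x) q)"
 have gint: "(\<integral>x. nrm N2 g x) < \<infinity>"
 proof -
  have "(\<integral>x. nrm N2 g x) <= (\<integral>x. ennreal mg * ind (ball z R) x)"
  proof (intro nn_integral_mono)
   fix x show "nrm N2 g x <= ennreal mg * ind (ball z R) x"
    using mg[of x] Bg by (cases "x \<in> ball z R") auto
  qed
  also have "... = ennreal mg * emeasure M (ball z R)" by (rule nn_integral_cmult_indicator) measurable
  also have "... < \<infinity>" using emeasure_ball_finite[of z R] by (simp add: ennreal_mult_less_top)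
  finally show ?thesis .
 qed
 have AEG: "AE y in M. G y < \<infinity>"
 proof -
  have "AE y in M. Ad.fin_at g y"
   using Schur(2) gint by (intro Ad.AE_fin_at[of "ennreal L"]) (auto simp: hs')
  then show ?thesis
  proof (rule AE_mp, intro AE_I2 impI)
   fix y assume "y \<in> space M" "Ad.fin_at g y"
   then show "G y < \<infinity>" unfolding G_def w_def Ad.fin_at_def using Ad.S_le[of g y] by (auto intro: le_less_trans)
  qed
 qed
 define Y where "Y m = {y \<in> space M. y \<in> ball z (real m) \<and> G y <= ennreal (real m)}" for m :: nat
 have Ys [measurable]: "Y m \<in> sets M" for m
 proof -
  have "Y m = ball z (real m) \<inter> {y \<in> space M. G y <= ennreal (real m)}" unfolding Y_def by auto
  then show ?thesis by simp
 qed
 have main: "(\<integral>y. ennpowr (G y) q * ind (Y m) y) <= ennreal (A powr q) * Ig" for m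
 proof -
  \<comment> \<open>The extremal function for the L^q norm. For \<open>q < 2\<close> the exponent is
    negative, but a zero of \<open>G\<close> does no harm as \<open>0 powr s\<close> is 0.\<close>
  define u where "u p = of_real (ind (Y m) (fst p) * enn2real (G (fst p)) powr (q - 2)) * cnj (w p)" for p
  have [measurable]: "(\<lambda>p. cnj (w p)) \<in> borel_measurable W1"
   by (rule borel_measurable_continuous_on[OF _ wm]) (intro continuous_intros)
  have um [measurable]: "u \<in> borel_measurable W1" unfolding u_def by measurable
  have GY: "G y = ennreal (enn2real (G y))" if "y \<in> Y m" for y
   using that unfolding Y_def by (intro ennreal_enn2real[symmetric]) (auto simp: less_top[symmetric] top_unique)
  have nu: "nrm N1 u y = ind (Y m) y * ennpowr (G y) (q - 1)" for y
  proof (cases "y \<in> Y m")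
   case True
   let ?c = "enn2real (G y) powr (q - 2)"
   have "nrm N1 u y = l2 N1 (\<lambda>b. ennreal ?c * ecmod (w (y, b)))"
    unfolding nrm_def u_def using True by (simp add: norm_mult ennreal_mult)
   also have "... = ennreal ?c * l2 N1 (\<lambda>b. ecmod (w (y, b)))" by (rule l2_cmult) measurable
   also have "... = ennreal ?c * ennreal (enn2real (G y))" using GY[OF True] unfolding G_def nrm_def by simp
   also have "... = ennreal (enn2real (G y) powr (q - 1))"
   proof (cases "enn2real (G y) = 0")
    case False
    then have "enn2real (G y) powr (q - 2) * enn2real (G y) = enn2real (G y) powr (q - 1)"
     using powr_add[of "enn2real (G y)" "q - 2" 1] by simp
    then show ?thesis by (simp flip: ennreal_mult)
   qed simp
   also have "... = ennpowr (G y) (q - 1)" by (subst (2) GY[OF True]) (simp add: ennpowr_ennreal)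
   finally show ?thesis using True by simp
  qed (simp add: nrm_def u_def l2_def)
  have nice_u: "nice M N1 u"
   unfolding nice_def
  proof (intro conjI um exI allI)
   fix y show "nrm N1 u y <= ennreal (real m powr (q - 1))"
   proof (cases "y \<in> Y m")
    case True
    then have "ennpowr (G y) (q - 1) <= ennpowr (ennreal (real m)) (q - 1)"
     using pq unfolding Y_def by (intro ennpowr_mono) auto
    then show ?thesis unfolding nu using True by (simp add: ennpowr_ennreal)
   qed (simp add: nu)
   show "bounded {y. nrm N1 u y \<noteq> 0}"
    by (rule bounded_subset[OF bounded_ball[of z "real m"]]) (auto simp: nu Y_def indicator_def split: if_splits)
  qed
  define I where "I = (\<integral>y. ennpowr (G y) q * ind (Y m) y)"
  have Ifin: "I < \<infinity>"
  proof -
   have "I <= (\<integral>y. ennpowr (ennreal (real m)) q * ind (ball z (real m)) y)"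
    unfolding I_def
   proof (intro nn_integral_mono)
    fix y
    show "ennpowr (G y) q * ind (Y m) y <= ennpowr (ennreal (real m)) q * ind (ball z (real m)) y"
    proof (cases "y \<in> Y m")
     case True
     then have "ennpowr (G y) q <= ennpowr (ennreal (real m)) q" "y \<in> ball z (real m)"
      using pq unfolding Y_def by (auto intro!: ennpowr_mono)
     then show ?thesis using True by simp
    qed simp
   qed
   also have "... = ennpowr (ennreal (real m)) q * emeasure M (ball z (real m))"
    by (rule nn_integral_cmult_indicator) measurable
   also have "... < \<infinity>" using emeasure_ball_finite[of z "real m"] by (simp add: ennreal_mult_less_top ennpowr_ennreal)
   finally show ?thesis .
  qed
  have pp: "ennpowr (nrm N1 u y) p = ennpowr (G y) q * ind (Y m) y" for y
  proof -
   have "(q - 1) * p = q" using pq by (simp add: field_simps)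
   then show ?thesis unfolding nu using pq by (cases "y \<in> Y m") (auto simp: ennpowr_ennpowr)
  qed
  have pos: "ecmod (LINT p|W1. w p * u p) = I"
  proof -
   let ?f = "\<lambda>p. ind (Y m) (fst p) * enn2real (G (fst p)) powr (q - 2) * (cmod (w p))\<^sup>2"
   have wu: "w p * u p = of_real (?f p)" for p
    unfolding u_def using complex_norm_square[of "w p"] by (simp add: mult_ac)
   have nn: "(\<integral>\<^sup>+p. ennreal (?f p) \<partial>W1) = I"
   proof -
    have "(\<integral>\<^sup>+p. ennreal (?f p) \<partial>W1) = (\<integral>y. \<integral>\<^sup>+b. ennreal (?f (y, b)) \<partial>N1)"
     by (rule N1.nn_integral_fst[symmetric]) measurable
    also have "... = I" unfolding I_def
    proof (intro nn_integral_cong)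
     fix y
     show "(\<integral>\<^sup>+b. ennreal (?f (y, b)) \<partial>N1) = ennpowr (G y) q * ind (Y m) y"
     proof (cases "y \<in> Y m")
      case True
      let ?c = "enn2real (G y) powr (q - 2)"
      have "(\<integral>\<^sup>+b. ennreal (?f (y, b)) \<partial>N1) = (\<integral>\<^sup>+b. ennreal ?c * (ecmod (w (y, b)))\<^sup>2 \<partial>N1)"
       using True by (simp add: ennreal_mult ennreal_power)
      also have "... = ennreal ?c * (\<integral>\<^sup>+b. (ecmod (w (y, b)))\<^sup>2 \<partial>N1)"
       by (rule nn_integral_cmult) measurable
      also have "... = ennreal ?c * (G y)\<^sup>2" unfolding G_def nrm_def by (simp add: l2_sq)
      also have "... = ennreal ?c * (ennreal (enn2real (G y)))\<^sup>2" using GY[OF True] by simp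
      also have "... = ennreal (enn2real (G y) powr q)"
      proof (cases "enn2real (G y) = 0")
       case False
       then have "enn2real (G y) powr (q - 2) * (enn2real (G y))\<^sup>2 = enn2real (G y) powr q"
        using powr_add[of "enn2real (G y)" "q - 2" 2] by simp
       then show ?thesis by (simp add: ennreal_power flip: ennreal_mult)
      next
       case True
       then show ?thesis by (simp only:) simp
      qed
      also have "... = ennpowr (G y) q" by (subst (2) GY[OF True]) (simp add: ennpowr_ennreal)
      finally show ?thesis using True by simp
     qed simp
    qed
    finally show ?thesis .
   qed
   have i: "integrable W1 ?f"
    by (rule integrableI_bounded) (use nn Ifin in \<open>auto simp: abs_mult\<close>)
   have "(LINT p|W1. w p * u p) = of_real (LINT p|W1. ?f p)"
    unfolding wu using i by (rule integral_of_real)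
   moreover have "0 <= (LINT p|W1. ?f p)" by (intro integral_nonneg_AE) auto
   moreover have "ennreal (LINT p|W1. ?f p) = I"
    using nn_integral_eq_integral[OF i] nn by auto
   ultimately show ?thesis by simp
  qed
  have "(\<integral>x. nrm N2 g x * (\<integral>y. hk x y * nrm N1 u y)) <= (\<integral>x. ennreal mg * (\<integral>y. hk x y * nrm N1 u y))"
   by (intro nn_integral_mono mult_right_mono mg) auto
  also have "... = ennreal mg * (\<integral>x. \<integral>y. hk x y * nrm N1 u y)" by (rule nn_integral_cmult) measurable
  also have "... <= ennreal mg * (ennreal L * I1 u)"
   using Schur(1) by (intro mult_left_mono nn_integral_Schur1) auto
  also have "... < \<infinity>" using nice_integrable1[OF nice_u] by (simp add: ennreal_mult_less_top)
  finally have "ecmod (LINT p|W1. w p * u p) <= (\<integral>x. nrm N2 g x * S u x)"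
   unfolding w_def by (intro duality) auto
  then have "I <= (\<integral>x. nrm N2 g x * S u x)" unfolding pos .
  also have "... <= ennpowr Ig (1 / q) * ennpowr (\<integral>x. ennpowr (S u x) p) (1 / p)"
   unfolding Ig_def using pq by (intro Hoelder_ennreal) (auto intro!: measurable_S)
  also have "... <= ennpowr Ig (1 / q) * ennpowr (ennreal (A powr p) * I) (1 / p)"
   using bnd nice_u pq unfolding bounded_nice_def I_def pp[symmetric]
   by (intro mult_left_mono ennpowr_mono) auto
  also have "... = ennpowr Ig (1 / q) * (ennreal A * ennpowr I (1 / p))"
   using pq A by (simp add: ennpowr_mult ennpowr_ennreal powr_powr)
  finally have le: "I <= ennpowr Ig (1 / q) * (ennreal A * ennpowr I (1 / p))" .
  have "I <= ennreal (A powr q) * Ig"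
  proof (cases "I = 0")
   case False
   \<comment> \<open>The division is legitimate only because the truncation makes \<open>I\<close>
     finite.\<close>
   define X where "X = ennpowr I (1 / p)"
   have X: "X \<noteq> 0" "X \<noteq> \<infinity>" unfolding X_def using False Ifin pq by (auto simp: ennpowr_eq_0_iff ennpowr_eq_top_iff)
   have "ennpowr I (1 / q) * X = I"
    unfolding X_def using ennpowr_add_exp[of "1 / q" "1 / p" I] pq by (simp add: add.commute)
   then have "ennpowr I (1 / q) * X <= (ennpowr Ig (1 / q) * ennreal A) * X"
    using le unfolding X_def by (simp add: mult.assoc)
   then have "ennpowr I (1 / q) * X / X <= (ennpowr Ig (1 / q) * ennreal A) * X / X" by (rule divide_right_mono_ennreal)
   then have "ennpowr I (1 / q) <= ennpowr Ig (1 / q) * ennreal A" using X by (simp add: mult_divide_eq_ennreal)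
   then have "ennpowr (ennpowr I (1 / q)) q <= ennpowr (ennpowr Ig (1 / q) * ennreal A) q" using pq by (intro ennpowr_mono) auto
   then show ?thesis using pq A by (simp add: ennpowr_mult ennpowr_inverse ennpowr_ennreal mult.commute)
  qed simp
  then show ?thesis unfolding I_def .
 qed
 have "(\<integral>y. ennpowr (G y) q) = (\<integral>y. (SUP m. ennpowr (G y) q * ind (Y m) y))"
 proof (rule nn_integral_cong_AE)
  show "AE y in M. ennpowr (G y) q = (SUP m. ennpowr (G y) q * ind (Y m) y)"
   using AEG
  proof eventually_elim
   fix y assume "G y < \<infinity>"
   then obtain t where t: "t >= 0" "G y = ennreal t" by (cases "G y") auto
   obtain n1 :: nat where n1: "t < real n1" using reals_Archimedean2 by blast
   obtain n2 :: nat where n2: "dist z y < real n2" using reals_Archimedean2 by blast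
   have "G y <= ennreal (real (n1 + n2))" unfolding t(2) using n1 by (intro ennreal_leI) simp
   then have "y \<in> Y (n1 + n2)" using n2 unfolding Y_def by simp
   then have "ennpowr (G y) q <= (SUP m. ennpowr (G y) q * ind (Y m) y)"
    by (intro SUP_upper2[of "n1 + n2"]) auto
   moreover have "(SUP m. ennpowr (G y) q * ind (Y m) y) <= ennpowr (G y) q"
    by (intro SUP_least) (auto simp: indicator_def)
   ultimately show "ennpowr (G y) q = (SUP m. ennpowr (G y) q * ind (Y m) y)" by (rule antisym)
  qed
 qed
 also have "... = (SUP m. (\<integral>y. ennpowr (G y) q * ind (Y m) y))"
 proof (rule nn_integral_monotone_convergence_SUP)
  show "incseq (\<lambda>m y. ennpowr (G y) q * ind (Y m) y)"
  proof (intro incseq_SucI le_funI mult_left_mono)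
   fix m y
   have "ennreal (real m) <= ennreal (real (Suc m))" by (rule ennreal_leI) simp
   then have "Y m \<subseteq> Y (Suc m)" unfolding Y_def by (auto intro: order_trans)
   then show "ind (Y m) y <= (ind (Y (Suc m)) y :: ennreal)" by (auto simp: indicator_def)
  qed simp
 qed measurable
 also have "... <= ennreal (A powr q) * Ig" by (intro SUP_least main)
 finally show "(\<integral>x. ennpowr (nrm N1 (int_op W2 (\<lambda>w z. k z w) g) x) q) <= ennreal (A powr q) * (\<integral>x. ennpowr (nrm N2 g x) q)"
  unfolding G_def w_def Ig_def .
qed

end

section \<open>Bounds linear in the L^2 norm\<close>

context cz_space begin

text \<open>Collects the coefficients of \<open>weak_bound\<close> for exponent 2 once
  \<open>h\<close> is chosen proportional to \<open>s / A\<close>. It depends on the space and on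
  the kernel constant \<open>c\<close> alone, hence not on the truncation.\<close>

definition W0 :: "real => real" where "W0 c = 10 + 3 * \<beta> + 2 * c + 4 * c * Cl ^ (a + 2)"

definition C\<^sub>p :: "real => real => real" where
 "C\<^sub>p c p = (p * (2 * (3 * W0 c)) / (p - 1) + p * 4 / (2 - p)) powr (1 / p)"

lemma W0_pos: "c >= 0 ==> W0 c >= 1"
 unfolding W0_def using beta_ge Cl_pos by (simp add: add_increasing2 add_increasing)

lemma Cp_pos: "c >= 0 ==> 1 < p ==> p < 2 ==> C\<^sub>p c p > 0"
proof -
 assume c: "c >= 0" "1 < p" "p < 2"
 have "p * 4 / (2 - p) > 0" "p * (2 * (3 * W0 c)) / (p - 1) >= 0" using c W0_pos[OF c(1)] by auto
 then have "p * (2 * (3 * W0 c)) / (p - 1) + p * 4 / (2 - p) > 0" by linarith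
 then show "C\<^sub>p c p > 0" unfolding C\<^sub>p_def by simp
qed

end

context cz_kernel begin

text \<open>The height \<open>h = s / (3 * A)\<close> equalises the quadratic term of the good part
  with the terms that are linear in \<open>A\<close>. Linearity in \<open>A\<close> of this and the
  next bounds is what lets the bootstrap gain a power.\<close>

lemma weak11_of_L2:
 assumes bnd: "bdd 2 A" and A: "A >= 1" and u: "nice M N1 u" and s: "s > 0"
 shows "mlev (S u) s <= ennreal (3 * W0 Ck * A * s powr - 1) * (\<integral>x. ennpowr (nrm N1 u x) 1)"
proof -
 have "mlev (S u) (3 * (s / 3)) <= ennreal (weak_bound 2 A (s / 3) (s / 3 / A)) * I1 u"
  using A s by (intro weak_type bnd u) auto
 also have "weak_bound 2 A (s / 3) (s / 3 / A) <= 3 * W0 Ck * A * s powr - 1"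
 proof -
  have "weak_bound 2 A (s / 3) (s / 3 / A) = 3 * (10 * A + \<beta> * A + (2 * Ck + 4 * Ck * Cl ^ (a + 2)) * 1 + 2 * \<beta> * A) / s"
   unfolding weak_bound_def using A s by (simp add: powr_minus field_simps power2_eq_square powr_numeral)
  also have "... <= 3 * (10 * A + \<beta> * A + (2 * Ck + 4 * Ck * Cl ^ (a + 2)) * A + 2 * \<beta> * A) / s"
   using A s Ck Cl_pos by (intro divide_right_mono mult_left_mono add_mono order_refl) auto
  also have "... = 3 * W0 Ck * A * s powr - 1"
   unfolding W0_def using s by (simp add: powr_minus field_simps)
  finally show ?thesis .
 qed
 finally show ?thesis by (simp add: mult_right_mono ennreal_leI)
qed

text \<open>Cutting with \<open>\<kappa> = 1 / A\<close> gives both terms of the interpolation the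
  factor \<open>A powr p\<close>, so the bound stays linear in \<open>A\<close>.\<close>

lemma Lp_below_2:
 assumes bnd: "bdd 2 A" and A: "A >= 1" and p: "1 < p" "p < 2"
 shows "bdd p (C\<^sub>p Ck p * A)"
proof -
 have W: "W0 Ck >= 0" using W0_pos[OF Ck] by simp
 have "bdd p ((p * (2 powr 1 * (3 * W0 Ck * A)) * (1 / A) powr (1 - p) / (p - 1) + p * (2 * A) powr 2 * (1 / A) powr (2 - p) / (2 - p)) powr (1 / p))"
  using W A p by (intro interpolate[OF weak11_of_L2[OF bnd A] bnd]) auto
 also have "p * (2 powr 1 * (3 * W0 Ck * A)) * (1 / A) powr (1 - p) / (p - 1) + p * (2 * A) powr 2 * (1 / A) powr (2 - p) / (2 - p)
   = (p * (2 * (3 * W0 Ck)) / (p - 1) + p * 4 / (2 - p)) * A powr p"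
 proof -
  have 1: "A * (1 / A) powr (1 - p) = A powr p"
   using A powr_add[of A 1 "p - 1"] by (simp add: powr_divide powr_minus[symmetric] powr_diff)
  have 2: "A powr 2 * (1 / A) powr (2 - p) = A powr p"
   using A by (simp add: powr_divide powr_diff)
  have "(2 * A) powr 2 = 4 * A powr 2" using A by (simp add: powr_mult)
  then have "p * (2 powr 1 * (3 * W0 Ck * A)) * (1 / A) powr (1 - p) / (p - 1) + p * (2 * A) powr 2 * (1 / A) powr (2 - p) / (2 - p)
   = (p * (2 * (3 * W0 Ck))) * (A * (1 / A) powr (1 - p)) / (p - 1) + (p * 4) * (A powr 2 * (1 / A) powr (2 - p)) / (2 - p)"
   by (simp add: mult_ac)
  then show ?thesis unfolding 1 2 by (simp add: distrib_right)
 qed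
 also have "((p * (2 * (3 * W0 Ck)) / (p - 1) + p * 4 / (2 - p)) * A powr p) powr (1 / p) = C\<^sub>p Ck p * A"
  unfolding C\<^sub>p_def using A p W by (simp add: powr_mult powr_powr)
 finally show ?thesis .
qed

text \<open>The adjoint kernel satisfies the same conditions, so the range below 2 is available for
  it; dualising twice carries it to the range above 2.\<close>

lemma Lp_above_2:
 assumes adj: "cz_kernel M lam Cl N a N2 N1 (\<lambda>w z. k z w) Ck L"
  and bnd: "bdd 2 A" and A: "A >= 1" and p: "2 < p"
 shows "bdd p (C\<^sub>p Ck (p / (p - 1)) * A)"
proof -
 interpret Ad: cz_kernel M lam Cl N a N2 N1 "\<lambda>w z. k z w" Ck L by (rule adj)
 define q where "q = p / (p - 1)"
 have q: "1 < q" "q < 2" "1 / q + 1 / p = 1" using p unfolding q_def by (auto simp: field_simps)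
 have "bounded_nice M N2 N1 (\<lambda>w z. k z w) 2 A" using A by (intro dual_bound[OF bnd]) auto
 then have "bounded_nice M N2 N1 (\<lambda>w z. k z w) q (C\<^sub>p Ck q * A)" by (rule Ad.Lp_below_2[OF _ A q(1,2)])
 then show ?thesis
  unfolding q_def[symmetric] by (rule Ad.dual_bound) (use q p A Cp_pos[OF Ck q(1,2)] in auto)
qed

text \<open>The interpolation is between \<open>L\<^sup>1\<close>, with a bound that does not involve \<open>A\<close>, and \<open>L\<^sup>4\<close>, where the bound
 is linear in \<open>A\<close>; cutting at the heights \<open>A powr - (3 / 2) * s\<close> balances the two parts.\<close>

lemma L2_improve_weak11:
 assumes adj: "cz_kernel M lam Cl N a N2 N1 (\<lambda>w z. k z w) Ck L"
  and weak: "\<And>u s. nice M N1 u ==> s > 0 ==>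
   mlev (S u) s <= ennreal (D / s) * I1 u"
  and D: "D >= 0" and bnd: "bdd 2 A" and A: "A >= 1"
 shows "bdd 2 ((4 * D + (2 * C\<^sub>p Ck (4 / 3)) powr 4) powr (1 / 2) * A powr (3 / 4))"
proof -
 let ?c = "C\<^sub>p Ck (4 / 3)" and ?\<kappa> = "A powr - (3 / 2)"
 have c: "?c > 0" by (rule Cp_pos[OF Ck]) auto
 have "bdd 4 (C\<^sub>p Ck (4 / (4 - 1)) * A)" by (rule Lp_above_2[OF adj bnd A]) simp
 then have b4: "bdd 4 (?c * A)" by simp
 have b: "bdd 2 ((2 * (2 powr 1 * D) * ?\<kappa> powr (1 - 2) / (2 - 1) + 2 * (2 * (?c * A)) powr 4 * ?\<kappa> powr (4 - 2) / (4 - 2)) powr (1 / 2))"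
 proof (rule interpolate[OF _ b4])
  fix u s assume "nice M N1 u" "(s :: real) > 0"
  then show "mlev (S u) s <= ennreal (D * s powr - 1) * (\<integral>x. ennpowr (nrm N1 u x) 1)"
   using weak[of u s] by (simp add: powr_minus divide_inverse)
 qed (use D A c in auto)
 have le: "(2 * (2 powr 1 * D) * ?\<kappa> powr (1 - 2) / (2 - 1) + 2 * (2 * (?c * A)) powr 4 * ?\<kappa> powr (4 - 2) / (4 - 2)) powr (1 / 2)
  <= (4 * D + (2 * ?c) powr 4) powr (1 / 2) * A powr (3 / 4)"
 proof -
  have "?\<kappa> powr (1 - 2) = A powr (- (3 / 2) * (1 - 2))" by (rule powr_powr)
  also have "- (3 / 2) * (1 - 2) = (3 / 2 :: real)" by simp
  finally have 1: "?\<kappa> powr (1 - 2) = A powr (3 / 2)" .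
  have "?\<kappa> powr (4 - 2) = A powr (- (3 / 2) * (4 - 2))" by (rule powr_powr)
  also have "- (3 / 2) * (4 - 2) = (- 3 :: real)" by simp
  finally have k3: "?\<kappa> powr (4 - 2) = A powr - 3" .
  have "(2 * (?c * A)) powr 4 * ?\<kappa> powr (4 - 2) = (2 * ?c) powr 4 * (A powr 4 * A powr - 3)"
   unfolding k3 using A c by (simp add: powr_mult del: powr_numeral powr_neg_numeral)
  also have "A powr 4 * A powr - 3 = A powr (4 + - 3)" by (rule powr_add[symmetric])
  also have "4 + - 3 = (1 :: real)" by simp
  also have "(2 * ?c) powr 4 * A powr 1 <= (2 * ?c) powr 4 * A powr (3 / 2)"
   using A by (intro mult_left_mono powr_mono) auto
  finally have 2: "(2 * (?c * A)) powr 4 * ?\<kappa> powr (4 - 2) <= (2 * ?c) powr 4 * A powr (3 / 2)" .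
  have "(2 * (2 powr 1 * D) * ?\<kappa> powr (1 - 2) / (2 - 1) + 2 * (2 * (?c * A)) powr 4 * ?\<kappa> powr (4 - 2) / (4 - 2)) powr (1 / 2)
   <= ((4 * D + (2 * ?c) powr 4) * A powr (3 / 2)) powr (1 / 2)"
   using 2 D unfolding 1 by (intro powr_mono2) (auto simp: distrib_right)
  also have "... = (4 * D + (2 * ?c) powr 4) powr (1 / 2) * A powr (3 / 4)"
   using D by (simp add: powr_mult powr_powr)
  finally show ?thesis .
 qed
 show ?thesis by (rule bounded_nice_mono[OF b _ le]) auto
qed

section \<open>Removal of the a priori constant\<close>

lemma bounded_nice_limit:
 assumes "\<And>n. bdd q (A n)" "A \<longlonglongrightarrow> B" "\<And>n. A n > 0" "B > 0" "q > 0"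
 shows "bdd q B"
 unfolding bounded_nice_def
proof (intro allI impI)
 fix u assume u: "nice M N1 u"
 define I where "I = (\<integral>x. ennpowr (nrm N1 u x) q)"
 have "I < \<infinity>" unfolding I_def by (rule nice_integrable[OF u \<open>q > 0\<close>])
 then have "(\<lambda>n. ennreal (A n powr q) * I) \<longlonglongrightarrow> ennreal (B powr q) * I"
  using assms by (intro tendsto_mult_ennreal tendsto_ennrealI tendsto_powr) auto
 moreover have "(\<integral>x. ennpowr (S u x) q) <= ennreal (A n powr q) * I" for n
  using assms(1)[of n] u unfolding bounded_nice_def I_def by blast
 ultimately have "(\<integral>x. ennpowr (S u x) q) <= ennreal (B powr q) * I"
  by (intro LIMSEQ_le_const) auto
 then show "(\<integral>x. ennpowr (S u x) q) <= ennreal (B powr q) * (\<integral>x. ennpowr (nrm N1 u x) q)"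
  unfolding I_def .
qed

lemma Schur_bounded_nice: "bdd 2 (L + 1)"
 unfolding bounded_nice_def
proof (intro allI impI)
 fix u assume "nice M N1 u"
 then have "(\<integral>x. (S u x)\<^sup>2) <= (ennreal L)\<^sup>2 * (\<integral>y. (nrm N1 u y)\<^sup>2)"
  using Schur by (intro Schur_L2) (auto simp: nice_def)
 also have "(ennreal L)\<^sup>2 <= ennreal ((L + 1) powr 2)"
  using L by (simp add: ennreal_power powr_numeral)
 finally show "(\<integral>x. ennpowr (S u x) 2) <= ennreal ((L + 1) powr 2) * (\<integral>x. ennpowr (nrm N1 u x) 2)"
  by (simp add: ennpowr_2 mult_right_mono)
qed

text \<open>The map that sends \<open>A\<close> to \<open>B * A powr (3 / 4)\<close> has the fixed
  point \<open>B ^ 4\<close>. Starting from Schur's bound, its iterates are dominated by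
  \<open>B ^ 4 * (L + 1) powr ((3 / 4) ^ n)\<close>, in which \<open>L\<close> disappears in the
  limit.\<close>

lemma bootstrap:
 assumes improve: "\<And>A. A >= 1 ==> bdd 2 A ==> bdd 2 (B * A powr (3 / 4))"
  and B: "B >= 1"
 shows "bdd 2 (B ^ 4)"
proof -
 define A where "A n = B ^ 4 * (L + 1) powr ((3 / 4) ^ n)" for n :: nat
 have L1: "L + 1 >= 1" using L by simp
 have B4: "B ^ 4 >= 1" using B by simp
 have A1: "A n >= 1" for n
  unfolding A_def using mult_mono[OF B4 ge_one_powr_ge_zero[OF L1, of "(3 / 4) ^ n"]] B4 by simp
 have bn: "bdd 2 (A n)" for n
 proof (induction n)
  case 0
  have "1 * (L + 1) <= B ^ 4 * (L + 1)" using B4 L by (intro mult_right_mono) auto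
  then show ?case unfolding A_def using L by (intro bounded_nice_mono[OF Schur_bounded_nice]) auto
 next
  case (Suc n)
  have "B * A n powr (3 / 4) = A (Suc n)"
  proof -
   have "(B ^ 4) powr (3 / 4) = B ^ 3"
    using B by (simp add: powr_powr flip: powr_numeral)
   then show ?thesis unfolding A_def using B L by (simp add: powr_mult powr_powr mult.commute power_numeral_reduce)
  qed
  then show ?case using improve[OF A1 Suc] by simp
 qed
 have lim: "A \<longlonglongrightarrow> B ^ 4 * (L + 1) powr 0"
  unfolding A_def using L by (intro tendsto_intros LIMSEQ_power_zero) auto
 have pos: "A n > 0" for n using A1[of n] by linarith
 have B4': "B ^ 4 * (L + 1) powr 0 = B ^ 4" "B ^ 4 > 0" using B L by auto
 show ?thesis by (rule bounded_nice_limit[OF bn lim[unfolded B4'(1)] pos B4'(2)]) simp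
qed

end

section \<open>The Marcinkiewicz integral as a vector-valued operator\<close>

abbreviation unitM :: "unit measure" where "unitM \<equiv> count_space UNIV"

lemma l2_unit [simp]: "l2 unitM w = w ()"
 by (simp add: l2_def nn_integral_count_space_finite UNIV_unit)

lemma nrm_unit [simp]: "nrm unitM u x = ecmod (u (x, ()))"
 by (simp add: nrm_def)

lemma sigma_finite_unit: "sigma_finite_measure unitM"
 by (rule sigma_finite_measure_count_space_finite) simp

lemma pair_unit_eq_distr:
 assumes "sigma_finite_measure M"
 shows "M \<Otimes>\<^sub>M unitM = distr M (M \<Otimes>\<^sub>M unitM) (\<lambda>x. (x, ()))"
proof (rule pair_measure_eqI[OF assms sigma_finite_unit])
 fix A and B :: "unit set" assume A: "A \<in> sets M" and "B \<in> sets unitM"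
 consider "B = {}" | "B = UNIV" by (metis UNIV_unit insert_absorb2 subset_singletonD subset_UNIV)
 then show "emeasure M A * emeasure unitM B = emeasure (distr M (M \<Otimes>\<^sub>M unitM) (\<lambda>x. (x, ()))) (A \<times> B)"
 proof cases
  case 2
  have "(\<lambda>x. (x, ())) -` (A \<times> UNIV) \<inter> space M = A" using sets.sets_into_space[OF A] by auto
  then show ?thesis using A 2 by (subst emeasure_distr) (auto simp: UNIV_unit)
 qed simp
qed simp

lemma integral_pair_unit:
 fixes f :: "'a \<times> unit => complex"
 assumes "sigma_finite_measure M" and [measurable]: "f \<in> borel_measurable (M \<Otimes>\<^sub>M unitM)"
 shows "(LINT p|(M \<Otimes>\<^sub>M unitM). f p) = (LINT x|M. f (x, ()))"
 by (subst pair_unit_eq_distr[OF assms(1)], subst integral_distr) auto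

text \<open>The measure \<open>dt / t ^ 3\<close> on the interval from \<open>1 / (n + 1)\<close> to
  \<open>n + 1\<close>. The lower end makes its mass finite, the upper one confines the kernel to
  bounded distances; both are needed for Schur's condition.\<close>

definition cut :: "nat => real measure" where
 "cut n = density lborel (\<lambda>t. ennreal (ind {1 / Suc n<..<Suc n} t * (1 / t ^ 3)))"

lemma sets_cut [simp, measurable_cong]: "sets (cut n) = sets borel"
 by (simp add: cut_def)

lemma space_cut [simp]: "space (cut n) = UNIV"
 by (simp add: cut_def)

lemma nn_integral_cut:
 assumes [measurable]: "f \<in> borel_measurable borel"
 shows "(\<integral>\<^sup>+t. f t \<partial>cut n) = (\<integral>\<^sup>+t. ennreal (ind {1 / Suc n<..<Suc n} t * (1 / t ^ 3)) * f t \<partial>lborel)"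
 unfolding cut_def by (rule nn_integral_density) measurable

lemma sigma_finite_cut: "sigma_finite_measure (cut n)"
 unfolding cut_def
 by (subst sigma_finite_measure.sigma_finite_iff_density_finite[OF lborel.sigma_finite_measure_axioms]) auto

lemma nn_integral_inverse_cube:
 assumes "d > (0::real)"
 shows "(\<integral>\<^sup>+t. ennreal (1 / t ^ 3) * ind {d..} t \<partial>lborel) <= ennreal (1 / d\<^sup>2)"
proof -
 have "(\<integral>\<^sup>+t. ennreal (1 / t ^ 3) * ind {d..} t \<partial>lborel) = (\<integral>\<^sup>+t. ennreal (t powr (- 2 - 1)) * ind {d..} t \<partial>lborel)"
  using assms by (intro nn_integral_cong) (auto simp: indicator_def powr_minus powr_numeral divide_inverse)
 also have "... = ennreal (d powr (- 2) / 2)" using assms by (intro nn_integral_powr_above) auto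
 also have "... <= ennreal (1 / d\<^sup>2)"
  using assms by (intro ennreal_leI) (simp add: powr_minus powr_numeral field_simps)
 finally show ?thesis .
qed

lemma l2_cut_tail:
 assumes "d > 0"
 shows "l2 (cut n) (\<lambda>t. ind {d<..} t) <= ennreal (1 / d)"
proof -
 have "(l2 (cut n) (\<lambda>t. ind {d<..} t))\<^sup>2 = (\<integral>\<^sup>+t. ennreal (ind {1 / Suc n<..<Suc n} t * (1 / t ^ 3)) * (ind {d<..} t)\<^sup>2 \<partial>lborel)"
  unfolding l2_sq by (rule nn_integral_cut) measurable
 also have "... <= (\<integral>\<^sup>+t. ennreal (1 / t ^ 3) * ind {d..} t \<partial>lborel)"
  using assms by (intro nn_integral_mono) (auto simp: indicator_def)
 also have "... <= ennreal (1 / d\<^sup>2)" by (rule nn_integral_inverse_cube[OF assms])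
 also have "... = (ennreal (1 / d))\<^sup>2" using assms by (simp add: ennreal_power power_one_over)
 finally show ?thesis by (simp add: sq_le_sq_ennreal)
qed

lemma l2_cut_total:
 shows "l2 (cut n) (\<lambda>t. ind {d<..} t) <= ennreal (real (Suc n) * ind {..<real (Suc n)} d)"
proof (cases "d < real (Suc n)")
 case True
 have "(l2 (cut n) (\<lambda>t. ind {d<..} t))\<^sup>2 = (\<integral>\<^sup>+t. ennreal (ind {1 / Suc n<..<Suc n} t * (1 / t ^ 3)) * (ind {d<..} t)\<^sup>2 \<partial>lborel)"
  unfolding l2_sq by (rule nn_integral_cut) measurable
 also have "... <= (\<integral>\<^sup>+t. ennreal (1 / t ^ 3) * ind {1 / real (Suc n)..} t \<partial>lborel)"
  by (intro nn_integral_mono) (auto simp: indicator_def)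
 also have "... <= ennreal (1 / (1 / real (Suc n))\<^sup>2)" by (rule nn_integral_inverse_cube) simp
 also have "... = (ennreal (real (Suc n)))\<^sup>2" by (simp add: ennreal_power power_one_over del: of_nat_Suc)
 finally show ?thesis using True by (simp add: sq_le_sq_ennreal)
next
 case False
 have "(l2 (cut n) (\<lambda>t. ind {d<..} t))\<^sup>2 = (\<integral>\<^sup>+t. ennreal (ind {1 / Suc n<..<Suc n} t * (1 / t ^ 3)) * (ind {d<..} t)\<^sup>2 \<partial>lborel)"
  unfolding l2_sq by (rule nn_integral_cut) measurable
 also have "... = (\<integral>\<^sup>+(t::real). 0 \<partial>lborel)"
  using False by (intro nn_integral_cong) (auto simp: indicator_def)
 finally show ?thesis using False sq_le_sq_ennreal[of "l2 (cut n) (\<lambda>t. ind {d<..} t)" 0] by simp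
qed

lemma l2_cut_interval:
 assumes "0 < d1" "d2 - d1 <= h"
 shows "l2 (cut n) (\<lambda>t. ind {d1<..d2} t) <= ennreal (sqrt (h / d1 ^ 3))"
proof (cases "d1 <= d2")
 case True
 have h: "h >= 0" using assms True by simp
 have "(l2 (cut n) (\<lambda>t. ind {d1<..d2} t))\<^sup>2 = (\<integral>\<^sup>+t. ennreal (ind {1 / Suc n<..<Suc n} t * (1 / t ^ 3)) * (ind {d1<..d2} t)\<^sup>2 \<partial>lborel)"
  unfolding l2_sq by (rule nn_integral_cut) measurable
 also have "... <= (\<integral>\<^sup>+t. ennreal (1 / d1 ^ 3) * ind {d1<..d2} t \<partial>lborel)"
  using assms by (intro nn_integral_mono) (auto simp: indicator_def intro!: ennreal_leI divide_left_mono power_mono)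
 also have "... = ennreal (1 / d1 ^ 3) * ennreal (d2 - d1)"
  using True by (simp add: nn_integral_cmult_indicator)
 also have "... <= ennreal (h / d1 ^ 3)"
  using assms True by (simp add: divide_right_mono flip: ennreal_mult) 
 also have "... = (ennreal (sqrt (h / d1 ^ 3)))\<^sup>2" using assms h by (simp add: ennreal_power)
 finally show ?thesis by (simp add: sq_le_sq_ennreal)
next
 case False
 then have "{d1<..d2} = {}" by auto
 then show ?thesis by (simp add: l2_def)
qed

text \<open>The difference of the two step functions is \<open>p - p0\<close> after
  \<open>d0\<close>, plus \<open>p\<close> on the interval between the two jumps. That interval has
  length at most \<open>h\<close>, so the sharp cut at \<open>t\<close> costs a term with the factor
  \<open>sqrt (h / d0)\<close>, whose decay still suffices for summation over dyadic annuli.\<close>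

lemma l2_cut_difference:
 fixes p p0 :: complex
 assumes d: "d0 > 0" "d >= d0 / 2" and h: "\<bar>d - d0\<bar> <= h"
 shows "l2 (cut n) (\<lambda>t. ecmod ((if d < t then p else 0) - (if d0 < t then p0 else 0))) <=
  ennreal (cmod (p - p0) / d0 + cmod p * sqrt (8 * h / d0 ^ 3))"
proof -
 let ?m = "min d d0" and ?M = "max d d0"
 have "l2 (cut n) (\<lambda>t. ecmod ((if d < t then p else 0) - (if d0 < t then p0 else 0))) <=
  l2 (cut n) (\<lambda>t. ecmod (p - p0) * ind {d0<..} t + ennreal (cmod p) * ind {?m<..?M} t)"
 proof (rule l2_mono)
  fix t
  have "cmod p0 <= cmod (p - p0) + cmod p" using norm_triangle_ineq4[of p "p - p0"] by simp
  then have "ennreal (cmod p0) <= ecmod (p - p0) + ennreal (cmod p)"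
   by (simp add: ennreal_leI flip: ennreal_plus)
  then show "ecmod ((if d < t then p else 0) - (if d0 < t then p0 else 0)) <= ecmod (p - p0) * ind {d0<..} t + ennreal (cmod p) * ind {?m<..?M} t"
   by (auto simp: indicator_def min_def max_def)
 qed
 also have "... <= l2 (cut n) (\<lambda>t. ecmod (p - p0) * ind {d0<..} t) + l2 (cut n) (\<lambda>t. ennreal (cmod p) * ind {?m<..?M} t)"
  by (rule l2_add) measurable
 also have "... = ecmod (p - p0) * l2 (cut n) (\<lambda>t. ind {d0<..} t) + ennreal (cmod p) * l2 (cut n) (\<lambda>t. ind {?m<..?M} t)"
  by (subst l2_cmult, measurable)+
 also have "... <= ecmod (p - p0) * ennreal (1 / d0) + ennreal (cmod p) * ennreal (sqrt (h / (d0 / 2) ^ 3))"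
 proof (intro add_mono mult_left_mono l2_cut_tail d(1))
  have "l2 (cut n) (\<lambda>t. ind {?m<..?M} t) <= ennreal (sqrt (h / ?m ^ 3))"
   using d h by (intro l2_cut_interval) auto
  also have "... <= ennreal (sqrt (h / (d0 / 2) ^ 3))"
   using d h by (intro ennreal_leI real_sqrt_le_mono divide_left_mono power_mono) auto
  finally show "l2 (cut n) (\<lambda>t. ind {?m<..?M} t) <= ennreal (sqrt (h / (d0 / 2) ^ 3))" .
 qed auto
 also have "h / (d0 / 2) ^ 3 = 8 * h / d0 ^ 3" by (simp add: power_divide)
 finally show ?thesis using d h by (simp flip: ennreal_mult ennreal_plus)
qed

section \<open>Integrals of the dominating function over dyadic annuli\<close>

lemma (in cz_space) nn_integral_countable_cover:
 fixes f :: "'a => ennreal"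
 assumes "\<And>i::nat. B i \<in> sets M" "D \<subseteq> (\<Union>i. B i)" "\<And>i y. y \<in> B i ==> f y <= ennreal (c i)"
  and "\<And>i. emeasure M (B i) <= ennreal (m i)" "\<And>i. c i >= 0" "\<And>i. m i >= 0" "\<And>i. c i * m i <= s i" "s sums S"
 shows "(\<integral>y. f y * ind D y) <= ennreal S"
proof -
 have "f y * ind D y <= (\<Sum>i. ennreal (c i) * ind (B i) y)" for y
 proof (cases "y \<in> D")
  case True
  then obtain i where i: "y \<in> B i" using assms(2) by blast
  have "f y * ind D y <= ennreal (c i) * ind (B i) y" using i True assms(3) by simp
  also have "... <= (\<Sum>i. ennreal (c i) * ind (B i) y)"
  proof -
   define f where "f i = ennreal (c i) * ind (B i) y" for i
   have "f i = sum f {i}" by simp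
   also have "... <= suminf f" by (rule sum_le_suminf) auto
   finally show ?thesis unfolding f_def .
  qed
  finally show ?thesis .
 qed simp
 then have "(\<integral>y. f y * ind D y) <= (\<integral>y. (\<Sum>i. ennreal (c i) * ind (B i) y))" by (rule nn_integral_mono)
 also have "... = (\<Sum>i. \<integral>y. ennreal (c i) * ind (B i) y)"
  using assms(1) by (intro nn_integral_suminf) auto
 also have "... = (\<Sum>i. ennreal (c i) * emeasure M (B i))"
  using assms(1) by (simp add: nn_integral_cmult_indicator)
 also have "... <= (\<Sum>i. ennreal (s i))"
 proof (rule suminf_le)
  fix i
  have "ennreal (c i) * emeasure M (B i) <= ennreal (c i) * ennreal (m i)" using assms(4) by (rule mult_left_mono) simp
  also have "... <= ennreal (s i)" using assms(5-7)[of i] by (simp add: ennreal_leI flip: ennreal_mult)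
  finally show "ennreal (c i) * emeasure M (B i) <= ennreal (s i)" .
 qed auto
 also have "... = ennreal S"
  using assms(5-8) by (intro suminf_ennreal_eq) (auto intro: order_trans[OF mult_nonneg_nonneg])
 finally show ?thesis .
qed

text \<open>Dyadic annuli shrinking to \<open>x\<close>: halving the radius costs one
  \<open>Cl\<close> in \<open>lam\<close>, so the \<open>i\<close>-th annulus contributes at most
  \<open>Cl * R / 2 ^ i\<close>. The centre is left out since it may be an atom.\<close>

lemma (in cz_space) nn_integral_near:
 assumes R: "R > 0"
 shows "(\<integral>\<^sup>+y. ennreal (dist x y / lam x (dist x y)) * ind {y. x \<noteq> y \<and> dist x y < R} y \<partial>M) <= ennreal (2 * Cl * R)"
proof (rule nn_integral_countable_cover[where B = "\<lambda>i. ball x (R / 2 ^ i) - ball x (R / 2 ^ Suc i)"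
   and c = "\<lambda>i. R / 2 ^ i / lam x (R / 2 ^ Suc i)" and m = "\<lambda>i. lam x (R / 2 ^ i)" and s = "\<lambda>i. Cl * R * (1 / 2) ^ i"])
 show "{y. x \<noteq> y \<and> dist x y < R} \<subseteq> (\<Union>i. ball x (R / 2 ^ i) - ball x (R / 2 ^ Suc i))"
 proof
  fix y assume "y \<in> {y. x \<noteq> y \<and> dist x y < R}"
  then have y: "0 < dist x y" "dist x y < R" by auto
  obtain n :: nat where "R / dist x y < 2 ^ n" using real_arch_pow[of 2 "R / dist x y"] by auto
  then have ex: "\<exists>n. R / 2 ^ n <= dist x y" using y by (intro exI[of _ n]) (simp add: field_simps)
  define k where "k = (LEAST n. R / 2 ^ n <= dist x y)"
  have k: "R / 2 ^ k <= dist x y" unfolding k_def using ex by (rule LeastI_ex)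
  have "k \<noteq> 0" using k y by (intro notI) simp
  then obtain i where i: "k = Suc i" by (cases k) auto
  have "\<not> R / 2 ^ i <= dist x y" using not_less_Least[of i "\<lambda>n. R / 2 ^ n <= dist x y"] i unfolding k_def by auto
  then show "y \<in> (\<Union>i. ball x (R / 2 ^ i) - ball x (R / 2 ^ Suc i))" using k i by (intro UN_I[of i]) auto
 qed
 fix i :: nat
 have r: "R / 2 ^ Suc i > 0" "R / 2 ^ i > 0" using R by auto
 note l = lam_pos[OF r(1), of x] lam_pos[OF r(2), of x]
 show "ennreal (dist x y / lam x (dist x y)) <= ennreal (R / 2 ^ i / lam x (R / 2 ^ Suc i))"
  if "y \<in> ball x (R / 2 ^ i) - ball x (R / 2 ^ Suc i)" for y
  using that r l by (intro ennreal_leI frac_le lam_mono) auto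
 show "emeasure M (ball x (R / 2 ^ i) - ball x (R / 2 ^ Suc i)) <= ennreal (lam x (R / 2 ^ i))"
  by (rule order_trans[OF emeasure_mono ball_le_lam[OF r(2)]]) auto
 show "0 <= R / 2 ^ i / lam x (R / 2 ^ Suc i)" "0 <= lam x (R / 2 ^ i)"
  by (rule divide_nonneg_pos[OF less_imp_le[OF r(2)] l(1)], rule less_imp_le[OF l(2)])
 have "lam x (R / 2 ^ i) <= Cl * lam x (R / 2 ^ Suc i)" using lam_half[OF r(2), of x] by (simp add: mult.commute)
 then have "lam x (R / 2 ^ i) / lam x (R / 2 ^ Suc i) <= Cl" using l by (simp add: divide_le_eq)
 then have "R / 2 ^ i * (lam x (R / 2 ^ i) / lam x (R / 2 ^ Suc i)) <= R / 2 ^ i * Cl" using r by (intro mult_left_mono) auto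
 moreover have "R / 2 ^ i / lam x (R / 2 ^ Suc i) * lam x (R / 2 ^ i) = R / 2 ^ i * (lam x (R / 2 ^ i) / lam x (R / 2 ^ Suc i))"
  by (simp only: times_divide_eq_left times_divide_eq_right)
 moreover have "Cl * R * (1 / 2) ^ i = R / 2 ^ i * Cl" by (simp add: power_one_over)
 ultimately show "R / 2 ^ i / lam x (R / 2 ^ Suc i) * lam x (R / 2 ^ i) <= Cl * R * (1 / 2) ^ i"
  by (simp only:)
 show "(\<lambda>i. Cl * R * (1 / 2) ^ i) sums (2 * Cl * R)"
  using sums_mult[OF geometric_sums[of "1 / 2 :: real"], of "Cl * R"] by (simp add: mult_ac)
qed auto

text \<open>On dyadic annuli of radius \<open>2 ^ i * h\<close> the quotient of measure and
  \<open>lam\<close> is at most \<open>Cl\<close>, and \<open>sqrt (h / dist y x)\<close> decays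
  geometrically. This makes the error term of \<open>l2_cut_difference\<close> integrable.\<close>

lemma (in cz_space) nn_integral_off_ball:
 assumes h: "h > 0"
 shows "(\<integral>x. ennreal (sqrt (h / dist y x) / lam y (dist y x)) * ind {x. 2 * h <= dist y x} x) <= ennreal (4 * Cl)"
proof (rule nn_integral_countable_cover[where B = "\<lambda>i. ball y (2 ^ Suc (Suc i) * h) - ball y (2 ^ Suc i * h)"
   and c = "\<lambda>i. sqrt (1 / 2) ^ Suc i / lam y (2 ^ Suc i * h)" and m = "\<lambda>i. lam y (2 ^ Suc (Suc i) * h)"
   and s = "\<lambda>i. Cl * (3 / 4) ^ i"])
 show "{x. 2 * h <= dist y x} \<subseteq> (\<Union>i. ball y (2 ^ Suc (Suc i) * h) - ball y (2 ^ Suc i * h))"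
 proof
  fix x assume "x \<in> {x. 2 * h <= dist y x}"
  then have y: "2 * h <= dist y x" by auto
  obtain n :: nat where "dist y x / h < 2 ^ n" using real_arch_pow[of 2 "dist y x / h"] by auto
  then have ex: "\<exists>n. dist y x < 2 ^ n * h" using h by (intro exI[of _ n]) (simp add: field_simps)
  define k where "k = (LEAST n. dist y x < 2 ^ n * h)"
  have k: "dist y x < 2 ^ k * h" unfolding k_def using ex by (rule LeastI_ex)
  have "k \<noteq> 0"
  proof
   assume "k = 0"
   with k y h show False by simp
  qed
  moreover have "k \<noteq> 1"
  proof
   assume "k = 1"
   with k y show False by simp
  qed
  ultimately obtain i where i: "k = Suc (Suc i)" by (metis One_nat_def nat.exhaust)
  have "\<not> dist y x < 2 ^ Suc i * h" using not_less_Least[of "Suc i" "\<lambda>n. dist y x < 2 ^ n * h"] i unfolding k_def by auto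
  then show "x \<in> (\<Union>i. ball y (2 ^ Suc (Suc i) * h) - ball y (2 ^ Suc i * h))" using k i by (intro UN_I[of i]) auto
 qed
 fix i :: nat
 have r: "2 ^ Suc i * h > 0" "2 ^ Suc (Suc i) * h > 0" using h by auto
 note l = lam_pos[OF r(1), of y] lam_pos[OF r(2), of y]
 show "ennreal (sqrt (h / dist y x) / lam y (dist y x)) <= ennreal (sqrt (1 / 2) ^ Suc i / lam y (2 ^ Suc i * h))"
  if x: "x \<in> ball y (2 ^ Suc (Suc i) * h) - ball y (2 ^ Suc i * h)" for x
 proof (intro ennreal_leI frac_le lam_mono r l)
  have d: "2 ^ Suc i * h <= dist y x" using x by auto
  have "0 < dist y x" using d r(1) by linarith
  then have "h / dist y x <= h / (2 ^ Suc i * h)" using h by (intro divide_left_mono d mult_pos_pos r(1)) auto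
  also have "... = (1 / 2) ^ Suc i" using h by (simp add: power_one_over)
  finally show "sqrt (h / dist y x) <= sqrt (1 / 2) ^ Suc i" by (simp add: real_sqrt_power[symmetric] real_sqrt_le_mono del: power_Suc)
  show "2 ^ Suc i * h <= dist y x" by (rule d)
 qed simp
 show "emeasure M (ball y (2 ^ Suc (Suc i) * h) - ball y (2 ^ Suc i * h)) <= ennreal (lam y (2 ^ Suc (Suc i) * h))"
  by (rule order_trans[OF emeasure_mono ball_le_lam[OF r(2)]]) auto
 show "0 <= sqrt (1 / 2) ^ Suc i / lam y (2 ^ Suc i * h)" "0 <= lam y (2 ^ Suc (Suc i) * h)" using l by auto
 \<comment> \<open>A rational ratio, for which the geometric series sums to 4.\<close>
 have s: "sqrt (1 / 2) <= 3 / 4" by (rule real_le_lsqrt) (auto simp: power2_eq_square)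
 have "2 ^ Suc (Suc i) * h / 2 = 2 ^ Suc i * h" by simp
 then have "lam y (2 ^ Suc (Suc i) * h) <= Cl * lam y (2 ^ Suc i * h)" using lam_half[OF r(2), of y] by (simp only:)
 then have "lam y (2 ^ Suc (Suc i) * h) / lam y (2 ^ Suc i * h) <= Cl" using l by (simp add: divide_le_eq)
 moreover have "sqrt (1 / 2) ^ Suc i <= (3 / 4) ^ i"
 proof -
  have "sqrt (1 / 2) ^ Suc i <= (3 / 4) ^ Suc i" using s by (intro power_mono) auto
  also have "... <= (3 / 4) ^ i" by (intro power_decreasing) auto
  finally show ?thesis .
 qed
 ultimately have "sqrt (1 / 2) ^ Suc i * (lam y (2 ^ Suc (Suc i) * h) / lam y (2 ^ Suc i * h)) <= (3 / 4) ^ i * Cl"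
  using l by (intro mult_mono) auto
 then show "sqrt (1 / 2) ^ Suc i / lam y (2 ^ Suc i * h) * lam y (2 ^ Suc (Suc i) * h) <= Cl * (3 / 4) ^ i"
  by (simp only: times_divide_eq_left times_divide_eq_right mult.commute[of Cl])
 show "(\<lambda>i. Cl * (3 / 4) ^ i) sums (4 * Cl)"
  using sums_mult[OF geometric_sums[of "3 / 4 :: real"], of Cl] by (simp add: mult_ac)
qed auto

locale marc = cz_space +
 fixes K :: "'a => 'a => complex" and CK :: real
 assumes CK: "CK > 0"
  and K_int: "locally_integrable_on (M \<Otimes>\<^sub>M M) {(x, y). x \<noteq> y} (\<lambda>(x, y). K x y)"
  and K_size: "\<And>x y. x \<noteq> y ==> cmod (K x y) <= CK * (dist x y / lam x (dist x y))"
  and K_Hoermander: "\<And>y y'. (\<integral>\<^sup>+x\<in>{x. dist x y >= 2 * dist y y'}.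
    ennreal ((cmod (K x y - K x y') + cmod (K y x - K y' x)) * (1 / dist x y)) \<partial>M) <= ennreal CK"
begin

text \<open>The value 0 on the diagonal reproduces the omission of \<open>x\<close> in
  \<open>marcinkiewicz\<close>, also when \<open>x\<close> is an atom, and makes the kernel a total
  measurable function.\<close>

definition K0 :: "'a => 'a => complex" where "K0 x y = (if x = y then 0 else K x y)"

text \<open>The sharp cut at distance \<open>t\<close> is part of the kernel, with \<open>t\<close>
  as the variable of the target fibre. The truncation to \<open>(1 / (n + 1), n + 1)\<close> is left
  to the measure \<open>cut n\<close>, so the kernel does not depend on \<open>n\<close>.\<close>

definition kn :: "'a \<times> real => 'a \<times> unit => complex" where
 "kn z w = (if dist (fst z) (fst w) < snd z then K0 (fst z) (fst w) else 0)"

abbreviation bdd where "bdd n \<equiv> bounded_nice M unitM (cut n) kn"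
abbreviation MK where "MK \<equiv> marcinkiewicz M K"

text \<open>Measurability off the diagonal is extracted from local integrability: the complement of
  the diagonal is open and the product has a countable basis.\<close>

lemma measurable_K0 [measurable (raw)]:
 assumes "f \<in> measurable L M" "g \<in> measurable L M"
 shows "(\<lambda>l. K0 (f l) (g l)) \<in> borel_measurable L"
proof -
 obtain B :: "'a set set" where B: "countable B" "topological_basis B" using countable_basis by blast
 have "open {(x :: 'a, y). x \<noteq> y}"
  using open_Collect_neq[OF continuous_on_fst[OF continuous_on_id] continuous_on_snd[OF continuous_on_id]]
  by (simp add: case_prod_unfold)
 then have "(\<lambda>z. ind {(x, y). x \<noteq> y} z *\<^sub>R (\<lambda>(x, y). K x y) z) \<in> borel_measurable (M \<Otimes>\<^sub>M M)"
  using B K_int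
  by (intro measurable_if_locally_integrable[of "(\<lambda>(a, b). a \<times> b) ` (B \<times> B)"] topological_basis_prod open_in_product) auto
 also have "(\<lambda>z. ind {(x, y). x \<noteq> y} z *\<^sub>R (\<lambda>(x, y). K x y) z) = (\<lambda>z. K0 (fst z) (snd z))"
  by (auto simp: fun_eq_iff K0_def)
 finally have "(\<lambda>z. K0 (fst z) (snd z)) \<in> borel_measurable (M \<Otimes>\<^sub>M M)" .
 from measurable_compose[OF measurable_Pair[OF assms] this] show ?thesis by simp
qed

section \<open>The kernel conditions for the truncated operator\<close>

lemma hs_kernel_kn: "hs_kernel M unitM (cut n) kn"
proof (intro hs_kernel.intro hs_kernel_axioms.intro sigma_finite_measure_axioms sigma_finite_unit sigma_finite_cut)
 show "(\<lambda>(z, w). kn z w) \<in> borel_measurable ((M \<Otimes>\<^sub>M cut n) \<Otimes>\<^sub>M (M \<Otimes>\<^sub>M unitM))"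
  unfolding kn_def by measurable
qed

lemma hs_kn: "hs unitM (cut n) kn x y = ecmod (K0 x y) * l2 (cut n) (\<lambda>t. ind {dist x y<..} t)"
proof -
 have "hs unitM (cut n) kn x y = l2 (cut n) (\<lambda>t. ecmod (K0 x y) * ind {dist x y<..} t)"
  unfolding hs_def by (simp add: kn_def) (auto intro!: arg_cong[where f = "l2 (cut n)"] simp: fun_eq_iff)
 then show ?thesis by (subst (asm) l2_cmult) measurable
qed

lemma hs_kn_size:
 assumes "x \<noteq> y"
 shows "hs unitM (cut n) kn x y <= ennreal (CK / lam x (dist x y))"
proof -
 have d: "dist x y > 0" using assms by simp
 have "hs unitM (cut n) kn x y <= ennreal (CK * (dist x y / lam x (dist x y))) * ennreal (1 / dist x y)"
  unfolding hs_kn using assms K_size[OF assms] by (intro mult_mono l2_cut_tail ennreal_leI) (auto simp: K0_def)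
 also have "... = ennreal (CK / lam x (dist x y))"
  using d CK lam_pos[OF d, of x] by (simp flip: ennreal_mult)
 finally show ?thesis .
qed

lemma lam_symmetric: "x \<noteq> y ==> lam y (dist x y) <= Cl * lam x (dist x y)"
 using lam_comp[of "dist x y" y x] by (simp add: dist_commute)

lemma hs_kn_size':
 assumes "x \<noteq> y"
 shows "hs unitM (cut n) kn x y <= ennreal (CK * Cl / lam y (dist x y))"
proof -
 have d: "dist x y > 0" using assms by simp
 have "CK / lam x (dist x y) <= CK * Cl / lam y (dist x y)"
  using lam_symmetric[OF assms] lam_pos[OF d, of x] lam_pos[OF d, of y] CK by (simp add: field_simps)
 then show ?thesis using hs_kn_size[OF assms] by (meson ennreal_leI order_trans)
qed

lemma hs_kn_Schur:
 fixes n :: nat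
 defines "L \<equiv> 2 * CK * Cl\<^sup>2 * (real (Suc n))\<^sup>2"
 shows "(\<integral>x. hs unitM (cut n) kn x y) <= ennreal L"
  "(\<integral>y. hs unitM (cut n) kn x y) <= ennreal L"
proof -
 let ?n = "real (Suc n)"
 \<comment> \<open>Allowing \<open>lam\<close> to be centred at either point lets one estimate serve
   both marginal integrals.\<close>
 have le: "hs unitM (cut n) kn x y <=
   ennreal (CK * Cl * ?n) * (ennreal (dist x y / lam z (dist x y)) * ind {y. x \<noteq> y \<and> dist x y < ?n} y)" if z: "z = x \<or> z = y" for x y z
 proof (cases "x = y")
  case False
  then have d: "dist x y > 0" by simp
  have "lam z (dist x y) <= Cl * lam x (dist x y)"
   using z lam_symmetric[OF False] Cl_ge_1 lam_pos[OF d, of x] by (auto simp: mult_le_cancel_right1)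
  then have "dist x y / lam x (dist x y) <= Cl * (dist x y / lam z (dist x y))"
   using d lam_pos[OF d, of x] lam_pos[OF d, of z] by (simp add: field_simps)
  then have "CK * (dist x y / lam x (dist x y)) <= CK * (Cl * (dist x y / lam z (dist x y)))" by (rule mult_left_mono) (use CK in simp)
  then have K: "cmod (K0 x y) <= CK * Cl * (dist x y / lam z (dist x y))"
   using K_size[OF False] False unfolding K0_def by simp
  have "hs unitM (cut n) kn x y <= ennreal (CK * Cl * (dist x y / lam z (dist x y))) * ennreal (?n * ind {..<?n} (dist x y))"
   unfolding hs_kn using K by (intro mult_mono l2_cut_total ennreal_leI) auto
  also have "... = ennreal (CK * Cl * ?n) * (ennreal (dist x y / lam z (dist x y)) * ind {y. x \<noteq> y \<and> dist x y < ?n} y)"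
  proof (cases "dist x y < ?n")
   case True
   have "ennreal (CK * Cl * (dist x y / lam z (dist x y))) * ennreal ?n = ennreal (CK * Cl * ?n) * ennreal (dist x y / lam z (dist x y))"
    using CK Cl_pos lam_pos[OF d, of z] by (simp add: mult_ac del: of_nat_Suc flip: ennreal_mult)
   then show ?thesis using True False by (simp del: of_nat_Suc)
  qed simp
  finally show ?thesis .
 qed (simp add: hs_kn K0_def)
 have meas: "(\<lambda>y. ennreal (dist z y / lam z (dist z y)) * ind {y. z \<noteq> y \<and> dist z y < ?n} y) \<in> borel_measurable M" for z
 proof -
  have "(\<lambda>t. ind {0<..} t *\<^sub>R lam z t) \<in> borel_measurable borel"
   using borel_measurable_mono_on_fnc[OF lam_mono'[of z]] by (subst borel_measurable_restrict_space_iff[symmetric]) auto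
  then have "(\<lambda>y. ind {0<..} (dist z y) *\<^sub>R lam z (dist z y)) \<in> borel_measurable M"
   by (rule measurable_compose[rotated]) measurable
  then have "(\<lambda>y. ennreal (dist z y / (ind {0<..} (dist z y) *\<^sub>R lam z (dist z y))) * ind {..<?n} (dist z y)) \<in> borel_measurable M"
   by measurable
  also have "(\<lambda>y. ennreal (dist z y / (ind {0<..} (dist z y) *\<^sub>R lam z (dist z y))) * ind {..<?n} (dist z y)) =
   (\<lambda>y. ennreal (dist z y / lam z (dist z y)) * ind {y. z \<noteq> y \<and> dist z y < ?n} y)"
   by (auto simp: fun_eq_iff indicator_def)
  finally show ?thesis .
 qed
 have tot: "(\<integral>y. ennreal (CK * Cl * ?n) * (ennreal (dist z y / lam z (dist z y)) * ind {y. z \<noteq> y \<and> dist z y < ?n} y)) <= ennreal L" for z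
 proof -
  have "(\<integral>y. ennreal (CK * Cl * ?n) * (ennreal (dist z y / lam z (dist z y)) * ind {y. z \<noteq> y \<and> dist z y < ?n} y))
    = ennreal (CK * Cl * ?n) * (\<integral>y. ennreal (dist z y / lam z (dist z y)) * ind {y. z \<noteq> y \<and> dist z y < ?n} y)"
   by (rule nn_integral_cmult[OF meas])
  also have "... <= ennreal (CK * Cl * ?n) * ennreal (2 * Cl * ?n)"
   by (intro mult_left_mono nn_integral_near) auto
  also have "... = ennreal L" unfolding L_def using CK Cl_pos
   by (simp add: power2_eq_square mult_ac del: of_nat_Suc flip: ennreal_mult)
  finally show ?thesis .
 qed
 show "(\<integral>y. hs unitM (cut n) kn x y) <= ennreal L"
  by (rule order_trans[OF nn_integral_mono tot[of x]]) (rule le, simp)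
 have "(\<integral>x. hs unitM (cut n) kn x y) <=
  (\<integral>x. ennreal (CK * Cl * ?n) * (ennreal (dist y x / lam y (dist y x)) * ind {x. y \<noteq> x \<and> dist y x < ?n} x))"
 proof (intro nn_integral_mono)
  fix x
  show "hs unitM (cut n) kn x y <= ennreal (CK * Cl * ?n) * (ennreal (dist y x / lam y (dist y x)) * ind {x. y \<noteq> x \<and> dist y x < ?n} x)"
   using le[of y x y] by (simp add: dist_commute indicator_def eq_commute)
 qed
 then show "(\<integral>x. hs unitM (cut n) kn x y) <= ennreal L"
  using tot[of y] by (rule order_trans)
qed

text \<open>The variation of \<open>P\<close> is the hypothesis \<open>horm\<close>; the
  displacement of the jump is paid for by the size of \<open>P\<close> and
  \<open>nn_integral_off_ball\<close>. Stated for a general \<open>P\<close> so that it covers both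
  \<open>K0 x y\<close> and \<open>K0 y x\<close>, that is, the kernel and its adjoint.\<close>

lemma Hoermander_cut:
 fixes P :: "'a => 'a => complex"
 assumes [measurable]: "\<And>y. (\<lambda>x. P x y) \<in> borel_measurable M"
  and size: "\<And>x. 2 * dist y y0 <= dist x y0 ==> x \<noteq> y0 ==> cmod (P x y) <= 2 * CK * Cl\<^sup>2 * (dist x y0 / lam y0 (dist x y0))"
  and horm: "(\<integral>x. ennreal (cmod (P x y - P x y0) / dist x y0) * ind {x. 2 * dist y y0 <= dist x y0} x) <= ennreal CK"
 shows "(\<integral>x. l2 (cut n) (\<lambda>t. ecmod ((if dist x y < t then P x y else 0) - (if dist x y0 < t then P x y0 else 0))) *
   ind {x. 2 * dist y y0 <= dist x y0} x) <= ennreal (CK + 24 * CK * Cl ^ 3)"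
proof (cases "y = y0")
 case True
 show ?thesis unfolding True by (simp add: l2_def)
next
 case False
 define h where "h = dist y y0"
 have h: "h > 0" unfolding h_def using False by simp
 let ?f = "\<lambda>x. ennreal (cmod (P x y - P x y0) / dist x y0) * ind {x. 2 * dist y y0 <= dist x y0} x"
 let ?g = "\<lambda>x. ennreal (sqrt (h / dist y0 x) / lam y0 (dist y0 x)) * ind {x. 2 * h <= dist y0 x} x"
 have gm [measurable]: "?g \<in> borel_measurable M"
 proof -
  have "mono (\<lambda>t. lam y0 (max t (2 * h)))" using h by (intro monoI lam_mono) auto
  then have [measurable]: "(\<lambda>t. lam y0 (max t (2 * h))) \<in> borel_measurable borel" by (rule borel_measurable_mono)
  have "(\<lambda>x. ennreal (sqrt (h / dist y0 x) / lam y0 (max (dist y0 x) (2 * h))) * ind {2 * h..} (dist y0 x)) \<in> borel_measurable M"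
   by measurable
  also have "(\<lambda>x. ennreal (sqrt (h / dist y0 x) / lam y0 (max (dist y0 x) (2 * h))) * ind {2 * h..} (dist y0 x)) = ?g"
   by (auto simp: fun_eq_iff indicator_def max_def)
  finally show ?thesis .
 qed
 have fm [measurable]: "?f \<in> borel_measurable M"
 proof -
  have "(\<lambda>x. ennreal (cmod (P x y - P x y0) / dist x y0) * ind {2 * dist y y0..} (dist x y0)) \<in> borel_measurable M"
   by measurable
  then show ?thesis by (simp add: indicator_def)
 qed
 have "l2 (cut n) (\<lambda>t. ecmod ((if dist x y < t then P x y else 0) - (if dist x y0 < t then P x y0 else 0))) *
   ind {x. 2 * dist y y0 <= dist x y0} x <= ?f x + ennreal (6 * CK * Cl\<^sup>2) * ?g x" for x
 proof (cases "2 * dist y y0 <= dist x y0")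
  case True
  define d0 where "d0 = dist x y0"
  define d where "d = dist x y"
  have hd: "2 * h <= d0" using True unfolding h_def d0_def by simp
  have d0: "d0 > 0" using hd h by linarith
  have "\<bar>d - d0\<bar> <= h" unfolding d_def d0_def h_def
   using abs_dist_diff_le[of y x y0] by (simp add: dist_commute)
  moreover have "d >= d0 / 2" using calculation hd by linarith
  ultimately have 1: "l2 (cut n) (\<lambda>t. ecmod ((if d < t then P x y else 0) - (if d0 < t then P x y0 else 0))) <=
    ennreal (cmod (P x y - P x y0) / d0 + cmod (P x y) * sqrt (8 * h / d0 ^ 3))"
   using d0 by (intro l2_cut_difference) auto
  have l: "lam y0 d0 > 0" using d0 by (rule lam_pos)
  have "x \<noteq> y0" using d0 unfolding d0_def by auto
  then have P: "cmod (P x y) <= 2 * CK * Cl\<^sup>2 * (d0 / lam y0 d0)" using size[OF True] unfolding d0_def by simp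
  have "8 * h / d0 ^ 3 = 8 * (h / d0) * (1 / d0)\<^sup>2" using d0 by (simp add: power2_eq_square power3_eq_cube)
  then have "sqrt (8 * h / d0 ^ 3) = sqrt 8 * sqrt (h / d0) * (1 / d0)" using d0 by (simp add: real_sqrt_mult real_sqrt_divide)
  also have "... <= 3 * sqrt (h / d0) * (1 / d0)"
   using d0 h by (intro mult_right_mono real_le_lsqrt) auto
  finally have "cmod (P x y) * sqrt (8 * h / d0 ^ 3) <= 2 * CK * Cl\<^sup>2 * (d0 / lam y0 d0) * (3 * sqrt (h / d0) * (1 / d0))"
   using P d0 h l CK by (intro mult_mono) auto
  also have "... = 6 * CK * Cl\<^sup>2 * (sqrt (h / d0) / lam y0 d0)" using d0 by (simp add: field_simps)
  finally have 2: "cmod (P x y) * sqrt (8 * h / d0 ^ 3) <= 6 * CK * Cl\<^sup>2 * (sqrt (h / d0) / lam y0 d0)" .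
  have "ennreal (cmod (P x y - P x y0) / d0 + cmod (P x y) * sqrt (8 * h / d0 ^ 3)) <=
   ennreal (cmod (P x y - P x y0) / d0 + 6 * CK * Cl\<^sup>2 * (sqrt (h / d0) / lam y0 d0))"
   using 2 by (intro ennreal_leI add_left_mono)
  also have "... = ennreal (cmod (P x y - P x y0) / d0) + ennreal (6 * CK * Cl\<^sup>2) * ennreal (sqrt (h / d0) / lam y0 d0)"
   using d0 h l CK by (simp flip: ennreal_mult ennreal_plus)
  finally show ?thesis using True order_trans[OF 1] unfolding d_def d0_def h_def by (simp add: dist_commute[of y0 x])
 qed simp
 then have "(\<integral>x. l2 (cut n) (\<lambda>t. ecmod ((if dist x y < t then P x y else 0) - (if dist x y0 < t then P x y0 else 0))) *
   ind {x. 2 * dist y y0 <= dist x y0} x) <= (\<integral>x. ?f x + ennreal (6 * CK * Cl\<^sup>2) * ?g x)"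
  by (rule nn_integral_mono)
 also have "... = (\<integral>x. ?f x) + (\<integral>x. ennreal (6 * CK * Cl\<^sup>2) * ?g x)"
  by (rule nn_integral_add) (use fm gm in measurable)
 also have "(\<integral>x. ennreal (6 * CK * Cl\<^sup>2) * ?g x) = ennreal (6 * CK * Cl\<^sup>2) * (\<integral>x. ?g x)"
  by (rule nn_integral_cmult[OF gm])
 also have "(\<integral>x. ?f x) + ennreal (6 * CK * Cl\<^sup>2) * (\<integral>x. ?g x) <= ennreal CK + ennreal (6 * CK * Cl\<^sup>2) * ennreal (4 * Cl)"
  by (intro add_mono mult_left_mono horm nn_integral_off_ball h) auto
 also have "... = ennreal (CK + 24 * CK * Cl ^ 3)"
  using CK Cl_pos by (simp add: power2_eq_square power3_eq_cube mult_ac flip: ennreal_mult ennreal_plus)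
 finally show ?thesis .
qed

text \<open>\<open>CK * Cl\<close> is the size constant of the adjoint kernel, where
  \<open>lam\<close> has to be recentred; the other summands are the constant of
  \<open>Hoermander_cut\<close>. The sum serves both kernels.\<close>

definition Ck where "Ck = CK * Cl + CK + 24 * CK * Cl ^ 3"

definition Ln where "Ln n = 2 * CK * Cl\<^sup>2 * (real (Suc n))\<^sup>2" for n :: nat

lemma Ck_ge: "CK + 24 * CK * Cl ^ 3 <= Ck" "CK <= Ck" "CK * Cl <= Ck" "Ck >= 0"
proof -
 have "0 <= CK * Cl" "0 <= CK * Cl ^ 3" using CK Cl_pos by auto
 then show "CK + 24 * CK * Cl ^ 3 <= Ck" "CK <= Ck" "CK * Cl <= Ck" "Ck >= 0" unfolding Ck_def using CK by auto
qed

text \<open>In Hoermander's region all distances from \<open>x\<close> agree up to the factor 2. One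
  \<open>Cl\<close> moves the centre of \<open>lam\<close>, the other halves its radius.\<close>

lemma lam_shift:
 assumes "2 * dist y y0 <= dist x y0" "x \<noteq> y0"
 shows "dist x y >= dist x y0 / 2" "dist x y <= 2 * dist x y0" "x \<noteq> y"
  "lam y0 (dist x y0) <= Cl\<^sup>2 * lam x (dist x y)" "lam y0 (dist x y0) <= Cl\<^sup>2 * lam y (dist x y)"
proof -
 have t: "dist x y0 <= dist x y + dist y y0" "dist x y <= dist x y0 + dist y y0"
  using dist_triangle[of x y0 y] dist_triangle[of x y y0] by (auto simp: dist_commute)
 show d: "dist x y >= dist x y0 / 2" "dist x y <= 2 * dist x y0" using t assms by auto
 have d0: "dist x y0 > 0" using assms by simp
 then show "x \<noteq> y" using d by auto
 have *: "lam y0 (dist x y0) <= Cl\<^sup>2 * lam z (dist x y)" if "dist y0 z <= dist x y0" for z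
 proof -
  have "lam y0 (dist x y0) <= Cl * lam z (dist x y0)" using d0 that by (rule lam_comp)
  also have "... <= Cl * (Cl * lam z (dist x y0 / 2))" using d0 Cl_pos by (intro mult_left_mono lam_half) auto
  also have "... <= Cl * (Cl * lam z (dist x y))" using d0 d Cl_pos by (intro mult_left_mono lam_mono) auto
  finally show ?thesis by (simp add: power2_eq_square mult.assoc)
 qed
 show "lam y0 (dist x y0) <= Cl\<^sup>2 * lam x (dist x y)" by (rule *) (simp add: dist_commute)
 show "lam y0 (dist x y0) <= Cl\<^sup>2 * lam y (dist x y)"
  using assms(1) zero_le_dist[of y y0] by (intro *) (subst dist_commute, linarith)
qed

lemma size_shift:
 assumes "2 * dist y y0 <= dist x y0" "x \<noteq> y0"
 shows "cmod (K0 x y) <= 2 * CK * Cl\<^sup>2 * (dist x y0 / lam y0 (dist x y0))"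
  "cmod (K0 y x) <= 2 * CK * Cl\<^sup>2 * (dist x y0 / lam y0 (dist x y0))"
proof -
 note s = lam_shift[OF assms]
 have d: "dist x y > 0" and d0: "dist x y0 > 0" using s(3) assms by auto
 have *: "CK * (dist x y / lam z (dist x y)) <= 2 * CK * Cl\<^sup>2 * (dist x y0 / lam y0 (dist x y0))"
  if z: "lam y0 (dist x y0) <= Cl\<^sup>2 * lam z (dist x y)" for z
 proof -
  have l: "lam z (dist x y) > 0" "lam y0 (dist x y0) > 0" using d d0 by (auto intro: lam_pos)
  have "1 / lam z (dist x y) <= Cl\<^sup>2 / lam y0 (dist x y0)" using z l by (simp add: field_simps)
  then have "dist x y * (1 / lam z (dist x y)) <= (2 * dist x y0) * (Cl\<^sup>2 / lam y0 (dist x y0))"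
   using s(2) l by (intro mult_mono) auto
  then have "CK * (dist x y * (1 / lam z (dist x y))) <= CK * ((2 * dist x y0) * (Cl\<^sup>2 / lam y0 (dist x y0)))"
   using CK by (intro mult_left_mono) auto
  then show ?thesis by (simp add: mult_ac)
 qed
 have "cmod (K0 x y) <= CK * (dist x y / lam x (dist x y))" "cmod (K0 y x) <= CK * (dist x y / lam y (dist x y))"
  using K_size[of x y] K_size[of y x] s(3) unfolding K0_def by (auto simp: dist_commute)
 then show "cmod (K0 x y) <= 2 * CK * Cl\<^sup>2 * (dist x y0 / lam y0 (dist x y0))"
  "cmod (K0 y x) <= 2 * CK * Cl\<^sup>2 * (dist x y0 / lam y0 (dist x y0))"
  using *[OF s(4)] *[OF s(5)] by auto
qed

lemma horm_K0:
 shows "(\<integral>x. ennreal (cmod (K0 x y - K0 x y0) / dist x y0) * ind {x. 2 * dist y y0 <= dist x y0} x) <= ennreal CK"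
  "(\<integral>x. ennreal (cmod (K0 y x - K0 y0 x) / dist x y0) * ind {x. 2 * dist y y0 <= dist x y0} x) <= ennreal CK"
proof -
 have *: "ennreal (cmod (K0 x y - K0 x y0) / dist x y0) * ind {x. 2 * dist y y0 <= dist x y0} x <=
   ennreal ((cmod (K x y0 - K x y) + cmod (K y0 x - K y x)) * (1 / dist x y0)) * ind {x. 2 * dist y0 y <= dist x y0} x \<and>
  ennreal (cmod (K0 y x - K0 y0 x) / dist x y0) * ind {x. 2 * dist y y0 <= dist x y0} x <=
   ennreal ((cmod (K x y0 - K x y) + cmod (K y0 x - K y x)) * (1 / dist x y0)) * ind {x. 2 * dist y0 y <= dist x y0} x" for x
 proof (cases "2 * dist y y0 <= dist x y0 \<and> x \<noteq> y0")
  case True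
  then have "x \<noteq> y" using lam_shift(3) by blast
  then show ?thesis using True unfolding K0_def
   by (auto simp: norm_minus_commute dist_commute intro!: ennreal_leI divide_right_mono)
 next
  case False
  then show ?thesis by (auto simp: indicator_def)
 qed
 show "(\<integral>x. ennreal (cmod (K0 x y - K0 x y0) / dist x y0) * ind {x. 2 * dist y y0 <= dist x y0} x) <= ennreal CK"
  by (rule order_trans[OF nn_integral_mono K_Hoermander[of y0 y]]) (use * in blast)
 show "(\<integral>x. ennreal (cmod (K0 y x - K0 y0 x) / dist x y0) * ind {x. 2 * dist y y0 <= dist x y0} x) <= ennreal CK"
  by (rule order_trans[OF nn_integral_mono K_Hoermander[of y0 y]]) (use * in blast)
qed

lemma cz_kernel_kn: "cz_kernel M lam Cl N a unitM (cut n) kn Ck (Ln n)"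
proof (intro cz_kernel.intro cz_space_axioms hs_kernel_kn cz_kernel_axioms.intro)
 show "Ck >= 0" by (rule Ck_ge)
 show "Ln n >= 0" unfolding Ln_def using CK by simp
 fix x y
 show "hs unitM (cut n) kn x y <= ennreal (Ck / lam x (dist x y))" if "x \<noteq> y"
 proof -
  have "CK / lam x (dist x y) <= Ck / lam x (dist x y)" using lam_pos[of "dist x y" x] that Ck_ge by (intro divide_right_mono) auto
  then show ?thesis using hs_kn_size[OF that] by (meson ennreal_leI order_trans)
 qed
 show "hs unitM (cut n) kn x x = 0" by (simp add: hs_kn K0_def)
 show "(\<integral>x. hs unitM (cut n) kn x y) <= ennreal (Ln n)"
  "(\<integral>y. hs unitM (cut n) kn x y) <= ennreal (Ln n)"
  unfolding Ln_def by (rule hs_kn_Schur)+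
 fix y0
 have "(\<integral>x. hs unitM (cut n) (\<lambda>z w. kn z w - kn z (y0, snd w)) x y * ind {x. 2 * dist y y0 <= dist x y0} x)
   <= ennreal (CK + 24 * CK * Cl ^ 3)"
  unfolding hs_def l2_unit kn_def fst_conv snd_conv by (rule Hoermander_cut[OF _ size_shift(1) horm_K0(1)]) measurable
 also have "... <= ennreal Ck" by (intro ennreal_leI Ck_ge)
 finally show "(\<integral>x. hs unitM (cut n) (\<lambda>z w. kn z w - kn z (y0, snd w)) x y * ind {x. 2 * dist y y0 <= dist x y0} x) <= ennreal Ck" .
qed

sublocale k: cz_kernel M lam Cl N a unitM "cut n" kn Ck "Ln n" for n
 by (rule cz_kernel_kn)

text \<open>The hypotheses on \<open>K\<close> are symmetric in the two variables up to the centre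
  of \<open>lam\<close>, so the transposed kernel satisfies the same conditions with the same
  constants. This gives access to exponents above 2.\<close>

lemma cz_kernel_adjoint: "cz_kernel M lam Cl N a (cut n) unitM (\<lambda>w z. kn z w) Ck (Ln n)"
proof -
 interpret k: hs_kernel M unitM "cut n" kn by (rule hs_kernel_kn)
 have hs': "hs (cut n) unitM (\<lambda>w z. kn z w) y x = hs unitM (cut n) kn x y" for x y
  by (rule k.hs_adjoint) auto
 show ?thesis
 proof (intro cz_kernel.intro cz_space_axioms k.adjoint_kernel cz_kernel_axioms.intro, unfold hs')
  show "Ck >= 0" by (rule Ck_ge)
  show "Ln n >= 0" unfolding Ln_def using CK by simp
  fix x y
  show "hs unitM (cut n) kn y x <= ennreal (Ck / lam x (dist x y))" if "x \<noteq> y"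
  proof -
   have "CK * Cl / lam x (dist x y) <= Ck / lam x (dist x y)" using lam_pos[of "dist x y" x] that Ck_ge by (intro divide_right_mono) auto
   then show ?thesis using hs_kn_size'[of y x n] that by (metis dist_commute ennreal_leI order_trans)
  qed
  show "hs unitM (cut n) kn x x = 0" by (simp add: hs_kn K0_def)
  show "(\<integral>x. hs unitM (cut n) kn y x) <= ennreal (Ln n)"
   "(\<integral>y. hs unitM (cut n) kn y x) <= ennreal (Ln n)"
   unfolding Ln_def by (rule hs_kn_Schur)+
  fix y0
  have "(\<integral>x. hs (cut n) unitM (\<lambda>z w. kn w z - kn (y0, snd w) z) x y * ind {x. 2 * dist y y0 <= dist x y0} x)
   = (\<integral>x. l2 (cut n) (\<lambda>t. ecmod ((if dist x y < t then K0 y x else 0) - (if dist x y0 < t then K0 y0 x else 0))) *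
   ind {x. 2 * dist y y0 <= dist x y0} x)"
  proof (intro nn_integral_cong)
   fix x
   show "hs (cut n) unitM (\<lambda>z w. kn w z - kn (y0, snd w) z) x y * ind {x. 2 * dist y y0 <= dist x y0} x
    = l2 (cut n) (\<lambda>t. ecmod ((if dist x y < t then K0 y x else 0) - (if dist x y0 < t then K0 y0 x else 0))) *
     ind {x. 2 * dist y y0 <= dist x y0} x"
    unfolding hs_def l2_unit kn_def fst_conv snd_conv dist_commute[of y x] dist_commute[of y0 x] ..
  qed
  also have "... <= ennreal (CK + 24 * CK * Cl ^ 3)"
   by (rule Hoermander_cut[OF _ size_shift(2) horm_K0(2)]) measurable
  also have "... <= ennreal Ck" by (intro ennreal_leI Ck_ge)
  finally show "(\<integral>x. hs (cut n) unitM (\<lambda>z w. kn w z - kn (y0, snd w) z) x y * ind {x. 2 * dist y y0 <= dist x y0} x) <= ennreal Ck" .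
 qed
qed

section \<open>The truncated operators and their limit\<close>

definition Sn :: "nat => ('a => complex) => 'a => ennreal" where
 "Sn n f = nrm (cut n) (int_op (M \<Otimes>\<^sub>M unitM) kn (\<lambda>p. f (fst p)))"

definition avg :: "('a => complex) => 'a => real => complex" where
 "avg f x t = (LINT y:(ball x t - {x})|M. K x y * f y)"

lemma unit_fun: "(u :: 'a \<times> unit => complex) = (\<lambda>p. (\<lambda>x. u (x, ())) (fst p))"
 by (auto simp: fun_eq_iff)

lemma measurable_lift [measurable]:
 "f \<in> borel_measurable M ==> (\<lambda>p. f (fst p)) \<in> borel_measurable (M \<Otimes>\<^sub>M unitM)"
 by (rule measurable_compose[OF measurable_fst])

lemma measurable_kn [measurable (raw)]:
 assumes "f \<in> measurable L (M \<Otimes>\<^sub>M borel)" "g \<in> measurable L (M \<Otimes>\<^sub>M unitM)"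
 shows "(\<lambda>l. kn (f l) (g l)) \<in> borel_measurable L"
proof -
 have [measurable]: "(\<lambda>l. fst (f l)) \<in> measurable L M" "(\<lambda>l. snd (f l)) \<in> measurable L borel"
  "(\<lambda>l. fst (g l)) \<in> measurable L M"
  using measurable_compose[OF assms(1) measurable_fst] measurable_compose[OF assms(1) measurable_snd]
   measurable_compose[OF assms(2) measurable_fst] by auto
 show ?thesis unfolding kn_def by measurable
qed

lemma int_op_kn:
 assumes [measurable]: "f \<in> borel_measurable M"
 shows "int_op (M \<Otimes>\<^sub>M unitM) kn (\<lambda>p. f (fst p)) (x, t) = (LINT y|M. kn (x, t) (y, ()) * f y)"
  "(LINT y|M. kn (x, t) (y, ()) * f y) = avg f x t"
proof -
 have [measurable]: "(\<lambda>_. (x, t)) \<in> measurable L (M \<Otimes>\<^sub>M borel)" for L :: "'l measure"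
  by (intro measurable_const) (simp add: space_pair_measure)
 show "int_op (M \<Otimes>\<^sub>M unitM) kn (\<lambda>p. f (fst p)) (x, t) = (LINT y|M. kn (x, t) (y, ()) * f y)"
  unfolding int_op_def by (subst integral_pair_unit[OF sigma_finite_measure_axioms]) auto
 show "(LINT y|M. kn (x, t) (y, ()) * f y) = avg f x t"
  unfolding avg_def set_lebesgue_integral_def
  by (intro Bochner_Integration.integral_cong refl) (auto simp: kn_def K0_def indicator_def)
qed

lemma measurable_avg:
 assumes [measurable]: "f \<in> borel_measurable M"
 shows "(\<lambda>z. avg f (fst z) (snd z)) \<in> borel_measurable (M \<Otimes>\<^sub>M borel)"
proof -
 have "(\<lambda>z. LINT y|M. kn (fst z, snd z) (y, ()) * f y) \<in> borel_measurable (M \<Otimes>\<^sub>M borel)" by measurable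
 then show ?thesis unfolding int_op_kn(2)[OF assms] .
qed

lemma measurable_avg_t [measurable]:
 assumes "f \<in> borel_measurable M" shows "(\<lambda>t. avg f x t) \<in> borel_measurable borel"
 using measurable_compose[OF measurable_Pair1'[of x M borel] measurable_avg[OF assms]] by simp

lemma Sn_sq:
 assumes f: "f \<in> borel_measurable M"
 shows "(Sn n f x)\<^sup>2 = (\<integral>\<^sup>+t. ennreal (ind {1 / Suc n<..<Suc n} t * (1 / t ^ 3)) * (ecmod (avg f x t))\<^sup>2 \<partial>lborel)"
 unfolding Sn_def nrm_def l2_sq int_op_kn(1)[OF f] int_op_kn(2)[OF f]
 by (rule nn_integral_cut) (use measurable_avg_t[OF f] in measurable)

lemma marcinkiewicz_sq:
 "(MK f x)\<^sup>2 = (\<integral>\<^sup>+t\<in>{0<..}. ennreal ((cmod (avg f x t))\<^sup>2 * (1 / t ^ 3)) \<partial>lborel)"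
 unfolding marcinkiewicz_def avg_def by simp

text \<open>Monotone convergence in \<open>t\<close>, stated for squares because these are the
  integrals. Estimates uniform in \<open>n\<close> thereby become estimates of the Marcinkiewicz
  integral.\<close>

lemma marcinkiewicz_SUP:
 assumes f: "f \<in> borel_measurable M"
 shows "(MK f x)\<^sup>2 = (SUP n. (Sn n f x)\<^sup>2)" and "incseq (\<lambda>n. (Sn n f x)\<^sup>2)"
proof -
 note [measurable] = measurable_avg_t[OF f]
 let ?g = "\<lambda>n t. ennreal (ind {1 / Suc n<..<Suc n} t * (1 / t ^ 3)) * (ecmod (avg f x t))\<^sup>2"
 have sub: "{1 / real (Suc n)<..<real (Suc n)} \<subseteq> {1 / real (Suc (Suc n))<..<real (Suc (Suc n))}" for n
 proof -
  have "1 / real (Suc (Suc n)) <= 1 / real (Suc n)" by (intro divide_left_mono) auto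
  then show ?thesis by (intro greaterThanLessThan_subseteq_greaterThanLessThan[THEN iffD2]) auto
 qed
 have inc: "incseq ?g"
 proof (intro incseq_SucI le_funI, rule mult_right_mono[OF ennreal_leI])
  fix n and t :: real
  show "ind {1 / Suc n<..<Suc n} t * (1 / t ^ 3) <= ind {1 / Suc (Suc n)<..<Suc (Suc n)} t * (1 / t ^ 3)"
  proof (cases "t \<in> {1 / Suc (Suc n)<..<Suc (Suc n)}")
   case True
   have "0 < 1 / real (Suc (Suc n))" by simp
   also have "... < t" using True by (simp only: greaterThanLessThan_iff)
   finally have "t > 0" .
   then show ?thesis using True by (auto simp: indicator_def simp del: of_nat_Suc)
  next
   case False
   then have "t \<notin> {1 / Suc n<..<Suc n}" using sub[of n] by blast
   then show ?thesis using False by (simp add: indicator_simps(2) del: of_nat_Suc greaterThanLessThan_iff)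
  qed
 qed simp
 then show "incseq (\<lambda>n. (Sn n f x)\<^sup>2)"
  unfolding Sn_sq[OF f] by (auto simp: incseq_def le_fun_def intro!: nn_integral_mono)
 have "(SUP n. (Sn n f x)\<^sup>2) = (\<integral>\<^sup>+t. (SUP n. ?g n t) \<partial>lborel)"
  unfolding Sn_sq[OF f] by (rule nn_integral_monotone_convergence_SUP[symmetric, OF inc]) measurable
 also have "... = (\<integral>\<^sup>+t\<in>{0<..}. ennreal ((cmod (avg f x t))\<^sup>2 * (1 / t ^ 3)) \<partial>lborel)"
 proof (intro nn_integral_cong antisym SUP_least)
  fix t :: real
  have eq: "?g n t = ind {1 / Suc n<..<Suc n} t * ennreal ((cmod (avg f x t))\<^sup>2 * (1 / t ^ 3))" if "t > 0" for n
   using that by (auto simp: indicator_def ennreal_power mult.commute simp flip: ennreal_mult)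
  have neg: "?g n t = 0" if "\<not> t > 0" for n
  proof -
   have "0 < 1 / real (Suc n)" by simp
   then have "\<not> 1 / real (Suc n) < t" using that by linarith
   then have "t \<notin> {1 / Suc n<..<Suc n}" by (simp del: of_nat_Suc)
   then show ?thesis by simp
  qed
  show "?g n t <= ennreal ((cmod (avg f x t))\<^sup>2 * (1 / t ^ 3)) * ind {0<..} t" for n
   using eq[of n] neg[of n] by (cases "t > 0") (auto simp: indicator_def)
  show "ennreal ((cmod (avg f x t))\<^sup>2 * (1 / t ^ 3)) * ind {0<..} t <= (SUP n. ?g n t)"
  proof (cases "t > 0")
   case True
   obtain n1 where n1: "inverse (real (Suc n1)) < t" using reals_Archimedean[OF True] by blast
   obtain n2 :: nat where n2: "t < real n2" using reals_Archimedean2 by blast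
   have "1 / real (Suc (n1 + n2)) <= inverse (real (Suc n1))" by (simp add: inverse_eq_divide frac_le)
   then have "t \<in> {1 / Suc (n1 + n2)<..<Suc (n1 + n2)}" using n1 n2 by auto
   then have "ennreal ((cmod (avg f x t))\<^sup>2 * (1 / t ^ 3)) * ind {0<..} t <= ?g (n1 + n2) t"
    unfolding eq[OF True] using True by simp
   then show ?thesis by (intro SUP_upper2[of "n1 + n2"]) auto
  qed simp
 qed
 finally show "(MK f x)\<^sup>2 = (SUP n. (Sn n f x)\<^sup>2)" unfolding marcinkiewicz_sq ..
qed

lemma Sn_le: assumes "f \<in> borel_measurable M" shows "Sn n f x <= MK f x"
proof -
 have "(Sn n f x)\<^sup>2 <= (MK f x)\<^sup>2"
  unfolding marcinkiewicz_SUP(1)[OF assms] by (rule SUP_upper) simp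
 then show ?thesis by (simp only: sq_le_sq_ennreal)
qed

lemma Sn_mono: assumes "f \<in> borel_measurable M" "n <= m" shows "Sn n f x <= Sn m f x"
 using marcinkiewicz_SUP(2)[OF assms(1), of x] assms(2) by (simp add: incseq_def sq_le_sq_ennreal)

lemma marcinkiewicz_le: assumes "f \<in> borel_measurable M" "\<And>n. Sn n f x <= c" shows "MK f x <= c"
proof -
 have "(MK f x)\<^sup>2 <= c\<^sup>2"
  unfolding marcinkiewicz_SUP(1)[OF assms(1)] using assms(2) by (intro SUP_least) (simp add: sq_le_sq_ennreal)
 then show ?thesis by (simp add: sq_le_sq_ennreal)
qed

lemma measurable_Sn [measurable]:
 assumes [measurable]: "f \<in> borel_measurable M" shows "Sn n f \<in> borel_measurable M"
proof -
 show ?thesis unfolding Sn_def using k.measurable_S[of "\<lambda>p. f (fst p)"] by simp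
qed

lemma measurable_marcinkiewicz [measurable]:
 assumes [measurable]: "f \<in> borel_measurable M" shows "MK f \<in> borel_measurable M"
proof -
 have "MK f = (\<lambda>x. ennpowr (SUP n. (Sn n f x)\<^sup>2) (1 / 2))"
  by (simp add: fun_eq_iff marcinkiewicz_SUP(1)[OF assms, symmetric])
 also have "... \<in> borel_measurable M" by measurable
 finally show ?thesis .
qed

lemma nice_scalar:
 "nice M unitM (\<lambda>p. f (fst p)) \<longleftrightarrow> f \<in> borel_measurable M \<and> (\<exists>m. \<forall>x. cmod (f x) <= m) \<and> bounded {x. f x \<noteq> 0}"
proof -
 have "(\<lambda>p. f (fst p)) \<in> borel_measurable (M \<Otimes>\<^sub>M unitM) \<longleftrightarrow> f \<in> borel_measurable M"
 proof
  assume m: "(\<lambda>p. f (fst p)) \<in> borel_measurable (M \<Otimes>\<^sub>M unitM)"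
  have "(\<lambda>x. (x, ())) \<in> measurable M (M \<Otimes>\<^sub>M unitM)" by measurable
  from measurable_compose[OF this m] show "f \<in> borel_measurable M" by simp
 next
  assume "f \<in> borel_measurable M" then show "(\<lambda>p. f (fst p)) \<in> borel_measurable (M \<Otimes>\<^sub>M unitM)" by (rule measurable_lift)
 qed
 moreover have "(\<exists>m. \<forall>x. ecmod (f x) <= ennreal m) \<longleftrightarrow> (\<exists>m. \<forall>x. cmod (f x) <= m)"
 proof
  assume "\<exists>m. \<forall>x. ecmod (f x) <= ennreal m"
  then obtain m where m: "\<forall>x. ecmod (f x) <= ennreal m" by (elim exE)
  have "cmod (f x) <= max m 0" for x
  proof -
   have "ecmod (f x) <= ennreal (max m 0)" 
    by (rule order_trans[OF m[rule_format] ennreal_leI]) simp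
   then show ?thesis by (subst (asm) ennreal_le_iff) auto
  qed
  then show "\<exists>m. \<forall>x. cmod (f x) <= m" by (intro exI allI)
 qed (auto intro: ennreal_leI)
 ultimately show ?thesis unfolding nice_def by simp
qed

text \<open>Cut in height and in range: a \<open>nice\<close> approximation dominated by
  \<open>f\<close> that eventually equals \<open>f\<close> at each point.\<close>

definition cutoff :: "('a => complex) => nat => 'a => complex" where
 "cutoff f m x = (if cmod (f x) <= real m \<and> dist undefined x < real m then f x else 0)"

lemma cutoff:
 assumes [measurable]: "f \<in> borel_measurable M"
 shows "nice M unitM (\<lambda>p. cutoff f m (fst p))" "cmod (cutoff f m x) <= cmod (f x)"
  "(\<lambda>m. cutoff f m x) \<longlonglongrightarrow> f x" "cutoff f m \<in> borel_measurable M"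
proof -
 show m: "cutoff f m \<in> borel_measurable M" unfolding cutoff_def by measurable
 have "bounded {x. cutoff f m x \<noteq> 0}"
  by (rule bounded_subset[OF bounded_ball[of undefined "real m"]]) (auto simp: cutoff_def split: if_splits)
 moreover have "cmod (cutoff f m x) <= real m" for x unfolding cutoff_def by simp
 ultimately show "nice M unitM (\<lambda>p. cutoff f m (fst p))" unfolding nice_scalar using m by blast
 show "cmod (cutoff f m x) <= cmod (f x)" unfolding cutoff_def by simp
 obtain n1 n2 :: nat where n: "cmod (f x) < real n1" "dist undefined x < real n2" using reals_Archimedean2 by metis
 have "eventually (\<lambda>m. cutoff f m x = f x) sequentially"
  unfolding eventually_sequentially using n by (intro exI[of _ "max n1 n2"]) (auto simp: cutoff_def)
 then show "(\<lambda>m. cutoff f m x) \<longlonglongrightarrow> f x" by (rule tendsto_eventually)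
qed

text \<open>On a bounded set, \<open>|f| <= 1 + |f| powr p\<close> makes \<open>f\<close>
  integrable; for \<open>x\<close> in a ball of radius \<open>m\<close> and \<open>t < n + 1\<close>
  only values of \<open>f\<close> in the ball of radius \<open>m + n + 1\<close> matter. Without
  this convergence the inner integral would be the default 0 and no limit could be taken.\<close>

lemma AE_integrable_kn:
 assumes [measurable]: "f \<in> borel_measurable M" and p: "p >= 1" and fin: "(\<integral>x. ennpowr (ecmod (f x)) p) < \<infinity>"
 shows "AE x in M. AE t in cut n. integrable M (\<lambda>y. kn (x, t) (y, ()) * f y)"
proof -
 have cutAE: "AE t in cut n. t < real (Suc n)"
  unfolding cut_def by (subst AE_density) (auto simp: indicator_def)
 have "AE x in M. x \<in> ball undefined (real m) \<longrightarrow> (AE t in cut n. integrable M (\<lambda>y. kn (x, t) (y, ()) * f y))" for m :: nat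
 proof -
  define B where "B = ball (undefined :: 'a) (real m + real (Suc n))"
  have Bs [measurable]: "B \<in> sets M" unfolding B_def by auto
  define g where "g y = ind B y * f y" for y
  have gm [measurable]: "g \<in> borel_measurable M" unfolding g_def by measurable
  have "L1 g <= (\<integral>y. ind B y + ennpowr (ecmod (f y)) p)"
  proof (intro nn_integral_mono)
   fix y
   have "cmod (f y) <= 1 + cmod (f y) powr p"
   proof (cases "cmod (f y) <= 1")
    case False
    then have "cmod (f y) powr 1 <= cmod (f y) powr p" using p by (intro powr_mono) auto
    then show ?thesis using False by simp
   qed (simp add: add_increasing2)
   then have "ecmod (f y) <= ennreal (1 + cmod (f y) powr p)" by (rule ennreal_leI)
   also have "... = 1 + ennpowr (ecmod (f y)) p" by (simp add: ennpowr_ennreal)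
   finally show "ecmod (g y) <= ind B y + ennpowr (ecmod (f y)) p"
    unfolding g_def by (cases "y \<in> B") auto
  qed
  also have "... = emeasure M B + (\<integral>x. ennpowr (ecmod (f x)) p)"
   by (subst nn_integral_add) auto
  also have "... < \<infinity>" using fin emeasure_ball_finite[of undefined "real m + real (Suc n)"] unfolding B_def by simp
  finally have "AE x in M. k.fin_at n (\<lambda>p. g (fst p)) x"
   by (intro k.AE_fin_at[OF k.Schur(1)]) auto
  then show ?thesis
  proof (eventually_elim, intro impI)
   fix x assume x: "k.fin_at n (\<lambda>p. g (fst p)) x" "x \<in> ball undefined (real m)"
   have "AE t in cut n. integrable (M \<Otimes>\<^sub>M unitM) (\<lambda>w. kn (x, t) w * g (fst w))"
    using k.AE_integrable[OF _ _ x(1)] by simp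
   then show "AE t in cut n. integrable M (\<lambda>y. kn (x, t) (y, ()) * f y)"
    using cutAE
   proof eventually_elim
    fix t assume i: "integrable (M \<Otimes>\<^sub>M unitM) (\<lambda>w. kn (x, t) w * g (fst w))" and t: "t < real (Suc n)"
    have [measurable]: "(\<lambda>_. (x, t)) \<in> measurable L (M \<Otimes>\<^sub>M borel)" for L :: "'l measure"
     by (intro measurable_const) (simp add: space_pair_measure)
    have "integrable M (\<lambda>y. kn (x, t) (y, ()) * g y)"
    proof -
     have "integrable (distr M (M \<Otimes>\<^sub>M unitM) (\<lambda>x. (x, ()))) (\<lambda>w. kn (x, t) w * g (fst w))"
      using i by (subst pair_unit_eq_distr[OF sigma_finite_measure_axioms, symmetric])
     then show ?thesis by (subst (asm) integrable_distr_eq) auto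
    qed
    moreover have "kn (x, t) (y, ()) * g y = kn (x, t) (y, ()) * f y" for y
    proof (cases "dist x y < t")
     case True
     have "dist undefined y <= dist undefined x + dist x y" by (rule dist_triangle)
     then have "y \<in> B" using True t x(2) unfolding B_def by simp
     then show ?thesis unfolding g_def by simp
    qed (simp add: kn_def)
    ultimately show "integrable M (\<lambda>y. kn (x, t) (y, ()) * f y)" by simp
   qed
  qed
 qed
 then have "AE x in M. \<forall>m::nat. x \<in> ball undefined (real m) \<longrightarrow> (AE t in cut n. integrable M (\<lambda>y. kn (x, t) (y, ()) * f y))"
  by (subst AE_all_countable) blast
 then show ?thesis
 proof eventually_elim
  fix x assume *: "\<forall>m::nat. x \<in> ball undefined (real m) \<longrightarrow> (AE t in cut n. integrable M (\<lambda>y. kn (x, t) (y, ()) * f y))"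
  obtain m :: nat where "dist undefined x < real m" using reals_Archimedean2 by blast
  then show "AE t in cut n. integrable M (\<lambda>y. kn (x, t) (y, ()) * f y)" using * by auto
 qed
qed

text \<open>Extends estimates from the test class to all of L^p: the averages of the cutoffs
  converge by dominated convergence, and Fatou's lemma in \<open>t\<close> gives the lower limit.
  Cutoff and truncation share the index, so that a single further use of Fatou suffices
  later.\<close>

lemma marcinkiewicz_le_liminf:
 assumes f [measurable]: "f \<in> borel_measurable M" and p: "p >= 1" and fin: "(\<integral>x. ennpowr (ecmod (f x)) p) < \<infinity>"
 shows "AE x in M. MK f x <= liminf (\<lambda>m. Sn m (cutoff f m) x)"
proof -
 have "AE x in M. \<forall>n. AE t in cut n. integrable M (\<lambda>y. kn (x, t) (y, ()) * f y)"
  unfolding AE_all_countable using AE_integrable_kn[OF assms] by blast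
 then show ?thesis
 proof eventually_elim
  fix x assume *: "\<forall>n. AE t in cut n. integrable M (\<lambda>y. kn (x, t) (y, ()) * f y)"
  have "Sn n f x <= liminf (\<lambda>m. Sn m (cutoff f m) x)" for n
  proof -
   have conv: "AE t in cut n. (\<lambda>m. avg (cutoff f m) x t) \<longlonglongrightarrow> avg f x t"
    using *[rule_format, of n]
   proof eventually_elim
    fix t assume i: "integrable M (\<lambda>y. kn (x, t) (y, ()) * f y)"
    have [measurable]: "(\<lambda>_. (x, t)) \<in> measurable L (M \<Otimes>\<^sub>M borel)" for L :: "'l measure"
     by (intro measurable_const) (simp add: space_pair_measure)
    note [measurable] = cutoff(4)[OF f]
    have "(\<lambda>m. LINT y|M. kn (x, t) (y, ()) * cutoff f m y) \<longlonglongrightarrow> (LINT y|M. kn (x, t) (y, ()) * f y)"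
    proof (rule integral_dominated_convergence[where w = "\<lambda>y. cmod (kn (x, t) (y, ()) * f y)"])
     show "integrable M (\<lambda>y. cmod (kn (x, t) (y, ()) * f y))" using i by (rule integrable_norm)
     show "AE y in M. (\<lambda>m. kn (x, t) (y, ()) * cutoff f m y) \<longlonglongrightarrow> kn (x, t) (y, ()) * f y"
      by (intro AE_I2 tendsto_mult_left cutoff(3) f)
     show "AE y in M. norm (kn (x, t) (y, ()) * cutoff f m y) <= cmod (kn (x, t) (y, ()) * f y)" for m
      by (intro AE_I2) (auto simp: norm_mult intro!: mult_left_mono cutoff(2))
    qed measurable
    then show "(\<lambda>m. avg (cutoff f m) x t) \<longlonglongrightarrow> avg f x t"
     using int_op_kn(2)[OF cutoff(4)[OF f]] int_op_kn(2)[OF f] by simp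
   qed
   have Sq: "(Sn n g x)\<^sup>2 = (\<integral>\<^sup>+t. (ecmod (avg g x t))\<^sup>2 \<partial>cut n)" if "g \<in> borel_measurable M" for g
    unfolding Sn_def nrm_def l2_sq int_op_kn(1)[OF that] int_op_kn(2)[OF that] ..
   have "(Sn n f x)\<^sup>2 = (\<integral>\<^sup>+t. liminf (\<lambda>m. (ecmod (avg (cutoff f m) x t))\<^sup>2) \<partial>cut n)"
    unfolding Sq[OF f]
   proof (rule nn_integral_cong_AE)
    show "AE t in cut n. (ecmod (avg f x t))\<^sup>2 = liminf (\<lambda>m. (ecmod (avg (cutoff f m) x t))\<^sup>2)"
     using conv
    proof eventually_elim
     fix t assume "(\<lambda>m. avg (cutoff f m) x t) \<longlonglongrightarrow> avg f x t"
     then have "(\<lambda>m. ennreal ((cmod (avg (cutoff f m) x t))\<^sup>2)) \<longlonglongrightarrow> ennreal ((cmod (avg f x t))\<^sup>2)"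
      by (intro tendsto_ennrealI tendsto_power tendsto_norm)
     then show "(ecmod (avg f x t))\<^sup>2 = liminf (\<lambda>m. (ecmod (avg (cutoff f m) x t))\<^sup>2)"
      by (intro lim_imp_Liminf[symmetric]) (auto simp: ennreal_power)
    qed
   qed
   also have "... <= liminf (\<lambda>m. \<integral>\<^sup>+t. (ecmod (avg (cutoff f m) x t))\<^sup>2 \<partial>cut n)"
    by (rule nn_integral_liminf) (use measurable_avg_t[OF cutoff(4)[OF f]] in measurable)
   also have "... = liminf (\<lambda>m. (Sn n (cutoff f m) x)\<^sup>2)" using Sq[OF cutoff(4)[OF f]] by simp
   finally have 1: "Sn n f x <= ennpowr (liminf (\<lambda>m. (Sn n (cutoff f m) x)\<^sup>2)) (1 / 2)"
    using ennpowr_mono[of "(Sn n f x)\<^sup>2" _ "1 / 2"] by simp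
   also have "... <= liminf (\<lambda>m. ennpowr ((Sn n (cutoff f m) x)\<^sup>2) (1 / 2))" by (rule ennpowr_Liminf) simp
   also have "... = liminf (\<lambda>m. Sn n (cutoff f m) x)" by simp
   \<comment> \<open>From \<open>m = n\<close> on, \<open>Sn m\<close> dominates
     \<open>Sn n\<close>; this passes to the diagonal.\<close>
   also have "... <= liminf (\<lambda>m. Sn m (cutoff f m) x)"
    by (rule Liminf_mono) (auto simp: eventually_sequentially intro!: exI[of _ n] Sn_mono cutoff(4) f)
   finally show ?thesis .
  qed
  then show "MK f x <= liminf (\<lambda>m. Sn m (cutoff f m) x)" by (rule marcinkiewicz_le[OF f])
 qed
qed

end

section \<open>Boundedness on Lebesgue spaces and uniform bounds for the truncations\<close>

lemma eLp_norm_ennreal: "0 <= q ==> eLp_norm M (ennreal q) g = ennpowr (\<integral>\<^sup>+x. ennpowr (g x) q \<partial>M) (1 / q)"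
 by (simp add: eLp_norm_def)

lemma eLp_norm_1: "eLp_norm M 1 g = (\<integral>\<^sup>+x. g x \<partial>M)"
 using eLp_norm_ennreal[of 1 M g] by simp

context marc begin

abbreviation nice\<^sub>1 :: "('a => complex) => bool" where "nice\<^sub>1 f \<equiv> nice M unitM (\<lambda>p. f (fst p))"

abbreviation Lq :: "real => ('a => complex) => ennreal" where "Lq q f \<equiv> \<integral>\<^sup>+x. ennpowr (ecmod (f x)) q \<partial>M"

definition bounded_Sn :: "real => real => bool" where
 "bounded_Sn q A \<longleftrightarrow> (\<forall>n. bdd n q A)"

lemma bounded_Sn_iff:
 "bounded_Sn q A \<longleftrightarrow> (\<forall>n f. nice\<^sub>1 f \<longrightarrow> (\<integral>x. ennpowr (Sn n f x) q) <= ennreal (A powr q) * Lq q f)"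
proof -
 have "(\<forall>u. P u) \<longleftrightarrow> (\<forall>f. P (\<lambda>p. f (fst p)))" for P :: "('a \<times> unit => complex) => bool"
 proof (intro iffI allI)
  fix u assume "\<forall>f. P (\<lambda>p. f (fst p))"
  then have "P (\<lambda>p. (\<lambda>x. u (x, ())) (fst p))" by (rule spec)
  from this unit_fun[of u, symmetric] show "P u" by (rule back_subst)
 next
  fix f assume "\<forall>u. P u" then show "P (\<lambda>p. f (fst p))" by (rule spec)
 qed
 then show ?thesis unfolding bounded_Sn_def bounded_nice_def Sn_def by simp
qed

lemma bounded_SnD:
 "bounded_Sn q A ==> nice\<^sub>1 f ==> (\<integral>x. ennpowr (Sn n f x) q) <= ennreal (A powr q) * Lq q f"
 unfolding bounded_Sn_iff by blast

lemma nice1_meas: "nice\<^sub>1 f ==> f \<in> borel_measurable M"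
 unfolding nice_scalar by blast

lemma nice1_finite: "nice\<^sub>1 f ==> q > 0 ==> Lq q f < \<infinity>"
proof -
 show "nice\<^sub>1 f ==> q > 0 ==> Lq q f < \<infinity>" using k.nice_integrable[of "\<lambda>p. f (fst p)" q] by simp
qed

lemma bounded_on_Lp_of_Sn:
 assumes b: "bounded_Sn q A" and q: "q >= 1" and A: "A >= 0"
 shows "bounded_on_Lp M (ennreal q) (MK)"
 unfolding bounded_on_Lp_def bounded_operator_def
\<comment> \<open>\<open>bounded_operator\<close> asks for a positive constant, while
  \<open>A\<close> may be 0.\<close>
proof (intro exI[of _ "A + 1"] conjI ballI)
 have q0: "0 <= q" "0 < q" using q by auto
 fix f assume "f \<in> Lp_space M (ennreal q)"
 then have f [measurable]: "f \<in> borel_measurable M" and "ennpowr (Lq q f) (1 / q) < \<infinity>"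
  unfolding Lp_space_def eLp_norm_ennreal[OF q0(1)] by auto
 then have fin: "Lq q f < \<infinity>" by (simp add: less_top[symmetric] ennpowr_eq_top_iff)
 show "MK f \<in> borel_measurable M" by measurable
 note [measurable] = cutoff(4)[OF f]
 have "(\<integral>x. ennpowr (MK f x) q) <= (\<integral>x. liminf (\<lambda>m. ennpowr (Sn m (cutoff f m) x) q))"
 proof (rule nn_integral_mono_AE)
  show "AE x in M. ennpowr (MK f x) q <= liminf (\<lambda>m. ennpowr (Sn m (cutoff f m) x) q)"
   using marcinkiewicz_le_liminf[OF f q fin]
  proof eventually_elim
   fix x assume "MK f x <= liminf (\<lambda>m. Sn m (cutoff f m) x)"
   from order_trans[OF ennpowr_mono[OF this q0(2)] ennpowr_Liminf[OF q0(2)]]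
   show "ennpowr (MK f x) q <= liminf (\<lambda>m. ennpowr (Sn m (cutoff f m) x) q)" .
  qed
 qed
 also have "... <= liminf (\<lambda>m. \<integral>x. ennpowr (Sn m (cutoff f m) x) q)"
  by (rule nn_integral_liminf) measurable
 also have "... <= ennreal (A powr q) * Lq q f"
 proof (rule order_trans[OF Liminf_le_Limsup Limsup_bounded])
  show "\<forall>\<^sub>F m in sequentially. (\<integral>x. ennpowr (Sn m (cutoff f m) x) q) <= ennreal (A powr q) * Lq q f"
  proof (rule always_eventually, rule allI)
   fix m
   have "(\<integral>x. ennpowr (Sn m (cutoff f m) x) q) <= ennreal (A powr q) * Lq q (cutoff f m)"
    by (rule bounded_SnD[OF b cutoff(1)[OF f]])
   also have "... <= ennreal (A powr q) * Lq q f"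
    by (intro mult_left_mono nn_integral_mono ennpowr_mono ennreal_leI cutoff(2) f q0) simp
   finally show "(\<integral>x. ennpowr (Sn m (cutoff f m) x) q) <= ennreal (A powr q) * Lq q f" .
  qed
 qed simp
 finally have "ennpowr (\<integral>x. ennpowr (MK f x) q) (1 / q) <= ennpowr (ennreal (A powr q) * Lq q f) (1 / q)"
  using q0 by (intro ennpowr_mono) auto
 also have "... = ennreal A * ennpowr (Lq q f) (1 / q)"
  using q0 A by (simp add: ennpowr_mult ennpowr_ennreal powr_powr)
 also have "... <= ennreal (A + 1) * ennpowr (Lq q f) (1 / q)" by (intro mult_right_mono ennreal_leI) auto
 finally show "eLp_norm M (ennreal q) (MK f) <= ennreal (A + 1) * Lp_norm M (ennreal q) f"
  unfolding eLp_norm_ennreal[OF q0(1)] .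
qed (use A in simp)

lemma bounded_L1_weak_L1_of_Sn:
 assumes b: "\<And>n f s. nice\<^sub>1 f ==> s > 0 ==>
   mlev (Sn n f) s <= ennreal (D / s) * L1 f"
  and D: "D >= 0"
 shows "bounded_L1_weak_L1 M (MK)"
 unfolding bounded_L1_weak_L1_def bounded_operator_def
proof (intro exI[of _ "D + 1"] conjI ballI)
 fix f assume "f \<in> Lp_space M 1"
 then have f [measurable]: "f \<in> borel_measurable M" and fin: "Lq 1 f < \<infinity>"
  unfolding Lp_space_def eLp_norm_1 by auto
 show [measurable]: "MK f \<in> borel_measurable M" by measurable
 note [measurable] = cutoff(4)[OF f]
 show "weak_L1_norm M (MK f) <= ennreal (D + 1) * Lp_norm M 1 f"
  unfolding weak_L1_norm_def eLp_norm_1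
 proof (rule SUP_least)
  fix s :: real assume "s \<in> {0<..}"
  then have s: "s > 0" by simp
  let ?U = "\<lambda>m. (lev (Sn m (cutoff f m)) s)"
  have "mlev (MK f) s = (\<integral>x. ind (lev (MK f) s) x)"
   by (rule nn_integral_indicator[symmetric]) measurable
  also have "... <= (\<integral>x. liminf (\<lambda>m. ind (?U m) x))"
  proof (rule nn_integral_mono_AE)
   show "AE x in M. ind (lev (MK f) s) x <= liminf (\<lambda>m. ind (?U m) x :: ennreal)"
    using marcinkiewicz_le_liminf[OF f order_refl fin]
   proof eventually_elim
    fix x assume le: "MK f x <= liminf (\<lambda>m. Sn m (cutoff f m) x)"
    show "ind (lev (MK f) s) x <= liminf (\<lambda>m. ind (?U m) x :: ennreal)"
    proof (cases "x \<in> space M \<and> ennreal s < MK f x")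
     case True
     then have "ennreal s < liminf (\<lambda>m. Sn m (cutoff f m) x)" using le by (meson less_le_trans)
     \<comment> \<open>A strict inequality for the lower limit holds eventually along the sequence,
       so the indicator of the level set is at most the lower limit of the indicators, and Fatou
       applies.\<close>
     then have "eventually (\<lambda>m. ennreal s < Sn m (cutoff f m) x) sequentially" by (rule less_LiminfD)
     then have "eventually (\<lambda>m. (1 :: ennreal) <= ind (?U m) x) sequentially"
      by eventually_elim (use True in simp)
     then have "1 <= liminf (\<lambda>m. ind (?U m) x :: ennreal)" by (rule Liminf_bounded)
     then show ?thesis using True by simp
    qed auto
   qed
  qed
  also have "... <= liminf (\<lambda>m. \<integral>x. ind (?U m) x)" by (rule nn_integral_liminf) measurable
  also have "... <= ennreal (D / s) * L1 f"
  proof (rule order_trans[OF Liminf_le_Limsup Limsup_bounded])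
   show "\<forall>\<^sub>F m in sequentially. (\<integral>x. ind (?U m) x) <= ennreal (D / s) * L1 f"
   proof (rule always_eventually, rule allI)
    fix m
    have "(\<integral>x. ind (?U m) x) = emeasure M (?U m)" by (rule nn_integral_indicator) measurable
    also have "... <= ennreal (D / s) * L1 (cutoff f m)"
     by (rule b[OF cutoff(1)[OF f] s])
    also have "... <= ennreal (D / s) * L1 f"
     by (intro mult_left_mono nn_integral_mono ennreal_leI cutoff(2) f) simp
    finally show "(\<integral>x. ind (?U m) x) <= ennreal (D / s) * L1 f" .
   qed
  qed simp
  finally have "ennreal s * mlev (MK f) s <=
   ennreal s * (ennreal (D / s) * L1 f)" by (rule mult_left_mono) simp
  also have "... = ennreal D * L1 f"
   using s D by (simp add: mult.assoc[symmetric] flip: ennreal_mult)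
  also have "... <= ennreal (D + 1) * L1 f" by (intro mult_right_mono ennreal_leI) auto
  finally show "ennreal s * mlev (MK f) s <= ennreal (D + 1) * L1 f" .
 qed
qed (use D in simp)

lemma bounded_Sn_of_Lp:
 assumes b: "bounded_on_Lp M (ennreal q) (MK)" and q: "q >= 1"
 obtains A where "A >= 0" "bounded_Sn q A"
proof -
 have q0: "0 <= q" "0 < q" using q by auto
 obtain C where C: "C > 0" and bC: "\<forall>f\<in>Lp_space M (ennreal q). MK f \<in> borel_measurable M \<and>
   eLp_norm M (ennreal q) (MK f) <= ennreal C * Lp_norm M (ennreal q) f"
  using b unfolding bounded_on_Lp_def bounded_operator_def by (elim exE conjE)
 have "bounded_Sn q C"
  unfolding bounded_Sn_iff
 proof (intro allI impI)
  fix n f assume f: "nice\<^sub>1 f"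
  have fm: "f \<in> borel_measurable M" by (rule nice1_meas[OF f])
  have "f \<in> Lp_space M (ennreal q)"
   unfolding Lp_space_def eLp_norm_ennreal[OF q0(1)] using fm nice1_finite[OF f q0(2)] by (simp add: less_top[symmetric] ennpowr_eq_top_iff)
  then have "ennpowr (\<integral>x. ennpowr (MK f x) q) (1 / q) <= ennreal C * ennpowr (Lq q f) (1 / q)"
   using bspec[OF bC, of f] unfolding eLp_norm_ennreal[OF q0(1)] by blast
  then have "ennpowr (ennpowr (\<integral>x. ennpowr (MK f x) q) (1 / q)) q <= ennpowr (ennreal C * ennpowr (Lq q f) (1 / q)) q"
   using q0 by (intro ennpowr_mono) auto
  then have *: "(\<integral>x. ennpowr (MK f x) q) <= ennreal (C powr q) * Lq q f"
   unfolding ennpowr_inverse[OF q0(2)] ennpowr_mult[OF q0(2)] using C by (simp add: ennpowr_ennreal)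
  have "(\<integral>x. ennpowr (Sn n f x) q) <= (\<integral>x. ennpowr (MK f x) q)"
   by (intro nn_integral_mono ennpowr_mono Sn_le fm q0)
  then show "(\<integral>x. ennpowr (Sn n f x) q) <= ennreal (C powr q) * Lq q f" using * by (rule order_trans)
 qed
 with C show ?thesis by (intro that[of C]) auto
qed

lemma weak_Sn_of_L1_weak_L1:
 assumes b: "bounded_L1_weak_L1 M (MK)"
 obtains D where "D >= 0" "\<And>n f s. nice\<^sub>1 f ==> s > 0 ==>
   mlev (Sn n f) s <= ennreal (D / s) * L1 f"
proof -
 obtain C where C: "C > 0" and bC: "\<forall>f\<in>Lp_space M 1. MK f \<in> borel_measurable M \<and>
   weak_L1_norm M (MK f) <= ennreal C * Lp_norm M 1 f"
  using b unfolding bounded_L1_weak_L1_def bounded_operator_def by (elim exE conjE)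
 show ?thesis
 proof (rule that[of C])
  fix n f and s :: real assume f: "nice\<^sub>1 f" and s: "s > 0"
  let ?I = "\<integral>\<^sup>+x. ecmod (f x) \<partial>M"
  have fm [measurable]: "f \<in> borel_measurable M" by (rule nice1_meas[OF f])
  have "f \<in> Lp_space M 1"
   unfolding Lp_space_def eLp_norm_1 using fm nice1_finite[OF f, of 1] by simp
  then have w: "weak_L1_norm M (MK f) <= ennreal C * ?I"
   using bspec[OF bC, of f] unfolding eLp_norm_1 by blast
  have "ennreal s * mlev (Sn n f) s <= ennreal s * mlev (MK f) s"
  proof (intro mult_left_mono emeasure_mono)
   show "lev (MK f) s \<in> sets M" by measurable
  qed (auto intro: less_le_trans[OF _ Sn_le[OF fm]])
  also have "... <= weak_L1_norm M (MK f)"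
   unfolding weak_L1_norm_def by (rule SUP_upper) (use s in simp)
  also note w
  finally have "ennreal (1 / s) * (ennreal s * mlev (Sn n f) s) <= ennreal (1 / s) * (ennreal C * ?I)"
   by (rule mult_left_mono) simp
  then show "mlev (Sn n f) s <= ennreal (C / s) * ?I"
   using s C by (simp add: mult.assoc[symmetric] flip: ennreal_mult)
 qed (use C in auto)
qed

text \<open>With a fixed bound \<open>A\<close> there is nothing to balance: the height
  \<open>h = s\<close> already makes every term of \<open>weak_bound\<close> a multiple of
  \<open>1 / s\<close>.\<close>

lemma L1_weak_L1_of_Lp:
 assumes b: "bounded_on_Lp M (ennreal q) (MK)" and q: "q > 1"
 shows "bounded_L1_weak_L1 M (MK)"
proof -
 obtain A where A: "A >= 0" and bA: "bounded_Sn q A" by (rule bounded_Sn_of_Lp[OF b]) (use q in auto)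
 define D where "D = 2 * 5 powr (q - 1) * A powr q * 3 powr q + \<beta> + 3 * (2 * Ck + 4 * Ck * Cl ^ (a + 2) + 2 * \<beta> * A)"
 have D: "D >= 0" unfolding D_def using A beta_ge Ck_ge(4) Cl_pos by simp
 show ?thesis
 proof (rule bounded_L1_weak_L1_of_Sn[OF _ D])
  fix n f and s :: real assume f: "nice\<^sub>1 f" and s: "s > 0"
  have bn: "bdd n q A" using bA unfolding bounded_Sn_def by blast
  have "k.weak_bound q A (s / 3) s = D / s"
  proof -
   have "(s / 3) powr - q * s powr (q - 1) = 3 powr q * (s powr - q * s powr (q - 1))"
    using s by (simp add: powr_divide powr_minus field_simps)
   also have "s powr - q * s powr (q - 1) = s powr (- q + (q - 1))" by (rule powr_add[symmetric])
   also have "... = 1 / s" using s by (simp add: powr_minus_divide)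
   finally have e: "(s / 3) powr - q * s powr (q - 1) = 3 powr q * (1 / s)" .
   have "k.weak_bound q A (s / 3) s = 2 * 5 powr (q - 1) * A powr q * ((s / 3) powr - q * s powr (q - 1)) + \<beta> / s +
    (2 * Ck + 4 * Ck * Cl ^ (a + 2) + 2 * \<beta> * A) / (s / 3)"
    unfolding k.weak_bound_def by (simp only: mult.assoc)
   then show ?thesis unfolding e D_def by (simp add: add_divide_distrib)
  qed
  moreover have "mlev (Sn n f) (3 * (s / 3)) <= ennreal (k.weak_bound q A (s / 3) s) * (\<integral>y. nrm unitM (\<lambda>p. f (fst p)) y)"
   unfolding Sn_def by (rule k.weak_type[OF bn q A f]) (use s in auto)
  ultimately show "mlev (Sn n f) s <= ennreal (D / s) * L1 f"
   by simp
 qed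
qed

lemma L2_of_improvement:
 assumes imp: "\<And>n A. A >= 1 ==> bdd n 2 A ==>
   bdd n 2 (B * A powr (3 / 4))" and B: "B >= 1"
 shows "bounded_Sn 2 (B ^ 4)"
 unfolding bounded_Sn_def
proof
 fix n
 show "bdd n 2 (B ^ 4)"
  by (rule k.bootstrap[OF imp B])
qed

lemma L2_of_L1_weak_L1:
 assumes b: "bounded_L1_weak_L1 M (MK)"
 obtains A where "A >= 1" "bounded_Sn 2 A"
proof -
 obtain D where D: "D >= 0" and w: "\<And>n f s. nice\<^sub>1 f ==> s > 0 ==>
   mlev (Sn n f) s <= ennreal (D / s) * L1 f"
 proof (rule weak_Sn_of_L1_weak_L1[OF b], goal_cases)
  case (1 D)
  show ?case by (rule 1(1)[OF 1(2)]) (rule 1(3))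
 qed
 \<comment> \<open>The maximum with 1 keeps the iterates of the bootstrap above 1, where the
   improvement is available.\<close>
 define B where "B = max 1 ((4 * D + (2 * C\<^sub>p Ck (4 / 3)) powr 4) powr (1 / 2))"
 have "bounded_Sn 2 (B ^ 4)"
 proof (rule L2_of_improvement)
  fix n A assume A: "A >= (1 :: real)" and bA: "bdd n 2 A"
  have "bdd n 2 ((4 * D + (2 * C\<^sub>p Ck (4 / 3)) powr 4) powr (1 / 2) * A powr (3 / 4))"
  proof (rule k.L2_improve_weak11[OF cz_kernel_adjoint _ D bA A])
   fix u :: "'a \<times> unit => complex" and s :: real assume u: "nice M unitM u" and s: "s > 0"
   show "mlev (k.S n u) s <= ennreal (D / s) * (\<integral>x. nrm unitM u x)"
    using w[of "\<lambda>x. u (x, ())", folded unit_fun, OF u s, of n] unfolding Sn_def unit_fun[symmetric] by simp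
  qed
  then show "bdd n 2 (B * A powr (3 / 4))"
   by (rule k.bounded_nice_mono) (auto simp: B_def intro!: mult_right_mono)
 qed (simp add: B_def)
 then show ?thesis by (intro that[of "B ^ 4"]) (auto simp: B_def intro!: one_le_power)
qed

lemma Lp_of_L2:
 assumes b: "bounded_Sn 2 A" and A: "A >= 1" and q: "q > 1"
 shows "\<exists>A\<ge>0. bounded_Sn q A"
proof -
 consider "q < 2" | "q = 2" | "q > 2" by linarith
 then show ?thesis
 proof cases
  case 1
  have "bdd n q (C\<^sub>p Ck q * A)" for n
  proof -
   show ?thesis by (rule k.Lp_below_2[OF _ A q 1]) (use b in \<open>simp add: bounded_Sn_def\<close>)
  qed
  then show ?thesis using Cp_pos[OF Ck_ge(4) q 1] A unfolding bounded_Sn_def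
   by (intro exI[of _ "C\<^sub>p Ck q * A"]) auto
 next
  case 2 then show ?thesis using b A by (intro exI[of _ A]) auto
 next
  case 3
  have "bdd n q (C\<^sub>p Ck (q / (q - 1)) * A)" for n
  proof -
   show ?thesis by (rule k.Lp_above_2[OF cz_kernel_adjoint _ A 3]) (use b in \<open>simp add: bounded_Sn_def\<close>)
  qed
  moreover have "q / (q - 1) > 1" "q / (q - 1) < 2" using 3 by (auto simp: field_simps)
  ultimately show ?thesis using Cp_pos[OF Ck_ge(4), of "q / (q - 1)"] A unfolding bounded_Sn_def
   by (intro exI[of _ "C\<^sub>p Ck (q / (q - 1)) * A"]) auto
 qed
qed

lemma all_Lp_of_L2:
 assumes b: "bounded_Sn 2 A" "A >= 1" and q: "1 < q" "q < \<infinity>"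
 shows "bounded_on_Lp M q (MK)"
proof -
 define r where "r = enn2real q"
 have qr: "q = ennreal r" unfolding r_def using q(2) by (simp add: less_top)
 have r: "r > 1" using q(1) unfolding qr by (metis ennreal_1 ennreal_leI linorder_not_le)
 obtain A' where "A' >= 0" "bounded_Sn r A'" using Lp_of_L2[OF b r] by blast
 then show ?thesis unfolding qr by (intro bounded_on_Lp_of_Sn[of r A']) (use r in auto)
qed

end

text \<open>The sup norm is included through the exponent \<open>1 / p = 0\<close>, so one formula
  serves all \<open>p\<close> in the normalisation of atoms.\<close>

lemma eLp_norm_bounded_support:
 assumes a [measurable]: "a \<in> borel_measurable M" and B [measurable]: "B \<in> sets M" and fin: "emeasure M B < \<infinity>"
  and bd: "AE x in M. a x <= ennreal m * ind B x" and m: "m >= 0" and p: "p >= 1"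
 shows "eLp_norm M p a <= ennreal (m * measure M B powr enn2real (1 / p))"
proof (cases "p = \<infinity>")
 case True
 have "esssup M a <= ennreal (m * measure M B powr 0)"
 proof (rule esssup_I[OF a])
  show "AE x in M. a x <= ennreal (m * measure M B powr 0)"
  \<comment> \<open>As \<open>0 powr 0\<close> is 0, the right-hand side vanishes for a null set;
    the function then vanishes almost everywhere as well.\<close>
  proof (cases "measure M B = 0")
   case True
   then have "B \<in> null_sets M" using fin by (auto simp: measure_def enn2real_eq_0_iff null_sets_def)
   then have "AE x in M. x \<notin> B" by (rule AE_not_in)
   with bd show ?thesis by eventually_elim simp
  next
   case False
   from bd show ?thesis
   proof eventually_elim
    fix x assume "a x <= ennreal m * ind B x"
    also have "... <= ennreal m" by (auto simp: indicator_def)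
    finally show "a x <= ennreal (m * measure M B powr 0)" using False by simp
   qed
  qed
 qed
 then show ?thesis unfolding eLp_norm_def using True by (simp add: divide_ennreal_def)
next
 case False
 define q where "q = enn2real p"
 have pq: "p = ennreal q" unfolding q_def using False by (simp add: less_top)
 have q: "q >= 1" using p unfolding pq by (metis ennreal_1 ennreal_le_iff2 not_one_le_zero)
 have q0: "0 <= q" "0 < q" using q by auto
 have "(\<integral>\<^sup>+x. ennpowr (a x) q \<partial>M) <= (\<integral>\<^sup>+x. ennreal (m powr q) * ind B x \<partial>M)"
 proof (rule nn_integral_mono_AE)
  from bd show "AE x in M. ennpowr (a x) q <= ennreal (m powr q) * ind B x"
  proof eventually_elim
   fix x assume "a x <= ennreal m * ind B x"
   then have "ennpowr (a x) q <= ennpowr (ennreal m * ind B x) q" using q0 by (intro ennpowr_mono)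
   then show "ennpowr (a x) q <= ennreal (m powr q) * ind B x"
    using m q0 by (cases "x \<in> B") (auto simp: ennpowr_ennreal)
  qed
 qed
 also have "... = ennreal (m powr q) * emeasure M B" by (rule nn_integral_cmult_indicator) measurable
 also have "emeasure M B = ennreal (measure M B)" using fin by (intro emeasure_eq_ennreal_measure) auto
 finally have "ennpowr (\<integral>\<^sup>+x. ennpowr (a x) q \<partial>M) (1 / q) <= ennpowr (ennreal (m powr q) * ennreal (measure M B)) (1 / q)"
  using q0 by (intro ennpowr_mono) auto
 also have "... = ennreal (m * measure M B powr (1 / q))"
  using m q0 by (simp add: ennpowr_mult ennpowr_ennreal powr_powr ennreal_mult)
 finally show ?thesis
 proof -
  have "1 / p = ennreal (1 / q)" unfolding pq using q0 divide_ennreal[of 1 q] by simp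
  then have "enn2real (1 / p) = 1 / q" using q0 by simp
  moreover assume "ennpowr (\<integral>\<^sup>+x. ennpowr (a x) q \<partial>M) (1 / q) <= ennreal (m * measure M B powr (1 / q))"
  ultimately show ?thesis unfolding pq eLp_norm_ennreal[OF q0(1)] by simp
 qed
qed

section \<open>Tools for building atomic blocks\<close>

context marc begin

lemma delta_coeff_bounds:
 assumes "r > 0"
 shows "delta_coeff M lam c r c' r' >= 0"
  and "\<Delta> >= 0 ==> (\<integral>y. dl c y * ind (ball c' (2 * r') - ball c r) y) <= ennreal \<Delta>
   ==> delta_coeff M lam c r c' r' <= \<Delta>"
proof -
 let ?f = "\<lambda>x. ind (ball c' (2 * r') - ball c r) x *\<^sub>R (1 / lam c (dist x c))"
 have pos: "?f x >= 0" for x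
 proof (cases "x \<in> ball c r")
  case False
  then have "0 < dist x c" using assms by (auto simp: dist_commute)
  then show ?thesis using lam_pos[of "dist x c" c] by simp
 qed simp
 show "delta_coeff M lam c r c' r' >= 0"
  unfolding delta_coeff_def set_lebesgue_integral_def using pos by simp
 assume D: "\<Delta> >= 0" and le: "(\<integral>y. dl c y * ind (ball c' (2 * r') - ball c r) y) <= ennreal \<Delta>"
 have "(\<integral>x. ennreal (?f x)) = (\<integral>y. dl c y * ind (ball c' (2 * r') - ball c r) y)"
  by (intro nn_integral_cong) (auto simp: indicator_def dist_commute)
 then show "delta_coeff M lam c r c' r' <= \<Delta>"
  unfolding delta_coeff_def set_lebesgue_integral_def using D le by (intro integral_real_bounded) auto
qed

text \<open>The coefficient \<delta> of a ball with respect to itself is bounded: on the annulus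
  \<open>lam\<close> is at least \<open>lam c R\<close>, and doubling the radius costs one
  \<open>Cl\<close>.\<close>

lemma nn_integral_lam_double:
 assumes R: "R > 0"
 shows "(\<integral>y. dl c y * ind (ball c (2 * R) - ball c R) y) <= ennreal Cl"
proof -
 have l: "lam c R > 0" using R by (rule lam_pos)
 have "(\<integral>y. dl c y * ind (ball c (2 * R) - ball c R) y) <= (\<integral>y. ennreal (1 / lam c R) * ind (ball c (2 * R)) y)"
 proof (intro nn_integral_mono)
  fix y
  show "dl c y * ind (ball c (2 * R) - ball c R) y <= ennreal (1 / lam c R) * ind (ball c (2 * R)) y"
  proof (cases "y \<in> ball c (2 * R) - ball c R")
   case True
   then have "lam c R <= lam c (dist c y)" using R by (intro lam_mono) auto
   then have "1 / lam c (dist c y) <= 1 / lam c R" using l by (intro divide_left_mono) auto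
   then show ?thesis using True by (simp add: ennreal_leI)
  qed simp
 qed
 also have "... = ennreal (1 / lam c R) * ennreal (mb c (2 * R))"
  unfolding emeasure_ball[symmetric] by (rule nn_integral_cmult_indicator) simp
 also have "... = ennreal (mb c (2 * R) / lam c R)" using l by (simp flip: ennreal_mult)
 also have "... <= ennreal Cl"
 proof (rule ennreal_leI)
  have "mb c (2 * R) <= lam c (2 * R)" using R by (intro mb_le_lam) simp
  also have "... <= Cl * lam c R" using lam_half[of "2 * R" c] R by simp
  finally show "mb c (2 * R) / lam c R <= Cl" using l by (simp add: field_simps)
 qed
 finally show ?thesis .
qed

lemma Sn_L1:
 assumes "f \<in> borel_measurable M"
 shows "(\<integral>x. Sn n f x) <= ennreal (Ln n) * L1 f"
proof -
 show ?thesis using k.Schur_L1[OF k.Schur(1) measurable_lift[OF assms]] unfolding Sn_def by simp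
qed

lemma Sn_cong_AE:
 assumes f: "f \<in> borel_measurable M" "g \<in> borel_measurable M" and ae: "AE x in M. f x = g x"
 shows "Sn n f x = Sn n g x"
proof -
 have "avg f x t = avg g x t" for t
 proof -
  have [measurable]: "(\<lambda>_. (x, t)) \<in> measurable L (M \<Otimes>\<^sub>M borel)" for L :: "'l measure"
   by (intro measurable_const) (simp add: space_pair_measure)
  note [measurable] = f
  have "(LINT y|M. kn (x, t) (y, ()) * f y) = (LINT y|M. kn (x, t) (y, ()) * g y)"
   using ae by (intro integral_cong_AE) auto
  then show ?thesis unfolding int_op_kn(2)[OF f(1)] int_op_kn(2)[OF f(2)] .
 qed
 then have "(Sn n f x)\<^sup>2 = (Sn n g x)\<^sup>2" unfolding Sn_sq[OF f(1)] Sn_sq[OF f(2)] by simp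
 then show ?thesis by (intro antisym) (simp_all flip: sq_le_sq_ennreal)
qed

lemma Sn_sum_AE:
 assumes "finite I" and f: "\<And>i. i \<in> I ==> f i \<in> borel_measurable M" "\<And>i. i \<in> I ==> (L1 (f i)) < \<infinity>"
 shows "AE x in M. Sn n (\<lambda>x. \<Sum>i\<in>I. f i x) x <= (\<Sum>i\<in>I. Sn n (f i) x)"
proof -
 have "AE x in M. k.fin_at n (\<lambda>p. f i (fst p)) x" if "i \<in> I" for i
  using f[OF that] by (intro k.AE_fin_at[OF k.Schur(1)]) auto
 then have "AE x in M. \<forall>i\<in>I. k.fin_at n (\<lambda>p. f i (fst p)) x" using assms(1) by (intro AE_finite_allI) auto
 then show ?thesis
 proof eventually_elim
  fix x assume fin: "\<forall>i\<in>I. k.fin_at n (\<lambda>p. f i (fst p)) x"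
  have "k.S n (\<lambda>w. \<Sum>i\<in>I. f i (fst w)) x <= (\<Sum>i\<in>I. k.S n (\<lambda>p. f i (fst p)) x)"
   using k.S_sum[OF assms(1), of x "\<lambda>i p. f i (fst p)"] measurable_lift[OF f(1)] fin by auto
  then show "Sn n (\<lambda>x. \<Sum>i\<in>I. f i x) x <= (\<Sum>i\<in>I. Sn n (f i) x)" unfolding Sn_def .
 qed
qed

lemma Sn_add_AE:
 assumes "f \<in> borel_measurable M" "g \<in> borel_measurable M" "L1 f < \<infinity>" "L1 g < \<infinity>"
 shows "AE x in M. Sn n (\<lambda>x. f x + g x) x <= Sn n f x + Sn n g x"
 using Sn_sum_AE[of "UNIV :: bool set" "\<lambda>b. if b then f else g" n] assms by (simp add: UNIV_bool add.commute)

lemma nice1_bound_support: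
 assumes f: "nice\<^sub>1 f"
 obtains m z R where "m >= 0" "\<And>x. cmod (f x) <= m" "\<And>x. x \<notin> ball z R ==> f x = 0"
proof -
 obtain m where m: "\<forall>x. cmod (f x) <= m" and b: "bounded {x. f x \<noteq> 0}" using f unfolding nice_scalar by (elim conjE exE)
 obtain z R where "{x. f x \<noteq> 0} \<subseteq> ball z R" using b by (metis bounded_subset_ballD)
 moreover have "0 <= m" using m norm_ge_zero order_trans by metis
 ultimately show ?thesis using m by (intro that[of m z R]) auto
qed

lemma nice1_integrable: "nice\<^sub>1 f ==> integrable M f"
 using nice1_finite[of f 1] nice1_meas[of f] by (intro integrableI_bounded) auto

lemma nice1_cmult: "nice\<^sub>1 f ==> nice\<^sub>1 (\<lambda>x. c * f x)"
proof -
 assume f: "nice\<^sub>1 f"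
 obtain m z R where mz: "m >= 0" "\<And>x. cmod (f x) <= m" "\<And>x. x \<notin> ball z R ==> f x = 0" using nice1_bound_support[OF f] by metis
 note [measurable] = nice1_meas[OF f]
 have "\<exists>m. \<forall>x. cmod (c * f x) <= m"
  using mz(2) by (intro exI[of _ "cmod c * m"]) (auto simp: norm_mult intro!: mult_left_mono)
 moreover have "bounded {x. c * f x \<noteq> 0}" by (rule bounded_subset[OF bounded_ball[of z R]]) (use mz(3) in fastforce)
 ultimately show ?thesis unfolding nice_scalar[of "\<lambda>x. c * f x"] by simp
qed

lemma nice1_indicator: "nice\<^sub>1 f ==> D \<in> sets M ==> nice\<^sub>1 (\<lambda>x. ind D x * f x)"
proof -
 show "nice\<^sub>1 f ==> D \<in> sets M ==> nice\<^sub>1 (\<lambda>x. ind D x * f x)" using k.nice_indicator(1)[of "\<lambda>p. f (fst p)" D] by simp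
qed

end

section \<open>From the Hardy space to square integrable functions\<close>

locale hardy = marc +
 fixes \<rho> :: real and p :: ennreal
 assumes rho: "1 < \<rho>" "\<rho> <= \<alpha>" and p: "1 < p"
begin

text \<open>Normalises a bounded function on a ball to an atom, with \<open>\<Delta>\<close> as an
  upper bound of \<delta>. If \<open>\<kappa>\<close> is 0 then \<open>f\<close> vanishes almost
  everywhere, and division by 0 being 0 still yields an admissible atom.\<close>

lemma atom_of_bounded:
 assumes f: "nice\<^sub>1 f" and supp: "\<forall>x. x \<notin> ball c r \<longrightarrow> f x = 0" and bd: "\<And>x. cmod (f x) <= m"
  and r: "r > 0" and d: "0 <= d" "d <= \<Delta>"
 defines "\<kappa> \<equiv> (1 + \<Delta>) * (m * mb c (\<rho> * r))"
 shows "AE x in M. f x = of_real \<kappa> * (f x / of_real \<kappa>)"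
  and "Lp_norm M p (\<lambda>x. f x / of_real \<kappa>) <= ennreal (mb c (\<rho> * r) powr (enn2real (1 / p) - 1) * inverse (1 + d))"
proof -
 note [measurable] = nice1_meas[OF f]
 have m0: "m >= 0" using bd norm_ge_zero order_trans by blast
 have sub: "ball c r \<subseteq> ball c (\<rho> * r)" using rho r by (intro subset_ball) simp
 have mono: "mb c r <= mb c (\<rho> * r)" by (rule mb_mono[OF sub])
 have k0: "\<kappa> >= 0" unfolding \<kappa>_def using d m0 by simp
 have z: "AE x in M. f x = 0" if "\<kappa> = 0"
 proof (cases "m = 0")
  case True then show ?thesis using bd by (intro AE_I2) simp
 next
  case False
  then have "mb c (\<rho> * r) = 0" using that d unfolding \<kappa>_def by simp
  then have "mb c r = 0" using mono mb_nonneg[of c r] by linarith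
  then have "ball c r \<in> null_sets M" by (simp add: null_sets_def emeasure_ball)
  then have "AE x in M. x \<notin> ball c r" by (rule AE_not_in)
  then show ?thesis by eventually_elim (use supp in blast)
 qed
 show "AE x in M. f x = of_real \<kappa> * (f x / of_real \<kappa>)"
 proof (cases "\<kappa> = 0")
  case True then show ?thesis using z by simp
 qed simp
 have p1: "p >= 1" using p by simp
 have e0: "enn2real (1 / p) >= 0" by simp
 show "Lp_norm M p (\<lambda>x. f x / of_real \<kappa>) <= ennreal (mb c (\<rho> * r) powr (enn2real (1 / p) - 1) * inverse (1 + d))"
 proof (cases "\<kappa> = 0")
  case True
  have "Lp_norm M p (\<lambda>x. f x / of_real \<kappa>) <= ennreal (0 * measure M (ball c r) powr enn2real (1 / p))"
   using True emeasure_ball_finite[of c r] by (intro eLp_norm_bounded_support p1) auto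
  then show ?thesis by simp
 next
  case False
  then have kp: "\<kappa> > 0" and mbp: "mb c (\<rho> * r) > 0" and mp: "m > 0"
   using k0 m0 mb_nonneg[of c "\<rho> * r"] unfolding \<kappa>_def by (auto simp: less_le)
  have le: "AE x in M. ecmod (f x / of_real \<kappa>) <= ennreal (m / \<kappa>) * ind (ball c r) x"
  proof (rule AE_I2)
   fix x
   show "ecmod (f x / of_real \<kappa>) <= ennreal (m / \<kappa>) * ind (ball c r) x"
    using supp[rule_format, of x] bd[of x] kp
    by (cases "x \<in> ball c r") (auto simp: norm_divide intro!: ennreal_leI divide_right_mono)
  qed
  have "Lp_norm M p (\<lambda>x. f x / of_real \<kappa>) <= ennreal (m / \<kappa> * measure M (ball c r) powr enn2real (1 / p))"
   using emeasure_ball_finite[of c r] m0 kp by (intro eLp_norm_bounded_support[OF _ _ _ le] p1) auto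
  also have "... <= ennreal (mb c (\<rho> * r) powr (enn2real (1 / p) - 1) * inverse (1 + d))"
  proof (rule ennreal_leI)
   have "m / \<kappa> = inverse (1 + \<Delta>) * inverse (mb c (\<rho> * r))" unfolding \<kappa>_def using mp by (simp add: inverse_eq_divide)
   also have "... * measure M (ball c r) powr enn2real (1 / p) <= inverse (1 + d) * inverse (mb c (\<rho> * r)) * mb c (\<rho> * r) powr enn2real (1 / p)"
    using d mbp mono e0 by (intro mult_mono powr_mono2 le_imp_inverse_le) (auto simp: mb_def)
   also have "... = mb c (\<rho> * r) powr (enn2real (1 / p) - 1) * inverse (1 + d)"
    using mbp by (simp add: powr_diff field_simps)
   finally show "m / \<kappa> * measure M (ball c r) powr enn2real (1 / p) <= mb c (\<rho> * r) powr (enn2real (1 / p) - 1) * inverse (1 + d)" .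
  qed
  finally show ?thesis .
 qed
qed

text \<open>The two atoms live on concentric balls, the larger of which also carries the block. The
  coefficient of the larger ball is an integral over a subset of the annulus in
  \<open>delta\<close>, so one \<open>\<Delta>\<close> serves both. Sup bounds are used, which makes
  the result valid for every \<open>p\<close>.\<close>

lemma block_of_bounded:
 assumes f: "nice\<^sub>1 \<psi>" "nice\<^sub>1 \<phi>" and r: "0 < r" "r <= R"
  and supp: "\<And>x. x \<notin> ball c r ==> \<psi> x = 0" "\<And>x. x \<notin> ball c R ==> \<phi> x = 0"
  and bd: "\<And>x. cmod (\<psi> x) <= m" "\<And>x. cmod (\<phi> x) <= m'"
  and canc: "(LINT x|M. \<psi> x + \<phi> x) = 0" and D: "\<Delta> >= 0"
  and delta: "(\<integral>y. dl c y * ind (ball c (2 * R) - ball c r) y) <= ennreal \<Delta>"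
 shows "proper_atomic_block M lam \<rho> p (\<lambda>x. \<psi> x + \<phi> x) ((1 + \<Delta>) * (m * mb c (\<rho> * r) + m' * mb c (\<rho> * R)))"
proof -
 have R: "R > 0" using r by simp
 have m0: "m >= 0" "m' >= 0" using bd norm_ge_zero order_trans by blast+
 note [measurable] = nice1_meas[OF f(1)] nice1_meas[OF f(2)]
 have int: "integrable M (\<lambda>x. \<psi> x + \<phi> x)" by (intro Bochner_Integration.integrable_add nice1_integrable f)
 have sub: "ball c r \<subseteq> ball c R" using r by (intro subset_ball)
 have delta': "(\<integral>y. dl c y * ind (ball c (2 * R) - ball c R) y) <= ennreal \<Delta>"
 proof (rule order_trans[OF nn_integral_mono delta])
  fix y
  show "dl c y * ind (ball c (2 * R) - ball c R) y <= dl c y * ind (ball c (2 * R) - ball c r) y"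
   using sub by (intro mult_left_mono) (auto simp: indicator_def)
 qed
 define k1 where "k1 = (1 + \<Delta>) * (m * mb c (\<rho> * r))"
 define k2 where "k2 = (1 + \<Delta>) * (m' * mb c (\<rho> * R))"
 have k0: "k1 >= 0" "k2 >= 0" unfolding k1_def k2_def using D m0 by auto
 note d1 = delta_coeff_bounds(1)[OF r(1)] delta_coeff_bounds(2)[OF r(1) D delta]
 note d2 = delta_coeff_bounds(1)[OF R] delta_coeff_bounds(2)[OF R D delta']
 have supp': "\<forall>x. x \<notin> ball c r \<longrightarrow> \<psi> x = 0" "\<forall>x. x \<notin> ball c R \<longrightarrow> \<phi> x = 0" using supp by blast+
 note A1 = atom_of_bounded[OF f(1), of c r m, OF supp'(1) bd(1) r(1) d1, folded k1_def]
 note A2 = atom_of_bounded[OF f(2), of c R m', OF supp'(2) bd(2) R d2, folded k2_def]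
 show ?thesis
  unfolding proper_atomic_block_def
 proof (intro conjI)
  show "locally_integrable_on M UNIV (\<lambda>x. \<psi> x + \<phi> x)"
   unfolding locally_integrable_on_def using int by (auto intro!: exI[of _ UNIV] simp: set_integrable_def)
  show "(LINT x|M. \<psi> x + \<phi> x) = 0" by (rule canc)
  show "\<exists>c' r'. 0 < r' \<and> supported_in M (ball c' r') (\<lambda>x. \<psi> x + \<phi> x) \<and>
   (\<exists>(a :: nat => 'a => complex) (cc :: nat => 'a) (rr :: nat => real) (\<kappa> :: nat => complex). (\<forall>j\<in>{1, 2}. 0 < rr j \<and> ball (cc j) (rr j) \<subseteq> ball c' r' \<and> a j \<in> borel_measurable M \<and>
    supported_in M (ball (cc j) (rr j)) (a j) \<and> Lp_norm M p (a j) <= ennreal (measure M (ball (cc j) (\<rho> * rr j)) powr (enn2real (1 / p) - 1) *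
      inverse (1 + delta_coeff M lam (cc j) (rr j) c' r'))) \<and>
    (AE x in M. \<psi> x + \<phi> x = \<kappa> 1 * a 1 x + \<kappa> 2 * a 2 x) \<and>
    (1 + \<Delta>) * (m * mb c (\<rho> * r) + m' * mb c (\<rho> * R)) = cmod (\<kappa> 1) + cmod (\<kappa> 2))"
  proof (rule exI[of _ c], rule exI[of _ R], intro conjI, rule R)
   show "supported_in M (ball c R) (\<lambda>x. \<psi> x + \<phi> x)"
    unfolding supported_in_def using supp(1)[OF contra_subsetD[OF sub]] supp(2) by (intro AE_I2) simp
   show "\<exists>(a :: nat => 'a => complex) (cc :: nat => 'a) (rr :: nat => real) (\<kappa> :: nat => complex). (\<forall>j\<in>{1, 2}. 0 < rr j \<and> ball (cc j) (rr j) \<subseteq> ball c R \<and> a j \<in> borel_measurable M \<and>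
    supported_in M (ball (cc j) (rr j)) (a j) \<and> Lp_norm M p (a j) <= ennreal (measure M (ball (cc j) (\<rho> * rr j)) powr (enn2real (1 / p) - 1) *
      inverse (1 + delta_coeff M lam (cc j) (rr j) c R))) \<and>
    (AE x in M. \<psi> x + \<phi> x = \<kappa> 1 * a 1 x + \<kappa> 2 * a 2 x) \<and>
    (1 + \<Delta>) * (m * mb c (\<rho> * r) + m' * mb c (\<rho> * R)) = cmod (\<kappa> 1) + cmod (\<kappa> 2)"
   proof (rule exI[of _ "\<lambda>(j::nat) x. if j = 1 then \<psi> x / of_real k1 else \<phi> x / of_real k2"], rule exI[of _ "\<lambda>_ :: nat. c"],
     rule exI[of _ "\<lambda>j :: nat. if j = 1 then r else R"], rule exI[of _ "\<lambda>j :: nat. complex_of_real (if j = 1 then k1 else k2)"], intro conjI ballI)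
    fix j :: nat assume "j \<in> {1, 2}"
    show "0 < (if j = 1 then r else R)" "ball c (if j = 1 then r else R) \<subseteq> ball c R" using r R sub by auto
    show "(\<lambda>x. if j = 1 then \<psi> x / of_real k1 else \<phi> x / of_real k2) \<in> borel_measurable M" by measurable
    show "supported_in M (ball c (if j = 1 then r else R)) (\<lambda>x. if j = 1 then \<psi> x / of_real k1 else \<phi> x / of_real k2)"
     unfolding supported_in_def using supp by (intro AE_I2) auto
    show "Lp_norm M p (\<lambda>x. if j = 1 then \<psi> x / of_real k1 else \<phi> x / of_real k2) <=
     ennreal (measure M (ball c (\<rho> * (if j = 1 then r else R))) powr (enn2real (1 / p) - 1) *
      inverse (1 + delta_coeff M lam c (if j = 1 then r else R) c R))"
     using A1(2) A2(2) unfolding mb_def by (cases "j = 1") simp_all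
   next
    from A1(1) A2(1) show "AE x in M. \<psi> x + \<phi> x = complex_of_real (if (1::nat) = 1 then k1 else k2) * (if (1::nat) = 1 then \<psi> x / of_real k1 else \<phi> x / of_real k2) +
     complex_of_real (if (2::nat) = 1 then k1 else k2) * (if (2::nat) = 1 then \<psi> x / of_real k1 else \<phi> x / of_real k2)"
    proof eventually_elim
     fix x assume "\<psi> x = of_real k1 * (\<psi> x / of_real k1)" "\<phi> x = of_real k2 * (\<phi> x / of_real k2)"
     then have h: "\<psi> x + \<phi> x = of_real k1 * (\<psi> x / of_real k1) + of_real k2 * (\<phi> x / of_real k2)" by (rule arg_cong2[where f = "(+)"])
     show "\<psi> x + \<phi> x = complex_of_real (if (1::nat) = 1 then k1 else k2) * (if (1::nat) = 1 then \<psi> x / of_real k1 else \<phi> x / of_real k2) +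
      complex_of_real (if (2::nat) = 1 then k1 else k2) * (if (2::nat) = 1 then \<psi> x / of_real k1 else \<phi> x / of_real k2)" by (subst h) simp
    qed
    show "(1 + \<Delta>) * (m * mb c (\<rho> * r) + m' * mb c (\<rho> * R)) =
     cmod (complex_of_real (if (1::nat) = 1 then k1 else k2)) + cmod (complex_of_real (if (2::nat) = 1 then k1 else k2))"
     using k0 by (simp add: k1_def[symmetric] k2_def[symmetric] distrib_left)
   qed
  qed
 qed
qed

text \<open>Pads finite sums of blocks to the infinite sequences that a decomposition consists
  of.\<close>

lemma zero_block: "atomic_block M lam \<rho> p (\<lambda>_. 0) 0"
proof -
 have n: "nice\<^sub>1 (\<lambda>_. 0)" unfolding nice_scalar[of "\<lambda>_. 0"] by auto
 show ?thesis
  using block_of_bounded[OF n n, of 1 1 undefined 0 0 Cl] nn_integral_lam_double[of 1 undefined] Cl_pos unfolding atomic_block_def by simp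
qed

end

section \<open>Finite sums of blocks in the Hardy space\<close>

lemma atomic_block_size_nonneg: "atomic_block M lam \<rho> p b s ==> s >= 0"
 unfolding atomic_block_def proper_atomic_block_def by (elim disjE conjE exE) simp_all

lemma Hardy_norm_le:
 assumes "atomic_decomposition M lam \<rho> p f b s"
 shows "Hardy_norm M lam \<rho> p f <= suminf s"
 unfolding Hardy_norm_def
proof (rule cInf_lower)
 show "suminf s \<in> {suminf s |b s. atomic_decomposition M lam \<rho> p f b s}" using assms by blast
 show "bdd_below {suminf s |b s. atomic_decomposition M lam \<rho> p f b s}"
 proof (rule bdd_belowI[of _ 0])
  fix v assume "v \<in> {suminf s |b s. atomic_decomposition M lam \<rho> p f b s}"
  then obtain b s where v: "v = suminf s" and d: "atomic_decomposition M lam \<rho> p f b s" by (elim CollectE exE conjE)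
  then have "summable s" "\<And>j. s j >= 0" unfolding atomic_decomposition_def using atomic_block_size_nonneg by blast+
  then show "0 <= v" unfolding v by (rule suminf_nonneg)
 qed
qed

context hardy begin

lemma Hardy_finite_sum:
 assumes I: "finite I" and b: "\<And>i. i \<in> I ==> atomic_block M lam \<rho> p (b i) (s i)"
  and f: "f \<in> Lp_space M 1" "\<And>x. f x = (\<Sum>i\<in>I. b i x)"
 shows "f \<in> Hardy_space M lam \<rho> p" and "Hardy_norm M lam \<rho> p f <= (\<Sum>i\<in>I. s i)"
proof -
 obtain h where h: "bij_betw h {0..<card I} I" using ex_bij_betw_nat_finite[OF I] by (elim exE)
 define b' where "b' j = (if j < card I then b (h j) else (\<lambda>_. 0))" for j
 define s' where "s' j = (if j < card I then s (h j) else 0)" for j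
 have hI: "h j \<in> I" if "j < card I" for j using bij_betwE[OF h] that by simp
 have "(\<lambda>j. b' j x) sums f x" for x
 proof -
  have "(\<lambda>j. b' j x) sums (\<Sum>j\<in>{0..<card I}. b' j x)" by (rule sums_finite) (auto simp: b'_def)
  also have "(\<Sum>j\<in>{0..<card I}. b' j x) = (\<Sum>j\<in>{0..<card I}. b (h j) x)" by (intro sum.cong) (auto simp: b'_def)
  also have "... = f x" unfolding f(2) by (rule sum.reindex_bij_betw[OF h])
  finally show ?thesis .
 qed
 moreover have sm: "s' sums (\<Sum>i\<in>I. s i)"
 proof -
  have "s' sums (\<Sum>j\<in>{0..<card I}. s' j)" by (rule sums_finite) (auto simp: s'_def)
  also have "(\<Sum>j\<in>{0..<card I}. s' j) = (\<Sum>j\<in>{0..<card I}. s (h j))" by (intro sum.cong) (auto simp: s'_def)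
  also have "... = (\<Sum>i\<in>I. s i)" by (rule sum.reindex_bij_betw[OF h])
  finally show ?thesis .
 qed
 moreover have "atomic_block M lam \<rho> p (b' j) (s' j)" for j
  unfolding b'_def s'_def using b[OF hI[of j]] zero_block by auto
 ultimately have d: "atomic_decomposition M lam \<rho> p f b' s'"
  unfolding atomic_decomposition_def by (auto simp: sums_iff)
 then show "f \<in> Hardy_space M lam \<rho> p" unfolding Hardy_space_def using f(1) by blast
 show "Hardy_norm M lam \<rho> p f <= (\<Sum>i\<in>I. s i)" using Hardy_norm_le[OF d] sums_unique[OF sm] by simp
qed

end

locale hardy_bounded = hardy +
 fixes C0 :: real
 assumes C0: "C0 > 0" and H: "\<And>f. f \<in> Hardy_space M lam \<rho> p ==>
  (\<integral>x. MK f x) <= ennreal C0 * ennreal (Hardy_norm M lam \<rho> p f)"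
begin

lemma Sn_blocks:
 assumes I: "finite I" and b: "\<And>i. i \<in> I ==> atomic_block M lam \<rho> p (b i) (s i)"
  and f: "f \<in> Lp_space M 1" "\<And>x. f x = (\<Sum>i\<in>I. b i x)" and le: "(\<Sum>i\<in>I. s i) <= t"
 shows "(\<integral>x. Sn n f x) <= ennreal (C0 * t)"
proof -
 note h = Hardy_finite_sum[OF I b f]
 have fm: "f \<in> borel_measurable M" using f unfolding Lp_space_def by simp
 have "(\<integral>x. Sn n f x) <= (\<integral>x. MK f x)" by (intro nn_integral_mono Sn_le fm)
 also have "... <= ennreal C0 * ennreal (Hardy_norm M lam \<rho> p f)" by (rule H[OF h(1)])
 also have "... <= ennreal C0 * ennreal t" using h(2) le by (intro mult_left_mono ennreal_leI) auto
 also have "... = ennreal (C0 * t)" using C0 by (simp add: ennreal_mult')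
 finally show ?thesis .
qed

text \<open>Serves spaces too small for the decomposition. Subtracting \<open>\<kappa>\<close> on a
  large ball turns \<open>f\<close> into a proper block, and the constant \<open>\<kappa>\<close> is
  a constant block. The space may be unbounded, so the ball carries only nearly all of the mass; the
  remainder \<open>- \<kappa>\<close> off the ball is made negligible with the L^1 bound
  \<open>Ln n\<close>, which may depend on \<open>n\<close> because the ball is chosen
  afterwards.\<close>

lemma Sn_finite_space:
 assumes f: "nice\<^sub>1 f" and bd: "\<And>x. cmod (f x) <= 1" and V: "emeasure M (space M) = ennreal V" "V > 0"
 defines "I \<equiv> enn2real (L1 f)"
 shows "(\<integral>x. Sn n f x) <= ennreal (C0 * ((1 + Cl) * (V + 2 * I) + 2 * I))"
proof (rule ennreal_le_epsilon)
 fix \<epsilon> :: real assume eps: "\<epsilon> > 0"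
 note [measurable] = nice1_meas[OF f]
 have I0: "I >= 0" unfolding I_def by simp
 have fin: "L1 f = ennreal I"
  unfolding I_def using nice1_finite[OF f, of 1] by simp
 have L0: "Ln n >= 0"
 proof -
  show ?thesis by (rule k.L[of n])
 qed
 have mX: "measure M (space M) = V" using V by (simp add: measure_def)
 obtain m z R\<^sub>1 where supp: "\<And>x. x \<notin> ball z R\<^sub>1 ==> f x = 0" using nice1_bound_support[OF f] by metis
 \<comment> \<open>\<open>V / 2\<close> keeps the measure of the ball at least half of the total,
   which bounds \<open>\<kappa>\<close>; the second entry makes \<open>Ln n\<close> times the norm
   of the remainder at most \<open>\<epsilon>\<close>.\<close>
 define \<delta> where "\<delta> = min (V / 2) (\<epsilon> * V / (2 * I * Ln n + 1))"
 have den: "2 * I * Ln n + 1 > 0" using I0 L0 by (simp add: add_nonneg_pos)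
 have "\<delta> > 0" using V eps den unfolding \<delta>_def by simp
 moreover have "\<delta> <= V / 2" "\<delta> <= \<epsilon> * V / (2 * I * Ln n + 1)"
  unfolding \<delta>_def by (rule min.cobounded1, rule min.cobounded2)
 ultimately have \<delta>: "\<delta> > 0" "\<delta> <= V / 2" "\<delta> <= \<epsilon> * V / (2 * I * Ln n + 1)" .
 have "(\<lambda>i. measure M (ball z (real i))) \<longlonglongrightarrow> measure M (\<Union>i. ball z (real i))"
 proof (rule Lim_measure_incseq)
  have "emeasure M (\<Union>i. ball z (real i)) <= emeasure M (space M)" by (rule emeasure_space)
  then show "emeasure M (\<Union>i. ball z (real i)) \<noteq> \<infinity>" unfolding V(1) by (auto simp: top_unique)
 qed (auto simp: incseq_def)
 moreover have "(\<Union>i. ball z (real i)) = space M" using reals_Archimedean2 by auto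
 ultimately have "(\<lambda>i. mb z (real i)) \<longlonglongrightarrow> V" unfolding mb_def by (simp only: mX)
 then have "eventually (\<lambda>i. V - \<delta> < mb z (real i)) sequentially" using \<delta>(1) by (intro order_tendstoD(1)) auto
 moreover have "eventually (\<lambda>i. max R\<^sub>1 1 < real i) sequentially"
  by (rule filterlim_real_sequentially[unfolded filterlim_at_top_dense, rule_format])
 ultimately obtain i where i: "V - \<delta> < mb z (real i)" "max R\<^sub>1 1 < real i"
  using eventually_happens'[OF sequentially_bot eventually_conj] by blast
 define R where "R = real i"
 have R: "V - \<delta> < mb z R" "R\<^sub>1 <= R" "R > 0" using i unfolding R_def by auto
 have mR: "mb z R >= V / 2" "mb z R > 0" using R \<delta> V by auto
 have mV: "mb z r <= V" for r
 proof -
  have "ennreal (mb z r) <= ennreal V" unfolding emeasure_ball[symmetric] V(1)[symmetric] by (rule emeasure_space)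
  then show ?thesis using V(2) by (subst (asm) ennreal_le_iff) auto
 qed
 have supp: "f x = 0" if "x \<notin> ball z R" for x using supp[of x] that R by auto
 define \<kappa> where "\<kappa> = (LINT x|M. f x) / complex_of_real (mb z R)"
 have k: "cmod \<kappa> <= 2 * I / V"
 proof -
  have "ecmod (LINT x|M. f x) <= ennreal I"
   using integral_norm_bound_ennreal[OF nice1_integrable[OF f]] unfolding fin by simp
  then have "cmod (LINT x|M. f x) <= I" using I0 by simp
  then have "cmod \<kappa> <= I / mb z R" unfolding \<kappa>_def using mR by (simp add: norm_divide divide_right_mono)
  also have "... <= I / (V / 2)" using mR V I0 by (intro divide_left_mono) auto
  finally show ?thesis by (simp add: mult.commute)
 qed
 define \<phi> where "\<phi> x = - \<kappa> * ind (ball z R) x" for x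
 have \<phi>: "nice\<^sub>1 \<phi>" unfolding nice_scalar[of \<phi>]
 proof (intro conjI exI[of _ "cmod \<kappa>"] allI)
  show "\<phi> \<in> borel_measurable M" unfolding \<phi>_def by measurable
  show "cmod (\<phi> x) <= cmod \<kappa>" for x unfolding \<phi>_def by (auto simp: indicator_def)
  show "bounded {x. \<phi> x \<noteq> 0}" by (rule bounded_subset[OF bounded_ball[of z R]]) (auto simp: \<phi>_def indicator_def)
 qed
 note [measurable] = nice1_meas[OF \<phi>]
 have canc: "(LINT x|M. f x + \<phi> x) = 0"
 proof -
  have "(LINT x|M. \<phi> x) = - \<kappa> * (LINT x|M. complex_of_real (ind (ball z R) x))"
   unfolding \<phi>_def integral_mult_right_zero[symmetric] by (intro Bochner_Integration.integral_cong refl) (simp add: indicator_def)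
  also have "... = - \<kappa> * complex_of_real (mb z R)"
   unfolding integral_complex_of_real by (simp add: mb_def)
  also have "... = - (LINT x|M. f x)" unfolding \<kappa>_def using mR by simp
  finally show ?thesis using nice1_integrable[OF f] nice1_integrable[OF \<phi>] by simp
 qed
 have blk: "proper_atomic_block M lam \<rho> p (\<lambda>x. f x + \<phi> x) ((1 + Cl) * (1 * mb z (\<rho> * R) + cmod \<kappa> * mb z (\<rho> * R)))"
 proof (rule block_of_bounded[OF f \<phi> R(3) order_refl supp _ bd _ canc _ nn_integral_lam_double[OF R(3)]])
  show "\<phi> x = 0" if "x \<notin> ball z R" for x using that unfolding \<phi>_def by simp
  show "cmod (\<phi> x) <= cmod \<kappa>" for x unfolding \<phi>_def by (auto simp: indicator_def)
 qed (use Cl_pos in auto)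
 have cblk: "atomic_block M lam \<rho> p (\<lambda>x. \<kappa> * of_real V * of_real (1 / measure M (space M))) (cmod (\<kappa> * of_real V))"
  unfolding atomic_block_def V(1) by auto
 define G where "G x = f x + \<phi> x + \<kappa>" for x
 define er where "er x = - \<kappa> * ind (space M - ball z R) x" for x
 have [measurable]: "G \<in> borel_measurable M" "er \<in> borel_measurable M" unfolding G_def er_def by auto
 have finV: "(\<integral>x. ennreal c) < \<infinity>" for c unfolding nn_integral_const V(1) by (simp add: ennreal_mult_less_top)
 have \<phi>b: "cmod (\<phi> x) <= cmod \<kappa>" "cmod (er x) <= cmod \<kappa>" for x unfolding \<phi>_def er_def by (auto simp: indicator_def)
 have Gf: "L1 G < \<infinity>"
 proof (rule le_less_trans[OF nn_integral_mono finV])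
  fix x
  have "cmod (G x) <= cmod (f x) + cmod (\<phi> x) + cmod \<kappa>" unfolding G_def by (intro order_trans[OF norm_triangle_ineq] add_mono norm_triangle_ineq) simp
  also have "... <= 1 + cmod \<kappa> + cmod \<kappa>" using bd \<phi>b by (intro add_mono) auto
  finally show "ecmod (G x) <= ennreal (1 + cmod \<kappa> + cmod \<kappa>)" by (rule ennreal_leI)
 qed
 have ef: "L1 er < \<infinity>"
  by (rule le_less_trans[OF nn_integral_mono finV[of "cmod \<kappa>"]]) (use \<phi>b in \<open>auto intro: ennreal_leI\<close>)
 have SG: "(\<integral>x. Sn n G x) <= ennreal (C0 * ((1 + Cl) * (V + 2 * I) + 2 * I))"
 proof (rule Sn_blocks[of "UNIV :: bool set"])
  show "atomic_block M lam \<rho> p (if t then (\<lambda>x. f x + \<phi> x) else (\<lambda>x. \<kappa> * of_real V * of_real (1 / measure M (space M))))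
   (if t then (1 + Cl) * (1 * mb z (\<rho> * R) + cmod \<kappa> * mb z (\<rho> * R)) else cmod (\<kappa> * of_real V))" for t
   using blk cblk unfolding atomic_block_def by (cases t) auto
  show "G \<in> Lp_space M 1" unfolding Lp_space_def eLp_norm_1 using Gf by simp
  show "G x = (\<Sum>t\<in>UNIV. (if t then (\<lambda>x. f x + \<phi> x) else (\<lambda>x. \<kappa> * of_real V * of_real (1 / measure M (space M)))) x)" for x
   unfolding G_def using V(2) mX by (simp add: UNIV_bool)
  have kV: "cmod \<kappa> * V <= 2 * I" using k V(2) by (simp add: field_simps)
  have "cmod \<kappa> * mb z (\<rho> * R) <= cmod \<kappa> * V" by (intro mult_left_mono mV) simp
  then have "1 * mb z (\<rho> * R) + cmod \<kappa> * mb z (\<rho> * R) <= V + 2 * I" using mV[of "\<rho> * R"] kV by simp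
  then have "(1 + Cl) * (1 * mb z (\<rho> * R) + cmod \<kappa> * mb z (\<rho> * R)) <= (1 + Cl) * (V + 2 * I)"
   using Cl_pos by (intro mult_left_mono) auto
  then show "(\<Sum>t\<in>UNIV. if t then (1 + Cl) * (1 * mb z (\<rho> * R) + cmod \<kappa> * mb z (\<rho> * R)) else cmod (\<kappa> * of_real V)) <= (1 + Cl) * (V + 2 * I) + 2 * I"
   using kV V(2) by (simp add: UNIV_bool norm_mult)
 qed simp
 have Se: "(\<integral>x. Sn n er x) <= ennreal \<epsilon>"
 proof -
  have "(\<integral>x. Sn n er x) <= ennreal (Ln n) * L1 er" by (rule Sn_L1) measurable
  also have "L1 er = (\<integral>x. ennreal (cmod \<kappa>) * ind (space M - ball z R) x)"
   unfolding er_def by (intro nn_integral_cong) (auto simp: indicator_def)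
  also have "... = ennreal (cmod \<kappa>) * emeasure M (space M - ball z R)" by (rule nn_integral_cmult_indicator) measurable
  also have "emeasure M (space M - ball z R) = ennreal (V - mb z R)"
  proof -
   have "emeasure M (space M - ball z R) = emeasure M (space M) - emeasure M (ball z R)"
    using emeasure_ball_finite[of z R] by (intro emeasure_compl) (auto simp: less_top)
   then show ?thesis unfolding V(1) emeasure_ball using mb_nonneg[of z R] by (simp add: ennreal_minus)
  qed
  also have "ennreal (Ln n) * (ennreal (cmod \<kappa>) * ennreal (V - mb z R)) = ennreal (Ln n * (cmod \<kappa> * (V - mb z R)))"
   using L0 mV[of R] by (simp add: ennreal_mult)
  also have "... <= ennreal \<epsilon>"
  proof (rule ennreal_leI)
   have "cmod \<kappa> * (V - mb z R) <= (2 * I / V) * (\<epsilon> * V / (2 * I * Ln n + 1))"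
    using k R(1) \<delta>(3) mV[of R] I0 V by (intro mult_mono) auto
   also have "... = 2 * I * \<epsilon> / (2 * I * Ln n + 1)" using V by simp
   finally have "Ln n * (cmod \<kappa> * (V - mb z R)) <= Ln n * (2 * I * \<epsilon> / (2 * I * Ln n + 1))" using L0 by (rule mult_left_mono)
   also have "... = (2 * I * Ln n) / (2 * I * Ln n + 1) * \<epsilon>" by simp
   also have "... <= 1 * \<epsilon>" using den eps by (intro mult_right_mono) auto
   finally show "Ln n * (cmod \<kappa> * (V - mb z R)) <= \<epsilon>" by simp
  qed
  finally show ?thesis .
 qed
 have feq: "f = (\<lambda>x. G x + er x)" unfolding G_def er_def \<phi>_def by (auto simp: fun_eq_iff indicator_def)
 have "(\<integral>x. Sn n f x) <= (\<integral>x. Sn n G x + Sn n er x)"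
  unfolding feq using Gf ef by (intro nn_integral_mono_AE Sn_add_AE) auto
 also have "... = (\<integral>x. Sn n G x) + (\<integral>x. Sn n er x)" by (rule nn_integral_add) measurable
 also have "... <= ennreal (C0 * ((1 + Cl) * (V + 2 * I) + 2 * I)) + ennreal \<epsilon>" by (rule add_mono[OF SG Se])
 finally show "(\<integral>x. Sn n f x) <= ennreal (C0 * ((1 + Cl) * (V + 2 * I) + 2 * I)) + ennreal \<epsilon>" .
qed

text \<open>Since \<open>|f| <= 1\<close>, the bad pieces are bounded by 1 and become blocks of size
  comparable to \<open>mb j (\<alpha>\<^sup>2 * r j) + t j\<close>. The sizes add up to a multiple
  of \<open>1 / h\<close> times the L^1 norm, \<open>h <= 1\<close> absorbing the second kind of
  term. The Hardy bound is applied once, to the whole bad part, and the good part is left to the L^4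
  bound.\<close>

lemma restricted_CZ:
 assumes f: "nice\<^sub>1 f" and bd: "\<And>x. cmod (f x) <= 1" and b4: "bdd n 4 A" and A: "A >= 0"
  and s: "s > 0" and h: "0 < h" "h <= 1"
  and large: "ennreal (\<beta> / h) * L1 f < emeasure M (space M)"
 shows "mlev (Sn n f) (3 * s) <=
  ennreal (250 * A powr 4 * s powr - 4 * h powr 3 + C0 * (1 + 4 * Cl ^ a) * (3 * \<beta>) / (h * s)) * L1 f"
proof -
 let ?I = "\<integral>y. nrm unitM (\<lambda>p. f (fst p)) y" and ?c = "1 + 4 * Cl ^ a"
 note [measurable] = nice1_meas[OF f]
 have c0: "C0 * ?c * (3 * \<beta>) / (h * s) >= 0" using C0 Cl_pos beta_ge s h by simp
 have large': "ennreal (\<beta> / h) * ?I < emeasure M (space M)" using large by simp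
 have "mlev (k.S n (\<lambda>p. f (fst p))) (3 * s) <=
  ennreal (2 * 5 powr (4 - 1) * A powr 4 * s powr - 4 * h powr (4 - 1) + C0 * ?c * (3 * \<beta>) / (h * s)) * ?I"
 proof (rule k.CZ_weak[OF b4 _ A f s h(1) c0 large'])
  fix \<epsilon> :: real and J :: "'a set" and r R Q B t \<psi>' \<phi>'
  assume eps: "\<epsilon> > 0" and fJ: "finite J" and blk': "\<And>j. j \<in> J ==> k.CZ_block (\<lambda>p. f (fst p)) j (r j) (R j) (Q j) (B j) (t j) (\<psi>' j) (\<phi>' j)"
   and sumB: "(\<Sum>j\<in>J. mb j (\<alpha>\<^sup>2 * r j)) <= \<beta> / h * (enn2real ?I + \<epsilon>)"
   and sumt: "(\<Sum>j\<in>J. t j) <= enn2real ?I + \<epsilon>"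
  define I where "I = enn2real ?I + \<epsilon>"
  have I0: "I >= 0" unfolding I_def using eps by simp
  note sumB = sumB[folded I_def] and sumt = sumt[folded I_def]
  note CZ = k.CZ_blockD[OF blk']
  define \<psi> where "\<psi> j x = \<psi>' j (x, ())" for j x
  define \<phi> where "\<phi> j x = \<phi>' j (x, ())" for j x
  have nG: "nice\<^sub>1 (\<psi> j)" "nice\<^sub>1 (\<phi> j)" if "j \<in> J" for j
   unfolding \<psi>_def \<phi>_def unit_fun[symmetric] using CZ(11,12)[OF that] by auto
  define b where "b x = (\<Sum>j\<in>J. \<psi> j x + \<phi> j x)" for x
  have int: "integrable M b"
   unfolding b_def by (intro nice1_integrable nG Bochner_Integration.integrable_sum Bochner_Integration.integrable_add; simp)
  have b1: "b \<in> Lp_space M 1" unfolding Lp_space_def eLp_norm_1 using int by (simp add: integrable_iff_bounded)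
  have canc: "(LINT x|M. \<psi> j x + \<phi> j x) = 0" if j: "j \<in> J" for j
   using CZ(16)[OF j] unfolding \<psi>_def \<phi>_def by (simp add: AE_count_space)
  have \<psi>0: "\<psi> j x = 0" if "j \<in> J" "x \<notin> ball j (\<alpha> * r j)" for j x
  proof -
   have "x \<notin> Q j" using CZ(3)[OF that(1)] that(2) by blast
   then show ?thesis using spec[OF CZ(13)[OF that(1)], of x] unfolding \<psi>_def by simp
  qed
  have \<psi>1: "cmod (\<psi> j x) <= 1" if "j \<in> J" for j x
  proof -
   have "ecmod (\<psi> j x) <= ind (Q j) x * ecmod (f x)" using spec[OF CZ(13)[OF that], of x] unfolding \<psi>_def by simp
   also have "... <= 1 * ennreal 1" using bd[of x] by (intro mult_mono ennreal_leI) (auto simp: indicator_def)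
   finally show ?thesis by simp
  qed
  have \<phi>0: "\<phi> j x = 0" if "j \<in> J" "x \<notin> ball j (R j)" for j x
  proof -
   have "x \<notin> B j" using CZ(5)[OF that(1)] that(2) by blast
   then show ?thesis using spec[OF CZ(15)[OF that(1)], of x] unfolding \<phi>_def by simp
  qed
  have \<phi>1: "cmod (\<phi> j x) <= t j / measure M (B j)" if "j \<in> J" for j x
  proof -
   have nn: "t j / measure M (B j) >= 0" using CZ(10)[OF that] by simp
   have "ecmod (\<phi> j x) <= ennreal (t j / measure M (B j)) * ind (B j) x"
    using spec[OF CZ(15)[OF that], of x] unfolding \<phi>_def by simp
   also have "... <= ennreal (t j / measure M (B j))" by (auto simp: indicator_def)
   finally show ?thesis using nn by (subst (asm) ennreal_le_iff)
  qed
  have D0: "4 * Cl ^ a >= 0" using Cl_pos by simp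
  define sz where "sz j = ?c * (1 * mb j (\<rho> * (\<alpha> * r j)) + t j / measure M (B j) * mb j (\<rho> * R j))" for j
  have blk: "atomic_block M lam \<rho> p (\<lambda>x. \<psi> j x + \<phi> j x) (sz j)" if j: "j \<in> J" for j
   unfolding atomic_block_def sz_def
  proof (rule disjI1, rule block_of_bounded[OF nG[OF j] _ CZ(2)[OF j] \<psi>0[OF j] \<phi>0[OF j] \<psi>1[OF j] \<phi>1[OF j] canc[OF j] D0])
   show "0 < \<alpha> * r j" using CZ(1)[OF j] alpha_pos(1) by simp
   then have "R j > 0" using CZ(2)[OF j] by linarith
   then have sub: "ball j (2 * R j) \<subseteq> ball j (\<alpha> * R j)" using alpha_ge_8 by (intro subset_ball) simp
   show "(\<integral>y. dl j y * ind (ball j (2 * R j) - ball j (\<alpha> * r j)) y) <= ennreal (4 * Cl ^ a)"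
   proof (rule order_trans[OF nn_integral_mono CZ(9)[OF j]])
    fix y
    show "dl j y * ind (ball j (2 * R j) - ball j (\<alpha> * r j)) y <= dl j y * ind (ball j (\<alpha> * R j) - ball j (\<alpha> * r j)) y"
     using sub by (intro mult_left_mono) (auto simp: indicator_def)
   qed
  qed
  have sizes: "(\<Sum>j\<in>J. sz j) <= ?c * (3 * \<beta>) / h * I"
  proof -
   have "sz j <= ?c * (mb j (\<alpha>\<^sup>2 * r j) + 2 * \<beta> * t j)" if j: "j \<in> J" for j
    unfolding sz_def
   proof (intro mult_left_mono add_mono)
    have "0 < \<alpha> * r j" using CZ(1)[OF j] alpha_pos(1) by simp
    then have "R j > 0" using CZ(2)[OF j] by (rule less_le_trans)
    then have r: "r j > 0" "R j > 0" "measure M (B j) > 0" using CZ(1,6)[OF j] by auto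
    \<comment> \<open>Here \<open>\<rho> <= \<alpha>\<close> enters: the dilates by \<rho> in the
      normalisation of atoms fit into the dilates by \<open>\<alpha>\<close> whose measure the
      decomposition controls.\<close>
    have "\<rho> * (\<alpha> * r j) <= \<alpha> * (\<alpha> * r j)" using rho r alpha_pos(1) by (intro mult_right_mono) auto
    then show "1 * mb j (\<rho> * (\<alpha> * r j)) <= mb j (\<alpha>\<^sup>2 * r j)" using mb_le[of "\<rho> * (\<alpha> * r j)" "\<alpha>\<^sup>2 * r j" j] by (simp add: power2_eq_square mult.assoc)
    have "\<rho> <= \<alpha> * 1" using rho(2) by simp
    also have "... <= \<alpha> * \<alpha>\<^sup>2" using alpha_ge_8 by (intro mult_left_mono one_le_power) auto
    finally have "\<rho> <= \<alpha> * \<alpha>\<^sup>2" .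
    then have "\<rho> * R j <= \<alpha> ^ 3 * R j" using r by (intro mult_right_mono) (auto simp: power3_eq_cube power2_eq_square)
    then have "mb j (\<rho> * R j) <= mb j (\<alpha> ^ 3 * R j)" by (rule mb_le)
    also have "... <= \<beta> * mb j (R j)" by (rule CZ(7)[OF j])
    also have "... <= \<beta> * (2 * measure M (B j))" using CZ(8)[OF j] beta_ge by (intro mult_left_mono) auto
    finally have "t j / measure M (B j) * mb j (\<rho> * R j) <= t j / measure M (B j) * (\<beta> * (2 * measure M (B j)))"
     using CZ(10)[OF j] r by (intro mult_left_mono) auto
    then show "t j / measure M (B j) * mb j (\<rho> * R j) <= 2 * \<beta> * t j" using r by (simp add: mult_ac)
   qed (use Cl_pos in simp)
   then have "(\<Sum>j\<in>J. sz j) <= (\<Sum>j\<in>J. ?c * (mb j (\<alpha>\<^sup>2 * r j) + 2 * \<beta> * t j))" by (rule sum_mono)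
   also have "... = ?c * ((\<Sum>j\<in>J. mb j (\<alpha>\<^sup>2 * r j)) + 2 * \<beta> * (\<Sum>j\<in>J. t j))"
    by (simp only: sum_distrib_left[symmetric] sum.distrib)
   also have "... <= ?c * (\<beta> / h * I + 2 * \<beta> / h * I)"
   proof (intro mult_left_mono add_mono sumB)
    have "2 * \<beta> * (\<Sum>j\<in>J. t j) <= 2 * \<beta> * I" using sumt beta_ge by (intro mult_left_mono) auto
    also have "... <= 2 * \<beta> / h * I"
    proof (rule mult_right_mono)
     have "\<beta> * h <= \<beta> * 1" using h(2) beta_ge by (intro mult_left_mono) auto
     then show "2 * \<beta> <= 2 * \<beta> / h" using h by (simp add: field_simps)
    qed (use I0 in simp)
    finally show "2 * \<beta> * (\<Sum>j\<in>J. t j) <= 2 * \<beta> / h * I" .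
   qed (use Cl_pos in simp)
   also have "... = ?c * (3 * \<beta>) / h * I"
   proof -
    have "?c * (\<beta> / h * Y + 2 * \<beta> / h * Y) = ?c * (3 * \<beta>) / h * Y" for Y
     by (simp add: field_simps)
    then show ?thesis .
   qed
   finally show ?thesis .
  qed
  have Sb: "(\<integral>x. Sn n b x) <= ennreal (C0 * (?c * (3 * \<beta>) / h * I))"
   by (rule Sn_blocks[OF fJ blk b1 _ sizes]) (simp_all add: b_def)
  have "mlev (Sn n b) s <= ennreal (s powr - 1) * (\<integral>x. ennpowr (Sn n b x) 1)"
   using s b1 unfolding Lp_space_def by (intro k.Markov_q) auto
  also have "... <= ennreal (s powr - 1) * ennreal (C0 * (?c * (3 * \<beta>) / h * I))"
   using Sb by (simp add: mult_left_mono)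
  also have "... = ennreal (s powr - 1 * (C0 * (?c * (3 * \<beta>) / h * I)))"
   by (rule ennreal_mult'[symmetric]) simp
  also have "s powr - 1 * (C0 * (?c * (3 * \<beta>) / h * I)) = C0 * ?c * (3 * \<beta>) / (h * s) * I"
  proof -
   have "s powr - 1 * (C0 * (?c * (3 * \<beta>) / h * Y)) = C0 * ?c * (3 * \<beta>) / (h * s) * Y" for Y
    using s by (simp add: powr_minus_divide mult_ac)
   then show ?thesis .
  qed
  finally show "mlev (k.S n (\<lambda>p. \<Sum>j\<in>J. \<psi>' j p + \<phi>' j p)) s <=
   ennreal (C0 * ?c * (3 * \<beta>) / (h * s) * (enn2real ?I + \<epsilon>))"
   unfolding Sn_def b_def \<psi>_def \<phi>_def I_def[symmetric] unit_fun[symmetric, of "\<lambda>p. \<Sum>j\<in>J. \<psi>' j p + \<phi>' j p"] .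
 qed simp
 moreover have "2 * 5 powr (4 - 1) = (250 :: real)" by simp
 ultimately show ?thesis unfolding Sn_def by simp
qed

text \<open>A common majorant for the three cases of \<open>restricted_weak\<close>: large height,
  decomposition, and small total measure.\<close>

definition D\<^sub>r :: real where
 "D\<^sub>r = 251 + C0 * ((1 + 4 * Cl ^ a) * (3 * \<beta>) + (1 + Cl) * (\<beta> + 2) + 2)"

text \<open>For \<open>h >= 1\<close> Chebyshev in L^4 is enough, because \<open>|f| <= 1\<close>
  makes the fourth power of the L^4 norm at most the L^1 norm. For \<open>h <= 1\<close> either the
  decomposition is available or the total measure is at most \<open>\<beta> / h\<close> times the
  L^1 norm, and \<open>Sn_finite_space\<close> applies.\<close>

lemma restricted_weak:
 assumes f: "nice\<^sub>1 f" and bd: "\<And>x. cmod (f x) <= 1" and b4: "bdd n 4 A" and A: "A >= 1"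
  and s: "s > 0"
 shows "mlev (Sn n f) (3 * s) <= ennreal (D\<^sub>r * A * s powr - (7 / 4)) * L1 f"
proof -
 note [measurable] = nice1_meas[OF f]
 let ?I = "\<integral>\<^sup>+x. ecmod (f x) \<partial>M"
 define I where "I = enn2real ?I"
 have I0: "I >= 0" unfolding I_def by simp
 have fin: "?I = ennreal I" unfolding I_def using nice1_finite[OF f, of 1] by simp
 \<comment> \<open>The solution of \<open>A powr 4 * s powr - 4 * h powr 3 = 1 / (h * s)\<close>;
   both sides then equal \<open>A * s powr - (7 / 4)\<close>.\<close>
 define h where "h = s powr (3 / 4) / A"
 have h: "h > 0" unfolding h_def using s A by simp
 have lnh: "ln h = 3 / 4 * ln s - ln A" unfolding h_def using s A by (simp add: ln_div ln_powr)
 have e1: "A powr 4 * s powr - 4 * h powr 3 = A * s powr - (7 / 4)"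
 proof -
  have "ln (A powr 4 * s powr - 4 * h powr 3) = ln (A * s powr - (7 / 4))"
   using A s h lnh by (simp add: ln_mult ln_powr del: powr_numeral powr_neg_numeral)
  then show ?thesis using A s h by (subst (asm) ln_inj_iff) auto
 qed
 have e2: "1 / (h * s) = A * s powr - (7 / 4)"
 proof -
  have "ln (1 / (h * s)) = ln (A * s powr - (7 / 4))"
   using A s h lnh by (simp add: ln_mult ln_powr ln_div)
  then show ?thesis using A s h by (subst (asm) ln_inj_iff) auto
 qed
 have nn: "C0 * ((1 + 4 * Cl ^ a) * (3 * \<beta>)) >= 0" "C0 * ((1 + Cl) * (\<beta> + 2) + 2) >= 0" using C0 Cl_pos beta_ge by auto
 have Dr: "D\<^sub>r = 251 + C0 * ((1 + 4 * Cl ^ a) * (3 * \<beta>)) + C0 * ((1 + Cl) * (\<beta> + 2) + 2)"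
  unfolding D\<^sub>r_def by (simp add: distrib_left)
 have As: "A * s powr - (7 / 4) >= 0" using A by simp
 have mono: "mlev (Sn n f) (3 * s) <= mlev (Sn n f) s"
 proof (rule emeasure_mono)
  have "ennreal s <= ennreal (3 * s)" using s by (intro ennreal_leI) simp
  then show "lev (Sn n f) (3 * s) \<subseteq> (lev (Sn n f) s)" by auto
 qed measurable
 consider "h >= 1" | "h <= 1" "ennreal (\<beta> / h) * ?I < emeasure M (space M)" | "h <= 1" "emeasure M (space M) <= ennreal (\<beta> / h) * ?I"
  by fastforce
 then show ?thesis
 proof cases
  case 1
  have "Lq 4 f <= ?I"
  proof (intro nn_integral_mono)
   fix x
   have "cmod (f x) ^ 4 <= cmod (f x) ^ 1" using bd[of x] by (intro power_decreasing) auto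
   then show "ennpowr (ecmod (f x)) 4 <= ecmod (f x)" by (simp add: ennpowr_ennreal ennreal_leI)
  qed
  note L4 = this
  have "mlev (Sn n f) s <= ennreal (s powr - 4) * (\<integral>x. ennpowr (Sn n f x) 4)"
   using s by (intro k.Markov_q) auto
  also have "... <= ennreal (s powr - 4) * (ennreal (A powr 4) * Lq 4 f)"
   using b4 f unfolding bounded_nice_def Sn_def by (intro mult_left_mono) auto
  also have "... <= ennreal (s powr - 4) * (ennreal (A powr 4) * ?I)" using L4 by (intro mult_left_mono) auto
  also have "... = ennreal (A powr 4 * s powr - 4) * ?I" by (simp add: ennreal_mult mult_ac)
  also have "... <= ennreal (D\<^sub>r * A * s powr - (7 / 4)) * ?I"
  proof (intro mult_right_mono ennreal_leI)
   have "A powr 4 * s powr - 4 * 1 <= A powr 4 * s powr - 4 * h powr 3"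
    using 1 by (intro mult_left_mono ge_one_powr_ge_zero) auto
   also note e1
   also have "A * s powr - (7 / 4) <= D\<^sub>r * (A * s powr - (7 / 4))"
   proof -
    have "1 <= D\<^sub>r" using nn Dr by linarith
    from mult_right_mono[OF this As] show ?thesis by simp
   qed
   finally show "A powr 4 * s powr - 4 <= D\<^sub>r * A * s powr - (7 / 4)" by (simp only: mult.assoc mult_1_right)
  qed simp
  finally show ?thesis by (rule order_trans[OF mono])
 next
  case 2
  have "mlev (Sn n f) (3 * s) <=
   ennreal (250 * A powr 4 * s powr - 4 * h powr 3 + C0 * (1 + 4 * Cl ^ a) * (3 * \<beta>) / (h * s)) * ?I"
   by (rule restricted_CZ[OF f bd b4 _ s h 2]) (use A in simp)
  also have "... <= ennreal (D\<^sub>r * A * s powr - (7 / 4)) * ?I"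
  proof (intro mult_right_mono ennreal_leI)
   have "250 * A powr 4 * s powr - 4 * h powr 3 + C0 * (1 + 4 * Cl ^ a) * (3 * \<beta>) / (h * s)
    = 250 * (A powr 4 * s powr - 4 * h powr 3) + C0 * ((1 + 4 * Cl ^ a) * (3 * \<beta>)) * (1 / (h * s))"
    by (simp only: mult.assoc times_divide_eq_right mult_1_right)
   also have "... = (250 + C0 * ((1 + 4 * Cl ^ a) * (3 * \<beta>))) * (A * s powr - (7 / 4))"
    unfolding e1 e2 by (rule distrib_right[symmetric])
   also have "... <= D\<^sub>r * (A * s powr - (7 / 4))"
   proof (rule mult_right_mono[OF _ As])
    show "250 + C0 * ((1 + 4 * Cl ^ a) * (3 * \<beta>)) <= D\<^sub>r" using nn Dr by linarith
   qed
   finally show "250 * A powr 4 * s powr - 4 * h powr 3 + C0 * (1 + 4 * Cl ^ a) * (3 * \<beta>) / (h * s) <= D\<^sub>r * A * s powr - (7 / 4)"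
    by (simp only: mult.assoc)
  qed simp
  finally show ?thesis .
 next
  case 3
  define V where "V = measure M (space M)"
  have bI: "\<beta> / h * I >= 0" using beta_ge h I0 by simp
  have V': "emeasure M (space M) <= ennreal (\<beta> / h * I)" 
   using 3(2) unfolding fin by (subst ennreal_mult) (use beta_ge h I0 in auto)
  then have "emeasure M (space M) < \<infinity>" by (rule le_less_trans) simp
  then have V: "emeasure M (space M) = ennreal V" unfolding V_def by (intro emeasure_eq_ennreal_measure) auto
  have VI: "V <= \<beta> / h * I" using V' bI unfolding V by (subst (asm) ennreal_le_iff) auto
  show ?thesis
  proof (cases "V > 0")
   case False
   then have "emeasure M (space M) = 0" unfolding V by (simp add: ennreal_neg)
   then have "mlev (Sn n f) (3 * s) <= 0" by (metis emeasure_space)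
   then show ?thesis by (rule order_trans) simp
  next
   case True
   have "mlev (Sn n f) s <= ennreal (s powr - 1) * (\<integral>x. ennpowr (Sn n f x) 1)"
    using s by (intro k.Markov_q) auto
   also have "... <= ennreal (s powr - 1) * ennreal (C0 * ((1 + Cl) * (V + 2 * I) + 2 * I))"
    using Sn_finite_space[OF f bd V True, of n] unfolding I_def by (simp add: mult_left_mono)
   also have "... = ennreal (s powr - 1 * (C0 * ((1 + Cl) * (V + 2 * I) + 2 * I)))" by (rule ennreal_mult'[symmetric]) simp
   also have "... <= ennreal (D\<^sub>r * A * s powr - (7 / 4) * I)"
   proof (rule ennreal_leI)
    have h1: "1 <= 1 / h" using h 3(1) by simp
    have "V + 2 * I <= (\<beta> + 2) / h * I"
    proof -
     have "2 * I <= 2 * I * (1 / h)" using mult_left_mono[OF h1, of "2 * I"] I0 by simp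
     then show ?thesis using VI by (simp add: add_divide_distrib distrib_right)
    qed
    then have "(1 + Cl) * (V + 2 * I) <= (1 + Cl) * ((\<beta> + 2) / h * I)" using Cl_pos by (intro mult_left_mono) auto
    moreover have "2 * I <= 2 / h * I" using mult_left_mono[OF h1, of "2 * I"] I0 by simp
    ultimately have "(1 + Cl) * (V + 2 * I) + 2 * I <= (1 + Cl) * ((\<beta> + 2) / h * I) + 2 / h * I" by (rule add_mono)
    also have "... = ((1 + Cl) * (\<beta> + 2) + 2) / h * I" using h by (simp add: field_simps)
    finally have "(1 + Cl) * (V + 2 * I) + 2 * I <= ((1 + Cl) * (\<beta> + 2) + 2) / h * I" .
    then have "s powr - 1 * (C0 * ((1 + Cl) * (V + 2 * I) + 2 * I)) <= s powr - 1 * (C0 * (((1 + Cl) * (\<beta> + 2) + 2) / h * I))"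
     using C0 by (intro mult_left_mono) auto
    also have "... = C0 * ((1 + Cl) * (\<beta> + 2) + 2) * I * (1 / (h * s))" using s by (simp add: powr_minus_divide mult_ac)
    also have "... = C0 * ((1 + Cl) * (\<beta> + 2) + 2) * (A * s powr - (7 / 4) * I)" unfolding e2 by (simp only: mult_ac)
    also have "... <= D\<^sub>r * (A * s powr - (7 / 4) * I)"
    proof (rule mult_right_mono)
     show "C0 * ((1 + Cl) * (\<beta> + 2) + 2) <= D\<^sub>r" using nn Dr by linarith
    qed (use A I0 in simp)
    finally show "s powr - 1 * (C0 * ((1 + Cl) * (V + 2 * I) + 2 * I)) <= D\<^sub>r * A * s powr - (7 / 4) * I" by (simp only: mult.assoc)
   qed
   also have "... = ennreal (D\<^sub>r * A * s powr - (7 / 4)) * ?I" unfolding fin using I0 by (rule ennreal_mult'')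
   finally show ?thesis by (rule order_trans[OF mono])
  qed
 qed
qed

end

section \<open>From restricted to ordinary weak type\<close>

context marc begin

lemma Sn_cmult:
 assumes [measurable]: "f \<in> borel_measurable M"
 shows "Sn n (\<lambda>x. c * f x) x = ennreal (cmod c) * Sn n f x"
proof -
 have m: "(\<lambda>x. c * f x) \<in> borel_measurable M" by measurable
 have "avg (\<lambda>x. c * f x) x t = c * avg f x t" for t
 proof -
  have "(LINT y|M. kn (x, t) (y, ()) * (c * f y)) = (LINT y|M. c * (kn (x, t) (y, ()) * f y))"
   by (simp only: mult.left_commute)
  also have "... = c * (LINT y|M. kn (x, t) (y, ()) * f y)" by (rule integral_mult_right_zero)
  finally show ?thesis unfolding int_op_kn(2)[OF m] int_op_kn(2)[OF assms] .
 qed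
 then have "(Sn n (\<lambda>x. c * f x) x)\<^sup>2 = (\<integral>\<^sup>+t. (ennreal (cmod c))\<^sup>2 * (ennreal (ind {1 / Suc n<..<Suc n} t * (1 / t ^ 3)) * (ecmod (avg f x t))\<^sup>2) \<partial>lborel)"
  unfolding Sn_sq[OF m] by (intro nn_integral_cong) (simp add: norm_mult ennreal_mult power_mult_distrib mult_ac)
 also have "... = (ennreal (cmod c) * Sn n f x)\<^sup>2"
  unfolding power_mult_distrib Sn_sq[OF assms] by (rule nn_integral_cmult) (use measurable_avg_t[OF assms] in measurable)
 finally have "ennpowr ((Sn n (\<lambda>x. c * f x) x)\<^sup>2) (1 / 2) = ennpowr ((ennreal (cmod c) * Sn n f x)\<^sup>2) (1 / 2)" by (rule arg_cong)
 then show ?thesis by (simp only: ennpowr_sq_half)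
qed

text \<open>The ratio of the weights on dyadic levels, chosen so that
  \<open>x\<^sub>d powr - (7 / 4) = 2 powr (1 / 8)\<close>. This growth cancels exactly the decay
  \<open>2 powr - (i / 8)\<close> that the passage from exponent 7/4 to 15/8 gains at level
  \<open>i\<close>.\<close>

definition x\<^sub>d :: real where "x\<^sub>d = 2 powr (- 1 / 14)"
definition c\<^sub>d :: real where "c\<^sub>d = (1 - x\<^sub>d) powr - (7 / 4) * 2 powr (5 / 8)"

text \<open>The restricted weak type estimate with \<open>7 / 4\<close> is applied to the dyadic level sets of \<open>f\<close> with geometric
 weights; their decay costs \<open>1 / 8\<close> in the exponent.\<close>

lemma weak_of_restricted:
 assumes weak: "\<And>g s. nice\<^sub>1 g ==> (\<And>x. cmod (g x) <= 1) ==> s > 0 ==>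
   mlev (Sn n g) s <= ennreal (D * s powr - (7 / 4)) * L1 g"
  and D: "D >= 0" and f: "nice\<^sub>1 f" and s: "s > 0" and \<kappa>: "\<kappa> > 0"
  and big: "\<And>x. f x = 0 \<or> 2 * \<kappa> * s < cmod (f x)"
 shows "mlev (Sn n f) s <= ennreal (D * c\<^sub>d * \<kappa> powr - (1 / 8) * s powr - (15 / 8)) * Lq (15 / 8) f"
proof -
 have [measurable]: "f \<in> borel_measurable M" by (rule nice1_meas[OF f])
 have xd: "0 < x\<^sub>d" "x\<^sub>d < 1" unfolding x\<^sub>d_def using powr_less_mono[of "- 1 / 14" 0 "2 :: real"] by auto
 \<comment> \<open>The dyadic levels start at the height below which \<open>f\<close> vanishes by
   hypothesis \<open>big\<close>, so no infinite tail of small levels occurs; boundedness of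
   \<open>f\<close> ends them above.\<close>
 define \<tau> where "\<tau> i = 2 ^ i * (2 * \<kappa> * s)" for i :: nat
 define w where "w i = (1 - x\<^sub>d) * x\<^sub>d ^ i" for i :: nat
 have \<tau>: "\<tau> i > 0" "\<tau> (Suc i) = 2 * \<tau> i" for i unfolding \<tau>_def using \<kappa> s by auto
 have w: "w i > 0" for i unfolding w_def using xd by simp
 have sumw: "(\<Sum>i<m. w i) <= 1" for m
 proof -
  have "(\<Sum>i<m. w i) = 1 - x\<^sub>d ^ m"
   unfolding w_def sum_distrib_left[symmetric] using xd by (simp add: sum_gp_strict)
  then show ?thesis using xd by simp
 qed
 define E where "E i = {x \<in> space M. \<tau> i < cmod (f x) \<and> cmod (f x) <= \<tau> (Suc i)}" for i
 have [measurable]: "E i \<in> sets M" for i unfolding E_def by measurable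
 define F where "F i x = ind (E i) x * f x" for i x
 have nF: "nice\<^sub>1 (F i)" for i unfolding F_def by (rule nice1_indicator[OF f]) measurable
 have [measurable]: "F i \<in> borel_measurable M" for i by (rule nice1_meas[OF nF])
 have part: "(\<Sum>i<m. ind (E i) x) = (if \<tau> 0 < cmod (f x) \<and> cmod (f x) <= \<tau> m then 1 else (0 :: 'r :: semiring_1))" for m x
 proof (induction m)
  case (Suc m)
  have "\<tau> m <= \<tau> (Suc m)" "\<tau> 0 <= \<tau> m" unfolding \<tau>_def using \<kappa> s by auto
  then show ?case using Suc by (auto simp: E_def indicator_def)
 qed auto
 obtain m0 where m0: "\<And>x. cmod (f x) <= m0" using f unfolding nice_scalar by blast
 obtain m :: nat where m: "m0 / (2 * \<kappa> * s) < 2 ^ m" using real_arch_pow[of 2] by auto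
 have top: "cmod (f x) <= \<tau> m" for x
  using m0[of x] m \<kappa> s unfolding \<tau>_def by (simp add: field_simps)
 have feq: "f = (\<lambda>x. \<Sum>i<m. F i x)"
 proof
  fix x
  have "(\<Sum>i<m. F i x) = (\<Sum>i<m. ind (E i) x) * f x" unfolding F_def by (rule sum_distrib_right[symmetric])
  also have "... = f x" unfolding part using top[of x] big[of x] unfolding \<tau>_def by auto
  finally show "f x = (\<Sum>i<m. F i x)" ..
 qed
 have "AE x in M. Sn n f x <= (\<Sum>i<m. Sn n (F i) x)"
  unfolding feq by (rule Sn_sum_AE) (use nice1_finite[OF nF, of 1] in auto)
 then have "AE x in M. x \<in> lev (Sn n f) s \<longrightarrow> x \<in> (\<Union>i<m. (lev (Sn n (F i)) (w i * s)))"
 proof eventually_elim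
  fix x assume le: "Sn n f x <= (\<Sum>i<m. Sn n (F i) x)"
  show "x \<in> lev (Sn n f) s \<longrightarrow> x \<in> (\<Union>i<m. (lev (Sn n (F i)) (w i * s)))"
  proof (intro impI, rule ccontr)
   assume x: "x \<in> lev (Sn n f) s" and nx: "x \<notin> (\<Union>i<m. (lev (Sn n (F i)) (w i * s)))"
   have "(\<Sum>i<m. Sn n (F i) x) <= (\<Sum>i<m. ennreal (w i * s))"
    using x nx by (intro sum_mono) (auto simp: not_less)
   also have "... = ennreal ((\<Sum>i<m. w i) * s)" using w s by (subst sum_ennreal) (auto simp: sum_distrib_right less_imp_le)
   also have "... <= ennreal (1 * s)" using sumw[of m] s by (intro ennreal_leI mult_right_mono) auto
   finally show False using x le by auto
  qed
 qed
 moreover have lev [measurable]: "lev (Sn n (F i)) (w i * s) \<in> sets M" for i by measurable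
 ultimately have "mlev (Sn n f) s <= emeasure M (\<Union>i<m. (lev (Sn n (F i)) (w i * s)))"
  by (intro emeasure_mono_AE sets.finite_UN finite_lessThan lev)
 also have "... <= (\<Sum>i<m. mlev (Sn n (F i)) (w i * s))"
  by (intro emeasure_subadditive_finite image_subsetI finite_lessThan lev)
 also have "... <= (\<Sum>i<m. ennreal (D * c\<^sub>d * \<kappa> powr - (1 / 8) * s powr - (15 / 8)) * Lq (15 / 8) (F i))"
 proof (rule sum_mono)
  fix i
  \<comment> \<open>The restricted estimate needs sup norm at most 1, so the piece is rescaled by
    its upper height; homogeneity of \<open>Sn\<close> rescales the level with it.\<close>
  define g where "g x = complex_of_real (1 / \<tau> (Suc i)) * F i x" for x
  have ng: "nice\<^sub>1 g" unfolding g_def by (rule nice1_cmult[OF nF])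
  have gF: "cmod (g x) = cmod (F i x) / \<tau> (Suc i)" for x
   unfolding g_def norm_mult norm_of_real using \<tau>(1)[of "Suc i"] by simp
  have g1: "cmod (g x) <= 1" for x
   unfolding gF using \<tau>(1)[of "Suc i"] by (auto simp: F_def indicator_def E_def)
  have "lev (Sn n (F i)) (w i * s) = (lev (Sn n g) (w i * s / \<tau> (Suc i)))"
  proof -
   have "ennreal (w i * s) < Sn n (F i) x \<longleftrightarrow> ennreal (w i * s / \<tau> (Suc i)) < Sn n g x" for x
   proof -
    have Fg: "F i = (\<lambda>x. complex_of_real (\<tau> (Suc i)) * g x)" unfolding g_def using \<tau>(1)[of "Suc i"] by (auto simp: fun_eq_iff)
    have "Sn n (F i) x = ennreal (\<tau> (Suc i)) * Sn n g x"
     unfolding Fg using \<tau>(1)[of "Suc i"] by (subst Sn_cmult[OF nice1_meas[OF ng]]) simp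
    moreover have "ennreal (w i * s) = ennreal (\<tau> (Suc i)) * ennreal (w i * s / \<tau> (Suc i))"
     using \<tau>(1)[of "Suc i"] w[of i] s by (simp flip: ennreal_mult)
    moreover have "ennreal (\<tau> (Suc i)) * y < ennreal (\<tau> (Suc i)) * z \<longleftrightarrow> y < z" for y z
    proof
     show "ennreal (\<tau> (Suc i)) * y < ennreal (\<tau> (Suc i)) * z" if "y < z"
      using that \<tau>(1)[of "Suc i"] by (intro ennreal_mult_strict_left_mono) auto
     show "y < z" if "ennreal (\<tau> (Suc i)) * y < ennreal (\<tau> (Suc i)) * z"
      using that mult_left_mono[of z y "ennreal (\<tau> (Suc i))"] by (simp add: not_le[symmetric]) blast
    qed
    ultimately show ?thesis by simp
   qed
   then show ?thesis by simp
  qed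
  then have "mlev (Sn n (F i)) (w i * s) <= ennreal (D * (w i * s / \<tau> (Suc i)) powr - (7 / 4)) * L1 g"
   using weak[OF ng g1, of "w i * s / \<tau> (Suc i)"] w[of i] s \<tau>(1)[of "Suc i"] by simp
  also have "L1 g <= (\<integral>x. ennreal (\<tau> i powr - (7 / 8) / \<tau> (Suc i)) * ennpowr (ecmod (F i x)) (15 / 8))"
  proof (intro nn_integral_mono)
   fix x
   show "ecmod (g x) <= ennreal (\<tau> i powr - (7 / 8) / \<tau> (Suc i)) * ennpowr (ecmod (F i x)) (15 / 8)"
   proof (cases "x \<in> E i")
    case True
    then have F: "\<tau> i < cmod (F i x)" unfolding F_def E_def by (simp add: norm_mult)
    then have F0: "cmod (F i x) > 0" using \<tau>(1)[of i] by linarith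
    have "\<tau> i powr (7 / 8) <= cmod (F i x) powr (7 / 8)" using F \<tau>(1)[of i] by (intro powr_mono2) auto
    then have "1 <= \<tau> i powr - (7 / 8) * cmod (F i x) powr (7 / 8)" using \<tau>(1)[of i] by (simp add: powr_minus field_simps)
    then have "1 * cmod (F i x) <= \<tau> i powr - (7 / 8) * cmod (F i x) powr (7 / 8) * cmod (F i x)" by (rule mult_right_mono) simp
    also have "... = \<tau> i powr - (7 / 8) * (cmod (F i x) powr (7 / 8) * cmod (F i x) powr 1)" using F0 by (simp add: mult.assoc)
    also have "cmod (F i x) powr (7 / 8) * cmod (F i x) powr 1 = cmod (F i x) powr (7 / 8 + 1)" by (rule powr_add[symmetric])
    finally have "cmod (g x) <= \<tau> i powr - (7 / 8) * cmod (F i x) powr (15 / 8) / \<tau> (Suc i)"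
     unfolding gF using \<tau>(1)[of "Suc i"] by (intro divide_right_mono) auto
    also have "... = \<tau> i powr - (7 / 8) / \<tau> (Suc i) * cmod (F i x) powr (15 / 8)" by simp
    finally show ?thesis using \<tau>(1)[of "Suc i"] by (simp add: ennpowr_ennreal ennreal_leI flip: ennreal_mult)
   next
    case False
    then show ?thesis unfolding g_def F_def by simp
   qed
  qed
  also have "... = ennreal (\<tau> i powr - (7 / 8) / \<tau> (Suc i)) * Lq (15 / 8) (F i)" by (rule nn_integral_cmult) measurable
  also have "ennreal (D * (w i * s / \<tau> (Suc i)) powr - (7 / 4)) * (ennreal (\<tau> i powr - (7 / 8) / \<tau> (Suc i)) * Lq (15 / 8) (F i))
   = ennreal (D * (w i * s / \<tau> (Suc i)) powr - (7 / 4) * (\<tau> i powr - (7 / 8) / \<tau> (Suc i))) * Lq (15 / 8) (F i)"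
   by (subst mult.assoc[symmetric], subst ennreal_mult[symmetric]) (use D \<tau>(1)[of "Suc i"] in auto)
  \<comment> \<open>The powers of 2 depending on \<open>i\<close> cancel, so every level has the
    same constant and the pieces add up to the norm of \<open>f\<close> by disjointness.\<close>
  also have "D * (w i * s / \<tau> (Suc i)) powr - (7 / 4) * (\<tau> i powr - (7 / 8) / \<tau> (Suc i)) = D * c\<^sub>d * \<kappa> powr - (1 / 8) * s powr - (15 / 8)"
  proof -
   have lnw: "ln (w i) = ln (1 - x\<^sub>d) - real i / 14 * ln 2"
   proof -
    have "ln x\<^sub>d = - 1 / 14 * ln 2" unfolding x\<^sub>d_def by (simp add: ln_powr)
    then show ?thesis unfolding w_def using xd by (simp add: ln_mult ln_realpow)
   qed
   have ln\<tau>: "ln (\<tau> i) = (real i + 1) * ln 2 + ln \<kappa> + ln s" unfolding \<tau>_def using \<kappa> s by (simp add: ln_mult ln_realpow algebra_simps)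
   have ln\<tau>': "ln (\<tau> (Suc i)) = (real i + 2) * ln 2 + ln \<kappa> + ln s" unfolding \<tau>(2) using \<tau>(1)[of i] ln\<tau> by (simp add: ln_mult algebra_simps)
   have pos: "(w i * s / \<tau> (Suc i)) powr - (7 / 4) * (\<tau> i powr - (7 / 8) / \<tau> (Suc i)) > 0" "c\<^sub>d * \<kappa> powr - (1 / 8) * s powr - (15 / 8) > 0"
    unfolding c\<^sub>d_def using w[of i] s \<kappa> \<tau>(1)[of i] \<tau>(1)[of "Suc i"] xd by (auto intro!: mult_pos_pos divide_pos_pos)
   have "ln ((w i * s / \<tau> (Suc i)) powr - (7 / 4) * (\<tau> i powr - (7 / 8) / \<tau> (Suc i))) = - (7 / 4) * (ln (w i) + ln s - ln (\<tau> (Suc i))) + (- (7 / 8) * ln (\<tau> i) - ln (\<tau> (Suc i)))"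
    using w[of i] s \<tau>(1)[of i] \<tau>(1)[of "Suc i"] by (simp add: ln_mult ln_div ln_powr)
   also have "... = - (7 / 4) * ln (1 - x\<^sub>d) + 5 / 8 * ln 2 - 1 / 8 * ln \<kappa> - 15 / 8 * ln s"
    unfolding lnw ln\<tau> ln\<tau>' by (simp add: field_simps)
   also have "... = ln (c\<^sub>d * \<kappa> powr - (1 / 8) * s powr - (15 / 8))"
    unfolding c\<^sub>d_def using xd \<kappa> s by (simp add: ln_mult ln_powr)
   finally have "(w i * s / \<tau> (Suc i)) powr - (7 / 4) * (\<tau> i powr - (7 / 8) / \<tau> (Suc i)) = c\<^sub>d * \<kappa> powr - (1 / 8) * s powr - (15 / 8)"
    using pos by (subst (asm) ln_inj_iff)
   then show ?thesis by (simp only: mult.assoc)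
  qed
  finally show "mlev (Sn n (F i)) (w i * s) <= ennreal (D * c\<^sub>d * \<kappa> powr - (1 / 8) * s powr - (15 / 8)) * Lq (15 / 8) (F i)"
   by (simp add: mult_left_mono)
 qed
 also have "... = ennreal (D * c\<^sub>d * \<kappa> powr - (1 / 8) * s powr - (15 / 8)) * (\<integral>x. (\<Sum>i<m. ennpowr (ecmod (F i x)) (15 / 8)))"
  unfolding sum_distrib_left[symmetric] by (subst nn_integral_sum) auto
 also have "... <= ennreal (D * c\<^sub>d * \<kappa> powr - (1 / 8) * s powr - (15 / 8)) * Lq (15 / 8) f"
 proof (intro mult_left_mono nn_integral_mono)
  fix x
  have "(\<Sum>i<m. ennpowr (ecmod (F i x)) (15 / 8)) = (\<Sum>i<m. ind (E i) x * ennpowr (ecmod (f x)) (15 / 8))"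
   by (intro sum.cong refl) (auto simp: F_def indicator_def)
  also have "... = (\<Sum>i<m. ind (E i) x) * ennpowr (ecmod (f x)) (15 / 8)" by (rule sum_distrib_right[symmetric])
  also have "... <= 1 * ennpowr (ecmod (f x)) (15 / 8)" unfolding part by (intro mult_right_mono) auto
  finally show "(\<Sum>i<m. ennpowr (ecmod (F i x)) (15 / 8)) <= ennpowr (ecmod (f x)) (15 / 8)" by simp
 qed simp
 finally show ?thesis .
qed

end

context hardy_bounded begin

text \<open>Interpolation between exponents 15/8 and 4. With \<open>\<kappa> = A powr - 2\<close>
  the L^4 part, of order \<open>A powr 4 * \<kappa> powr 2\<close>, stays bounded, while the other
  part has order \<open>A * \<kappa> powr - (1 / 4) = A powr (3 / 2)\<close>. The square root gives
  the power 3/4 that the bootstrap requires.\<close>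

lemma L2_of_Hardy:
 obtains A where "A >= 1" "bounded_Sn 2 A"
proof -
 define c4 where "c4 = max 1 (C\<^sub>p Ck (4 / 3))"
 have c4: "c4 >= 1" "C\<^sub>p Ck (4 / 3) <= c4" unfolding c4_def by auto
 have Cp: "C\<^sub>p Ck (4 / 3) > 0" by (rule Cp_pos[OF Ck_ge(4)]) auto
 have cd: "c\<^sub>d >= 0" unfolding c\<^sub>d_def by simp
 have Dr: "D\<^sub>r >= 0" unfolding D\<^sub>r_def using C0 Cl_pos beta_ge by simp
 define B0 where "B0 = 2 * (2 powr (15 / 8) * (D\<^sub>r * c4 * 3 powr (7 / 4) * c\<^sub>d)) / (1 / 8) + (2 * c4) powr 4"
 define B where "B = max 1 (B0 powr (1 / 2))"
 have B00: "2 * (2 powr (15 / 8) * (D\<^sub>r * c4 * 3 powr (7 / 4) * c\<^sub>d)) / (1 / 8) >= 0" using Dr cd c4 by simp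
 have "bounded_Sn 2 (B ^ 4)"
 proof (rule L2_of_improvement)
  fix n A assume A: "A >= (1 :: real)" and bA: "bdd n 2 A"
  let ?\<kappa> = "A powr - 2" and ?D = "D\<^sub>r * (c4 * A) * 3 powr (7 / 4)"
  have "bdd n 4 (C\<^sub>p Ck (4 / (4 - 1)) * A)"
   by (rule k.Lp_above_2[OF cz_kernel_adjoint bA A]) simp
  then have "bdd n 4 (C\<^sub>p Ck (4 / 3) * A)" by simp
  then have b4: "bdd n 4 (c4 * A)"
   by (rule k.bounded_nice_mono) (use c4 Cp A in auto)
  have A4: "c4 * A >= 1" using mult_mono[OF c4(1) A] c4 by simp
  have r: "mlev (Sn n g) s <= ennreal (?D * s powr - (7 / 4)) * L1 g"
   if "nice\<^sub>1 g" "\<And>x. cmod (g x) <= 1" "s > 0" for g s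
  proof -
   \<comment> \<open>The restricted estimate measures the level set at \<open>3 * s\<close>;
     applying it at \<open>s / 3\<close> produces the factor \<open>3 powr (7 / 4)\<close>.\<close>
   have e: "D\<^sub>r * (c4 * A) * (s / 3) powr - (7 / 4) = ?D * s powr - (7 / 4)" and three: "3 * (s / 3) = s"
    using that(3) by (simp_all add: powr_divide powr_minus field_simps)
   have "s / 3 > 0" using that(3) by simp
   from restricted_weak[OF that(1,2) b4 A4 this] show ?thesis unfolding e three .
  qed
  have D0: "?D >= 0" "?D * c\<^sub>d * ?\<kappa> powr - (1 / 8) >= 0" using Dr A c4 cd by auto
  have \<kappa>0: "?\<kappa> > 0" using A by simp
  have "bdd n 2 ((2 * (2 powr (15 / 8) * (?D * c\<^sub>d * ?\<kappa> powr - (1 / 8))) * ?\<kappa> powr (15 / 8 - 2) / (2 - 15 / 8)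
   + 2 * (2 * (c4 * A)) powr 4 * ?\<kappa> powr (4 - 2) / (4 - 2)) powr (1 / 2))"
  proof (rule k.interpolate[OF _ b4])
   fix u :: "'a \<times> unit => complex" and s :: real
   assume u: "nice M unitM u" and s: "s > 0" and big: "\<And>x. nrm unitM u x = 0 \<or> ennreal (2 * ?\<kappa> * s) < nrm unitM u x"
   have big': "u (x, ()) = 0 \<or> 2 * ?\<kappa> * s < cmod (u (x, ()))" for x
    using big[of x] s \<kappa>0 by (simp add: ennreal_less_iff)
   have nu: "nice\<^sub>1 (\<lambda>x. u (x, ()))" using u unfolding unit_fun[symmetric] .
   show "mlev (k.S n u) s <= ennreal (?D * c\<^sub>d * ?\<kappa> powr - (1 / 8) * s powr - (15 / 8)) * (\<integral>x. ennpowr (nrm unitM u x) (15 / 8))"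
    using weak_of_restricted[OF r D0(1) nu s \<kappa>0 big'] unfolding Sn_def unit_fun[symmetric] by simp
  qed (use D0 \<kappa>0 A4 in auto)
  then show "bdd n 2 (B * A powr (3 / 4))"
  proof (rule k.bounded_nice_mono)
   have k1: "?\<kappa> powr - (1 / 8) = A powr (1 / 4)" "?\<kappa> powr (15 / 8 - 2) = A powr (1 / 4)" by (simp_all add: powr_powr)
   have k2: "?\<kappa> powr (4 - 2) = A powr - 4" by (simp add: powr_powr del: powr_neg_numeral)
   have a1: "A * A powr (1 / 4) * A powr (1 / 4) = A powr (3 / 2)"
   proof -
    have "A powr (3 / 2) = A powr (1 + 1 / 4 + 1 / 4)" by simp
    also have "... = A powr 1 * A powr (1 / 4) * A powr (1 / 4)" by (simp only: powr_add)
    finally show ?thesis using A by simp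
   qed
   have a2: "(2 * (c4 * A)) powr 4 * A powr - 4 = (2 * c4) powr 4"
   proof -
    have "(2 * (c4 * A)) powr 4 = ((2 * c4) * A) powr 4" by (simp only: mult.assoc)
    also have "... = (2 * c4) powr 4 * A powr 4" by (rule powr_mult)
    finally have "(2 * (c4 * A)) powr 4 * A powr - 4 = (2 * c4) powr 4 * (A powr 4 * A powr - 4)" by (simp only: mult.assoc)
    also have "A powr 4 * A powr - 4 = A powr (4 + - 4)" by (rule powr_add[symmetric])
    also have "... = 1" using A by simp
    finally show ?thesis by simp
   qed
   have A32: "A powr (3 / 2) >= 1" using A by (simp add: ge_one_powr_ge_zero)
   have "2 * (2 powr (15 / 8) * (?D * c\<^sub>d * ?\<kappa> powr - (1 / 8))) * ?\<kappa> powr (15 / 8 - 2) / (2 - 15 / 8)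
     + 2 * (2 * (c4 * A)) powr 4 * ?\<kappa> powr (4 - 2) / (4 - 2)
    = 2 * (2 powr (15 / 8) * (D\<^sub>r * c4 * 3 powr (7 / 4) * c\<^sub>d)) / (1 / 8) * (A * A powr (1 / 4) * A powr (1 / 4)) + (2 * (c4 * A)) powr 4 * A powr - 4"
    unfolding k1 k2 by (simp add: mult_ac del: powr_numeral powr_neg_numeral)
   also have "... <= B0 * A powr (3 / 2)"
   proof -
    have "(2 * c4) powr 4 * 1 <= (2 * c4) powr 4 * A powr (3 / 2)" using A32 by (intro mult_left_mono) auto
    then show ?thesis unfolding a1 a2 B0_def by (simp only: distrib_right mult_1_right add_left_mono)
   qed
   finally have "(2 * (2 powr (15 / 8) * (?D * c\<^sub>d * ?\<kappa> powr - (1 / 8))) * ?\<kappa> powr (15 / 8 - 2) / (2 - 15 / 8)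
     + 2 * (2 * (c4 * A)) powr 4 * ?\<kappa> powr (4 - 2) / (4 - 2)) powr (1 / 2) <= (B0 * A powr (3 / 2)) powr (1 / 2)"
    by (rule powr_mono2[rotated 2]) (use Dr A c4 cd in \<open>auto intro!: add_nonneg_nonneg\<close>)
   also have "... = B0 powr (1 / 2) * A powr (3 / 4)"
    unfolding B0_def by (simp only: powr_mult powr_powr) simp
   also have "... <= B * A powr (3 / 4)" unfolding B_def by (intro mult_right_mono) auto
   finally show "(2 * (2 powr (15 / 8) * (?D * c\<^sub>d * ?\<kappa> powr - (1 / 8))) * ?\<kappa> powr (15 / 8 - 2) / (2 - 15 / 8)
     + 2 * (2 * (c4 * A)) powr 4 * ?\<kappa> powr (4 - 2) / (4 - 2)) powr (1 / 2) <= B * A powr (3 / 4)" .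
  qed auto
 qed (simp add: B_def)
 then show ?thesis by (intro that[of "B ^ 4"]) (auto simp: B_def intro!: one_le_power)
qed

end

section \<open>Atomic blocks\<close>

lemma nn_integral_set_Hoelder:
 assumes g [measurable]: "g \<in> borel_measurable M" and E [measurable]: "E \<in> sets M" and q: "q > 1"
 shows "(\<integral>\<^sup>+x. g x * ind E x \<partial>M) <= eLp_norm M (ennreal q) g * ennpowr (emeasure M E) (1 - 1 / q)"
proof -
 define p where "p = q / (q - 1)"
 have pq: "p > 1" "1 / q + 1 / p = 1" "1 / p = 1 - 1 / q" using q unfolding p_def by (auto simp: field_simps)
 have "(\<integral>\<^sup>+x. g x * ind E x \<partial>M) <= ennpowr (\<integral>\<^sup>+x. ennpowr (g x) q \<partial>M) (1 / q) * ennpowr (\<integral>\<^sup>+x. ennpowr (ind E x) p \<partial>M) (1 / p)"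
  using q pq by (intro Hoelder_ennreal) auto
 also have "(\<integral>\<^sup>+x. ennpowr (ind E x) p \<partial>M) = (\<integral>\<^sup>+x. ind E x \<partial>M)"
  using pq ennpowr_ennreal[of 1 p] by (intro nn_integral_cong) (auto simp: indicator_def)
 also have "... = emeasure M E" by simp
 also have "ennpowr (\<integral>\<^sup>+x. ennpowr (g x) q \<partial>M) (1 / q) = eLp_norm M (ennreal q) g" using q by (intro eLp_norm_ennreal[symmetric]) simp
 finally show ?thesis by (simp only: pq)
qed

lemma eLp_norm_infinity_AE: "AE x in M. g x <= eLp_norm M \<infinity> g"
 unfolding eLp_norm_def by (simp add: esssup_AE)

lemma ennreal_norm_sums_le:
 fixes b :: "nat => complex"
 assumes "b sums y"
 shows "ennreal (cmod y) <= (\<Sum>j. ecmod (b j))"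
proof (rule LIMSEQ_le_const2)
 show "(\<lambda>n. ecmod (\<Sum>j<n. b j)) \<longlonglongrightarrow> ennreal (cmod y)"
  using assms unfolding sums_def by (intro tendsto_ennrealI tendsto_norm)
 have "ecmod (\<Sum>j<n. b j) <= (\<Sum>j. ecmod (b j))" for n
 proof -
  have "ecmod (\<Sum>j<n. b j) <= ennreal (\<Sum>j<n. cmod (b j))" by (intro ennreal_leI norm_sum)
  also have "... = (\<Sum>j<n. ecmod (b j))" by simp
  also have "... <= (\<Sum>j. ecmod (b j))" by (rule sum_le_suminf) auto
  finally show ?thesis .
 qed
 then show "\<exists>N. \<forall>n\<ge>N. ecmod (\<Sum>j<n. b j) <= (\<Sum>j. ecmod (b j))" by blast
qed

context marc begin

text \<open>\<open>delta_coeff\<close> is a Bochner integral and would be 0 if it diverged.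
  Monotonicity bounds the integrand by \<open>1 / lam c r\<close> on a ball, so it is the true value
  and can absorb the integral over the annuli.\<close>

lemma nn_integral_delta:
 assumes r: "r > 0"
 shows "(\<integral>y. dl c y * ind (ball c' (2 * r') - ball c r) y) = ennreal (delta_coeff M lam c r c' r')"
proof -
 let ?S = "ball c' (2 * r') - ball c r"
 let ?f = "\<lambda>x. ind ?S x *\<^sub>R (1 / lam c (dist x c))"
 have pos: "lam c (dist c x) > 0" if "x \<notin> ball c r" for x using that r by (intro lam_pos) auto
 have nn: "?f x >= 0" for x using pos[of x] by (cases "x \<in> ball c r") (auto simp: dist_commute indicator_def less_imp_le)
 obtain R where R: "ball c' (2 * r') \<subseteq> ball c R" using bounded_subset_ballD[OF bounded_ball] by metis
 have eq: "ennreal (?f x) = dl c x * ind ?S x" for x by (auto simp: indicator_def dist_commute)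
 have "(\<lambda>x. enn2real (dl c x * ind (ball c R - ball c r) x * ind (ball c' (2 * r')) x)) \<in> borel_measurable M"
  by (rule borel_measurable_enn2real[OF borel_measurable_times_ennreal[OF measurable_lam_annulus[OF r, of c R] borel_measurable_indicator]]) simp
 also have "(\<lambda>x. enn2real (dl c x * ind (ball c R - ball c r) x * ind (ball c' (2 * r')) x)) = ?f"
 proof
  fix x
  show "enn2real (dl c x * ind (ball c R - ball c r) x * ind (ball c' (2 * r')) x) = ?f x"
   using R pos[of x] by (cases "x \<in> ?S") (auto simp: indicator_def dist_commute)
 qed
 finally have fm: "?f \<in> borel_measurable M" .
 have "integrable M ?f"
 proof (rule Bochner_Integration.integrable_bound[OF _ fm])
  show "integrable M (\<lambda>x. 1 / lam c r * ind (ball c' (2 * r')) x)"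
   using emeasure_ball_finite[of c' "2 * r'"] by (intro integrable_mult_right integrable_real_indicator) auto
  have l: "lam c r > 0" using r by (rule lam_pos)
  show "AE x in M. norm (?f x) <= norm (1 / lam c r * ind (ball c' (2 * r')) x)"
  proof (rule AE_I2)
   fix x
   show "norm (?f x) <= norm (1 / lam c r * ind (ball c' (2 * r')) x)"
   proof (cases "x \<in> ?S")
    case True
    then have "lam c r <= lam c (dist c x)" using r by (intro lam_mono) auto
    then have "1 / lam c (dist c x) <= 1 / lam c r" using l by (intro divide_left_mono) auto
    then show ?thesis using True l pos[of x] by (simp add: dist_commute)
   qed simp
  qed
 qed
 then have "(\<integral>x. ennreal (?f x)) = ennreal (LINT x|M. ?f x)" using nn by (intro nn_integral_eq_integral) auto
 then show ?thesis unfolding eq delta_coeff_def set_lebesgue_integral_def .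
qed

lemma marcinkiewicz_eq_SUP: "f \<in> borel_measurable M ==> MK f x = (SUP n. Sn n f x)"
 by (intro antisym marcinkiewicz_le SUP_least Sn_le SUP_upper UNIV_I)

lemma nn_integral_marcinkiewicz_le:
 assumes f: "f \<in> borel_measurable M" and le: "\<And>n. (\<integral>x. Sn n f x) <= c"
 shows "(\<integral>x. MK f x) <= c"
proof -
 have "(\<integral>x. MK f x) = (\<integral>x. (SUP n. Sn n f x))" by (simp only: marcinkiewicz_eq_SUP[OF f])
 also have "... = (SUP n. \<integral>x. Sn n f x)"
  using f by (intro nn_integral_monotone_convergence_SUP) (auto simp: incseq_def le_fun_def intro: Sn_mono)
 also have "... <= c" using le by (rule SUP_least)
 finally show ?thesis .
qed

lemma measurable_block:
 assumes "locally_integrable_on M UNIV b" shows "b \<in> borel_measurable M"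
proof -
 obtain B :: "'a set set" where B: "countable B" "topological_basis B" using countable_basis by blast
 have "(\<lambda>z. ind UNIV z *\<^sub>R b z) \<in> borel_measurable M"
  by (rule measurable_if_locally_integrable[OF B _ assms]) (auto simp: sets_M)
 then show ?thesis by simp
qed

text \<open>Hoelder on \<open>E\<close>, where the powers of its measure cancel against the
  normalisation of the atom. The factor \<open>t\<close> stands for
  \<open>1 / (1 + \<delta>)\<close> and is kept, since it pays for the annuli later.\<close>

lemma local_atom_bound:
 assumes bnd: "\<forall>f\<in>Lp_space M (ennreal q). eLp_norm M (ennreal q) (MK f) <= ennreal C * Lp_norm M (ennreal q) f"
  and q: "q > 1" and C: "C >= 0" and f [measurable]: "f \<in> borel_measurable M" and E [measurable]: "E \<in> sets M" and m: "emeasure M E = ennreal m" "m >= 0"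
  and supp: "AE x in M. x \<notin> E \<longrightarrow> f x = 0" and t: "t >= 0"
  and norm: "Lp_norm M (ennreal q) f <= ennreal (m powr (1 / q - 1) * t)"
 shows "L1 f <= ennreal t" "(\<integral>x. MK f x * ind E x) <= ennreal (C * t)"
proof -
 have fL: "f \<in> Lp_space M (ennreal q)" unfolding Lp_space_def using norm by (auto intro: le_less_trans)
 have mm: "m powr (1 / q - 1) * t * m powr (1 - 1 / q) <= t"
 proof (cases "m = 0")
  case False
  have "m powr (1 / q - 1) * t * m powr (1 - 1 / q) = t * (m powr (1 / q - 1) * m powr (1 - 1 / q))" by (simp only: mult_ac)
  also have "m powr (1 / q - 1) * m powr (1 - 1 / q) = m powr (1 / q - 1 + (1 - 1 / q))" by (rule powr_add[symmetric])
  also have "... = 1" using False by simp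
  finally show ?thesis by (simp only: mult_1_right order_refl)
 qed (use t in simp)
 have E': "ennpowr (emeasure M E) (1 - 1 / q) = ennreal (m powr (1 - 1 / q))" unfolding m(1) using m(2) by (rule ennpowr_ennreal)
 have "L1 f = (\<integral>x. ecmod (f x) * ind E x)"
  using supp by (intro nn_integral_cong_AE) (auto elim!: eventually_mono simp: indicator_def)
 also have "... <= Lp_norm M (ennreal q) f * ennpowr (emeasure M E) (1 - 1 / q)" by (rule nn_integral_set_Hoelder) (use q in auto)
 also have "... <= ennreal (m powr (1 / q - 1) * t) * ennreal (m powr (1 - 1 / q))" unfolding E' using norm by (rule mult_right_mono) simp
 also have "... = ennreal (m powr (1 / q - 1) * t * m powr (1 - 1 / q))" using t by (simp flip: ennreal_mult)
 also have "... <= ennreal t" using mm by (rule ennreal_leI)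
 finally show "L1 f <= ennreal t" .
 have "(\<integral>x. MK f x * ind E x) <= eLp_norm M (ennreal q) (MK f) * ennpowr (emeasure M E) (1 - 1 / q)"
  by (rule nn_integral_set_Hoelder) (use q in auto)
 also have "... <= (ennreal C * ennreal (m powr (1 / q - 1) * t)) * ennreal (m powr (1 - 1 / q))"
  unfolding E' using norm by (intro mult_right_mono order_trans[OF bspec[OF bnd fL]] mult_left_mono) auto
 also have "... = ennreal (C * (m powr (1 / q - 1) * t * m powr (1 - 1 / q)))" using t C by (simp add: mult.assoc flip: ennreal_mult)
 also have "... <= ennreal (C * t)" using mm C by (intro ennreal_leI mult_left_mono)
 finally show "(\<integral>x. MK f x * ind E x) <= ennreal (C * t)" .
qed

end

context hardy begin

text \<open>The finite exponent in which atoms are measured: \<open>p\<close> itself, or 2 in place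
  of infinity, where an L^q bound of the operator is not among the assumptions.\<close>

definition q\<^sub>p :: real where "q\<^sub>p = (if p = \<infinity> then 2 else enn2real p)"

lemma q_p: "q\<^sub>p > 1" "p \<noteq> \<infinity> ==> p = ennreal q\<^sub>p"
proof -
 show e: "p \<noteq> \<infinity> ==> p = ennreal q\<^sub>p" unfolding q\<^sub>p_def by (simp add: less_top)
 show "q\<^sub>p > 1"
 proof (cases "p = \<infinity>")
  case True then show ?thesis unfolding q\<^sub>p_def by simp
 next
  case False
  then have "\<not> ennreal q\<^sub>p <= ennreal 1" using p e by (simp add: not_le)
  then show ?thesis using ennreal_leI[of q\<^sub>p 1] by linarith
 qed
qed

text \<open>For \<open>p = \<infinity>\<close> the sup bound on the small ball is turned into an L^2
  bound; enlarging the ball in the measure factor only weakens it.\<close>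

lemma atom_exponent:
 assumes f [measurable]: "f \<in> borel_measurable M" and supp: "supported_in M (ball c r) f" and sub: "ball c r \<subseteq> ball c R"
  and norm: "Lp_norm M p f <= ennreal (measure M (ball c R) powr (enn2real (1 / p) - 1) * t)" and t: "t >= 0"
 shows "Lp_norm M (ennreal q\<^sub>p) f <= ennreal (mb c R powr (1 / q\<^sub>p - 1) * t)"
proof (cases "p = \<infinity>")
 case False
 define q where "q = q\<^sub>p"
 have pq: "p = ennreal q" and q: "q > 1" using q_p(1) q_p(2)[OF False] unfolding q_def by auto
 have "1 / p = ennreal (1 / q)" unfolding pq using q divide_ennreal[of 1 q] by simp
 then have "enn2real (1 / p) = 1 / q" using q by simp
 then show ?thesis using norm unfolding q_def[symmetric] pq[symmetric] mb_def by simp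
next
 case True
 define m where "m = mb c R powr - 1 * t"
 have m0: "m >= 0" unfolding m_def using t by simp
 have "enn2real (1 / p) = 0" unfolding True by (simp add: divide_ennreal_def)
 then have n: "Lp_norm M \<infinity> f <= ennreal m" using norm unfolding True m_def mb_def by simp
 have "AE x in M. ecmod (f x) <= ennreal m * ind (ball c r) x"
  using eLp_norm_infinity_AE[of "\<lambda>x. ecmod (f x)" M] supp unfolding supported_in_def
 proof eventually_elim
  fix x assume "ecmod (f x) <= Lp_norm M \<infinity> f" "x \<notin> ball c r \<longrightarrow> f x = 0"
  then show "ecmod (f x) <= ennreal m * ind (ball c r) x" using order_trans[OF _ n] by (cases "x \<in> ball c r") auto
 qed
 then have "Lp_norm M 2 f <= ennreal (m * measure M (ball c r) powr enn2real (1 / 2))"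
  using emeasure_ball_finite[of c r] m0 by (intro eLp_norm_bounded_support) auto
 also have "enn2real (1 / 2) = 1 / 2" using divide_ennreal[of 1 2] enn2real_ennreal[of "1 / 2"] by simp
 also have "ennreal (m * measure M (ball c r) powr (1 / 2)) <= ennreal (mb c R powr (1 / 2 - 1) * t)"
 proof (rule ennreal_leI)
  have "m * measure M (ball c r) powr (1 / 2) <= m * mb c R powr (1 / 2)"
   using m0 mb_mono[OF sub] unfolding mb_def by (intro mult_left_mono powr_mono2) auto
  also have "... = mb c R powr - 1 * mb c R powr (1 / 2) * t" unfolding m_def by (simp only: mult_ac)
  also have "mb c R powr - 1 * mb c R powr (1 / 2) = mb c R powr (- 1 + 1 / 2)" by (rule powr_add[symmetric])
  also have "- 1 + 1 / 2 = (1 / 2 - 1 :: real)" by simp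
  finally show "m * measure M (ball c r) powr (1 / 2) <= mb c R powr (1 / 2 - 1) * t" .
 qed
 finally show ?thesis unfolding q\<^sub>p_def using True by simp
qed

end

lemma nn_integral_lincomb2:
 assumes f: "f \<in> borel_measurable M" and g: "g \<in> borel_measurable M"
 shows "(\<integral>\<^sup>+x. c * f x + d * g x \<partial>M) = c * (\<integral>\<^sup>+x. f x \<partial>M) + d * (\<integral>\<^sup>+x. g x \<partial>M)"
proof -
 have "(\<lambda>x. c * f x) \<in> borel_measurable M" "(\<lambda>x. d * g x) \<in> borel_measurable M"
  by (rule borel_measurable_times_ennreal[OF borel_measurable_const f] borel_measurable_times_ennreal[OF borel_measurable_const g])+
 then show ?thesis by (simp only: nn_integral_add nn_integral_cmult[OF f] nn_integral_cmult[OF g])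
qed

context hardy begin

text \<open>On the \<rho>-dilate of its own ball an atom is controlled by the L^q bound. On the rest
  of the double of the block's ball the size of the kernel leaves the integral of
  \<open>1 / lam\<close>, which is at most \<delta>; the factor \<open>1 / (1 + \<delta>)\<close> in
  the normalisation absorbs it. \<open>n0\<close> measures how close \<rho> is to 1.\<close>

lemma atom_estimate:
 assumes bnd: "\<forall>f\<in>Lp_space M (ennreal q\<^sub>p). eLp_norm M (ennreal q\<^sub>p) (MK f) <= ennreal C * Lp_norm M (ennreal q\<^sub>p) f"
  and C: "C >= 0" and n0: "2 ^ n0 * (\<rho> - 1) >= \<rho>"
  and f [measurable]: "f \<in> borel_measurable M" and supp: "supported_in M (ball c' r') f" and r': "r' > 0"
  and norm: "Lp_norm M p f <= ennreal (measure M (ball c' (\<rho> * r')) powr (enn2real (1 / p) - 1) * inverse (1 + delta_coeff M lam c' r' c r))"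
 shows "L1 f <= 1"
  and "(\<integral>x. Sn n f x * ind (ball c (2 * r)) x) <= ennreal (C + Ck * Cl ^ (n0 + 1))"
proof -
 define d where "d = delta_coeff M lam c' r' c r"
 define t where "t = inverse (1 + d)"
 define K1 where "K1 = Ck * Cl ^ (n0 + 1)"
 have d0: "d >= 0" unfolding d_def by (rule delta_coeff_bounds(1)[OF r'])
 have t: "t >= 0" "t <= 1" "t * d <= 1" unfolding t_def using d0 by (auto simp: field_simps)
 have K1: "K1 >= 0" unfolding K1_def using k.Ck Cl_pos by simp
 let ?E = "ball c' (\<rho> * r')"
 have sub: "ball c' r' \<subseteq> ?E" using rho r' by (intro subset_ball) simp
 have suppE: "AE x in M. x \<notin> ?E \<longrightarrow> f x = 0" using supp unfolding supported_in_def by eventually_elim (use sub in blast)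
 note nq = atom_exponent[OF f supp sub norm[folded d_def t_def] t(1)]
 note lb = local_atom_bound[OF bnd q_p(1) C f _ emeasure_ball mb_nonneg suppE t(1) nq]
 have I1: "L1 f <= ennreal t" by (rule lb(1)) auto
 also have "... <= 1" using t(2) by simp
 finally show "L1 f <= 1" .
 have I2: "(\<integral>x. MK f x * ind ?E x) <= ennreal (C * t)" by (rule lb(2)) auto
 let ?A = "\<lambda>x. dl c' x * ind (ball c (2 * r) - ball c' r') x"
 have far: "Sn n f x <= ennreal K1 * (dl c' x * ennreal t)" if x: "x \<notin> ?E" for x
 proof -
  have dx: "\<rho> * r' <= dist c' x" using x by simp
  have "0 < \<rho> * r'" using rho r' by simp
  then have l: "lam c' (dist c' x) > 0" using dx by (intro lam_pos) linarith
  have "k.S n (\<lambda>p. f (fst p)) x <= ennreal (Ck * Cl ^ (n0 + 1) / lam c' (dist c' x)) * (\<integral>y. nrm unitM (\<lambda>p. f (fst p)) y)"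
   by (rule k.S_near[OF measurable_lift[OF f] _ r' rho(1) n0 dx]) (use supp in \<open>simp add: supported_in_def\<close>)
  then have "Sn n f x <= ennreal (K1 * (1 / lam c' (dist c' x))) * L1 f"
   unfolding Sn_def K1_def by simp
  also have "... <= ennreal (K1 * (1 / lam c' (dist c' x))) * ennreal t" using I1 by (rule mult_left_mono) simp
  also have "... = ennreal K1 * (dl c' x * ennreal t)"
   using K1 l by (simp only: ennreal_mult' mult.assoc)
  finally show ?thesis .
 qed
 have Am [measurable]: "?A \<in> borel_measurable M"
 proof -
  obtain R where R: "ball c (2 * r) \<subseteq> ball c' R" using bounded_subset_ballD[OF bounded_ball] by metis
  have "(\<lambda>x. dl c' x * ind (ball c' R - ball c' r') x * ind (ball c (2 * r)) x) \<in> borel_measurable M"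
   by (rule borel_measurable_times_ennreal[OF measurable_lam_annulus[OF r', of c' R] borel_measurable_indicator]) simp
  also have "(\<lambda>x. dl c' x * ind (ball c' R - ball c' r') x * ind (ball c (2 * r)) x) = ?A"
   using R by (auto simp: fun_eq_iff indicator_def)
  finally show ?thesis .
 qed
 have "(\<integral>x. Sn n f x * ind (ball c (2 * r)) x) <= (\<integral>x. MK f x * ind ?E x + ennreal K1 * (?A x * ennreal t))"
 proof (intro nn_integral_mono)
  fix x
  show "Sn n f x * ind (ball c (2 * r)) x <= MK f x * ind ?E x + ennreal K1 * (?A x * ennreal t)"
  proof (cases "x \<in> ?E")
   case True
   have "Sn n f x * ind (ball c (2 * r)) x <= MK f x * 1" using Sn_le[OF f] by (intro mult_mono) (auto simp: indicator_def)
   also have "... <= MK f x * ind ?E x + ennreal K1 * (?A x * ennreal t)" using True by simp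
   finally show ?thesis .
  next
   case False
   show ?thesis
   proof (cases "x \<in> ball c (2 * r)")
    case True
    then show ?thesis using far[OF False] False subsetD[OF sub, of x] by (auto simp: indicator_def mult.assoc)
   qed simp
  qed
 qed
 also have "... = (\<integral>x. MK f x * ind ?E x) + ennreal K1 * ((\<integral>x. ?A x) * ennreal t)"
 proof -
  have "(\<lambda>x. MK f x * ind ?E x) \<in> borel_measurable M" by measurable
  moreover have m2: "(\<lambda>x. ?A x * ennreal t) \<in> borel_measurable M" by (rule borel_measurable_times_ennreal[OF Am borel_measurable_const])
  moreover have "(\<lambda>x. ennreal K1 * (?A x * ennreal t)) \<in> borel_measurable M" by (rule borel_measurable_times_ennreal[OF borel_measurable_const m2])
  ultimately show ?thesis by (simp only: nn_integral_add nn_integral_cmult nn_integral_multc[OF Am])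
 qed
 also have "... <= ennreal (C * t) + ennreal K1 * (ennreal d * ennreal t)"
  unfolding nn_integral_delta[OF r'] d_def[symmetric] using I2 by (rule add_right_mono)
 also have "... = ennreal (C * t + K1 * (t * d))" using C K1 t d0 by (simp add: mult.commute flip: ennreal_mult ennreal_plus)
 also have "... <= ennreal (C * 1 + K1 * 1)" using C K1 t by (intro ennreal_leI add_mono mult_left_mono) auto
 finally show "(\<integral>x. Sn n f x * ind (ball c (2 * r)) x) <= ennreal (C + Ck * Cl ^ (n0 + 1))"
  unfolding K1_def by simp
qed

text \<open>Three regions are treated by the \<open>L\<^sup>q\<close> bound near the atoms, the size of the kernel
 in the part of the annuli that is measured by \<open>\<delta>\<close>, and the cancellation of \<open>b\<close> far away.\<close>

lemma block_estimate:
 assumes bnd: "\<forall>f\<in>Lp_space M (ennreal q\<^sub>p). eLp_norm M (ennreal q\<^sub>p) (MK f) <= ennreal C * Lp_norm M (ennreal q\<^sub>p) f"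
  and C: "C >= 0" and n0: "2 ^ n0 * (\<rho> - 1) >= \<rho>" and blk: "atomic_block M lam \<rho> p b s"
 shows "b \<in> borel_measurable M \<and> (L1 b) <= ennreal s \<and> (\<integral>x. Sn n b x) <= ennreal ((C + Ck * Cl ^ (n0 + 1) + Ck) * s)"
 using blk unfolding atomic_block_def
proof (elim disjE conjE exE)
 define K1 where "K1 = Ck * Cl ^ (n0 + 1)"
 have K1: "K1 >= 0" unfolding K1_def using k.Ck Cl_pos by simp
 fix \<kappa> :: complex
 assume fin: "emeasure M (space M) < \<infinity>" and b: "b = (\<lambda>x. \<kappa> * of_real (1 / measure M (space M)))" and s: "s = cmod \<kappa>"
 define V where "V = measure M (space M)"
 have V: "emeasure M (space M) = ennreal V" "V >= 0" unfolding V_def using fin by (auto intro: emeasure_eq_ennreal_measure)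
 have bm [measurable]: "b \<in> borel_measurable M" unfolding b by measurable
 have sV: "1 <= ennreal q\<^sub>p" using q_p(1) by simp
 have "1 / ennreal q\<^sub>p = ennreal (1 / q\<^sub>p)" using q_p(1) divide_ennreal[of 1 "q\<^sub>p"] by simp
 then have eq: "enn2real (1 / ennreal q\<^sub>p) = 1 / q\<^sub>p" using q_p(1) by simp
 \<comment> \<open>A constant block has no cancellation; it is treated as an atom carried by the
   whole space, so Hoelder alone suffices.\<close>
 have "Lp_norm M (ennreal q\<^sub>p) b <= ennreal ((s / V) * measure M (space M) powr enn2real (1 / ennreal q\<^sub>p))"
 proof (rule eLp_norm_bounded_support[OF _ sets.top fin _ _ sV])
  show "(\<lambda>x. ecmod (b x)) \<in> borel_measurable M" by measurable
  show "s / V >= 0" using V(2) unfolding s by simp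
  have "cmod (b x) = s / V" for x unfolding b s V_def by (simp add: norm_mult norm_divide del: space_M)
  then show "AE x in M. ecmod (b x) <= ennreal (s / V) * ind (space M) x" by (intro AE_I2) simp
 qed
 also have "(s / V) * measure M (space M) powr enn2real (1 / ennreal q\<^sub>p) = V powr (1 / q\<^sub>p - 1) * s"
  unfolding eq V_def[symmetric] using V(2) by (simp add: powr_diff)
 finally have norm: "Lp_norm M (ennreal q\<^sub>p) b <= ennreal (V powr (1 / q\<^sub>p - 1) * s)" .
 note lb = local_atom_bound[OF bnd q_p(1) C bm sets.top V _ _ norm]
 have s0: "s >= 0" unfolding s by simp
 have I1: "L1 b <= ennreal s" by (rule lb(1)) (use s0 in auto)
 have "(\<integral>x. Sn n b x) <= (\<integral>x. MK b x * ind (space M) x)"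
  using Sn_le[OF bm] by (intro nn_integral_mono) auto
 also have "... <= ennreal (C * s)" by (rule lb(2)) (use s0 in auto)
 also have "... <= ennreal ((C + Ck * Cl ^ (n0 + 1) + Ck) * s)"
  unfolding K1_def[symmetric] using K1 k.Ck s0 by (intro ennreal_leI mult_right_mono) auto
 finally show ?thesis using bm I1 by blast
next
 assume "proper_atomic_block M lam \<rho> p b s"
 note P = this[unfolded proper_atomic_block_def]
 define K1 where "K1 = Ck * Cl ^ (n0 + 1)"
 have K1: "K1 >= 0" unfolding K1_def using k.Ck Cl_pos by simp
 have loc: "locally_integrable_on M UNIV b" and canc: "(LINT x|M. b x) = 0" using P by (rule conjunct1, rule conjunct1[OF conjunct2])
 obtain c r and f :: "nat => 'a => complex" and cc rr and \<kappa> :: "nat => complex" where r: "r > 0" and bs: "supported_in M (ball c r) b"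
  and at: "\<forall>j\<in>{1 :: nat, 2}. 0 < rr j \<and> ball (cc j) (rr j) \<subseteq> ball c r \<and> f j \<in> borel_measurable M \<and> supported_in M (ball (cc j) (rr j)) (f j) \<and>
    Lp_norm M p (f j) <= ennreal (measure M (ball (cc j) (\<rho> * rr j)) powr (enn2real (1 / p) - 1) * inverse (1 + delta_coeff M lam (cc j) (rr j) c r))"
  and beq: "AE x in M. b x = \<kappa> 1 * f 1 x + \<kappa> 2 * f 2 x" and s: "s = cmod (\<kappa> 1) + cmod (\<kappa> 2)"
  using P by (elim conjE exE) (rule that)
 have bm [measurable]: "b \<in> borel_measurable M" by (rule measurable_block[OF loc])
 have fj: "f j \<in> borel_measurable M" if "j \<in> {1, 2}" for j using bspec[OF at that] by (elim conjE)
 have fm [measurable]: "f 1 \<in> borel_measurable M" "f 2 \<in> borel_measurable M" by (auto intro: fj)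
 have s0: "s >= 0" unfolding s by simp
 have E: "L1 (f j) <= 1" "(\<integral>x. Sn n (f j) x * ind (ball c (2 * r)) x) <= ennreal (C + K1)"
  if j: "j \<in> {1, 2}" for j
 proof -
  note h = bspec[OF at j]
  note e = atom_estimate[OF bnd C n0 h[THEN conjunct2, THEN conjunct2, THEN conjunct1] h[THEN conjunct2, THEN conjunct2, THEN conjunct2, THEN conjunct1]
   h[THEN conjunct1] h[THEN conjunct2, THEN conjunct2, THEN conjunct2, THEN conjunct2]]
  show "L1 (f j) <= 1" by (rule e(1))
  show "(\<integral>x. Sn n (f j) x * ind (ball c (2 * r)) x) <= ennreal (C + K1)" unfolding K1_def by (rule e(2))
 qed
 have I1: "L1 b <= ennreal s"
 proof -
  have "L1 b <= (\<integral>x. ecmod (\<kappa> 1) * ecmod (f 1 x) + ecmod (\<kappa> 2) * ecmod (f 2 x))"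
  proof (rule nn_integral_mono_AE)
   from beq show "AE x in M. ecmod (b x) <= ecmod (\<kappa> 1) * ecmod (f 1 x) + ecmod (\<kappa> 2) * ecmod (f 2 x)"
   proof eventually_elim
    fix x assume "b x = \<kappa> 1 * f 1 x + \<kappa> 2 * f 2 x"
    then have "cmod (b x) <= cmod (\<kappa> 1) * cmod (f 1 x) + cmod (\<kappa> 2) * cmod (f 2 x)" using norm_triangle_ineq[of "\<kappa> 1 * f 1 x" "\<kappa> 2 * f 2 x"] by (simp add: norm_mult)
    then show "ecmod (b x) <= ecmod (\<kappa> 1) * ecmod (f 1 x) + ecmod (\<kappa> 2) * ecmod (f 2 x)"
     by (simp add: ennreal_leI flip: ennreal_mult ennreal_plus)
   qed
  qed
  also have "... = ecmod (\<kappa> 1) * L1 (f 1) + ecmod (\<kappa> 2) * L1 (f 2)"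
   by (rule nn_integral_lincomb2) measurable
  also have "... <= ecmod (\<kappa> 1) * 1 + ecmod (\<kappa> 2) * 1" using E(1) by (intro add_mono mult_left_mono) auto
  also have "... = ennreal s" unfolding s by simp
  finally show ?thesis .
 qed
 have fin1: "(\<integral>x. ecmod (\<kappa> j * f j x)) < \<infinity>" if j: "j \<in> {1, 2}" for j
 proof -
  have "(\<integral>x. ecmod (\<kappa> j * f j x)) = ecmod (\<kappa> j) * L1 (f j)"
   unfolding norm_mult ennreal_mult[OF norm_ge_zero norm_ge_zero] by (rule nn_integral_cmult) (use fj[OF j] in measurable)
  also have "... <= ecmod (\<kappa> j) * 1" using E(1)[OF j] by (rule mult_left_mono) simp
  also have "... < \<infinity>" by simp
  finally show ?thesis .
 qed
 have m12: "(\<lambda>x. \<kappa> 1 * f 1 x) \<in> borel_measurable M" "(\<lambda>x. \<kappa> 2 * f 2 x) \<in> borel_measurable M" by measurable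
 have "Sn n b x = Sn n (\<lambda>x. \<kappa> 1 * f 1 x + \<kappa> 2 * f 2 x) x" for x by (rule Sn_cong_AE[OF bm _ beq]) measurable
 moreover have "AE x in M. Sn n (\<lambda>x. \<kappa> 1 * f 1 x + \<kappa> 2 * f 2 x) x <= Sn n (\<lambda>x. \<kappa> 1 * f 1 x) x + Sn n (\<lambda>x. \<kappa> 2 * f 2 x) x"
  by (rule Sn_add_AE[OF m12 fin1 fin1]) simp_all
 ultimately have Sb: "AE x in M. Sn n b x <= ecmod (\<kappa> 1) * Sn n (f 1) x + ecmod (\<kappa> 2) * Sn n (f 2) x"
  by (simp only: Sn_cmult[OF fm(1)] Sn_cmult[OF fm(2)])
 have near: "(\<integral>x. Sn n b x * ind (ball c (2 * r)) x) <= ennreal ((C + K1) * s)"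
 proof -
  have "(\<integral>x. Sn n b x * ind (ball c (2 * r)) x) <= (\<integral>x. ecmod (\<kappa> 1) * (Sn n (f 1) x * ind (ball c (2 * r)) x) + ecmod (\<kappa> 2) * (Sn n (f 2) x * ind (ball c (2 * r)) x))"
  proof (rule nn_integral_mono_AE)
   from Sb show "AE x in M. Sn n b x * ind (ball c (2 * r)) x <= ecmod (\<kappa> 1) * (Sn n (f 1) x * ind (ball c (2 * r)) x) + ecmod (\<kappa> 2) * (Sn n (f 2) x * ind (ball c (2 * r)) x)"
    by eventually_elim (auto simp: indicator_def)
  qed
  also have "... = ecmod (\<kappa> 1) * (\<integral>x. Sn n (f 1) x * ind (ball c (2 * r)) x) + ecmod (\<kappa> 2) * (\<integral>x. Sn n (f 2) x * ind (ball c (2 * r)) x)"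
  proof -
   have m: "(\<lambda>x. Sn n (f j) x * ind (ball c (2 * r)) x) \<in> borel_measurable M" if "j \<in> {1, 2}" for j
    by (rule borel_measurable_times_ennreal[OF measurable_Sn[OF fj[OF that]] borel_measurable_indicator]) simp
   show ?thesis by (rule nn_integral_lincomb2) (rule m, simp)+
  qed
  also have "... <= ecmod (\<kappa> 1) * ennreal (C + K1) + ecmod (\<kappa> 2) * ennreal (C + K1)"
   using E(2) by (intro add_mono mult_left_mono) auto
  also have "... = ennreal ((C + K1) * s)" unfolding s using C K1 by (simp add: distrib_left mult.commute flip: ennreal_mult ennreal_plus)
  finally show ?thesis .
 qed
 have far: "(\<integral>x. Sn n b x * ind (- ball c (2 * r)) x) <= ennreal (Ck * s)"
 proof -
  have "(\<integral>x. k.S n (\<lambda>p. b (fst p)) x * ind (- ball c (2 * r)) x) <= ennreal Ck * (\<integral>y. nrm unitM (\<lambda>p. b (fst p)) y)"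
  proof (rule k.S_far[OF measurable_lift[OF bm] _ _ _ r])
   show "(\<integral>y. nrm unitM (\<lambda>p. b (fst p)) y) < \<infinity>" using I1 by (simp add: le_less_trans[OF I1])
   show "AE b' in unitM. (LINT y|M. b (fst (y, b'))) = 0" using canc by simp
   show "AE y in M. y \<notin> ball c r \<longrightarrow> nrm unitM (\<lambda>p. b (fst p)) y = 0" using bs by (simp add: supported_in_def)
  qed
  also have "... <= ennreal Ck * ennreal s" using I1 by (intro mult_left_mono) auto
  also have "... = ennreal (Ck * s)" using k.Ck by (simp add: ennreal_mult')
  finally show ?thesis unfolding Sn_def .
 qed
 \<comment> \<open>The two atoms are estimated separately inside the double ball; outside it only
   the sum \<open>b\<close> has integral zero, so cancellation is applied to the block and not to
   the atoms.\<close>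
 have "(\<integral>x. Sn n b x) = (\<integral>x. Sn n b x * ind (ball c (2 * r)) x + Sn n b x * ind (- ball c (2 * r)) x)"
  by (intro nn_integral_cong) (auto simp: indicator_def)
 also have "... = (\<integral>x. Sn n b x * ind (ball c (2 * r)) x) + (\<integral>x. Sn n b x * ind (- ball c (2 * r)) x)"
  by (intro nn_integral_add borel_measurable_times_ennreal measurable_Sn borel_measurable_indicator bm) (auto simp: sets_M)
 also have "... <= ennreal ((C + K1) * s) + ennreal (Ck * s)" by (rule add_mono[OF near far])
 also have "... = ennreal ((C + K1 + Ck) * s)" using C K1 k.Ck s0 by (simp add: distrib_right flip: ennreal_plus)
 finally show ?thesis unfolding K1_def using bm I1 by blast
qed

text \<open>Uniform bounds on blocks do not pass to infinite sums by themselves. For fixed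
  \<open>n\<close> the truncated operator is bounded on L^1 by \<open>Ln n\<close>, which removes
  the tail of a decomposition; the bound from the blocks is free of \<open>n\<close>, and monotone
  convergence concludes.\<close>

lemma Hardy_bound:
 assumes bnd: "\<forall>f\<in>Lp_space M (ennreal q\<^sub>p). eLp_norm M (ennreal q\<^sub>p) (MK f) <= ennreal C * Lp_norm M (ennreal q\<^sub>p) f"
  and C: "C > 0"
 shows "bounded_Hardy_L1 M lam \<rho> p (MK)"
proof -
 obtain n0 :: nat where "\<rho> / (\<rho> - 1) < 2 ^ n0" using real_arch_pow[of 2] by auto
 then have n0: "2 ^ n0 * (\<rho> - 1) >= \<rho>" using rho by (simp add: field_simps)
 define C' where "C' = C + Ck * Cl ^ (n0 + 1) + Ck"
 have C0: "C >= 0" using C by simp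
 have "Ck * Cl ^ (n0 + 1) >= 0" using Ck_ge(4) Cl_pos by simp
 then have C': "C' > 0" unfolding C'_def using Ck_ge(4) C by linarith
 note blk = block_estimate[OF bnd C0 n0, folded C'_def]
 show ?thesis
  unfolding bounded_Hardy_L1_def bounded_operator_def
 proof (intro exI[of _ C'] conjI ballI C')
  fix f assume f: "f \<in> Hardy_space M lam \<rho> p"
  then have fm [measurable]: "f \<in> borel_measurable M" unfolding Hardy_space_def Lp_space_def by auto
  show "MK f \<in> borel_measurable M" by measurable
  have main: "(\<integral>x. MK f x) <= ennreal (C' * suminf s)" if dec: "atomic_decomposition M lam \<rho> p f b s" for b s
  proof (rule nn_integral_marcinkiewicz_le[OF fm])
   fix n
   have ab: "atomic_block M lam \<rho> p (b j) (s j)" for j using dec unfolding atomic_decomposition_def by blast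
   have sm: "summable s" and su: "AE x in M. (\<lambda>j. b j x) sums f x" using dec unfolding atomic_decomposition_def by auto
   have s0: "s j >= 0" for j by (rule atomic_block_size_nonneg[OF ab])
   have bm: "b j \<in> borel_measurable M" and b1: "L1 (b j) <= ennreal (s j)"
    and bS: "(\<integral>x. Sn n (b j) x) <= ennreal (C' * s j)" for j using blk[OF ab[of j], of n] by auto
   note [measurable] = bm
   \<comment> \<open>The tail after \<open>m\<close> blocks is one further summand, estimated by the
     L^1 bound alone; its contribution vanishes as \<open>m\<close> grows.\<close>
   have step: "(\<integral>x. Sn n f x) <= ennreal (C' * suminf s + Ln n * (\<Sum>j. s (j + m)))" for m
   proof -
    define r where "r x = f x - (\<Sum>j<m. b j x)" for x
    define F where "F i = (if i < m then b i else r)" for i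
    have [measurable]: "r \<in> borel_measurable M" unfolding r_def by measurable
    have sm': "summable (\<lambda>j. s (j + m))" using sm by (simp add: summable_iff_shift)
    have r1: "L1 r <= ennreal (\<Sum>j. s (j + m))"
    proof -
     have "L1 r <= (\<integral>x. (\<Sum>j. ecmod (b (j + m) x)))"
     proof (rule nn_integral_mono_AE)
      from su show "AE x in M. ecmod (r x) <= (\<Sum>j. ecmod (b (j + m) x))"
      proof eventually_elim
       fix x assume "(\<lambda>j. b j x) sums f x"
       then have "(\<lambda>j. b (j + m) x) sums r x" unfolding r_def by (rule sums_split_initial_segment)
       then show "ecmod (r x) <= (\<Sum>j. ecmod (b (j + m) x))" by (rule ennreal_norm_sums_le)
      qed
     qed
     also have "... = (\<Sum>j. \<integral>x. ecmod (b (j + m) x))" by (rule nn_integral_suminf) measurable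
     also have "... <= (\<Sum>j. ennreal (s (j + m)))" using b1 by (intro suminf_le summableI)
     also have "... = ennreal (\<Sum>j. s (j + m))" using s0 sm' by (rule suminf_ennreal2)
     finally show ?thesis .
    qed
    have Fm: "F i \<in> borel_measurable M" for i unfolding F_def by simp
    have Fr: "f = (\<lambda>x. \<Sum>i\<in>{..m}. F i x)" unfolding F_def r_def by (simp add: lessThan_Suc_atMost[symmetric])
    have Ff: "L1 (F i) < \<infinity>" for i
     unfolding F_def using le_less_trans[OF b1[of i]] le_less_trans[OF r1] by simp
    have "(\<integral>x. Sn n f x) <= (\<integral>x. (\<Sum>i\<in>{..m}. Sn n (F i) x))"
     using Fm Ff by (subst Fr, intro nn_integral_mono_AE Sn_sum_AE) auto
    also have "... = (\<Sum>i\<in>{..m}. \<integral>x. Sn n (F i) x)" using Fm by (intro nn_integral_sum) auto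
    also have "... = (\<Sum>i<m. \<integral>x. Sn n (b i) x) + (\<integral>x. Sn n r x)"
     unfolding F_def by (simp add: lessThan_Suc_atMost[symmetric])
    also have "... <= (\<Sum>i<m. ennreal (C' * s i)) + ennreal (Ln n) * ennreal (\<Sum>j. s (j + m))"
     by (intro add_mono sum_mono bS order_trans[OF Sn_L1] mult_left_mono r1) auto
    also have "(\<Sum>i<m. ennreal (C' * s i)) = ennreal (C' * (\<Sum>i<m. s i))" using C' s0 by (subst sum_ennreal) (auto simp: sum_distrib_left)
    also have "... <= ennreal (C' * suminf s)" using C' s0 sm by (intro ennreal_leI mult_left_mono sum_le_suminf) auto
    also have "ennreal (Ln n) * ennreal (\<Sum>j. s (j + m)) = ennreal (Ln n * (\<Sum>j. s (j + m)))" using k.L[of n] by (simp add: ennreal_mult')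
    finally show ?thesis using C' k.L[of n] s0 sm sm' by (simp add: suminf_nonneg add_mono flip: ennreal_plus)
   qed
   show "(\<integral>x. Sn n f x) <= ennreal (C' * suminf s)"
   proof (rule ennreal_le_epsilon)
    fix e :: real assume e: "e > 0"
    have "e / (Ln n + 1) > 0" using e k.L[of n] by simp
    from suminf_exist_split[OF this sm] obtain m where m: "\<bar>\<Sum>j. s (j + m)\<bar> < e / (Ln n + 1)" by auto
    have "Ln n * (\<Sum>j. s (j + m)) <= Ln n * (e / (Ln n + 1))" using m k.L[of n] by (intro mult_left_mono) auto
    also have "... = e * (Ln n / (Ln n + 1))" by simp
    also have "... <= e * 1" using e k.L[of n] by (intro mult_left_mono) auto
    finally have "ennreal (C' * suminf s + Ln n * (\<Sum>j. s (j + m))) <= ennreal (C' * suminf s + e)" by (intro ennreal_leI) simp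
    also have "... = ennreal (C' * suminf s) + ennreal e" using e C' s0 sm by (intro ennreal_plus) (auto simp: suminf_nonneg)
    finally show "(\<integral>x. Sn n f x) <= ennreal (C' * suminf s) + ennreal e" using step[of m] by (rule order_trans[rotated])
   qed
  qed
  obtain b0 s0 where d0: "atomic_decomposition M lam \<rho> p f b0 s0" using f unfolding Hardy_space_def by auto
  define w where "w = enn2real (\<integral>x. MK f x)"
  have w: "(\<integral>x. MK f x) = ennreal w"
   unfolding w_def using le_less_trans[OF main[OF d0]] by simp
  \<comment> \<open>The norm is an infimum of reals, so the bound is proved for each decomposition
    in turn; that the integral is a real number \<open>w\<close> follows from one of them.\<close>
  have "w / C' <= Hardy_norm M lam \<rho> p f"
   unfolding Hardy_norm_def
  proof (rule cInf_greatest)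
   show "{suminf s |b s. atomic_decomposition M lam \<rho> p f b s} \<noteq> {}" using d0 by blast
   fix v assume "v \<in> {suminf s |b s. atomic_decomposition M lam \<rho> p f b s}"
   then obtain b s where v: "v = suminf s" and d: "atomic_decomposition M lam \<rho> p f b s" by (elim CollectE exE conjE)
   have "summable s" "\<And>j. s j >= 0" using d unfolding atomic_decomposition_def using atomic_block_size_nonneg by blast+
   then have v0: "v >= 0" unfolding v by (rule suminf_nonneg)
   have "ennreal w <= ennreal (C' * v)" using main[OF d] unfolding w v .
   then have "w <= C' * v" using C' v0 by (subst (asm) ennreal_le_iff) auto
   then show "w / C' <= v" using C' by (simp add: field_simps)
  qed
  then have "w <= C' * Hardy_norm M lam \<rho> p f" using C' by (simp add: field_simps)
  then have "ennreal w <= ennreal (C' * Hardy_norm M lam \<rho> p f)" by (rule ennreal_leI)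
  then show "eLp_norm M 1 (MK f) <= ennreal C' * ennreal (Hardy_norm M lam \<rho> p f)"
   unfolding eLp_norm_1 w using C' by (simp add: ennreal_mult')
 qed
qed

end

section \<open>Assembly of the equivalences\<close>

lemma obtain_hardy:
 assumes "nonhomogeneous_space M lam" "marcinkiewicz_kernel M lam K" "1 < \<rho>" "1 < p"
 obtains Cl N a CK where "hardy M lam Cl N a K CK \<rho> p"
proof -
 have sets: "sets M = sets borel" using assms(1) unfolding nonhomogeneous_space_def by (elim conjE)
 obtain Cl where ud: "upper_doubling M lam Cl" using assms(1) unfolding nonhomogeneous_space_def by (elim conjE exE)
 obtain N :: nat where N: "N >= 1" "\<forall>x::'a. \<forall>r>0. \<exists>F. finite F \<and> card F <= N \<and> ball x r \<subseteq> (\<Union>z\<in>F. ball z (r / 2))"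
  using assms(1) unfolding nonhomogeneous_space_def geometrically_doubling_def by (elim conjE exE)
 obtain CK where CK: "CK > 0" "\<forall>x y. x \<noteq> y \<longrightarrow> cmod (K x y) <= CK * (dist x y / lam x (dist x y))"
  "\<forall>y y'. (\<integral>\<^sup>+x\<in>{x. dist x y >= 2 * dist y y'}. ennreal ((cmod (K x y - K x y') + cmod (K y x - K y' x)) * (1 / dist x y)) \<partial>M) <= ennreal CK"
  and loc: "locally_integrable_on (M \<Otimes>\<^sub>M M) {(x, y). x \<noteq> y} (\<lambda>(x, y). K x y)"
  using assms(2) unfolding marcinkiewicz_kernel_def by (elim conjE exE)
 obtain a0 :: nat where a0: "\<rho> < 2 ^ a0" using real_arch_pow[of 2 \<rho>] by auto
 \<comment> \<open>\<open>a0\<close> makes the dilation ratio dominate \<rho>, and the 3 secures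
   \<open>a >= 3\<close>.\<close>
 define a where "a = a0 + 3"
 have "(2 :: real) ^ a0 <= 2 ^ a" unfolding a_def by (intro power_increasing) auto
 then have a: "a >= 3" "\<rho> <= 2 ^ a" using a0 by (simp add: a_def, linarith)
 interpret nonhomog M lam Cl N
  using sets ud N unfolding upper_doubling_def by unfold_locales auto
 interpret cz_space M lam Cl N a by unfold_locales (rule a(1))
 interpret marc M lam Cl N a K CK using CK loc by unfold_locales auto
 have "hardy M lam Cl N a K CK \<rho> p" using assms(3,4) a(2) by unfold_locales (auto simp: \<alpha>_def)
 then show ?thesis by (rule that)
qed

theorem theorem1p1:
  fixes M :: "'a::metric_space measure"
    and lam :: "'a \<Rightarrow> real \<Rightarrow> real"
    and K :: "'a \<Rightarrow> 'a \<Rightarrow> complex"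
    and \<rho> :: real
    and p :: ennreal
  assumes "nonhomogeneous_space M lam"
    and "marcinkiewicz_kernel M lam K"
    and "1 < \<rho>" and "1 < p"
  shows "((\<exists>p\<^sub>0. 1 < p\<^sub>0 \<and> p\<^sub>0 < \<infinity> \<and> bounded_on_Lp M p\<^sub>0 (marcinkiewicz M K))
            \<longleftrightarrow> bounded_L1_weak_L1 M (marcinkiewicz M K))
       \<and> (bounded_L1_weak_L1 M (marcinkiewicz M K)
            \<longleftrightarrow> (\<forall>q. 1 < q \<and> q < \<infinity> \<longrightarrow> bounded_on_Lp M q (marcinkiewicz M K)))
       \<and> ((\<forall>q. 1 < q \<and> q < \<infinity> \<longrightarrow> bounded_on_Lp M q (marcinkiewicz M K))
            \<longleftrightarrow> bounded_Hardy_L1 M lam \<rho> p (marcinkiewicz M K))"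
proof -
 obtain Cl N a CK where "hardy M lam Cl N a K CK \<rho> p" by (rule obtain_hardy[OF assms])
 then interpret hardy M lam Cl N a K CK \<rho> p .
 let ?T = "marcinkiewicz M K"
 let ?i = "\<exists>p0. 1 < p0 \<and> p0 < \<infinity> \<and> bounded_on_Lp M p0 ?T"
 let ?ii = "bounded_L1_weak_L1 M ?T"
 let ?iii = "\<forall>q. 1 < q \<and> q < \<infinity> \<longrightarrow> bounded_on_Lp M q ?T"
 let ?iv = "bounded_Hardy_L1 M lam \<rho> p ?T"
 have i_ii: ?ii if ?i
 proof -
  obtain p0 where p0: "1 < p0" "p0 < \<infinity>" "bounded_on_Lp M p0 ?T" using \<open>?i\<close> by blast
  define r where "r = enn2real p0"
  have pr: "p0 = ennreal r" unfolding r_def using p0(2) by simp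
  have "\<not> ennreal r <= ennreal 1" using p0(1) unfolding pr by simp
  then have "r > 1" using ennreal_leI[of r 1] by linarith
  then show ?ii using L1_weak_L1_of_Lp p0(3) unfolding pr by blast
 qed
 \<comment> \<open>Both the weak type and the Hardy space estimate reach all exponents only through
   a uniform L^2 bound of the truncations, so this last stretch is shared.\<close>
 have iii_of_L2: ?iii if "bounded_Sn 2 A" "A >= 1" for A using all_Lp_of_L2[OF that] by blast
 have ii_iii: ?iii if ?ii
 proof -
  obtain A where "A >= 1" "bounded_Sn 2 A" by (rule L2_of_L1_weak_L1[OF \<open>?ii\<close>])
  then show ?iii by (intro iii_of_L2)
 qed
 have iii_i: ?i if ?iii using that by (intro exI[of _ 2]) auto
 have iii_iv: ?iv if ?iii
 proof -
  have "1 < ennreal q\<^sub>p" using q_p(1) by simp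
  then have "bounded_on_Lp M (ennreal q\<^sub>p) ?T" using \<open>?iii\<close> by simp
  then obtain C where "C > 0" "\<forall>f\<in>Lp_space M (ennreal q\<^sub>p). ?T f \<in> borel_measurable M \<and> eLp_norm M (ennreal q\<^sub>p) (?T f) <= ennreal C * Lp_norm M (ennreal q\<^sub>p) f"
   unfolding bounded_on_Lp_def bounded_operator_def by (elim exE conjE)
  then show ?iv by (intro Hardy_bound[of C]) auto
 qed
 have iv_iii: ?iii if ?iv
 proof -
  obtain C where C: "C > 0" "\<forall>f\<in>Hardy_space M lam \<rho> p. ?T f \<in> borel_measurable M \<and> eLp_norm M 1 (?T f) <= ennreal C * ennreal (Hardy_norm M lam \<rho> p f)"
   using \<open>?iv\<close> unfolding bounded_Hardy_L1_def bounded_operator_def by (elim exE conjE)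
  interpret hardy_bounded M lam Cl N a K CK \<rho> p C
   using C by unfold_locales (auto simp: eLp_norm_1)
  obtain A where "A >= 1" "bounded_Sn 2 A" by (rule L2_of_Hardy)
  then show ?iii by (intro iii_of_L2)
 qed
 show ?thesis using i_ii ii_iii iii_i iii_iv iv_iii by blast
qed

end
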